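(* Let $1\le p\le\infty$ and $0<\delta\le\delta_\kappa(p)$, where $$\delta_\kappa(p):=\max\left\{(2\sigma_\kappa+1)\left|\tfrac1p-\tfrac12\right|-\tfrac12,\,0\right\}.$$ Then there exists a function $f\in L^p(h_\kappa^2;S^d)$ such that $S_n^\delta(h_\kappa^2;f)$ diverges in $L^p(h_\kappa^2;S^d)$ as $n\to\infty$.
   Context: Let $d\ge1$ be an integer, $S^d$ the unit sphere of $\mathbb R^{d+1}$, $d\omega$ its surface measure. Fix $\kappa=(\kappa_1,\dots,\kappa_{d+1})$ with all $\kappa_i\ge0$, and put $h_\kappa(x)=\prod_{i=1}^{d+1}|x_i|^{\kappa_i}$, $|\kappa|=\sum_{i=1}^{d+1}\kappa_i$, $\kappa_{\min}=\min_i\kappa_i$, $\sigma_\kappa=\frac{d-1}2+|\kappa|-\kappa_{\min}$, $a_\kappa^{-1}=\int_{S^d}h_\kappa^2\,d\omega$. Norms: $\|f\|_{\kappa,p}=\left(a_\kappa\int_{S^d}|f|^ph_\kappa^2\,d\omega\right)^{1/p}$ for $1\le p<\infty$, and $\|f\|_{\kappa,\infty}$ is the uniform norm on $S^d$; for $p=\infty$ the space $L^p(h_\kappa^2;S^d)$ is understood as $C(S^d)$. $h$-harmonics: with $\mathcal D_if(x)=\partial_if(x)+\kappa_i\frac{f(x)-f(x-2x_ie_i)}{x_i}$ ($1\le i\le d+1$) and $\Delta_h=\sum_{i=1}^{d+1}\mathcal D_i^2$, $\mathcal H_n^d(h_\kappa^2)$ denotes the space of restrictions to $S^d$ of homogeneous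 polynomials $P$ of degree $n$ on $\mathbb R^{d+1}$ with $\Delta_hP=0$. (Equivalently: restrictions to $S^d$ of polynomials of degree at most $n$ that are orthogonal in $L^2(h_\kappa^2;S^d)$ to all polynomials of degree at most $n-1$.) One has $L^2(h_\kappa^2;S^d)=\bigoplus_{n\ge0}\mathcal H_n^d(h_\kappa^2)$. The projection is $\mathrm{proj}_n(h_\kappa^2;f,x)=a_\kappa\int_{S^d}f(y)P_n(h_\kappa^2;x,y)h_\kappa^2(y)\,d\omega(y)$, where $P_n(h_\kappa^2;\cdot,\cdot)$ is the reproducing kernel of $\mathcal H_n^d(h_\kappa^2)$ (with respect to $a_\kappa h_\kappa^2d\omega$); it is defined for all $f\in L^1(h_\kappa^2;S^d)$. Cesàro means: for $\delta>-1$, $S_n^\delta(h_\kappa^2;f)=(A_n^\delta)^{-1}\sum_{j=0}^nA_{n-j}^\delta\,\mathrm{proj}_j(h_\kappa^2;f)$ with $A_m^\delta=\binom{m+\delta}{m}$. *)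

theory Defs
  imports "HOL-Analysis.Analysis"
begin

text \<open>
  Throughout, the sphere \<open>S^d\<close> is \<open>sphere 0 1 :: (real ^ 'n) set\<close> with \<open>d = CARD('n) - 1\<close>.
  Functions on the sphere are functions on the whole space whose values off the sphere are ignored.
\<close>

text \<open>
  Surface measure in polar coordinates: \<open>\<omega> A\<close> is \<open>d + 1\<close> times the Lebesgue measure of the part of
  the open unit ball lying on the rays through \<open>A\<close>.
\<close>

definition surface_measure :: "(real ^ 'n) measure" where
  "surface_measure =
     scale_measure (of_nat CARD('n))
       (distr (restrict_space lborel (ball 0 1 - {0})) (restrict_space borel (sphere 0 1)) sgn)"

lemma space_surface_measure [simp]: "space surface_measure = sphere 0 1"
  by (simp add: surface_measure_def space_scale_measure space_restrict_space)

lemma sets_surface_measure [simp]: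
  "sets surface_measure = sets (restrict_space borel (sphere 0 1))"
  by (simp add: surface_measure_def)

lemma emeasure_surface_measure:
  fixes A :: "(real ^ 'n) set"
  assumes "A \<in> sets borel" "A \<subseteq> sphere 0 1"
  shows "emeasure surface_measure A =
           of_nat CARD('n) * emeasure lborel {x. 0 < norm x \<and> norm x < 1 \<and> sgn x \<in> A}"
proof -
  let ?B = "ball 0 1 - {0} :: (real ^ 'n) set"
  have B: "?B \<in> sets lborel" by simp
  have sgn: "(sgn :: real ^ 'n \<Rightarrow> _) \<in> restrict_space lborel ?B \<rightarrow>\<^sub>M restrict_space borel (sphere 0 1)"
  proof (rule measurable_restrict_space2)
    show "sgn \<in> space (restrict_space lborel ?B) \<rightarrow> sphere 0 1"
      by (auto simp: space_restrict_space norm_sgn)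
    have "(\<lambda>x :: real ^ 'n. x /\<^sub>R norm x) \<in> borel_measurable borel" by measurable
    then show "sgn \<in> borel_measurable (restrict_space lborel ?B)"
      by (intro measurable_restrict_space1) (simp add: sgn_div_norm [abs_def])
  qed
  have A: "A \<in> sets (restrict_space borel (sphere 0 1))"
    using assms by (auto simp: sets_restrict_space)
  have eq: "sgn -` A \<inter> space (restrict_space lborel ?B) =
            {x. 0 < norm x \<and> norm x < 1 \<and> sgn x \<in> A}"
    by (auto simp: space_restrict_space)
  show ?thesis
    unfolding surface_measure_def emeasure_scale_measure emeasure_distr [OF sgn A] eq
    by (subst emeasure_restrict_space) (use B in auto)
qed

text \<open>
  The case distinction implements \<open>0\<^sup>0 = 1\<close>, whereas \<open>0 powr 0 = 0\<close> in the library.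
\<close>

definition hweight :: "real ^ 'n \<Rightarrow> real ^ 'n \<Rightarrow> real" where
  "hweight \<kappa> x = (\<Prod>i\<in>UNIV. if \<kappa> $ i = 0 then 1 else \<bar>x $ i\<bar> powr (\<kappa> $ i))"

definition a_const :: "real ^ 'n \<Rightarrow> real" where
  "a_const \<kappa> = inverse (\<integral>x. (hweight \<kappa> x)\<^sup>2 \<partial>surface_measure)"

definition hmeasure :: "real ^ 'n \<Rightarrow> (real ^ 'n) measure" where
  "hmeasure \<kappa> = density surface_measure (\<lambda>x. ennreal (a_const \<kappa> * (hweight \<kappa> x)\<^sup>2))"

definition Lp_space :: "real ^ 'n \<Rightarrow> ereal \<Rightarrow> (real ^ 'n \<Rightarrow> real) set" where
  "Lp_space \<kappa> p =
     (if p = \<infinity> then {f. continuous_on (sphere 0 1) f}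
      else {f \<in> borel_measurable (hmeasure \<kappa>).
              integrable (hmeasure \<kappa>) (\<lambda>x. \<bar>f x\<bar> powr real_of_ereal p)})"

definition Lp_norm :: "real ^ 'n \<Rightarrow> ereal \<Rightarrow> (real ^ 'n \<Rightarrow> real) \<Rightarrow> real" where
  "Lp_norm \<kappa> p f =
     (if p = \<infinity> then (SUP x\<in>sphere 0 1. \<bar>f x\<bar>)
      else (\<integral>x. \<bar>f x\<bar> powr real_of_ereal p \<partial>hmeasure \<kappa>) powr (1 / real_of_ereal p))"

definition partial_deriv :: "'n \<Rightarrow> (real ^ 'n \<Rightarrow> real) \<Rightarrow> real ^ 'n \<Rightarrow> real" where
  "partial_deriv i f x = deriv (\<lambda>t. f (x + t *\<^sub>R axis i 1)) 0"

text \<open>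
  On the hyperplane \<open>x $ i = 0\<close> the difference quotient is given its limiting value \<open>2 \<partial>\<^sub>i f x\<close>, so that
  the operators map polynomials to polynomials.
\<close>

definition dunkl :: "real ^ 'n \<Rightarrow> 'n \<Rightarrow> (real ^ 'n \<Rightarrow> real) \<Rightarrow> real ^ 'n \<Rightarrow> real" where
  "dunkl \<kappa> i f x = partial_deriv i f x + \<kappa> $ i *
     (if x $ i = 0 then 2 * partial_deriv i f x
      else (f x - f (x - (2 * x $ i) *\<^sub>R axis i 1)) / x $ i)"

definition h_laplacian :: "real ^ 'n \<Rightarrow> (real ^ 'n \<Rightarrow> real) \<Rightarrow> real ^ 'n \<Rightarrow> real" where
  "h_laplacian \<kappa> f x = (\<Sum>i\<in>UNIV. dunkl \<kappa> i (dunkl \<kappa> i f) x)"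

definition homogeneous_poly :: "nat \<Rightarrow> (real ^ 'n \<Rightarrow> real) \<Rightarrow> bool" where
  "homogeneous_poly n P \<longleftrightarrow>
     real_polynomial_function P \<and> (\<forall>t x. P (t *\<^sub>R x) = t ^ n * P x)"

definition h_harmonics :: "real ^ 'n \<Rightarrow> nat \<Rightarrow> (real ^ 'n \<Rightarrow> real) set" where
  "h_harmonics \<kappa> n =
     {restrict P (sphere 0 1) | P. homogeneous_poly n P \<and> (\<forall>x. h_laplacian \<kappa> P x = 0)}"

text \<open>
  The function \<open>P\<^sub>n(x, \<cdot>)\<close>; it is only meaningful for \<open>x\<close> on the sphere. Since the elements of
  \<^const>\<open>h_harmonics\<close> are fixed off the sphere by \<^const>\<open>restrict\<close>, it is unique as a
  function on the whole space.
\<close>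

definition repr_kernel :: "real ^ 'n \<Rightarrow> nat \<Rightarrow> real ^ 'n \<Rightarrow> real ^ 'n \<Rightarrow> real" where
  "repr_kernel \<kappa> n x =
     (THE k. k \<in> h_harmonics \<kappa> n \<and>
        (\<forall>g\<in>h_harmonics \<kappa> n. g x = (\<integral>y. g y * k y \<partial>hmeasure \<kappa>)))"

definition h_proj :: "real ^ 'n \<Rightarrow> nat \<Rightarrow> (real ^ 'n \<Rightarrow> real) \<Rightarrow> real ^ 'n \<Rightarrow> real" where
  "h_proj \<kappa> n f x = (\<integral>y. f y * repr_kernel \<kappa> n x y \<partial>hmeasure \<kappa>)"

definition cesaro_coeff :: "real \<Rightarrow> nat \<Rightarrow> real" where
  "cesaro_coeff \<delta> m = (real m + \<delta>) gchoose m"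

definition cesaro_mean ::
  "real ^ 'n \<Rightarrow> real \<Rightarrow> nat \<Rightarrow> (real ^ 'n \<Rightarrow> real) \<Rightarrow> real ^ 'n \<Rightarrow> real" where
  "cesaro_mean \<kappa> \<delta> n f x =
     inverse (cesaro_coeff \<delta> n) * (\<Sum>j\<le>n. cesaro_coeff \<delta> (n - j) * h_proj \<kappa> j f x)"

definition sigma_index :: "real ^ 'n \<Rightarrow> real" where
  "sigma_index \<kappa> =
     ((real CARD('n) - 1) - 1) / 2 + (\<Sum>i\<in>UNIV. \<kappa> $ i) - Min (range (\<lambda>i. \<kappa> $ i))"

definition delta_index :: "real ^ 'n \<Rightarrow> ereal \<Rightarrow> real" where
  "delta_index \<kappa> p =
     max ((2 * sigma_index \<kappa> + 1) * \<bar>real_of_ereal (1 / p) - 1 / 2\<bar> - 1 / 2) 0"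

end

theory Submission
  imports Defs "HOL-Complex_Analysis.Complex_Analysis" "HOL-Library.Function_Algebras"
begin

text \<open>
  Let \<open>N = d + 1\<close> be the dimension of the ambient space, \<open>i\<close> an index with \<open>\<kappa> $ i\<close> minimal,
  \<open>s = sigma_index \<kappa>\<close>, \<open>l = s + \<kappa> $ i\<close> and \<open>D = 2 * s + 1\<close>. The \<open>i\<close>-th unit vector is called the
  vertex, and \<open>y\<close> denotes the sine of the angle to it. A neighbourhood of the vertex with \<open>y\<close>
  comparable to \<open>\<rho>\<close> has mass of order \<open>\<rho> powr D\<close> in \<open>hmeasure \<kappa>\<close>, because \<open>\<kappa> $ i\<close> is the only
  exponent that does not contribute there. The critical order for an exponent \<open>q < 2\<close> is
  \<open>\<delta>c = D / q - s - 1\<close>.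

  The functions on which the means are large are the Poisson kernels \<open>F e\<close> with pole at the vertex,
  the sums of \<open>exp (- e) ^ n * Z n\<close> over the zonal h-harmonics \<open>Z n\<close>. They are nonnegative, have
  integral one and are bounded by a multiple of \<open>e powr (- D)\<close>, so that their \<open>L^q\<close> norm is at most of
  order \<open>e powr (- D * (1 - 1 / q))\<close> (\<open>F_bounds\<close>, \<open>F_integral_one\<close>). The generating
  function of the Cesaro means of \<open>F e\<close> is explicit: multiplied by the Cesaro coefficients and summed
  against \<open>z ^ n\<close> they give \<open>(1 - z) powr (- \<delta> - 1)\<close> times the Poisson
  kernel at \<open>exp (- e) * z\<close> (\<open>cesaro_F_sums\<close>). The Poisson kernel is an average, over a parameter \<open>u\<close>,
  of the Gegenbauer kernels \<open>(1 - r\<^sup>2) * (1 - 2 * t * u * r + r\<^sup>2) powr (- l - 1)\<close> with \<open>t = x $ i\<close>. For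
  \<open>x\<close> at angle \<open>\<theta>\<close> to the vertex and \<open>r\<close> near \<open>exp (- \<i> * \<theta>)\<close>, at a distance of order \<open>e\<close> and in a
  suitable direction, the integrand has almost constant argument, so that nothing cancels
  (\<open>zker_lower\<close>). The triangle inequality for the generating function then bounds the sum of
  \<open>exp (- e) ^ n\<close> times the Cesaro coefficient times the modulus of the \<open>n\<close>-th mean from below by a
  multiple of \<open>e powr (- s - 1) * y powr (- \<delta> - s - 1)\<close> wherever \<open>y\<close> lies between a multiple of \<open>e\<close>
  and \<open>1 / 2\<close> (\<open>cesaro_F_lower\<close>).

  Integrated against \<open>y powr (- (s - \<delta>c))\<close>, the weight dual to the norm of \<open>F e\<close>, this produces for
  every \<open>\<delta> \<le> \<delta>c\<close> the integral of \<open>y powr (- D)\<close> over that region, to which every dyadic shell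
  contributes the same amount: it tends to infinity as \<open>e\<close> tends to zero
  (\<open>vertex_integral_unbounded\<close>). Since the total of the generating weights is of order
  \<open>e powr (- \<delta> - 1)\<close>, one of the means must be large, and a smoothed sign of it yields functions \<open>f\<close>
  in the unit ball of \<open>L^q\<close> and \<open>g\<close> in that of the dual space whose pairings \<open>\<integral> g * S\<^sub>n f\<close> are
  unbounded (\<open>unbounded_pairings\<close>).

  The means are symmetric operators, so the same pairs serve for the dual exponent with the roles of
  \<open>f\<close> and \<open>g\<close> exchanged; this settles exponents above \<open>2\<close>, the uniform norm included. If all means of
  \<open>f\<close> converged, the pairings with \<open>S\<^sub>n f\<close> would be bounded for each fixed \<open>f\<close>; a gliding hump sum of
  multiples of the functions found above violates this (\<open>gliding_hump\<close>,
  \<open>divergence_finite_exponent\<close>, \<open>divergence_uniform\<close>).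

  The remaining material supplies the theory of h-harmonics that is used on the way: the action of
  Dunkl operators on polynomials, integration by parts, orthogonality of different degrees, the
  reproducing kernel as a sum over an orthonormal basis, and explicit zonal h-harmonics.
\<close>

\<comment> \<open>The dollar sign is left to vector components.\<close>
no_notation fps_nth (infixl "$" 75)

section \<open>Dunkl operators on monomials\<close>

definition coord_refl :: "'n \<Rightarrow> real ^ 'n \<Rightarrow> real ^ 'n" where
  "coord_refl i x = x - (2 * x $ i) *\<^sub>R axis i 1"

lemma coord_refl_nth: "coord_refl i x $ j = (if j = i then - (x $ i) else x $ j)"
  by (simp add: coord_refl_def axis_def)

definition axis_diff :: "'n \<Rightarrow> (real ^ 'n \<Rightarrow> real) \<Rightarrow> bool" where
  "axis_diff i f \<longleftrightarrow> (\<forall>x. (\<lambda>t. f (x + t *\<^sub>R axis i 1)) field_differentiable at 0)"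

lemma axis_diffD:
  assumes "axis_diff i f"
  shows "((\<lambda>t. f (x + t *\<^sub>R axis i 1)) has_real_derivative partial_deriv i f x) (at 0)"
  using assms unfolding axis_diff_def partial_deriv_def
  by (simp add: DERIV_deriv_iff_field_differentiable)

lemma axis_diffI:
  assumes "\<And>x. ((\<lambda>t. f (x + t *\<^sub>R axis i 1)) has_real_derivative f' x) (at 0)"
  shows "axis_diff i f" "partial_deriv i f x = f' x"
  using assms unfolding axis_diff_def partial_deriv_def field_differentiable_def
  by (auto intro!: DERIV_imp_deriv)

text \<open>
  On the hyperplane \<open>x $ i = 0\<close>, where a Dunkl operator has no difference quotient, the derivative of an
  even factor must be known to vanish for the product rule below to persist.
\<close>

lemma partial_deriv_even:
  assumes "axis_diff i E" "\<And>x. E (coord_refl i x) = E x" "x $ i = 0"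
  shows "partial_deriv i E x = 0"
proof -
  let ?g = "\<lambda>t. E (x + t *\<^sub>R axis i 1)"
  have ev: "?g (- t) = ?g t" for t
  proof -
    have "coord_refl i (x + t *\<^sub>R axis i 1) = x + (- t) *\<^sub>R axis i 1"
      using assms(3) by (simp add: vec_eq_iff coord_refl_nth axis_def)
    then show ?thesis using assms(2)[of "x + t *\<^sub>R axis i 1"] by simp
  qed
  have d: "(?g has_real_derivative partial_deriv i E x) (at 0)"
    by (rule axis_diffD[OF assms(1)])
  have "((\<lambda>t. ?g (- t)) has_real_derivative - partial_deriv i E x) (at 0)"
    using DERIV_mirror[of ?g "partial_deriv i E x" 0] d by simp
  then have "(?g has_real_derivative - partial_deriv i E x) (at 0)"
    by (simp only: ev)
  from DERIV_unique[OF d this] show ?thesis by simp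
qed

definition dunkl_coeff :: "real \<Rightarrow> nat \<Rightarrow> real" where
  "dunkl_coeff k a = real a + (if odd a then 2 * k else 0)"

lemma dunkl_coeff_0 [simp]: "dunkl_coeff k 0 = 0"
  by (simp add: dunkl_coeff_def)

lemma axis_diff_power_mult:
  assumes "axis_diff i E"
  shows "axis_diff i (\<lambda>x. x $ i ^ b * E x)"
    and "partial_deriv i (\<lambda>x. x $ i ^ b * E x) x =
           real b * x $ i ^ (b - 1) * E x + x $ i ^ b * partial_deriv i E x"
proof -
  have "((\<lambda>t. (x + t *\<^sub>R axis i 1) $ i ^ b * E (x + t *\<^sub>R axis i 1)) has_real_derivative
      real b * x $ i ^ (b - 1) * E x + x $ i ^ b * partial_deriv i E x) (at 0)" for x
  proof -
    have "((\<lambda>t. (x + t *\<^sub>R axis i 1) $ i ^ b) has_real_derivative real b * x $ i ^ (b - 1)) (at 0)"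
      by (auto intro!: derivative_eq_intros simp: axis_def)
    from DERIV_mult[OF this axis_diffD[OF assms, of x]] show ?thesis
      by (simp add: algebra_simps)
  qed
  from axis_diffI[OF this]
  show "axis_diff i (\<lambda>x. x $ i ^ b * E x)"
    and "partial_deriv i (\<lambda>x. x $ i ^ b * E x) x =
           real b * x $ i ^ (b - 1) * E x + x $ i ^ b * partial_deriv i E x"
    by auto
qed

text \<open>
  The reflection-invariant factor passes through the difference quotient, which maps \<open>x $ i ^ b\<close> to
  \<open>2 * x $ i ^ (b - 1)\<close> for odd \<open>b\<close> and to zero for even \<open>b\<close>. This is where the parity in
  \<open>dunkl_coeff\<close> comes from.
\<close>

lemma dunkl_power_mult_even:
  assumes "axis_diff i E" "\<And>x. E (coord_refl i x) = E x"
  shows "dunkl \<kappa> i (\<lambda>x. x $ i ^ b * E x) x =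
           dunkl_coeff (\<kappa> $ i) b * x $ i ^ (b - 1) * E x + x $ i ^ b * partial_deriv i E x"
proof (cases "x $ i = 0")
  case True
  have p0: "partial_deriv i E x = 0"
    by (rule partial_deriv_even[OF assms True])
  have "dunkl \<kappa> i (\<lambda>x. x $ i ^ b * E x) x = real b * x $ i ^ (b - 1) * E x + x $ i ^ b * partial_deriv i E x
      + \<kappa> $ i * (2 * (real b * x $ i ^ (b - 1) * E x + x $ i ^ b * partial_deriv i E x))"
    unfolding dunkl_def axis_diff_power_mult(2)[OF assms(1)] using True by simp
  then show ?thesis
    using True p0 by (cases "b = 0"; cases "b = 1") (auto simp: dunkl_coeff_def algebra_simps power_0_left)
next
  case False
  have "(x $ i ^ b * E x - (coord_refl i x) $ i ^ b * E (coord_refl i x)) / x $ i =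
      (if odd b then 2 else 0) * x $ i ^ (b - 1) * E x"
    using False by (cases b) (auto simp: coord_refl_nth assms(2))
  moreover have "dunkl \<kappa> i (\<lambda>x. x $ i ^ b * E x) x = real b * x $ i ^ (b - 1) * E x + x $ i ^ b * partial_deriv i E x
      + \<kappa> $ i * ((x $ i ^ b * E x - (coord_refl i x) $ i ^ b * E (coord_refl i x)) / x $ i)"
    unfolding dunkl_def axis_diff_power_mult(2)[OF assms(1)] coord_refl_def using False by simp
  ultimately show ?thesis
    by (auto simp: dunkl_coeff_def algebra_simps)
qed

lemma dunkl_add:
  assumes "axis_diff i f" "axis_diff i g"
  shows "axis_diff i (\<lambda>x. f x + g x)"
    and "dunkl \<kappa> i (\<lambda>x. f x + g x) = (\<lambda>x. dunkl \<kappa> i f x + dunkl \<kappa> i g x)"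
proof -
  have *: "((\<lambda>t. f (x + t *\<^sub>R axis i 1) + g (x + t *\<^sub>R axis i 1)) has_real_derivative
      partial_deriv i f x + partial_deriv i g x) (at 0)" for x
    by (intro DERIV_add axis_diffD assms)
  show "axis_diff i (\<lambda>x. f x + g x)"
    by (rule axis_diffI[OF *])
  show "dunkl \<kappa> i (\<lambda>x. f x + g x) = (\<lambda>x. dunkl \<kappa> i f x + dunkl \<kappa> i g x)"
    by (rule ext) (auto simp: dunkl_def axis_diffI(2)[OF *] algebra_simps add_divide_distrib
        diff_divide_distrib)
qed

lemma dunkl_cmult:
  assumes "axis_diff i f"
  shows "axis_diff i (\<lambda>x. c * f x)"
    and "dunkl \<kappa> i (\<lambda>x. c * f x) = (\<lambda>x. c * dunkl \<kappa> i f x)"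
proof -
  have *: "((\<lambda>t. c * f (x + t *\<^sub>R axis i 1)) has_real_derivative c * partial_deriv i f x) (at 0)" for x
    by (intro DERIV_cmult axis_diffD assms)
  show "axis_diff i (\<lambda>x. c * f x)"
    by (rule axis_diffI[OF *])
  show "dunkl \<kappa> i (\<lambda>x. c * f x) = (\<lambda>x. c * dunkl \<kappa> i f x)"
    by (rule ext) (auto simp: dunkl_def axis_diffI(2)[OF *] algebra_simps diff_divide_distrib)
qed

definition xpow :: "('n::finite \<Rightarrow> nat) \<Rightarrow> real ^ 'n \<Rightarrow> real" where
  "xpow \<alpha> x = (\<Prod>i\<in>UNIV. x $ i ^ \<alpha> i)"

lemma xpow_split: "xpow \<alpha> x = x $ i ^ \<alpha> i * (\<Prod>j\<in>UNIV-{i}. x $ j ^ \<alpha> j)"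
  unfolding xpow_def by (subst prod.remove[of _ i]) auto

lemma xpow_add: "xpow \<alpha> x * xpow \<beta> x = xpow (\<lambda>i. \<alpha> i + \<beta> i) x"
  by (simp add: xpow_def power_add prod.distrib)

lemma xpow_refl: "xpow \<alpha> (coord_refl i x) = (-1) ^ \<alpha> i * xpow \<alpha> x"
  unfolding xpow_split[of \<alpha> _ i]
  by (simp add: coord_refl_nth power_minus[of "x $ i"])

lemma xpow_scale: "xpow \<alpha> (t *\<^sub>R x) = t ^ (sum \<alpha> UNIV) * xpow \<alpha> x"
  by (simp add: xpow_def power_mult_distrib prod.distrib power_sum)

lemma dunkl_xpow:
  shows "axis_diff i (xpow \<alpha>)"
    and "dunkl \<kappa> i (xpow \<alpha>) = (\<lambda>x. dunkl_coeff (\<kappa> $ i) (\<alpha> i) * xpow (\<alpha>(i := \<alpha> i - 1)) x)"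
proof -
  let ?E = "\<lambda>x. \<Prod>j\<in>UNIV-{i}. (x :: real ^ 'a) $ j ^ \<alpha> j"
  have e: "?E (x + t *\<^sub>R axis i 1) = ?E x" for t x
    by (rule prod.cong) (auto simp: axis_def)
  have d: "((\<lambda>t. ?E (x + t *\<^sub>R axis i 1)) has_real_derivative 0) (at 0)" for x
    unfolding e by simp
  have E: "axis_diff i ?E" "\<And>x. partial_deriv i ?E x = 0"
    using axis_diffI[OF d] by auto
  have r: "?E (coord_refl i x) = ?E x" for x
    by (rule prod.cong) (auto simp: coord_refl_nth)
  have x: "xpow \<alpha> = (\<lambda>x. x $ i ^ \<alpha> i * ?E x)"
    by (rule ext) (rule xpow_split)
  show "axis_diff i (xpow \<alpha>)"
    unfolding x by (rule axis_diff_power_mult[OF E(1)])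
  have r2: "(\<Prod>j\<in>UNIV-{i}. x $ j ^ (\<alpha>(i := \<alpha> i - 1)) j) = ?E x" for x
    by (rule prod.cong) auto
  show "dunkl \<kappa> i (xpow \<alpha>) = (\<lambda>x. dunkl_coeff (\<kappa> $ i) (\<alpha> i) * xpow (\<alpha>(i := \<alpha> i - 1)) x)"
  proof (rule ext)
    fix x
    show "dunkl \<kappa> i (xpow \<alpha>) x = dunkl_coeff (\<kappa> $ i) (\<alpha> i) * xpow (\<alpha>(i := \<alpha> i - 1)) x"
      unfolding xpow_split[of "\<alpha>(i := \<alpha> i - 1)" _ i] r2
      unfolding x by (subst dunkl_power_mult_even[OF E(1)]) (auto simp: r E(2))
  qed
qed

section \<open>Homogeneous polynomials\<close>

text \<open>
  Generation from monomials makes statements about Dunkl operators accessible to induction.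
\<close>

inductive_set hpoly :: "nat \<Rightarrow> (real ^ 'n::finite \<Rightarrow> real) set" for k where
  zero: "(\<lambda>x. 0) \<in> hpoly k"
| monomial: "sum \<alpha> UNIV = k \<Longrightarrow> xpow \<alpha> \<in> hpoly k"
| add: "f \<in> hpoly k \<Longrightarrow> g \<in> hpoly k \<Longrightarrow> (\<lambda>x. f x + g x) \<in> hpoly k"
| scale: "f \<in> hpoly k \<Longrightarrow> (\<lambda>x. c * f x) \<in> hpoly k"

lemma hpoly_sum:
  assumes "finite A" "\<And>a. a \<in> A \<Longrightarrow> f a \<in> hpoly k"
  shows "(\<lambda>x. \<Sum>a\<in>A. f a x) \<in> hpoly k"
  using assms by (induction A rule: finite_induct) (auto intro: hpoly.intros)

lemma hpoly_mult:
  assumes "f \<in> hpoly k" "g \<in> hpoly l"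
  shows "(\<lambda>x. f x * g x) \<in> hpoly (k + l)"
  using assms(1)
proof induction
  case (monomial \<alpha>)
  show ?case using assms(2)
  proof induction
    case (monomial \<beta>)
    then show ?case using \<open>sum \<alpha> UNIV = k\<close>
      by (auto simp: xpow_add sum.distrib intro!: hpoly.intros)
  next
    case (add f g) then show ?case using hpoly.add by (force simp: algebra_simps)
  next
    case (scale f c) then show ?case using hpoly.scale[of "\<lambda>x. xpow \<alpha> x * f x" "k + l" c]
      by (simp add: mult.left_commute)
  qed (simp add: hpoly.zero)
next
  case (add f g) then show ?case using hpoly.add by (force simp: algebra_simps)
next
  case (scale f c) then show ?case using hpoly.scale[of "\<lambda>x. f x * g x" "k + l" c]
    by (simp add: mult.assoc)
qed (simp add: hpoly.zero)

lemma hpoly_homogeneous: "f \<in> hpoly k \<Longrightarrow> f (t *\<^sub>R x) = t ^ k * f x"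
  by (induction rule: hpoly.induct) (auto simp: xpow_scale algebra_simps)

lemma hpoly_const: "(\<lambda>x. c) \<in> hpoly 0"
proof -
  have "(\<lambda>x. c * xpow (\<lambda>_. 0) x) \<in> hpoly 0"
    by (intro hpoly.intros) auto
  then show ?thesis by (simp add: xpow_def)
qed

lemma xpow_unit: "xpow (\<lambda>j. if j = i then 1 else 0) x = x $ i"
  by (subst xpow_split[of _ _ i]) (auto intro!: prod.neutral)

lemma hpoly_coord: "(\<lambda>x. x $ i) \<in> hpoly 1"
proof -
  have "xpow (\<lambda>j. if j = i then 1 else 0) \<in> hpoly 1"
    by (intro hpoly.intros) auto
  then show ?thesis by (simp add: xpow_unit[abs_def])
qed

lemma hpoly_power: "f \<in> hpoly k \<Longrightarrow> (\<lambda>x. f x ^ m) \<in> hpoly (m * k)"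
  by (induction m) (auto simp: hpoly_const intro: hpoly_mult)

lemma hpoly_polynomial: "f \<in> hpoly k \<Longrightarrow> real_polynomial_function f"
proof (induction rule: hpoly.induct)
  case (monomial \<alpha>)
  have c: "real_polynomial_function (\<lambda>x :: real ^ 'a. x $ i)" for i
    by (intro real_polynomial_function.intros(1) bounded_linear_vec_nth)
  have "real_polynomial_function (\<lambda>x :: real ^ 'a. \<Prod>i\<in>UNIV. x $ i ^ \<alpha> i)"
    by (intro real_polynomial_function_prod real_polynomial_function_power c) auto
  then show ?case by (simp add: xpow_def[abs_def])
qed (auto intro: real_polynomial_function.intros)

text \<open>
  The decomposition into homogeneous components survives sums and products, and linear functionals
  are combinations of the coordinates.
\<close>

lemma polynomial_hpoly_sum:
  assumes "real_polynomial_function (P :: real ^ 'n::finite \<Rightarrow> real)"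
  shows "\<exists>d Q. (\<forall>m. Q m \<in> hpoly m) \<and> (\<forall>m>d. Q m = (\<lambda>x. 0)) \<and> P = (\<lambda>x. \<Sum>m\<le>d. Q m x)"
  using assms
proof induction
  case (linear f)
  have "f = (\<lambda>x. \<Sum>i\<in>UNIV. f (axis i 1) * x $ i)"
  proof
    fix x :: "real ^ 'n"
    have "f x = f (\<Sum>i\<in>UNIV. x $ i *\<^sub>R axis i 1)"
      using basis_expansion[of x] by (intro arg_cong[where f=f]) (simp add: scalar_mult_eq_scaleR)
    also have "\<dots> = (\<Sum>i\<in>UNIV. f (axis i 1) * x $ i)"
      using linear by (simp add: bounded_linear.linear linear_sum linear_scale mult.commute)
    finally show "f x = (\<Sum>i\<in>UNIV. f (axis i 1) * x $ i)" .
  qed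
  also have "\<dots> \<in> hpoly 1"
    by (intro hpoly_sum hpoly.scale hpoly_coord) auto
  finally have "f \<in> hpoly 1" .
  then show ?case
    by (intro exI[of _ 1] exI[of _ "\<lambda>m. if m = 1 then f else (\<lambda>x. 0)"])
       (auto intro: hpoly.zero)
next
  case (const c)
  then show ?case
    by (intro exI[of _ 0] exI[of _ "\<lambda>m. if m = 0 then (\<lambda>x. c) else (\<lambda>x. 0)"])
       (auto intro: hpoly.zero hpoly_const)
next
  case (add f g)
  then obtain d Q d' Q' where Q: "\<forall>m. Q m \<in> hpoly m" "\<forall>m>d. Q m = (\<lambda>x. 0)" "f = (\<lambda>x. \<Sum>m\<le>d. Q m x)"
    and Q': "\<forall>m. Q' m \<in> hpoly m" "\<forall>m>d'. Q' m = (\<lambda>x. 0)" "g = (\<lambda>x. \<Sum>m\<le>d'. Q' m x)"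
    by blast
  have "f x = (\<Sum>m\<le>max d d'. Q m x)" "g x = (\<Sum>m\<le>max d d'. Q' m x)" for x
    unfolding Q(3) Q'(3) using Q(2) Q'(2) by (auto intro!: sum.mono_neutral_left) (metis not_le)+
  then show ?case using Q Q'
    by (intro exI[of _ "max d d'"] exI[of _ "\<lambda>m x. Q m x + Q' m x"])
       (auto simp: sum.distrib intro: hpoly.add)
next
  case (mult f g)
  then obtain d Q d' Q' where Q: "\<forall>m. Q m \<in> hpoly m" "\<forall>m>d. Q m = (\<lambda>x. 0)" "f = (\<lambda>x. \<Sum>m\<le>d. Q m x)"
    and Q': "\<forall>m. Q' m \<in> hpoly m" "\<forall>m>d'. Q' m = (\<lambda>x. 0)" "g = (\<lambda>x. \<Sum>m\<le>d'. Q' m x)"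
    by blast
  have "f x * g x = (\<Sum>r\<le>d + d'. \<Sum>k\<le>r. Q k x * Q' (r - k) x)" for x
    unfolding Q(3) Q'(3)
    using polynomial_product[of d "\<lambda>k. Q k x" d' "\<lambda>k. Q' k x" 1] Q(2) Q'(2) by simp
  moreover have "(\<lambda>x. \<Sum>k\<le>r. Q k x * Q' (r - k) x) \<in> hpoly r" for r
  proof (rule hpoly_sum)
    fix k assume "k \<in> {..r}"
    then show "(\<lambda>x. Q k x * Q' (r - k) x) \<in> hpoly r"
      using hpoly_mult[of "Q k" k "Q' (r - k)" "r - k"] Q(1) Q'(1) by simp
  qed simp
  moreover have "(\<lambda>x. \<Sum>k\<le>r. Q k x * Q' (r - k) x) = (\<lambda>x. 0)" if "r > d + d'" for r
  proof -
    have "Q k x * Q' (r - k) x = 0" for k x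
      using that Q(2) Q'(2) by (cases "k > d") auto
    then show ?thesis by (intro ext sum.neutral) blast
  qed
  ultimately show ?case
    by (intro exI[of _ "d + d'"] exI[of _ "\<lambda>r x. \<Sum>k\<le>r. Q k x * Q' (r - k) x"]) auto
qed

text \<open>
  Along a ray both sides of \<open>P (t x) = t ^ k P x\<close> are polynomials in \<open>t\<close>; comparing coefficients leaves
  only the component of degree \<open>k\<close>.
\<close>

lemma homogeneous_poly_iff_hpoly: "homogeneous_poly k P \<longleftrightarrow> P \<in> hpoly k"
proof
  assume h: "homogeneous_poly k P"
  then obtain d Q where Q: "\<forall>m. Q m \<in> hpoly m" "\<forall>m>d. Q m = (\<lambda>x. 0)" "P = (\<lambda>x. \<Sum>m\<le>d. Q m x)"
    using polynomial_hpoly_sum[of P] by (auto simp: homogeneous_poly_def)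
  have "P x = Q k x" for x
  proof -
    let ?n = "max d k"
    have P: "P y = (\<Sum>m\<le>?n. Q m y)" for y
      unfolding Q(3) using Q(2) by (auto intro!: sum.mono_neutral_left) (metis not_le)
    have "(\<Sum>m\<le>?n. Q m x * t ^ m) = (\<Sum>m\<le>?n. (if m = k then P x else 0) * t ^ m)" for t
    proof -
      have "(\<Sum>m\<le>?n. Q m x * t ^ m) = P (t *\<^sub>R x)"
        unfolding P using hpoly_homogeneous[OF Q(1)[rule_format], of _ t x] by (simp add: mult.commute)
      also have "\<dots> = P x * t ^ k"
        using h by (simp add: homogeneous_poly_def)
      also have "\<dots> = (\<Sum>m\<le>?n. (if m = k then P x else 0) * t ^ m)"
        by (simp add: if_distrib[of "\<lambda>a. a * _"] cong: if_cong)
      finally show ?thesis .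
    qed
    then have "\<forall>i\<le>?n. Q i x = (if i = k then P x else 0)"
      by (subst polyfun_eq_coeffs[symmetric]) blast
    then show ?thesis by simp
  qed
  then have "P = Q k" by (rule ext)
  with Q(1) show "P \<in> hpoly k" by simp
next
  assume "P \<in> hpoly k"
  then show "homogeneous_poly k P"
    by (simp add: homogeneous_poly_def hpoly_polynomial hpoly_homogeneous)
qed

lemma hpoly_axis_diff: "f \<in> hpoly k \<Longrightarrow> axis_diff i f"
proof (induction rule: hpoly.induct)
  case zero show ?case unfolding axis_diff_def by simp
qed (auto intro: dunkl_xpow dunkl_add dunkl_cmult)

lemma dunkl_zero [simp]: "dunkl \<kappa> i (\<lambda>x. 0) = (\<lambda>x. 0)"
  by (auto simp: dunkl_def partial_deriv_def)

lemma dunkl_hpoly: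
  assumes "f \<in> hpoly k" shows "dunkl \<kappa> i f \<in> hpoly (k - 1)"
  using assms
proof induction
  case (monomial \<alpha>)
  show ?case
  proof (cases "\<alpha> i = 0")
    case True then show ?thesis by (simp add: dunkl_xpow hpoly.zero)
  next
    case False
    have "sum (\<alpha>(i := \<alpha> i - 1)) UNIV = k - 1"
      using monomial False by (simp add: sum.remove[of UNIV i])
    then show ?thesis unfolding dunkl_xpow by (intro hpoly.intros)
  qed
qed (auto simp: dunkl_add dunkl_cmult hpoly_axis_diff intro: hpoly.intros)

text \<open>
  On a monomial each operator only lowers one exponent and multiplies by a number depending on that
  exponent, so the order is immaterial.
\<close>

lemma dunkl_commute:
  assumes "f \<in> hpoly k"
  shows "dunkl \<kappa> i (dunkl \<kappa> j f) = dunkl \<kappa> j (dunkl \<kappa> i f)"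
  using assms
proof induction
  case (monomial \<alpha>)
  show ?case
    by (cases "i = j") (auto simp: dunkl_xpow dunkl_cmult fun_upd_twist)
next
  case (add f g)
  then show ?case
    by (simp add: dunkl_add hpoly_axis_diff hpoly_axis_diff[OF dunkl_hpoly])
next
  case (scale f c)
  then show ?case
    by (simp add: dunkl_cmult hpoly_axis_diff hpoly_axis_diff[OF dunkl_hpoly])
qed auto

lemma dunkl_sum:
  assumes "finite A" "\<And>a. a \<in> A \<Longrightarrow> f a \<in> hpoly k"
  shows "dunkl \<kappa> i (\<lambda>x. \<Sum>a\<in>A. f a x) = (\<lambda>x. \<Sum>a\<in>A. dunkl \<kappa> i (f a) x)"
  using assms
proof (induction A rule: finite_induct)
  case (insert a A)
  have "axis_diff i (f a)" "axis_diff i (\<lambda>x. \<Sum>a\<in>A. f a x)"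
    using insert by (auto intro!: hpoly_axis_diff[where k=k] hpoly_sum)
  then show ?case using insert by (simp add: dunkl_add)
qed auto

lemma h_laplacian_add:
  assumes "f \<in> hpoly k" "g \<in> hpoly k"
  shows "h_laplacian \<kappa> (\<lambda>x. f x + g x) x = h_laplacian \<kappa> f x + h_laplacian \<kappa> g x"
  using assms
  by (simp add: h_laplacian_def dunkl_add hpoly_axis_diff hpoly_axis_diff[OF dunkl_hpoly] sum.distrib)

lemma h_laplacian_cmult:
  assumes "f \<in> hpoly k"
  shows "h_laplacian \<kappa> (\<lambda>x. c * f x) x = c * h_laplacian \<kappa> f x"
  using assms
  by (simp add: h_laplacian_def dunkl_cmult hpoly_axis_diff hpoly_axis_diff[OF dunkl_hpoly] sum_distrib_left)

lemma h_laplacian_sum: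
  assumes "finite A" "\<And>a. a \<in> A \<Longrightarrow> f a \<in> hpoly k"
  shows "h_laplacian \<kappa> (\<lambda>x. \<Sum>a\<in>A. f a x) x = (\<Sum>a\<in>A. h_laplacian \<kappa> (f a) x)"
  using assms
proof (induction A rule: finite_induct)
  case empty show ?case by (simp add: h_laplacian_def)
next
  case (insert a A)
  then show ?case by (simp add: h_laplacian_add[of _ k] hpoly_sum)
qed

definition h_harm :: "real ^ 'n \<Rightarrow> nat \<Rightarrow> (real ^ 'n::finite \<Rightarrow> real) set" where
  "h_harm \<kappa> n = {P \<in> hpoly n. \<forall>x. h_laplacian \<kappa> P x = 0}"

lemma h_harmonics_eq: "h_harmonics \<kappa> n = (\<lambda>P. restrict P (sphere 0 1)) ` h_harm \<kappa> n"
  by (auto simp: h_harmonics_def h_harm_def homogeneous_poly_iff_hpoly)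

lemma harm_lincomb:
  assumes "P \<in> h_harm \<kappa> n" "Q \<in> h_harm \<kappa> n"
  shows "(\<lambda>x. P x + Q x) \<in> h_harm \<kappa> n" "(\<lambda>x. c * P x) \<in> h_harm \<kappa> n"
  using assms by (auto simp: h_harm_def h_laplacian_add h_laplacian_cmult intro: hpoly.intros)

lemma harm_sum:
  assumes "finite A" "\<And>a. a \<in> A \<Longrightarrow> f a \<in> h_harm \<kappa> k"
  shows "(\<lambda>x. \<Sum>a\<in>A. f a x) \<in> h_harm \<kappa> k"
  using assms by (auto simp: h_harm_def h_laplacian_sum[of _ _ k] intro!: hpoly_sum)

lemma harm_dunkl:
  assumes "P \<in> h_harm \<kappa> n"
  shows "dunkl \<kappa> i P \<in> h_harm \<kappa> (n - 1)"
proof -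
  have P: "P \<in> hpoly n" "\<And>x. h_laplacian \<kappa> P x = 0" using assms by (auto simp: h_harm_def)
  have d: "dunkl \<kappa> j (dunkl \<kappa> j P) \<in> hpoly (n - 1 - 1)" for j
    using P(1) by (intro dunkl_hpoly)
  have "h_laplacian \<kappa> (dunkl \<kappa> i P) x = dunkl \<kappa> i (\<lambda>x. \<Sum>j\<in>UNIV. dunkl \<kappa> j (dunkl \<kappa> j P) x) x" for x
    unfolding h_laplacian_def
    by (subst dunkl_sum[of _ _ "n - 1 - 1"])
       (use d in \<open>auto simp: dunkl_commute[OF dunkl_hpoly[OF P(1)]] dunkl_commute[OF P(1), of _ i]\<close>)
  moreover have "(\<lambda>x. \<Sum>j\<in>UNIV. dunkl \<kappa> j (dunkl \<kappa> j P) x) = (\<lambda>x. 0)"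
    using P(2) by (simp add: h_laplacian_def)
  ultimately have "h_laplacian \<kappa> (dunkl \<kappa> i P) x = 0" for x by simp
  then show ?thesis using dunkl_hpoly[OF P(1)] by (simp add: h_harm_def)
qed

lemma hpoly_refl: "f \<in> hpoly k \<Longrightarrow> (\<lambda>x. f (coord_refl i x)) \<in> hpoly k"
  by (induction rule: hpoly.induct) (auto simp: xpow_refl intro: hpoly.intros)

lemma h_laplacian_xpow:
  "h_laplacian \<kappa> (xpow \<alpha>) x = (\<Sum>j\<in>UNIV. dunkl_coeff (\<kappa> $ j) (\<alpha> j) * dunkl_coeff (\<kappa> $ j) (\<alpha> j - 1) * xpow (\<alpha>(j := \<alpha> j - 2)) x)"
  by (simp add: h_laplacian_def dunkl_xpow dunkl_cmult numeral_2_eq_2 mult.assoc)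

lemma h_laplacian_refl:
  assumes "f \<in> hpoly k"
  shows "h_laplacian \<kappa> (\<lambda>x. f (coord_refl i x)) x = h_laplacian \<kappa> f (coord_refl i x)"
  using assms
proof (induction arbitrary: x)
  case (monomial \<alpha>)
  have *: "dunkl_coeff (\<kappa> $ j) (\<alpha> j) * dunkl_coeff (\<kappa> $ j) (\<alpha> j - 1) * xpow (\<alpha>(j := \<alpha> j - 2)) (coord_refl i x)
     = (-1) ^ \<alpha> i * (dunkl_coeff (\<kappa> $ j) (\<alpha> j) * dunkl_coeff (\<kappa> $ j) (\<alpha> j - 1) * xpow (\<alpha>(j := \<alpha> j - 2)) x)" for j
  proof (cases "\<alpha> j < 2")
    case True
    then have "\<alpha> j = 0 \<or> \<alpha> j = 1" by auto
    then show ?thesis by auto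
  next
    case False
    then have "(-1::real) ^ ((\<alpha>(j := \<alpha> j - 2)) i) = (-1) ^ \<alpha> i"
      by (simp add: uminus_power_if)
    then show ?thesis by (simp add: xpow_refl)
  qed
  have "h_laplacian \<kappa> (\<lambda>x. xpow \<alpha> (coord_refl i x)) x = (-1) ^ \<alpha> i * h_laplacian \<kappa> (xpow \<alpha>) x"
    unfolding xpow_refl by (rule h_laplacian_cmult[OF hpoly.monomial[OF refl]])
  also have "\<dots> = h_laplacian \<kappa> (xpow \<alpha>) (coord_refl i x)"
    unfolding h_laplacian_xpow * by (simp add: sum_distrib_left)
  finally show ?case .
next
  case zero then show ?case by (simp add: h_laplacian_def)
next
  case (add f g)
  then show ?case by (simp add: h_laplacian_add[of _ k] hpoly_refl)
next
  case (scale f c)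
  then show ?case by (simp add: h_laplacian_cmult[of _ k] hpoly_refl)
qed

lemma harm_refl: "P \<in> h_harm \<kappa> n \<Longrightarrow> (\<lambda>x. P (coord_refl i x)) \<in> h_harm \<kappa> n"
  by (auto simp: h_harm_def hpoly_refl h_laplacian_refl)

text \<open>
  Leibniz rule for a monomial factor. The last term, in which the other factor is reflected, arises
  when the monomial changes sign under the reflection; for h-harmonic \<open>P\<close> it is again h-harmonic.
\<close>

lemma dunkl_xpow_mult:
  assumes "P \<in> hpoly k"
  shows "dunkl \<kappa> i (\<lambda>x. xpow \<beta> x * P x) = (\<lambda>x. xpow \<beta> x * dunkl \<kappa> i P x
      + real (\<beta> i) * (xpow (\<beta>(i := \<beta> i - 1)) x * P x)
      + (if odd (\<beta> i) then 2 * \<kappa> $ i else 0) * (xpow (\<beta>(i := \<beta> i - 1)) x * P (coord_refl i x)))"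
  using assms
proof induction
  case (monomial \<gamma>)
  have 1: "real (\<beta> i) * (xpow (\<beta>(i := \<beta> i - 1)) x * xpow \<gamma> x)
        = real (\<beta> i) * xpow (\<lambda>j. if j = i then \<beta> i + \<gamma> i - 1 else \<beta> j + \<gamma> j) x"
    "(if odd (\<beta> i) then c else 0) * (xpow (\<beta>(i := \<beta> i - 1)) x * xpow \<gamma> x)
        = (if odd (\<beta> i) then c else 0) * xpow (\<lambda>j. if j = i then \<beta> i + \<gamma> i - 1 else \<beta> j + \<gamma> j) x" for x c
    by (cases "\<beta> i = 0"; auto simp: xpow_add intro!: arg_cong[where f="\<lambda>a. xpow a x"])+
  have 2: "dunkl_coeff (\<kappa> $ i) (\<gamma> i) * (xpow \<beta> x * xpow (\<gamma>(i := \<gamma> i - 1)) x)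
        = dunkl_coeff (\<kappa> $ i) (\<gamma> i) * xpow (\<lambda>j. if j = i then \<beta> i + \<gamma> i - 1 else \<beta> j + \<gamma> j) x" for x
    by (cases "\<gamma> i = 0") (auto simp: xpow_add intro!: arg_cong[where f="\<lambda>a. xpow a x"])
  have 3: "(\<lambda>j. \<beta> j + \<gamma> j)(i := \<beta> i + \<gamma> i - 1) = (\<lambda>j. if j = i then \<beta> i + \<gamma> i - 1 else \<beta> j + \<gamma> j)"
    by auto
  show ?case
  proof
    fix x
    let ?X = "xpow (\<lambda>j. if j = i then \<beta> i + \<gamma> i - 1 else \<beta> j + \<gamma> j) x"
    have L: "dunkl \<kappa> i (\<lambda>x. xpow \<beta> x * xpow \<gamma> x) x = dunkl_coeff (\<kappa> $ i) (\<beta> i + \<gamma> i) * ?X"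
      unfolding xpow_add dunkl_xpow 3 by simp
    have R: "xpow \<beta> x * dunkl \<kappa> i (xpow \<gamma>) x + real (\<beta> i) * (xpow (\<beta>(i := \<beta> i - 1)) x * xpow \<gamma> x)
      + (if odd (\<beta> i) then 2 * \<kappa> $ i else 0) * (xpow (\<beta>(i := \<beta> i - 1)) x * xpow \<gamma> (coord_refl i x))
      = dunkl_coeff (\<kappa> $ i) (\<gamma> i) * ?X + real (\<beta> i) * ?X
        + (-1) ^ \<gamma> i * ((if odd (\<beta> i) then 2 * \<kappa> $ i else 0) * ?X)"
      unfolding dunkl_xpow xpow_refl 1(1)[symmetric] 2[symmetric] 1(2)[symmetric]
      by (simp add: algebra_simps)
    show "dunkl \<kappa> i (\<lambda>x. xpow \<beta> x * xpow \<gamma> x) x = xpow \<beta> x * dunkl \<kappa> i (xpow \<gamma>) x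
      + real (\<beta> i) * (xpow (\<beta>(i := \<beta> i - 1)) x * xpow \<gamma> x)
      + (if odd (\<beta> i) then 2 * \<kappa> $ i else 0) * (xpow (\<beta>(i := \<beta> i - 1)) x * xpow \<gamma> (coord_refl i x))"
      unfolding L R by (auto simp: dunkl_coeff_def algebra_simps)
  qed
next
  case (add f g)
  have "axis_diff i (\<lambda>x. xpow \<beta> x * f x)" "axis_diff i (\<lambda>x. xpow \<beta> x * g x)"
    using hpoly_axis_diff[OF hpoly_mult[OF hpoly.monomial[OF refl]]] add by blast+
  then show ?case using add
    by (simp add: distrib_left dunkl_add hpoly_axis_diff algebra_simps)
next
  case (scale f c)
  have "axis_diff i (\<lambda>x. xpow \<beta> x * f x)"
    using hpoly_axis_diff[OF hpoly_mult[OF hpoly.monomial[OF refl]]] scale by blast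
  from dunkl_cmult(2)[OF this, of \<kappa> c] show ?case using scale
    by (simp add: dunkl_cmult hpoly_axis_diff algebra_simps)
qed auto

text \<open>
  Euler's identity for the differential part; the difference parts add terms that integrate to zero
  against a reflection-invariant measure.
\<close>

lemma euler_dunkl:
  assumes "P \<in> hpoly n"
  shows "(\<Sum>i\<in>UNIV. x $ i * dunkl \<kappa> i P x) = real n * P x + (\<Sum>i\<in>UNIV. \<kappa> $ i * (P x - P (coord_refl i x)))"
  using assms
proof induction
  case (monomial \<alpha>)
  have "x $ i * dunkl \<kappa> i (xpow \<alpha>) x = real (\<alpha> i) * xpow \<alpha> x + \<kappa> $ i * (xpow \<alpha> x - xpow \<alpha> (coord_refl i x))" for i
  proof (cases "\<alpha> i")
    case 0 then show ?thesis by (simp add: dunkl_xpow xpow_refl)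
  next
    case (Suc m)
    have *: "x $ i * xpow (\<alpha>(i := m)) x = xpow \<alpha> x"
      using Suc by (simp add: xpow_split[of _ _ i])
    have "x $ i * dunkl \<kappa> i (xpow \<alpha>) x = dunkl_coeff (\<kappa> $ i) (\<alpha> i) * (x $ i * xpow (\<alpha>(i := m)) x)"
      using Suc by (simp add: dunkl_xpow)
    then show ?thesis using Suc
      by (auto simp: * xpow_refl dunkl_coeff_def uminus_power_if algebra_simps)
  qed
  then show ?case using monomial
    by (simp add: sum.distrib sum_distrib_right[symmetric] of_nat_sum[symmetric] del: of_nat_sum)
next
  case (add f g)
  then show ?case by (simp add: dunkl_add hpoly_axis_diff algebra_simps sum.distrib sum_subtractf)
next
  case (scale f c)
  have "(\<Sum>i\<in>UNIV. x $ i * dunkl \<kappa> i (\<lambda>x. c * f x) x) = c * (\<Sum>i\<in>UNIV. x $ i * dunkl \<kappa> i f x)"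
    using scale(1) by (simp add: dunkl_cmult hpoly_axis_diff sum_distrib_left mult.left_commute)
  also have "\<dots> = real n * (c * f x) + (\<Sum>i\<in>UNIV. \<kappa> $ i * (c * f x - c * f (coord_refl i x)))"
    unfolding scale.IH by (simp add: algebra_simps sum_distrib_left)
  finally show ?case .
qed auto

section \<open>Integration over the sphere in Lebesgue coordinates\<close>

abbreviation pball :: "(real ^ 'n) set" where "pball \<equiv> ball 0 1 - {0}"

definition hw2 :: "real ^ 'n \<Rightarrow> real ^ 'n \<Rightarrow> real" where
  "hw2 \<kappa> x = (hweight \<kappa> x)\<^sup>2"

lemma hw2_nonneg: "0 \<le> hw2 \<kappa> x"
  by (simp add: hw2_def)

lemma continuous_hw2:
  assumes "\<And>i. 0 \<le> \<kappa> $ i"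
  shows "continuous_on UNIV (hw2 \<kappa>)"
proof -
  have "continuous_on UNIV (\<lambda>x::real^'a. if \<kappa> $ i = 0 then 1 else \<bar>x $ i\<bar> powr (\<kappa> $ i))" for i
    using assms[of i] by (cases "\<kappa> $ i = 0") (auto intro!: continuous_intros continuous_on_powr')
  then show ?thesis
    unfolding hw2_def hweight_def by (intro continuous_intros) auto
qed

lemma borel_measurable_hw2 [measurable]:
  assumes "\<And>i. 0 \<le> \<kappa> $ i"
  shows "hw2 \<kappa> \<in> borel_measurable borel"
  using continuous_hw2[OF assms] by (rule borel_measurable_continuous_onI)

lemma hw2_scale:
  assumes "t > 0" "\<And>i. 0 \<le> \<kappa> $ i"
  shows "hw2 \<kappa> (t *\<^sub>R x) = t powr (2 * (\<Sum>i\<in>UNIV. \<kappa> $ i)) * hw2 \<kappa> x"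
proof -
  have "hweight \<kappa> (t *\<^sub>R x) = (\<Prod>i\<in>UNIV. t powr (\<kappa> $ i)) * hweight \<kappa> x"
    unfolding hweight_def prod.distrib[symmetric]
    using assms by (intro prod.cong) (auto simp: abs_mult powr_mult)
  also have "(\<Prod>i\<in>UNIV. t powr (\<kappa> $ i)) = t powr (\<Sum>i\<in>UNIV. \<kappa> $ i)"
    using assms by (subst powr_sum) auto
  finally show ?thesis
    using assms by (simp add: hw2_def power_mult_distrib powr_power mult.commute)
qed

lemma hw2_refl: "hw2 \<kappa> (coord_refl i x) = hw2 \<kappa> x"
proof -
  have "\<bar>coord_refl i x $ j\<bar> = \<bar>x $ j\<bar>" for j by (simp add: coord_refl_nth)
  then have "hweight \<kappa> (coord_refl i x) = hweight \<kappa> x"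
    unfolding hweight_def by (simp only:)
  then show ?thesis by (simp add: hw2_def)
qed

lemma hw2_pos: "(\<And>i. x $ i \<noteq> 0) \<Longrightarrow> 0 < hw2 \<kappa> x"
  by (auto simp: hw2_def hweight_def intro!: prod_pos zero_less_power)

lemma sgn_measurable_sphere:
  "(sgn :: real ^ 'n \<Rightarrow> _) \<in> restrict_space lborel pball \<rightarrow>\<^sub>M restrict_space borel (sphere 0 1)"
proof (rule measurable_restrict_space2)
  show "sgn \<in> space (restrict_space lborel pball) \<rightarrow> (sphere 0 1 :: (real ^ 'n) set)"
    by (auto simp: space_restrict_space norm_sgn)
  have "(\<lambda>x :: real ^ 'n. x /\<^sub>R norm x) \<in> borel_measurable borel" by measurable
  then show "(sgn :: real ^ 'n \<Rightarrow> _) \<in> borel_measurable (restrict_space lborel pball)"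
    by (intro measurable_restrict_space1) (simp add: sgn_div_norm [abs_def])
qed

lemma borel_measurable_sgn [measurable]: "(sgn :: real ^ 'n \<Rightarrow> _) \<in> borel_measurable borel"
proof -
  have "(\<lambda>x :: real ^ 'n. x /\<^sub>R norm x) \<in> borel_measurable borel" by measurable
  then show ?thesis by (simp add: sgn_div_norm [abs_def])
qed

lemma scale_measure_eq_density: "scale_measure r M = density M (\<lambda>_. r)"
  by (rule measure_eqI) (auto simp: emeasure_density_const emeasure_density nn_integral_cmult)

lemma integral_surface_measure:
  fixes f :: "real ^ 'n \<Rightarrow> real"
  assumes f: "f \<in> borel_measurable (restrict_space borel (sphere 0 1))"
  shows "(\<integral>x. f x \<partial>surface_measure) = real CARD('n) * (\<integral>x. indicator pball x * f (sgn x) \<partial>lborel)"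
proof -
  let ?M = "distr (restrict_space lborel pball) (restrict_space borel (sphere 0 1)) sgn :: (real ^ 'n) measure"
  have "(\<integral>x. f x \<partial>surface_measure) = (\<integral>x. f x \<partial>density ?M (\<lambda>_. ennreal (real CARD('n))))"
    unfolding surface_measure_def scale_measure_eq_density by (simp add: ennreal_of_nat_eq_real_of_nat)
  also have "\<dots> = real CARD('n) * (\<integral>x. f x \<partial>?M)"
    using f by (subst integral_density) auto
  also have "(\<integral>x. f x \<partial>?M) = (\<integral>x. f (sgn x) \<partial>restrict_space lborel pball)"
    by (rule integral_distr[OF sgn_measurable_sphere f])
  also have "\<dots> = (\<integral>x. indicator pball x *\<^sub>R f (sgn x) \<partial>lborel)"
    by (rule integral_restrict_space) simp
  finally show ?thesis by simp
qed

lemma emeasure_surface_space_finite: "emeasure (surface_measure :: (real ^ 'n) measure) (sphere 0 1) < \<infinity>"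
proof -
  have "emeasure (surface_measure :: (real ^ 'n) measure) (sphere 0 1) \<le> of_nat CARD('n) * emeasure lborel (ball 0 1 :: (real ^ 'n) set)"
    by (subst emeasure_surface_measure) (auto intro!: mult_left_mono emeasure_mono)
  also have "\<dots> < \<infinity>"
    using emeasure_lborel_ball_finite[of "0 :: real ^ 'n" 1] by (simp add: ennreal_mult_less_top less_top ennreal_of_nat_eq_real_of_nat)
  finally show ?thesis .
qed

text \<open>
  The weight vanishes only on coordinate hyperplanes, which form a null set, whereas the cone over
  \<open>{x. 0 < g x}\<close> is open.
\<close>

lemma weighted_integral_zero_imp_zero:
  fixes g :: "real ^ 'n \<Rightarrow> real"
  assumes g: "continuous_on (sphere 0 1) g" and nonneg: "\<And>x. x \<in> sphere 0 1 \<Longrightarrow> 0 \<le> g x"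
    and \<kappa>: "\<And>i. 0 \<le> \<kappa> $ i"
    and zero: "(\<integral>x. hw2 \<kappa> x * g x \<partial>surface_measure) = 0"
    and x0: "x0 \<in> sphere 0 1"
  shows "g x0 = 0"
proof (rule ccontr)
  assume "g x0 \<noteq> 0"
  with nonneg[OF x0] have pos: "g x0 > 0" by simp
  let ?G = "\<lambda>x. hw2 \<kappa> x * g x"
  have cG: "continuous_on (sphere 0 1) ?G"
    by (intro continuous_intros g continuous_on_subset[OF continuous_hw2[OF \<kappa>]]) auto
  have mG: "?G \<in> borel_measurable (restrict_space borel (sphere 0 1))"
    by (rule borel_measurable_continuous_on_restrict[OF cG])
  obtain B where B: "\<And>x. x \<in> sphere 0 1 \<Longrightarrow> norm (?G x) \<le> B"
  proof -
    have "bounded (?G ` sphere 0 1)"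
      using compact_continuous_image[OF cG] compact_imp_bounded by auto
    then obtain b where "\<forall>y\<in>?G ` sphere 0 1. norm y \<le> b" unfolding bounded_iff by blast
    then show ?thesis by (intro that[of b]) auto
  qed
  let ?H = "\<lambda>x. indicator pball x * ?G (sgn x)"
  have mH: "?H \<in> borel_measurable lborel"
  proof -
    have "(\<lambda>x. ?G (sgn x)) \<in> borel_measurable (restrict_space lborel pball)"
      using measurable_compose[OF sgn_measurable_sphere mG] .
    then show ?thesis
      by (subst (asm) borel_measurable_restrict_space_iff) (auto simp: mult.commute)
  qed
  have iH: "integrable lborel ?H"
  proof (rule integrableI_bounded_set[where A="ball 0 1" and B=B])
    show "AE x in lborel. x \<in> ball 0 1 \<longrightarrow> norm (?H x) \<le> B"
    proof (rule AE_I2, rule impI)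
      fix x :: "real ^ 'n"
      show "norm (?H x) \<le> B"
      proof (cases "x = 0")
        case True
        have "0 \<le> B" using B[OF x0] norm_ge_zero order_trans by blast
        with True show ?thesis by simp
      next
        case False
        then have "norm (?G (sgn x)) \<le> B" by (intro B) (simp add: norm_sgn)
        moreover have "norm (?H x) \<le> norm (?G (sgn x))" by (auto simp: indicator_def)
        ultimately show ?thesis by linarith
      qed
    qed
  qed (use mH emeasure_lborel_ball_finite in auto)
  have H0: "0 \<le> ?H x" for x
    by (auto simp: indicator_def norm_sgn intro!: mult_nonneg_nonneg hw2_nonneg nonneg)
  have "(\<integral>x. ?H x \<partial>lborel) = 0"
    using zero unfolding integral_surface_measure[OF mG] by simp
  then have ae: "AE x in lborel. ?H x = 0"
    using integral_nonneg_eq_0_iff_AE[OF iH] H0 by simp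
  have cs: "continuous_on pball (\<lambda>x. g (sgn x))"
    by (rule continuous_on_compose2[OF g]) (auto intro!: continuous_intros simp: norm_sgn split: if_splits)
  define V where "V = {x \<in> pball. g (sgn x) > 0}"
  have oV: "open V"
  proof -
    have "open ((\<lambda>x. g (sgn x)) -` {0<..} \<inter> pball)"
      using continuous_on_open_vimage[of pball "\<lambda>x. g (sgn x)"] cs by (simp add: open_Diff open_greaterThan)
    moreover have "V = (\<lambda>x. g (sgn x)) -` {0<..} \<inter> pball"
      by (auto simp: V_def)
    ultimately show ?thesis by simp
  qed
  have "(1/2) *\<^sub>R x0 \<in> V"
    using x0 pos by (auto simp: V_def sgn_div_norm)
  moreover have "V \<subseteq> {}"
  proof -
    have ae2: "AE x in lborel. x \<notin> V"
    proof -
      have "AE x in lborel. \<forall>i. (x :: real ^ 'n) $ i \<noteq> 0"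
      proof (subst AE_all_countable, rule allI)
        fix i :: 'n
        have "negligible {x :: real ^ 'n. axis i 1 \<bullet> x = 0}"
          by (rule negligible_hyperplane) (simp add: axis_eq_0_iff)
        then have "{x :: real ^ 'n. x $ i = 0} \<in> null_sets lebesgue"
          by (simp add: negligible_iff_null_sets inner_axis inner_commute)
        moreover have "{x :: real ^ 'n. x $ i = 0} \<in> sets borel"
          by (intro borel_closed closed_Collect_eq) (auto intro!: continuous_intros)
        ultimately have "{x :: real ^ 'n. x $ i = 0} \<in> null_sets lborel"
          by (simp add: null_sets_completion_iff)
        from AE_not_in[OF this] show "AE x :: real ^ 'n in lborel. x $ i \<noteq> 0" by simp
      qed
      with ae show ?thesis
      proof eventually_elim
        case (elim x)
        show ?case
        proof
          assume x: "x \<in> V"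
          then have "sgn x $ i \<noteq> 0" for i using elim(2)
            by (auto simp: V_def sgn_div_norm)
          from hw2_pos[OF this, of \<kappa>] x elim(1) show False by (auto simp: V_def)
        qed
      qed
    qed
    have "V \<in> null_sets lborel"
      using AE_iff_null_sets[of V lborel] ae2 oV by simp
    then have "negligible V"
      using negligible_iff_null_sets null_sets_completionI by blast
    with oV show ?thesis using open_not_negligible by blast
  qed
  ultimately show False by blast
qed

lemma surface_integral_hw2_pos:
  assumes "\<And>i. 0 \<le> (\<kappa> :: real ^ 'n) $ i"
  shows "(\<integral>x. (hweight \<kappa> x)\<^sup>2 \<partial>surface_measure) > 0"
proof -
  have "(\<integral>x. hw2 \<kappa> x * 1 \<partial>surface_measure) \<noteq> 0"
    using weighted_integral_zero_imp_zero[OF _ _ assms, of "\<lambda>_. 1" "axis undefined 1"] by auto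
  moreover have "(\<integral>x. hw2 \<kappa> x \<partial>surface_measure) \<ge> 0"
    by (rule Bochner_Integration.integral_nonneg) (rule hw2_nonneg)
  moreover have "hw2 \<kappa> = (\<lambda>x. (hweight \<kappa> x)\<^sup>2)"
    by (simp add: hw2_def fun_eq_iff)
  ultimately show ?thesis by (simp add: less_le)
qed

lemma a_const_pos: "(\<And>i. 0 \<le> (\<kappa> :: real ^ 'n) $ i) \<Longrightarrow> a_const \<kappa> > 0"
  unfolding a_const_def using surface_integral_hw2_pos[of \<kappa>] by simp

lemma sets_hmeasure [measurable_cong, simp]: "sets (hmeasure \<kappa>) = sets (restrict_space borel (sphere 0 1))"
  by (simp add: hmeasure_def)

lemma space_hmeasure [simp]: "space (hmeasure \<kappa>) = sphere 0 1"
  by (simp add: hmeasure_def)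

lemma hw2_measurable_sphere:
  assumes "\<And>i. 0 \<le> (\<kappa> :: real ^ 'n) $ i"
  shows "hw2 \<kappa> \<in> borel_measurable (restrict_space borel (sphere 0 1))"
  by (rule measurable_restrict_space1[OF borel_measurable_hw2[OF assms]])

lemma integral_hmeasure:
  fixes f :: "real ^ 'n \<Rightarrow> real"
  assumes \<kappa>: "\<And>i. 0 \<le> \<kappa> $ i"
    and f: "f \<in> borel_measurable (restrict_space borel (sphere 0 1))"
  shows "(\<integral>x. f x \<partial>hmeasure \<kappa>) =
           a_const \<kappa> * real CARD('n) * (\<integral>x. indicator pball x * (hw2 \<kappa> (sgn x) * f (sgn x)) \<partial>lborel)"
proof -
  note [measurable] = hw2_measurable_sphere[OF \<kappa>] f
  have cong: "(f \<in> borel_measurable surface_measure) = (f \<in> borel_measurable (restrict_space borel (sphere 0 1)))"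
    for f :: "real ^ 'n \<Rightarrow> real" by (subst measurable_cong_sets[of _ "restrict_space borel (sphere 0 1)" borel borel]) auto
  have "(\<integral>x. f x \<partial>hmeasure \<kappa>) = (\<integral>x. (a_const \<kappa> * hw2 \<kappa> x) *\<^sub>R f x \<partial>surface_measure)"
    unfolding hmeasure_def hw2_def[symmetric]
    using a_const_pos[OF \<kappa>, THEN less_imp_le] hw2_nonneg
    by (intro integral_density) (auto simp: cong intro!: AE_I2 mult_nonneg_nonneg)
  also have "\<dots> = a_const \<kappa> * (\<integral>x. hw2 \<kappa> x * f x \<partial>surface_measure)"
    by (simp add: mult.assoc)
  finally show ?thesis
    by (subst (asm) integral_surface_measure) auto
qed

lemma emeasure_hmeasure_space:
  assumes \<kappa>: "\<And>i. 0 \<le> (\<kappa> :: real ^ 'n) $ i"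
  shows "emeasure (hmeasure \<kappa>) (sphere 0 1) = 1"
proof -
  note [measurable] = hw2_measurable_sphere[OF \<kappa>]
  have cong: "(f \<in> borel_measurable surface_measure) = (f \<in> borel_measurable (restrict_space borel (sphere 0 1)))"
    for f :: "real ^ 'n \<Rightarrow> real" by (subst measurable_cong_sets[of _ "restrict_space borel (sphere 0 1)" borel borel]) auto
  have m: "hw2 \<kappa> \<in> borel_measurable surface_measure" by (simp add: cong)
  have cont: "continuous_on (sphere 0 1) (hw2 \<kappa>)"
    by (rule continuous_on_subset[OF continuous_hw2[OF \<kappa>]]) simp
  obtain B where B: "\<And>x. x \<in> sphere 0 1 \<Longrightarrow> norm (hw2 \<kappa> x) \<le> B"
  proof -
    have "bounded (hw2 \<kappa> ` sphere 0 1)"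
      using compact_continuous_image[OF cont] compact_imp_bounded by auto
    then obtain b where "\<forall>y\<in>hw2 \<kappa> ` sphere 0 1. norm y \<le> b" unfolding bounded_iff by blast
    then show ?thesis by (intro that[of b]) auto
  qed
  have int: "integrable surface_measure (hw2 \<kappa>)"
    by (rule integrableI_bounded_set[where A="sphere 0 1" and B=B])
       (use B m emeasure_surface_space_finite in \<open>auto simp: sets_restrict_space intro!: image_eqI[of _ _ UNIV]\<close>)
  have "emeasure (hmeasure \<kappa>) (sphere 0 1) = (\<integral>\<^sup>+x. ennreal (a_const \<kappa> * hw2 \<kappa> x) \<partial>surface_measure)"
    unfolding hmeasure_def hw2_def[symmetric]
    using m by (subst emeasure_density) (auto intro!: nn_integral_cong simp: sets_restrict_space intro!: image_eqI[of _ _ UNIV])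
  also have "\<dots> = ennreal (\<integral>x. a_const \<kappa> * hw2 \<kappa> x \<partial>surface_measure)"
    using int a_const_pos[OF \<kappa>] hw2_nonneg
    by (intro nn_integral_eq_integral) (auto intro!: AE_I2 mult_nonneg_nonneg)
  also have "(\<integral>x. a_const \<kappa> * hw2 \<kappa> x \<partial>surface_measure) = 1"
    using surface_integral_hw2_pos[OF \<kappa>] by (simp add: a_const_def hw2_def)
  finally show "emeasure (hmeasure \<kappa>) (sphere 0 1) = 1" by simp
qed

lemma finite_measure_hmeasure:
  assumes "\<And>i. 0 \<le> (\<kappa> :: real ^ 'n) $ i"
  shows "finite_measure (hmeasure \<kappa>)"
  by (rule finite_measureI) (simp add: emeasure_hmeasure_space[OF assms])

lemma continuous_measurable_hmeasure:
  "continuous_on (sphere 0 1) f \<Longrightarrow> (f :: real ^ 'n \<Rightarrow> real) \<in> borel_measurable (hmeasure \<kappa>)"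
  using borel_measurable_continuous_on_restrict[of "sphere 0 1" f]
  by (simp cong: measurable_cong_sets)

lemma integrable_hmeasure_bounded:
  fixes f :: "real ^ 'n \<Rightarrow> real"
  assumes \<kappa>: "\<And>i. 0 \<le> \<kappa> $ i" and "f \<in> borel_measurable (hmeasure \<kappa>)" "\<And>x. x \<in> sphere 0 1 \<Longrightarrow> \<bar>f x\<bar> \<le> B"
  shows "integrable (hmeasure \<kappa>) f"
proof -
  interpret finite_measure "hmeasure \<kappa>" by (rule finite_measure_hmeasure[OF \<kappa>])
  show ?thesis
    using assms by (intro integrable_const_bound[of _ B]) auto
qed

lemma continuous_sphere_bounded:
  fixes f :: "real ^ 'n \<Rightarrow> real"
  assumes "continuous_on (sphere 0 1) f"
  obtains B where "B > 0" "\<And>x. x \<in> sphere 0 1 \<Longrightarrow> \<bar>f x\<bar> \<le> B"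
proof -
  have "bounded (f ` sphere 0 1)"
    using compact_continuous_image[OF assms] compact_imp_bounded by auto
  then show ?thesis using that by (auto simp: bounded_pos)
qed

lemma integrable_hmeasure_continuous:
  fixes f :: "real ^ 'n \<Rightarrow> real"
  assumes "\<And>i. 0 \<le> \<kappa> $ i" "continuous_on (sphere 0 1) f"
  shows "integrable (hmeasure \<kappa>) f"
  using continuous_sphere_bounded[OF assms(2)] integrable_hmeasure_bounded[OF assms(1)]
    continuous_measurable_hmeasure[OF assms(2)] by metis

lemma hmeasure_definite:
  fixes g :: "real ^ 'n \<Rightarrow> real"
  assumes g: "continuous_on (sphere 0 1) g" and nonneg: "\<And>x. x \<in> sphere 0 1 \<Longrightarrow> 0 \<le> g x"
    and \<kappa>: "\<And>i. 0 \<le> \<kappa> $ i"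
    and zero: "(\<integral>x. g x \<partial>hmeasure \<kappa>) = 0"
    and x0: "x0 \<in> sphere 0 1"
  shows "g x0 = 0"
proof (rule weighted_integral_zero_imp_zero[OF g nonneg \<kappa> _ x0])
  have m: "g \<in> borel_measurable (restrict_space borel (sphere 0 1))"
    by (rule borel_measurable_continuous_on_restrict[OF g])
  note [measurable] = hw2_measurable_sphere[OF \<kappa>] m
  show "(\<integral>x. hw2 \<kappa> x * g x \<partial>surface_measure) = 0"
    using zero a_const_pos[OF \<kappa>] unfolding integral_hmeasure[OF \<kappa> m]
    by (subst integral_surface_measure) auto
qed

section \<open>Integration by parts for Dunkl operators\<close>

lemma pball_sets [measurable, simp]: "pball \<in> sets borel"
  by (intro sets.Diff borel_open borel_closed) auto

lemma borel_measurable_pball_sgn: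
  fixes g :: "real ^ 'n \<Rightarrow> real"
  assumes "continuous_on UNIV g"
  shows "(\<lambda>x. indicator pball x * g (sgn x)) \<in> borel_measurable borel"
  by (intro borel_measurable_times borel_measurable_indicator pball_sets
      measurable_compose[OF borel_measurable_sgn borel_measurable_continuous_onI[OF assms]])

lemma lborel_integral_coord_refl:
  fixes f :: "real ^ 'n \<Rightarrow> real"
  assumes [measurable]: "f \<in> borel_measurable borel"
  shows "(\<integral>x. f (coord_refl i x) \<partial>lborel) = (\<integral>x. f x \<partial>lborel)"
proof -
  define c :: "real ^ 'n \<Rightarrow> real" where "c j = (if j = axis i 1 then -1 else 1)" for j
  let ?T = "\<lambda>x :: real ^ 'n. 0 + (\<Sum>j\<in>Basis. (c j * (x \<bullet> j)) *\<^sub>R j)"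
  have T: "?T x = coord_refl i x" for x
  proof -
    have "(\<Sum>j\<in>Basis. (c j * (x \<bullet> j)) *\<^sub>R j) = (\<Sum>j\<in>Basis. (x \<bullet> j) *\<^sub>R j) - (\<Sum>j\<in>Basis. if j = axis i 1 then (2 * (x \<bullet> j)) *\<^sub>R j else 0)"
      unfolding sum_subtractf[symmetric] by (intro sum.cong) (auto simp: c_def algebra_simps scaleR_2[symmetric])
    also have "\<dots> = x - (2 * x $ i) *\<^sub>R axis i 1"
      by (simp add: euclidean_representation inner_axis axis_in_Basis_iff)
    finally show ?thesis by (simp add: coord_refl_def)
  qed
  have [measurable]: "?T \<in> borel_measurable borel" by measurable
  have "lborel = density (distr lborel borel ?T) (\<lambda>_. (\<Prod>j\<in>Basis. \<bar>c j\<bar>))"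
    by (rule lborel_affine_euclidean) (auto simp: c_def)
  moreover have "(\<Prod>j\<in>Basis. \<bar>c j\<bar>) = 1"
    by (intro prod.neutral) (auto simp: c_def)
  ultimately have L: "lborel = distr lborel borel ?T"
    by (simp add: density_1)
  have "(\<integral>x. f x \<partial>lborel) = (\<integral>x. f x \<partial>distr lborel borel ?T)"
    by (subst L) (rule refl)
  also have "\<dots> = (\<integral>x. f (?T x) \<partial>lborel)"
    by (rule integral_distr) auto
  finally show ?thesis by (simp only: T)
qed

lemma lborel_integral_odd:
  fixes f :: "real ^ 'n \<Rightarrow> real"
  assumes "f \<in> borel_measurable borel" "\<And>x. f (coord_refl i x) = - f x"
  shows "(\<integral>x. f x \<partial>lborel) = 0"
  using lborel_integral_coord_refl[OF assms(1), of i] by (simp add: assms(2))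

lemma lborel_integral_translate:
  fixes f :: "'a::euclidean_space \<Rightarrow> real"
  assumes [measurable]: "f \<in> borel_measurable borel"
  shows "(\<integral>x. f (x + c) \<partial>lborel) = (\<integral>x. f x \<partial>lborel)"
proof -
  have "(\<integral>x. f x \<partial>lborel) = (\<integral>x. f x \<partial>distr lborel borel ((+) c))"
    by (simp add: lborel_distr_plus)
  also have "\<dots> = (\<integral>x. f (c + x) \<partial>lborel)"
    by (rule integral_distr) auto
  finally show ?thesis by (simp add: add.commute)
qed

lemma lborel_integrable_continuous_ball:
  fixes f :: "'a::euclidean_space \<Rightarrow> real"
  assumes c: "continuous_on UNIV f" and z: "\<And>x. norm x \<ge> 1 \<Longrightarrow> f x = 0"
  shows "integrable lborel f" "\<exists>B. \<forall>x. \<bar>f x\<bar> \<le> B"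
proof -
  have m: "f \<in> borel_measurable borel" using c by (rule borel_measurable_continuous_onI)
  have "bounded (f ` cball 0 1)"
    by (intro compact_imp_bounded compact_continuous_image continuous_on_subset[OF c]) auto
  then obtain b where b: "\<forall>y\<in>f ` cball 0 1. norm y \<le> b" unfolding bounded_iff by blast
  have B: "\<bar>f x\<bar> \<le> max b 0" for x
    using b z[of x] by (cases "norm x \<le> 1") (auto simp: le_max_iff_disj)
  then show "\<exists>B. \<forall>x. \<bar>f x\<bar> \<le> B" by blast
  show "integrable lborel f"
  proof (rule integrableI_bounded_set[where A="ball 0 1" and B="max b 0"])
    show "AE x in lborel. x \<in> ball 0 1 \<longrightarrow> norm (f x) \<le> max b 0" using B by auto
    show "AE x in lborel. x \<notin> ball 0 1 \<longrightarrow> f x = 0" using z by (auto simp: not_less)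
  qed (use m emeasure_lborel_ball_finite in auto)
qed

text \<open>
  Averaging the derivative over the translates by \<open>t *\<^sub>R e\<close>, \<open>0 \<le> t \<le> 1\<close>, turns it into a difference of
  two translates of the function, whose integrals agree.
\<close>

lemma integral_directional_derivative:
  fixes u v :: "'a::euclidean_space \<Rightarrow> real"
  assumes u: "continuous_on UNIV u" "\<And>x. norm x \<ge> 1 \<Longrightarrow> u x = 0"
    and v: "continuous_on UNIV v" "\<And>x. norm x \<ge> 1 \<Longrightarrow> v x = 0"
    and ftc: "\<And>x. ((\<lambda>t. v (x + t *\<^sub>R e)) has_integral (u (x + e) - u x)) {0..1}"
  shows "(\<integral>x. v x \<partial>lborel) = 0"
proof -
  have [measurable]: "u \<in> borel_measurable borel" "v \<in> borel_measurable borel"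
    using u v by (auto intro: borel_measurable_continuous_onI)
  obtain B where B: "\<And>x. \<bar>v x\<bar> \<le> B" using lborel_integrable_continuous_ball[OF v] by blast
  have B0: "0 \<le> B" using B[of 0] by linarith
  let ?F = "\<lambda>(x, t :: real). indicator {0..1} t * v (x + t *\<^sub>R e)"
  let ?A = "ball 0 (1 + norm e) \<times> {0..1} :: ('a \<times> real) set"
  have intF: "integrable (lborel \<Otimes>\<^sub>M lborel) ?F"
  proof (rule integrableI_bounded_set[where A="?A" and B=B])
    have m: "?F \<in> borel_measurable (borel \<Otimes>\<^sub>M borel)" by measurable
    then show "?F \<in> borel_measurable (lborel \<Otimes>\<^sub>M lborel)"
      by (simp cong: measurable_cong_sets)
    show "emeasure (lborel \<Otimes>\<^sub>M lborel) ?A < \<infinity>"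
      by (subst lborel.emeasure_pair_measure_Times)
         (use emeasure_lborel_ball_finite[of "0 :: 'a" "1 + norm e"] in \<open>auto simp: ennreal_mult_less_top less_top\<close>)
    show "AE x in lborel \<Otimes>\<^sub>M lborel. x \<in> ?A \<longrightarrow> norm (?F x) \<le> B"
      using B B0 by (auto simp: indicator_def)
    show "AE x in lborel \<Otimes>\<^sub>M lborel. x \<notin> ?A \<longrightarrow> ?F x = 0"
    proof (rule AE_I2, rule impI)
      fix z :: "'a \<times> real"
      assume "z \<notin> ?A"
      moreover obtain x t where z: "z = (x, t)" by (cases z)
      ultimately have n: "(x, t) \<notin> ?A" by simp
      have "indicator {0..1} t * v (x + t *\<^sub>R e) = 0"
      proof (cases "t \<in> {0..1}")
        case True
        with n have "norm x \<ge> 1 + norm e" by auto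
        moreover have "norm (t *\<^sub>R e) \<le> norm e" using True by (auto intro!: mult_left_le_one_le)
        moreover have "norm x \<le> norm (x + t *\<^sub>R e) + norm (t *\<^sub>R e)"
          using norm_triangle_ineq4[of "x + t *\<^sub>R e" "t *\<^sub>R e"] by simp
        ultimately have "norm (x + t *\<^sub>R e) \<ge> 1" by linarith
        then show ?thesis by (simp add: v(2))
      qed simp
      then show "?F z = 0" by (simp add: z)
    qed
    show "?A \<in> sets (lborel \<Otimes>\<^sub>M lborel)" by auto
  qed
  have inner: "(\<integral>t. indicator {0..1} t * v (x + t *\<^sub>R e) \<partial>lborel) = u (x + e) - u x" for x
  proof -
    have c: "continuous_on {0..1} (\<lambda>t. v (x + t *\<^sub>R e))"
      by (rule continuous_on_compose2[OF v(1)]) (auto intro!: continuous_intros)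
    have "set_integrable lborel {0..1} (\<lambda>t. v (x + t *\<^sub>R e))"
      by (rule borel_integrable_atLeastAtMost'[OF c])
    from set_borel_integral_eq_integral(2)[OF this] integral_unique[OF ftc[of x]]
    show ?thesis by (simp add: set_lebesgue_integral_def)
  qed
  have "(\<integral>t. (\<integral>x. ?F (x, t) \<partial>lborel) \<partial>lborel) = (\<integral>x. (\<integral>t. ?F (x, t) \<partial>lborel) \<partial>lborel)"
    using lborel_pair.Fubini_integral[of "\<lambda>x t. indicator {0..1} t * v (x + t *\<^sub>R e)"] intF by simp
  also have "\<dots> = (\<integral>x. u (x + e) - u x \<partial>lborel)"
    by (simp add: inner)
  also have "\<dots> = (\<integral>x. u (x + e) \<partial>lborel) - (\<integral>x. u x \<partial>lborel)"
  proof (rule Bochner_Integration.integral_diff)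
    show "integrable lborel u" by (rule lborel_integrable_continuous_ball[OF u])
    then have "integrable (distr lborel borel ((+) e)) u" by (simp add: lborel_distr_plus)
    then have "integrable lborel (\<lambda>x. u (e + x))"
      by (subst (asm) integrable_distr_eq) auto
    then show "integrable lborel (\<lambda>x. u (x + e))" by (simp add: add.commute)
  qed
  also have "\<dots> = 0" by (simp add: lborel_integral_translate)
  finally have 1: "(\<integral>t. (\<integral>x. ?F (x, t) \<partial>lborel) \<partial>lborel) = 0" .
  have 2: "(\<integral>x. ?F (x, t) \<partial>lborel) = indicator {0..1} t * (\<integral>x. v x \<partial>lborel)" for t
    by (simp add: lborel_integral_translate)
  show ?thesis using 1 unfolding 2 by simp
qed

text \<open>
  A radial profile supported in the unit ball. It turns integration by parts on the sphere into
  integration by parts on the whole space without boundary terms.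
\<close>

definition bump :: "nat \<Rightarrow> real ^ 'n \<Rightarrow> real" where
  "bump m x = (max 0 (1 - (norm x)\<^sup>2)) ^ m"

lemma continuous_bump: "continuous_on A (bump m)"
  unfolding bump_def by (intro continuous_intros)

lemma bump_zero: "norm x \<ge> 1 \<Longrightarrow> m > 0 \<Longrightarrow> bump m x = 0"
  using one_le_power[of "norm x" 2] by (simp add: bump_def)

lemma norm_coord_refl [simp]: "norm (coord_refl i x) = norm x"
proof -
  have "(norm (coord_refl i x))\<^sup>2 = (norm x)\<^sup>2"
    unfolding norm_vec_def L2_set_def by (simp add: sum_nonneg, intro sum.cong, auto simp: coord_refl_nth)
  then show ?thesis by simp
qed

lemma continuous_xpow: "continuous_on A (xpow \<alpha>)"
  unfolding xpow_def[abs_def] by (intro continuous_intros)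

lemma continuous_hpoly: "f \<in> hpoly k \<Longrightarrow> continuous_on A f"
  by (induction rule: hpoly.induct) (auto intro!: continuous_intros continuous_xpow)

definition ball_int :: "real ^ 'n \<Rightarrow> nat \<Rightarrow> (real ^ 'n \<Rightarrow> real) \<Rightarrow> real" where
  "ball_int \<kappa> m f = (\<integral>x. f x * hw2 \<kappa> x * bump m x \<partial>lborel)"

text \<open>
  If the exponent of \<open>x $ i\<close> is even, both integrands are odd. Otherwise, in the variable \<open>x $ i\<close>, the
  derivative of \<open>s ^ a * (\<bar>s\<bar> powr k)\<^sup>2\<close> is \<open>(a + 2 * k) * s ^ (a - 1) * (\<bar>s\<bar> powr k)\<^sup>2\<close>, which is the Dunkl
  operator of the monomial times the weight, and the derivative of \<open>(1 - (norm x)\<^sup>2)\<^sup>2\<close> is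
  \<open>- 4 * x $ i * (1 - (norm x)\<^sup>2)\<close>. Hence the factor 4 and the drop of the exponent of the bump.
\<close>

lemma ball_int_xpow:
  fixes \<kappa> :: "real ^ 'n"
  assumes \<kappa>: "\<And>i. 0 \<le> \<kappa> $ i"
  shows "ball_int \<kappa> 2 (dunkl \<kappa> i (xpow \<alpha>)) = 4 * ball_int \<kappa> 1 (\<lambda>x. x $ i * xpow \<alpha> x)"
proof (cases "even (\<alpha> i)")
  case True
  have m: "(\<lambda>x. f x * hw2 \<kappa> x * bump m x) \<in> borel_measurable borel" if "continuous_on UNIV f" for f m
    by (intro borel_measurable_continuous_onI continuous_intros that continuous_hw2 \<kappa> continuous_bump)
  have b: "bump m (coord_refl i x) = bump m x" for x m by (simp add: bump_def)
  have "ball_int \<kappa> 2 (dunkl \<kappa> i (xpow \<alpha>)) = 0"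
    unfolding ball_int_def dunkl_xpow
  proof (rule lborel_integral_odd[of _ i], rule m)
    fix x
    show "dunkl_coeff (\<kappa> $ i) (\<alpha> i) * xpow (\<alpha>(i := \<alpha> i - 1)) (coord_refl i x) * hw2 \<kappa> (coord_refl i x) * bump 2 (coord_refl i x)
      = - (dunkl_coeff (\<kappa> $ i) (\<alpha> i) * xpow (\<alpha>(i := \<alpha> i - 1)) x * hw2 \<kappa> x * bump 2 x)"
      using True by (cases "\<alpha> i = 0") (auto simp: xpow_refl hw2_refl b)
  qed (intro continuous_intros continuous_xpow)
  moreover have "ball_int \<kappa> 1 (\<lambda>x. x $ i * xpow \<alpha> x) = 0"
    unfolding ball_int_def
  proof (rule lborel_integral_odd[of _ i], rule m)
    fix x
    show "coord_refl i x $ i * xpow \<alpha> (coord_refl i x) * hw2 \<kappa> (coord_refl i x) * bump 1 (coord_refl i x)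
      = - (x $ i * xpow \<alpha> x * hw2 \<kappa> x * bump 1 x)"
      using True by (simp add: xpow_refl hw2_refl b coord_refl_nth)
  qed (intro continuous_intros continuous_xpow)
  ultimately show ?thesis by simp
next
  case False
  define a where "a = \<alpha> i"
  define k where "k = \<kappa> $ i"
  have k: "k \<ge> 0" using \<kappa> by (simp add: k_def)
  have a: "odd a" "a \<ge> 1" using False by (auto simp: a_def elim: oddE)
  \<comment> \<open>The restriction to a line parallel to axis \<open>i\<close>: \<open>w\<close> is the weight in that variable, \<open>A\<close> the room left by the other coordinates.\<close>
  define w where "w s = (if k = 0 then 1 else (\<bar>s\<bar> powr k)\<^sup>2)" for s :: real
  define \<phi> where "\<phi> A s = s ^ a * w s * (max 0 (A - s\<^sup>2))\<^sup>2" for A s :: real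
  define \<phi>' where "\<phi>' A s = (a + 2 * k) * s ^ (a - 1) * w s * (max 0 (A - s\<^sup>2))\<^sup>2 - 4 * s ^ (a + 1) * w s * max 0 (A - s\<^sup>2)" for A s :: real
  let ?u = "\<lambda>x. xpow \<alpha> x * hw2 \<kappa> x * bump 2 x"
  let ?v = "\<lambda>x. dunkl \<kappa> i (xpow \<alpha>) x * hw2 \<kappa> x * bump 2 x - 4 * (x $ i * xpow \<alpha> x * hw2 \<kappa> x * bump 1 x)"
  let ?A = "\<lambda>x :: real ^ 'n. 1 - (\<Sum>j\<in>UNIV-{i}. (x $ j)\<^sup>2)"
  let ?c = "\<lambda>x :: real ^ 'n. (\<Prod>j\<in>UNIV-{i}. x $ j ^ \<alpha> j) * (\<Prod>j\<in>UNIV-{i}. if \<kappa> $ j = 0 then 1 else \<bar>x $ j\<bar> powr (\<kappa> $ j))\<^sup>2"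
  have n: "1 - (norm x)\<^sup>2 = ?A x - (x $ i)\<^sup>2" for x :: "real ^ 'n"
    by (simp add: norm_vec_def L2_set_def sum_nonneg sum.remove[of UNIV i])
  have h: "hw2 \<kappa> x = w (x $ i) * (\<Prod>j\<in>UNIV-{i}. if \<kappa> $ j = 0 then 1 else \<bar>x $ j\<bar> powr (\<kappa> $ j))\<^sup>2" for x
    by (simp add: hw2_def hweight_def prod.remove[of UNIV i] w_def k_def power_mult_distrib)
  have uc: "?u x = ?c x * \<phi> (?A x) (x $ i)" for x
    unfolding bump_def n h xpow_split[of \<alpha> x i] \<phi>_def a_def by (simp add: algebra_simps)
  have d: "dunkl \<kappa> i (xpow \<alpha>) x = (a + 2 * k) * x $ i ^ (a - 1) * (\<Prod>j\<in>UNIV-{i}. x $ j ^ \<alpha> j)" for x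
  proof -
    have "(\<Prod>j\<in>UNIV-{i}. x $ j ^ (\<alpha>(i := \<alpha> i - 1)) j) = (\<Prod>j\<in>UNIV-{i}. x $ j ^ \<alpha> j)"
      by (rule prod.cong) auto
    then show ?thesis
      using False unfolding dunkl_xpow xpow_split[of "\<alpha>(i := \<alpha> i - 1)" x i]
      by (simp add: dunkl_coeff_def a_def k_def mult.assoc)
  qed
  have vc: "?v x = ?c x * \<phi>' (?A x) (x $ i)" for x
    unfolding d unfolding bump_def n h xpow_split[of \<alpha> x i] \<phi>'_def a_def[symmetric]
    by (simp add: algebra_simps)
  have cw: "continuous_on UNIV w"
    unfolding w_def using k by (cases "k = 0") (auto intro!: continuous_intros continuous_on_powr')
  have c\<phi>: "continuous_on UNIV (\<phi> A)" for A
    unfolding \<phi>_def by (intro continuous_intros cw)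
  have dw: "(w has_real_derivative 2 * k * w s / s) (at s)" if "s \<noteq> 0" for s
  proof (cases "k = 0")
    case True
    then show ?thesis by (simp add: w_def[abs_def])
  next
    case False
    have 1: "w t = \<bar>t\<bar> powr (2 * k)" for t using False by (simp add: w_def power2_eq_square powr_add[symmetric])
    have "((\<lambda>t. \<bar>t\<bar> powr (2 * k)) has_real_derivative 2 * k * \<bar>s\<bar> powr (2 * k) / s) (at s)"
    proof (cases "s > 0")
      case True
      have "((\<lambda>t. t powr (2 * k)) has_real_derivative 2 * k * s powr (2 * k - 1)) (at s)"
        using has_real_derivative_powr[OF True, of "2 * k"] .
      moreover have "\<forall>\<^sub>F t in nhds s. \<bar>t\<bar> powr (2 * k) = t powr (2 * k)"
        using eventually_nhds_in_open[of "{0<..}" s] True by (auto elim!: eventually_mono)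
      ultimately have "((\<lambda>t. \<bar>t\<bar> powr (2 * k)) has_real_derivative 2 * k * s powr (2 * k - 1)) (at s)"
        by (subst DERIV_cong_ev[OF refl _ refl])
      then show ?thesis using True by (simp add: powr_diff)
    next
      case neg: False
      with that have neg: "s < 0" by simp
      have "((\<lambda>t. (- t) powr (2 * k)) has_real_derivative 2 * k * (- s) powr (2 * k - 1) * (-1)) (at s)"
        by (rule DERIV_chain2[where f="\<lambda>z. z powr (2 * k)" and g=uminus, OF has_real_derivative_powr])
           (use neg in \<open>auto intro!: derivative_eq_intros\<close>)
      moreover have "\<forall>\<^sub>F t in nhds s. \<bar>t\<bar> powr (2 * k) = (- t) powr (2 * k)"
        using eventually_nhds_in_open[of "{..<0}" s] neg by (auto elim!: eventually_mono)
      ultimately have "((\<lambda>t. \<bar>t\<bar> powr (2 * k)) has_real_derivative 2 * k * (- s) powr (2 * k - 1) * (-1)) (at s)"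
        by (subst DERIV_cong_ev[OF refl _ refl])
      then show ?thesis using neg by (simp add: powr_diff)
    qed
    then show ?thesis unfolding 1[abs_def] .
  qed
  have d\<phi>: "(\<phi> A has_real_derivative \<phi>' A s) (at s)" if s: "s \<noteq> 0" "A - s\<^sup>2 \<noteq> 0" for A s
  proof -
    have pd: "((\<lambda>s. s ^ a) has_real_derivative a * s ^ (a - 1)) (at s)"
      by (auto intro!: derivative_eq_intros)
    have md: "((\<lambda>s. (max 0 (A - s\<^sup>2))\<^sup>2) has_real_derivative - 4 * s * max 0 (A - s\<^sup>2)) (at s)"
    proof (cases "A - s\<^sup>2 > 0")
      case True
      have "open {t :: real. A - t\<^sup>2 > 0}" by (intro open_Collect_less continuous_intros)
      then have ev: "\<forall>\<^sub>F t in nhds s. (max 0 (A - t\<^sup>2))\<^sup>2 = (A - t\<^sup>2)\<^sup>2"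
        using eventually_nhds_in_open[of _ s] True by (fastforce elim!: eventually_mono simp: max_def)
      have "((\<lambda>t. (A - t\<^sup>2)\<^sup>2) has_real_derivative - 4 * s * max 0 (A - s\<^sup>2)) (at s)"
        using True by (auto intro!: derivative_eq_intros simp: max_def)
      then show ?thesis by (subst DERIV_cong_ev[OF refl ev refl])
    next
      case False
      with s have neg: "A - s\<^sup>2 < 0" by simp
      have "open {t :: real. A - t\<^sup>2 < 0}" by (intro open_Collect_less continuous_intros)
      then have ev: "\<forall>\<^sub>F t in nhds s. (max 0 (A - t\<^sup>2))\<^sup>2 = 0"
        using eventually_nhds_in_open[of _ s] neg by (fastforce elim!: eventually_mono simp: max_def)
      have "((\<lambda>t. 0) has_real_derivative - 4 * s * max 0 (A - s\<^sup>2)) (at s)"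
        using neg by (auto simp: max_def)
      then show ?thesis by (subst DERIV_cong_ev[OF refl ev refl])
    qed
    have "((\<lambda>s. s ^ a * w s * (max 0 (A - s\<^sup>2))\<^sup>2) has_real_derivative \<phi>' A s) (at s)"
    proof (rule DERIV_cong[OF DERIV_mult[OF DERIV_mult[OF pd dw[OF s(1)]] md]])
      have "s ^ a / s = s ^ (a - 1)" using s(1) a(2) by (cases a) auto
      moreover have "2 * k * w s / s * s ^ a = 2 * k * w s * (s ^ a / s)" by simp
      ultimately have "2 * k * w s / s * s ^ a = 2 * k * s ^ (a - 1) * w s"
        by (simp only: mult_ac)
      then show "(real a * s ^ (a - 1) * w s + 2 * k * w s / s * s ^ a) * (max 0 (A - s\<^sup>2))\<^sup>2 + - 4 * s * max 0 (A - s\<^sup>2) * (s ^ a * w s) = \<phi>' A s"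
        unfolding \<phi>'_def by (simp add: algebra_simps)
    qed
    then show ?thesis by (simp add: \<phi>_def[abs_def])
  qed
  have ftc1: "((\<lambda>t. \<phi>' A (s + t)) has_integral (\<phi> A (s + 1) - \<phi> A s)) {0..1}" for A s
  proof -
    have "((\<lambda>t. \<phi>' A (s + t)) has_integral (\<phi> A (s + 1) - \<phi> A (s + 0))) {0..1}"
    proof (rule fundamental_theorem_of_calculus_interior_strong[where S="{-s, sqrt A - s, - sqrt A - s}"])
      show "continuous_on {0..1} (\<lambda>t. \<phi> A (s + t))"
        by (rule continuous_on_compose2[OF c\<phi>]) (auto intro!: continuous_intros)
      fix t assume t: "t \<in> {0<..<1} - {-s, sqrt A - s, - sqrt A - s}"
      have "s + t \<noteq> 0" using t by auto
      moreover have "A - (s + t)\<^sup>2 \<noteq> 0"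
      proof
        assume "A - (s + t)\<^sup>2 = 0"
        then have "sqrt A = \<bar>s + t\<bar>" by (metis eq_iff_diff_eq_0 real_sqrt_abs)
        with t show False by (auto simp: abs_if split: if_splits)
      qed
      ultimately have "(\<phi> A has_real_derivative \<phi>' A (s + t)) (at (s + t))" by (rule d\<phi>)
      moreover have "((\<lambda>t. s + t) has_real_derivative 1) (at t)" by (auto intro!: derivative_eq_intros)
      ultimately have "((\<lambda>t. \<phi> A (s + t)) has_real_derivative \<phi>' A (s + t) * 1) (at t)"
        by (rule DERIV_chain2[where f="\<phi> A" and g="\<lambda>t. s + t"])
      then show "((\<lambda>t. \<phi> A (s + t)) has_vector_derivative \<phi>' A (s + t)) (at t)"
        by (simp add: has_real_derivative_iff_has_vector_derivative)
    qed auto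
    then show ?thesis by simp
  qed
  have inv: "?A (x + t *\<^sub>R axis i 1) = ?A x" "?c (x + t *\<^sub>R axis i 1) = ?c x"
    "(x + t *\<^sub>R axis i 1) $ i = x $ i + t" for x t
  proof -
    have e: "(x + t *\<^sub>R axis i 1) $ j = x $ j" if "j \<in> UNIV - {i}" for j
      using that by (auto simp: axis_def)
    show "?A (x + t *\<^sub>R axis i 1) = ?A x"
      by (intro arg_cong2[where f="(-)"] refl sum.cong) (simp only: e)
    show "?c (x + t *\<^sub>R axis i 1) = ?c x"
      by (intro arg_cong2[where f="(*)"] arg_cong[where f="\<lambda>z. z\<^sup>2"] refl prod.cong; simp only: e)
    show "(x + t *\<^sub>R axis i 1) $ i = x $ i + t" by (simp add: axis_def)
  qed
  have "(\<integral>x. ?v x \<partial>lborel) = 0"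
  proof (rule integral_directional_derivative[where u="?u" and e="axis i 1"])
    show "continuous_on UNIV ?u"
      by (intro continuous_intros continuous_xpow continuous_hw2 \<kappa> continuous_bump)
    show "continuous_on UNIV ?v"
      unfolding dunkl_xpow
      by (intro continuous_intros continuous_xpow continuous_hw2 \<kappa> continuous_bump)
    show "?u x = 0" "?v x = 0" if "norm x \<ge> 1" for x
      using that by (auto simp: bump_zero)
    fix x :: "real ^ 'n"
    have "((\<lambda>t. ?c x * \<phi>' (?A x) (x $ i + t)) has_integral ?c x * (\<phi> (?A x) (x $ i + 1) - \<phi> (?A x) (x $ i))) {0..1}"
      by (rule has_integral_mult_right[OF ftc1])
    moreover have "?v (x + t *\<^sub>R axis i 1) = ?c x * \<phi>' (?A x) (x $ i + t)" for t
      by (rule trans[OF vc]) (simp only: inv)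
    moreover have "?u (x + axis i 1) = ?c x * \<phi> (?A x) (x $ i + 1)"
      by (rule trans[OF uc]) (simp only: inv[of x 1, unfolded scaleR_one])
    moreover note uc[of x]
    ultimately show "((\<lambda>t. ?v (x + t *\<^sub>R axis i 1)) has_integral (?u (x + axis i 1) - ?u x)) {0..1}"
      by (simp only: right_diff_distrib)
  qed
  moreover have "integrable lborel (\<lambda>x. dunkl \<kappa> i (xpow \<alpha>) x * hw2 \<kappa> x * bump 2 x)"
    unfolding dunkl_xpow
    by (rule lborel_integrable_continuous_ball)
       (auto intro!: continuous_intros continuous_xpow continuous_hw2 \<kappa> continuous_bump simp: bump_zero)
  moreover have "integrable lborel (\<lambda>x. 4 * (x $ i * xpow \<alpha> x * hw2 \<kappa> x * bump 1 x))"
    by (rule lborel_integrable_continuous_ball)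
       (auto intro!: continuous_intros continuous_xpow continuous_hw2 \<kappa> continuous_bump simp: bump_zero)
  ultimately show ?thesis
    unfolding ball_int_def by (subst (asm) Bochner_Integration.integral_diff) auto
qed

lemma ball_int_linear:
  assumes \<kappa>: "\<And>i. 0 \<le> \<kappa> $ i" and m: "m > 0" and f: "continuous_on UNIV f" and g: "continuous_on UNIV g"
  shows "ball_int \<kappa> m (\<lambda>x. f x + g x) = ball_int \<kappa> m f + ball_int \<kappa> m g"
    "ball_int \<kappa> m (\<lambda>x. c * f x) = c * ball_int \<kappa> m f"
proof -
  have i: "integrable lborel (\<lambda>x. f x * hw2 \<kappa> x * bump m x)" if "continuous_on UNIV f" for f
    by (rule lborel_integrable_continuous_ball)
       (use m in \<open>auto intro!: continuous_intros that continuous_hw2 \<kappa> continuous_bump simp: bump_zero\<close>)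
  have "ball_int \<kappa> m (\<lambda>x. f x + g x) = (\<integral>x. f x * hw2 \<kappa> x * bump m x + g x * hw2 \<kappa> x * bump m x \<partial>lborel)"
    by (simp add: ball_int_def distrib_right)
  then show "ball_int \<kappa> m (\<lambda>x. f x + g x) = ball_int \<kappa> m f + ball_int \<kappa> m g"
    using i[OF f] i[OF g] by (simp add: ball_int_def)
  show "ball_int \<kappa> m (\<lambda>x. c * f x) = c * ball_int \<kappa> m f"
    by (simp add: ball_int_def mult.assoc)
qed

lemma ball_int_by_parts:
  fixes \<kappa> :: "real ^ 'n"
  assumes \<kappa>: "\<And>i. 0 \<le> \<kappa> $ i" and R: "R \<in> hpoly k"
  shows "ball_int \<kappa> 2 (dunkl \<kappa> i R) = 4 * ball_int \<kappa> 1 (\<lambda>x. x $ i * R x)"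
  using R
proof induction
  case zero show ?case by (simp add: ball_int_def)
next
  case (monomial \<alpha>) show ?case by (rule ball_int_xpow[OF \<kappa>])
next
  case (add f g)
  have "continuous_on UNIV (\<lambda>x. x $ i * f x)" "continuous_on UNIV (\<lambda>x. x $ i * g x)"
    using continuous_hpoly[OF add(1)] continuous_hpoly[OF add(2)] by (auto intro!: continuous_intros)
  moreover have "continuous_on UNIV (dunkl \<kappa> i f)" "continuous_on UNIV (dunkl \<kappa> i g)"
    using continuous_hpoly[OF dunkl_hpoly] add by blast+
  ultimately show ?case
    using add by (simp add: dunkl_add hpoly_axis_diff distrib_left ball_int_linear \<kappa>)
next
  case (scale f c)
  have "continuous_on UNIV (\<lambda>x. x $ i * f x)"
    using continuous_hpoly[OF scale(1)] by (auto intro!: continuous_intros)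
  moreover have "continuous_on UNIV (dunkl \<kappa> i f)"
    using continuous_hpoly[OF dunkl_hpoly] scale by blast
  ultimately show ?case
    using scale ball_int_linear(2)[of \<kappa> 1 "\<lambda>x. x $ i * f x" "\<lambda>x. x $ i * f x" c] \<kappa>
    by (simp add: dunkl_cmult hpoly_axis_diff ball_int_linear(2)[OF _ _ _ continuous_on_const] mult.left_commute)
qed


section \<open>Homogeneous functions in polar coordinates\<close>

lemma lborel_integral_scale:
  fixes f :: "'a::euclidean_space \<Rightarrow> real"
  assumes [measurable]: "f \<in> borel_measurable borel" and s: "s > 0"
  shows "(\<integral>x. f x \<partial>lborel) = s ^ DIM('a) * (\<integral>x. f (s *\<^sub>R x) \<partial>lborel)"
proof -
  have "(\<integral>x. f x \<partial>lborel) = (\<integral>x. f x \<partial>density (distr lborel borel (\<lambda>x. 0 + s *\<^sub>R x)) (\<lambda>_. ennreal (\<bar>s\<bar> ^ DIM('a))))"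
    using lborel_affine[of s "0 :: 'a"] s by simp
  also have "\<dots> = \<bar>s\<bar> ^ DIM('a) * (\<integral>x. f x \<partial>distr lborel borel (\<lambda>x. 0 + s *\<^sub>R x))"
    using s by (subst integral_density) auto
  also have "(\<integral>x. f x \<partial>distr lborel borel (\<lambda>x. 0 + s *\<^sub>R x)) = (\<integral>x. f (s *\<^sub>R x) \<partial>lborel)"
    by (subst integral_distr) auto
  finally show ?thesis using s by simp
qed

lemma integral_indicator_powr:
  assumes a: "a \<ge> (0 :: real)"
  shows "(\<integral>y. indicator {0..1} y * y powr a \<partial>lborel) = 1 / (a + 1)"
proof -
  have "continuous_on {0..1} (\<lambda>y :: real. y powr a)" if "a > 0"
    using that by (intro continuous_on_powr') (auto intro!: continuous_intros)
  then have "set_integrable lborel {0..1} (\<lambda>y :: real. y powr a)" if "a > 0"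
    using that by (intro borel_integrable_atLeastAtMost') auto
  moreover have "set_integrable lborel {0..1} (\<lambda>y :: real. y powr a)" if "a = 0"
    unfolding set_integrable_def
    by (rule integrableI_bounded_set[where A="{0..1}" and B=1]) (auto simp: that indicator_def)
  ultimately have "set_integrable lborel {0..1} (\<lambda>y :: real. y powr a)" using a by linarith
  from set_borel_integral_eq_integral(2)[OF this]
  show ?thesis
    using integral_unique[OF has_integral_powr_from_0[of a 1]] a
    by (simp add: set_lebesgue_integral_def)
qed

text \<open>
  By scaling, the truncation of a function of the direction to the ball of radius \<open>s\<close> has an integral
  proportional to the power of \<open>s\<close> given by the dimension. The formula follows by writing \<open>norm x powr q\<close>
  as the length of \<open>{0..norm x powr q}\<close> and exchanging the order of integration.
\<close>

lemma polar_power: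
  fixes g :: "real ^ 'n \<Rightarrow> real"
  assumes m[measurable]: "(\<lambda>x. indicator pball x * g (sgn x)) \<in> borel_measurable borel"
    and B: "\<And>x. \<bar>indicator pball x * g (sgn x)\<bar> \<le> B" and q: "q \<ge> 0"
  shows "(\<integral>x. indicator pball x * (norm x powr q * g (sgn x)) \<partial>lborel) =
     real CARD('n) / (real CARD('n) + q) * (\<integral>x. indicator pball x * g (sgn x) \<partial>lborel)"
proof (cases "q = 0")
  case True
  have "indicator pball x * (norm x powr q * g (sgn x)) = indicator pball x * g (sgn x)" for x :: "real ^ 'n"
    using True by (auto simp: indicator_def)
  then have "(\<integral>x. indicator pball x * (norm x powr q * g (sgn x)) \<partial>lborel) = (\<integral>x. indicator pball x * g (sgn x) \<partial>lborel)"
    by (rule Bochner_Integration.integral_cong[OF refl])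
  also have "\<dots> = real CARD('n) / (real CARD('n) + q) * (\<integral>x. indicator pball x * g (sgn x) \<partial>lborel)"
    using True by simp
  finally show ?thesis .
next
  case False
  with q have q: "q > 0" by simp
  let ?N = "real CARD('n)"
  define G where "G x = indicator pball x * g (sgn x)" for x :: "real ^ 'n"
  have [measurable]: "G \<in> borel_measurable borel" unfolding G_def by (rule m)
  have B0: "0 \<le> B" using B[of 0] by (meson abs_ge_zero order_trans)
  have Gz: "G x = 0" if "x \<notin> ball 0 1" for x using that by (simp add: G_def)
  have iG: "integrable lborel (\<lambda>x. c x * G x)" if [measurable]: "c \<in> borel_measurable borel" and "\<And>x. \<bar>c x\<bar> \<le> 1" for c
  proof (rule integrableI_bounded_set[where A="ball 0 1" and B=B])
    show "AE x in lborel. x \<in> ball 0 1 \<longrightarrow> norm (c x * G x) \<le> B"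
    proof (rule AE_I2, rule impI)
      fix x
      have "\<bar>c x\<bar> * \<bar>G x\<bar> \<le> 1 * B" using that(2)[of x] B[of x] by (intro mult_mono) (auto simp: G_def)
      then show "norm (c x * G x) \<le> B" by (simp add: abs_mult)
    qed
  qed (use Gz emeasure_lborel_ball_finite in auto)
  define T where "T = (\<integral>x. G x \<partial>lborel)"
  define F where "F x y = indicator {0<..<1} y * ((if y \<le> norm x powr q then 1 else 0) * G x)" for x and y :: real
  have intF: "integrable (lborel \<Otimes>\<^sub>M lborel) (case_prod F)"
  proof (rule integrableI_bounded_set[where A="ball 0 1 \<times> {0<..<1}" and B=B])
    have "case_prod F \<in> borel_measurable (borel \<Otimes>\<^sub>M borel)" unfolding F_def by measurable
    then show "case_prod F \<in> borel_measurable (lborel \<Otimes>\<^sub>M lborel)"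
      by (simp cong: measurable_cong_sets)
    show "emeasure (lborel \<Otimes>\<^sub>M lborel) (ball (0 :: real ^ 'n) 1 \<times> {0<..<1 :: real}) < \<infinity>"
      by (subst lborel.emeasure_pair_measure_Times)
         (use emeasure_lborel_ball_finite[of "0 :: real ^ 'n" 1] in \<open>auto simp: ennreal_mult_less_top less_top\<close>)
    show "AE x in lborel \<Otimes>\<^sub>M lborel. x \<in> ball 0 1 \<times> {0<..<1} \<longrightarrow> norm (case_prod F x) \<le> B"
    proof (rule AE_I2, rule impI)
      fix z :: "(real ^ 'n) \<times> real"
      have "\<bar>F (fst z) (snd z)\<bar> \<le> \<bar>G (fst z)\<bar>"
        by (cases "snd z \<in> {0<..<1}") (simp_all add: F_def)
      also have "\<dots> \<le> B" unfolding G_def by (rule B)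
      finally have "\<bar>F (fst z) (snd z)\<bar> \<le> B" .
      then show "norm (case_prod F z) \<le> B" by (simp only: case_prod_beta real_norm_def)
    qed
    show "AE x in lborel \<Otimes>\<^sub>M lborel. x \<notin> ball 0 1 \<times> {0<..<1} \<longrightarrow> case_prod F x = 0"
    proof (rule AE_I2, rule impI)
      fix z :: "(real ^ 'n) \<times> real" assume z: "z \<notin> ball 0 1 \<times> {0<..<1}"
      have "F (fst z) (snd z) = 0"
        using z Gz[of "fst z"] by (cases z) (auto simp: F_def indicator_def)
      then show "case_prod F z = 0" by (simp only: case_prod_beta)
    qed
    show "ball (0 :: real ^ 'n) 1 \<times> {0<..<1 :: real} \<in> sets (lborel \<Otimes>\<^sub>M lborel)" by auto
  qed
  have 1: "(\<integral>y. F x y \<partial>lborel) = indicator pball x * (norm x powr q * g (sgn x))" for x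
  proof (cases "x \<in> pball")
    case True
    then have n: "0 < norm x powr q" "norm x powr q < 1"
      using q powr_less_mono2[of q "norm x" 1] by auto
    have "(\<lambda>y. F x y) = (\<lambda>y. indicator {0<..norm x powr q} y * G x)"
      using n by (auto simp: F_def indicator_def fun_eq_iff)
    then show ?thesis using n True by (simp add: G_def)
  next
    case False
    then show ?thesis by (simp add: F_def G_def)
  qed
  have 2: "(\<integral>x. F x y \<partial>lborel) = T * indicator {0<..1} y - T * (indicator {0..1} y * y powr (?N / q))" for y
  proof (cases "y \<in> {0<..<1}")
    case True
    define s where "s = y powr (1 / q)"
    have s: "s > 0" "s < 1" using True q powr_less_mono2[of "1 / q" y 1] by (auto simp: s_def)
    have le: "y \<le> norm x powr q \<longleftrightarrow> \<not> norm x < s" for x :: "real ^ 'n"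
    proof -
      have sq: "s powr q = y" using q True by (simp add: s_def powr_powr)
      have "norm x < s \<longleftrightarrow> norm x powr q < s powr q"
        using q s powr_less_mono2[of q "norm x" s] powr_mono2[of q s "norm x"]
        by (metis less_imp_le norm_ge_zero not_le)
      then show ?thesis using sq by auto
    qed
    have "(\<integral>x. F x y \<partial>lborel) = (\<integral>x. G x - (if norm x < s then 1 else 0) * G x \<partial>lborel)"
      using True by (intro Bochner_Integration.integral_cong) (auto simp: F_def le)
    also have "\<dots> = T - (\<integral>x. (if norm x < s then 1 else 0) * G x \<partial>lborel)"
      unfolding T_def using iG[of "\<lambda>_. 1"]
      by (intro Bochner_Integration.integral_diff iG) auto
    also have "(\<integral>x. (if norm x < s then 1 else 0) * G x \<partial>lborel) =
        s ^ CARD('n) * (\<integral>x. (if norm (s *\<^sub>R x) < s then 1 else 0) * G (s *\<^sub>R x) \<partial>lborel)"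
      using lborel_integral_scale[of "\<lambda>x. (if norm x < s then 1 else 0) * G x" s] s by simp
    also have "(\<lambda>x. (if norm (s *\<^sub>R x) < s then 1 else 0) * G (s *\<^sub>R x)) = G"
    proof
      fix x :: "real ^ 'n"
      have "sgn (s *\<^sub>R x) = sgn x" using s by (simp add: sgn_scaleR)
      moreover have "norm (s *\<^sub>R x) < s \<longleftrightarrow> norm x < 1" using s by simp
      moreover have "s * norm x < 1" if "norm x < 1"
        using mult_strict_mono[of s 1 "norm x" 1] that s by simp
      ultimately show "(if norm (s *\<^sub>R x) < s then 1 else 0) * G (s *\<^sub>R x) = G x"
        using s by (auto simp: G_def indicator_def)
    qed
    also have "s ^ CARD('n) = y powr (?N / q)"
      using True by (simp add: s_def powr_power mult.commute)
    finally show ?thesis using True by (simp add: T_def mult.commute)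
  next
    case False
    then have "y = 0 \<or> y = 1 \<or> y \<notin> {0..1}" by auto
    then show ?thesis by (auto simp: F_def)
  qed
  have "(\<integral>x. indicator pball x * (norm x powr q * g (sgn x)) \<partial>lborel) = (\<integral>y. (\<integral>x. F x y \<partial>lborel) \<partial>lborel)"
    unfolding 1[symmetric] by (rule lborel_pair.Fubini_integral[OF intF, symmetric])
  also have "\<dots> = (\<integral>y. T * indicator {0<..1} y - T * (indicator {0..1} y * y powr (?N / q)) \<partial>lborel)"
    unfolding 2 ..
  also have "\<dots> = T - T * (1 / (?N / q + 1))"
  proof -
    have "integrable lborel (\<lambda>y. indicator {0..1} y * y powr (?N / q))"
      by (rule integrableI_bounded_set[where A="{0..1}" and B=1])
         (use q in \<open>auto simp: indicator_def powr_le1\<close>)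
    then show ?thesis
      using integral_indicator_powr[of "?N / q"] q by simp
  qed
  also have "\<dots> = ?N / (?N + q) * T"
  proof -
    have "1 / (?N / q + 1) = q / (?N + q)" using q by (simp add: field_simps)
    moreover have "?N + q > 0" using q by (simp add: add_nonneg_pos)
    ultimately show ?thesis by (simp only:) (simp add: field_simps)
  qed
  finally show ?thesis by (simp add: T_def G_def)
qed

definition total_weight :: "real ^ 'n \<Rightarrow> real" where
  "total_weight \<kappa> = 2 * (\<Sum>i\<in>UNIV. \<kappa> $ i)"

text \<open>
  A homogeneous integrand separates into a radial power and a function of the direction. Expanding the
  bump in powers of \<open>norm x\<close>, each power contributes the same directional integral with the
  coefficient given by \<open>polar_power\<close>; the combination of coefficients is positive.
\<close>

lemma ball_int_hmeasure:
  fixes \<kappa> :: "real ^ 'n"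
  assumes \<kappa>: "\<And>i. 0 \<le> \<kappa> $ i" and m: "m \<in> {1, 2}"
  shows "\<exists>c>0. \<forall>R\<in>hpoly k. ball_int \<kappa> m R = c * (\<integral>x. R x \<partial>hmeasure \<kappa>)"
proof -
  let ?N = "real CARD('n)"
  define Q where "Q = real k + total_weight \<kappa>"
  have Q: "Q \<ge> 0" using \<kappa> by (auto simp: Q_def total_weight_def intro!: add_nonneg_nonneg sum_nonneg mult_nonneg_nonneg)
  define T where "T j = ?N / (?N + (Q + 2 * j))" for j :: real
  define c where "c = (if m = 1 then T 0 - T 1 else T 0 - 2 * T 1 + T 2)"
  have N: "?N > 0" by simp
  have c: "c > 0"
  proof -
    define a where "a = ?N + Q"
    have a: "a > 0" unfolding a_def by (rule add_pos_nonneg[OF N Q])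
    have T: "T j = ?N / (a + 2 * j)" for j by (simp add: T_def a_def add.assoc)
    have e1: "1 / a - 1 / (a + 2) = 2 / (a * (a + 2))"
      using a by (simp add: field_simps)
    have e2: "1 / a - 2 * (1 / (a + 2)) + 1 / (a + 4) = 8 / (a * (a + 2) * (a + 4))"
    proof -
      have "a \<noteq> 0" "a + 2 \<noteq> 0" "a + 4 \<noteq> 0" using a by auto
      then show ?thesis by (simp add: divide_simps) (simp add: algebra_simps)
    qed
    have "T 0 - T 1 = ?N * (1 / a - 1 / (a + 2))"
      by (simp add: T right_diff_distrib)
    moreover have "T 0 - 2 * T 1 + T 2 = ?N * (1 / a - 2 * (1 / (a + 2)) + 1 / (a + 4))"
      by (simp add: T right_diff_distrib distrib_left)
    moreover have "?N * (2 / (a * (a + 2))) > 0" "?N * (8 / (a * (a + 2) * (a + 4))) > 0"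
      using N a by (auto intro!: mult_pos_pos divide_pos_pos)
    ultimately have "T 0 - T 1 > 0" "T 0 - 2 * T 1 + T 2 > 0"
      unfolding e1 e2 by (simp_all only:)
    then show ?thesis using m by (auto simp: c_def)
  qed
  have ak: "a_const \<kappa> * ?N > 0" using a_const_pos[OF \<kappa>] by simp
  show ?thesis
  proof (intro exI[of _ "c / (a_const \<kappa> * ?N)"] conjI ballI)
    show "c / (a_const \<kappa> * ?N) > 0" using c ak by simp
    fix R :: "real ^ 'n \<Rightarrow> real" assume R: "R \<in> hpoly k"
    define g where "g x = hw2 \<kappa> x * R x" for x
    have cg: "continuous_on UNIV g"
      unfolding g_def by (intro continuous_intros continuous_hw2 \<kappa> continuous_hpoly[OF R])
    have [measurable]: "g \<in> borel_measurable borel" by (rule borel_measurable_continuous_onI[OF cg])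
    obtain B where B: "B > 0" "\<And>x. x \<in> sphere 0 1 \<Longrightarrow> \<bar>g x\<bar> \<le> B"
      using continuous_sphere_bounded[OF continuous_on_subset[OF cg, of "sphere 0 1"]] by blast
    have mg: "(\<lambda>x. indicator pball x * g (sgn x)) \<in> borel_measurable borel"
      by (rule borel_measurable_pball_sgn[OF cg])
    have bg: "\<bar>indicator pball x * g (sgn x)\<bar> \<le> B" for x
      using B(1) B(2)[of "sgn x"] by (auto simp: indicator_def norm_sgn)
    have hom: "g x = norm x powr Q * g (sgn x)" if "x \<noteq> 0" for x
    proof -
      have x: "x = norm x *\<^sub>R sgn x" using that by (simp add: sgn_div_norm)
      have "g (norm x *\<^sub>R sgn x) = (norm x powr total_weight \<kappa> * norm x ^ k) * g (sgn x)"
        using that by (simp add: g_def hw2_scale \<kappa> hpoly_homogeneous[OF R] total_weight_def)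
      also have "norm x powr total_weight \<kappa> * norm x ^ k = norm x powr Q"
        using that by (simp add: Q_def powr_add powr_realpow)
      finally show ?thesis using x by simp
    qed
    define G where "G = (\<integral>x. indicator pball x * g (sgn x) \<partial>lborel)"
    define f where "f j x = indicator pball x * (norm x powr (Q + 2 * j) * g (sgn x))" for j and x :: "real ^ 'n"
    have P: "(\<integral>x. f j x \<partial>lborel) = T j * G" if "j \<ge> 0" for j
      unfolding T_def f_def G_def using polar_power[OF mg bg, of "Q + 2 * j"] Q that by simp
    have mf: "f j \<in> borel_measurable lborel" for j
    proof -
      have "(\<lambda>x. norm x powr (Q + 2 * j) * (indicator pball x * g (sgn x))) \<in> borel_measurable borel"
        by (rule borel_measurable_times[OF _ mg]) measurable
      then show ?thesis by (simp add: mult.left_commute f_def[abs_def])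
    qed
    have mb: "(\<lambda>x. R x * hw2 \<kappa> x * bump m x) \<in> borel_measurable lborel"
    proof -
      have "continuous_on UNIV (\<lambda>x. R x * hw2 \<kappa> x * bump m x)"
        by (intro continuous_intros continuous_hpoly[OF R] continuous_hw2 \<kappa> continuous_bump)
      then show ?thesis by (simp add: borel_measurable_continuous_onI)
    qed
    have I: "integrable lborel (f j)" if "j \<ge> 0" for j
    proof (rule integrableI_bounded_set[where A="ball 0 1" and B=B])
      show "AE x in lborel. x \<in> ball 0 1 \<longrightarrow> norm (f j x) \<le> B"
      proof (rule AE_I2, rule impI)
        fix x :: "real ^ 'n" assume "x \<in> ball 0 1"
        then have "\<bar>norm x powr (Q + 2 * j)\<bar> * \<bar>indicator pball x * g (sgn x)\<bar> \<le> 1 * B"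
          using Q that bg by (intro mult_mono) (auto simp: powr_le1)
        then show "norm (f j x) \<le> B" unfolding f_def by (simp add: abs_mult mult_ac)
      qed
      show "AE x in lborel. x \<notin> ball 0 1 \<longrightarrow> f j x = 0" by (auto simp: f_def)
    qed (use mf emeasure_lborel_ball_finite in auto)
    have f12: "f 1 x = f 0 x * (norm x)\<^sup>2" "f 2 x = f 0 x * ((norm x)\<^sup>2)\<^sup>2" if "x \<noteq> 0" for x
    proof -
      have n: "norm x > 0" using that by simp
      have "norm x powr (Q + 2 * 1) = norm x powr (Q + 2 * 0) * (norm x)\<^sup>2"
        using powr_add[of "norm x" Q 2] powr_realpow[OF n, of 2] by simp
      then show "f 1 x = f 0 x * (norm x)\<^sup>2" unfolding f_def by (simp only: mult_ac)
      have "norm x powr (Q + 2 * 2) = norm x powr (Q + 2 * 0) * norm x ^ 4"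
        using powr_add[of "norm x" Q 4] powr_realpow[OF n, of 4] by simp
      also have "norm x ^ 4 = ((norm x)\<^sup>2)\<^sup>2" by simp
      finally show "f 2 x = f 0 x * ((norm x)\<^sup>2)\<^sup>2" unfolding f_def by (simp only: mult_ac)
    qed
    have b: "R x * hw2 \<kappa> x * bump m x = f 0 x * (1 - (norm x)\<^sup>2) ^ m" if "x \<noteq> 0" for x
    proof (cases "norm x < 1")
      case True
      then have "(norm x)\<^sup>2 < 1" by (simp add: abs_square_less_1)
      moreover have "R x * hw2 \<kappa> x = norm x powr Q * g (sgn x)"
        using hom[OF that] by (simp add: g_def mult.commute)
      ultimately show ?thesis using True that by (simp add: f_def bump_def)
    next
      case False
      then show ?thesis using m by (auto simp: bump_zero f_def)
    qed
    have AE0: "AE x :: real ^ 'n in lborel. x \<noteq> 0" by (rule AE_lborel_singleton)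
    have "ball_int \<kappa> m R = c * G"
    proof (cases "m = 1")
      case True
      have "ball_int \<kappa> m R = (\<integral>x. f 0 x - f 1 x \<partial>lborel)"
        unfolding ball_int_def
      proof (rule integral_cong_AE[OF mb borel_measurable_diff[OF mf mf]])
        have e: "R x * hw2 \<kappa> x * bump m x = f 0 x - f 1 x" if "x \<noteq> 0" for x
          unfolding b[OF that] f12[OF that] using True by (simp add: algebra_simps)
        from AE0 show "AE x in lborel. R x * hw2 \<kappa> x * bump m x = f 0 x - f 1 x"
          by eventually_elim (rule e)
      qed
      also have "\<dots> = (\<integral>x. f 0 x \<partial>lborel) - (\<integral>x. f 1 x \<partial>lborel)"
        by (rule Bochner_Integration.integral_diff[OF I I]) auto
      also have "\<dots> = c * G" using True by (simp add: P c_def left_diff_distrib)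
      finally show ?thesis .
    next
      case False
      with m have m2: "m = 2" by simp
      have "ball_int \<kappa> m R = (\<integral>x. f 0 x - 2 * f 1 x + f 2 x \<partial>lborel)"
        unfolding ball_int_def
      proof (rule integral_cong_AE[OF mb borel_measurable_add[OF borel_measurable_diff[OF mf borel_measurable_times[OF borel_measurable_const mf]] mf]])
        have e: "R x * hw2 \<kappa> x * bump m x = f 0 x - 2 * f 1 x + f 2 x" if "x \<noteq> 0" for x
        proof -
          define u where "u = (norm x)\<^sup>2"
          have "f 0 x * (1 - u) ^ m = f 0 x - 2 * (f 0 x * u) + f 0 x * u\<^sup>2"
            using m2 by (simp add: power2_eq_square algebra_simps)
          then show ?thesis using b[OF that] f12[OF that] unfolding u_def by (simp only:)
        qed
        from AE0 show "AE x in lborel. R x * hw2 \<kappa> x * bump m x = f 0 x - 2 * f 1 x + f 2 x"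
          by eventually_elim (rule e)
      qed
      also have "\<dots> = (\<integral>x. f 0 x \<partial>lborel) - 2 * (\<integral>x. f 1 x \<partial>lborel) + (\<integral>x. f 2 x \<partial>lborel)"
        using I[of 0] I[of 1] I[of 2] by simp
      also have "\<dots> = c * G" unfolding c_def using m2 by (simp add: P left_diff_distrib distrib_right)
      finally show ?thesis .
    qed
    moreover have "(\<integral>x. R x \<partial>hmeasure \<kappa>) = a_const \<kappa> * ?N * G"
      unfolding g_def G_def by (rule integral_hmeasure[OF \<kappa>])
        (rule borel_measurable_continuous_on_restrict[OF continuous_hpoly[OF R]])
    ultimately show "ball_int \<kappa> m R = c / (a_const \<kappa> * ?N) * (\<integral>x. R x \<partial>hmeasure \<kappa>)"
      using a_const_pos[OF \<kappa>] by simp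
  qed
qed

text \<open>
  Passing from the ball to the sphere only costs constants, since both sides are homogeneous. That
  the constant is common to all \<open>i\<close> makes the identity applicable to the h-Laplacian.
\<close>

lemma hmeasure_by_parts:
  fixes \<kappa> :: "real ^ 'n"
  assumes \<kappa>: "\<And>i. 0 \<le> \<kappa> $ i"
  shows "\<exists>C>0. \<forall>R\<in>hpoly k. \<forall>i. (\<integral>x. dunkl \<kappa> i R x \<partial>hmeasure \<kappa>) = C * (\<integral>x. x $ i * R x \<partial>hmeasure \<kappa>)"
proof -
  obtain c2 where c2: "c2 > 0" "\<And>R. R \<in> hpoly (k - 1) \<Longrightarrow> ball_int \<kappa> 2 R = c2 * (\<integral>x. R x \<partial>hmeasure \<kappa>)"
    using ball_int_hmeasure[OF \<kappa>, of 2 "k - 1"] by auto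
  obtain c1 where c1: "c1 > 0" "\<And>R. R \<in> hpoly (1 + k) \<Longrightarrow> ball_int \<kappa> 1 R = c1 * (\<integral>x. R x \<partial>hmeasure \<kappa>)"
    using ball_int_hmeasure[OF \<kappa>, of 1 "1 + k"] by auto
  show ?thesis
  proof (intro exI[of _ "4 * c1 / c2"] conjI ballI allI)
    fix R :: "real ^ 'n \<Rightarrow> real" and i assume R: "R \<in> hpoly k"
    have "c2 * (\<integral>x. dunkl \<kappa> i R x \<partial>hmeasure \<kappa>) = 4 * (c1 * (\<integral>x. x $ i * R x \<partial>hmeasure \<kappa>))"
      using ball_int_by_parts[OF \<kappa> R, of i] c2(2)[OF dunkl_hpoly[OF R]] c1(2)[OF hpoly_mult[OF hpoly_coord R]]
      by simp
    then show "(\<integral>x. dunkl \<kappa> i R x \<partial>hmeasure \<kappa>) = 4 * c1 / c2 * (\<integral>x. x $ i * R x \<partial>hmeasure \<kappa>)"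
      using c2(1) by (simp add: field_simps)
  qed (use c1 c2 in simp)
qed

lemma sgn_coord_refl: "sgn (coord_refl i x) = coord_refl i (sgn x)"
  unfolding sgn_div_norm norm_coord_refl by (simp add: coord_refl_def vec_eq_iff algebra_simps)

lemma integral_hmeasure_refl:
  fixes \<kappa> :: "real ^ 'n" and f :: "real ^ 'n \<Rightarrow> real"
  assumes \<kappa>: "\<And>i. 0 \<le> \<kappa> $ i" and f: "continuous_on UNIV f"
  shows "(\<integral>x. f (coord_refl i x) \<partial>hmeasure \<kappa>) = (\<integral>x. f x \<partial>hmeasure \<kappa>)"
proof -
  have cr: "continuous_on UNIV (coord_refl i :: real ^ 'n \<Rightarrow> _)"
    unfolding coord_refl_def by (intro continuous_intros)
  have f2: "continuous_on UNIV (\<lambda>x. f (coord_refl i x))"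
    by (rule continuous_on_compose2[OF f cr]) auto
  have [measurable]: "f \<in> borel_measurable borel" "hw2 \<kappa> \<in> borel_measurable borel"
    using f continuous_hw2[OF \<kappa>] by (auto intro: borel_measurable_continuous_onI)
  have "(\<integral>x. indicator pball (coord_refl i x) * (hw2 \<kappa> (sgn (coord_refl i x)) * f (sgn (coord_refl i x))) \<partial>lborel)
      = (\<integral>x. indicator pball x * (hw2 \<kappa> (sgn x) * f (sgn x)) \<partial>lborel)"
  proof (rule lborel_integral_coord_refl)
    have "continuous_on UNIV (\<lambda>x. hw2 \<kappa> x * f x)"
      by (intro continuous_intros continuous_hw2 \<kappa> f)
    then show "(\<lambda>x. indicator pball x * (hw2 \<kappa> (sgn x) * f (sgn x))) \<in> borel_measurable borel"
      by (rule borel_measurable_pball_sgn)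
  qed
  moreover have "indicator pball (coord_refl i x) = (indicator pball x :: real)" for x :: "real ^ 'n"
  proof -
    have "coord_refl i x = 0 \<longleftrightarrow> x = 0" using norm_coord_refl[of i x] norm_eq_zero by metis
    then show ?thesis by (simp add: indicator_def)
  qed
  moreover have "f \<in> borel_measurable (restrict_space borel (sphere 0 1))"
    "(\<lambda>x. f (coord_refl i x)) \<in> borel_measurable (restrict_space borel (sphere 0 1))"
    using continuous_on_subset[OF f] continuous_on_subset[OF f2]
    by (auto intro!: borel_measurable_continuous_on_restrict)
  ultimately show ?thesis
    by (simp add: integral_hmeasure[OF \<kappa>] sgn_coord_refl hw2_refl)
qed

lemma harm_scale: "P \<in> h_harm \<kappa> n \<Longrightarrow> (\<lambda>x. c * P x) \<in> h_harm \<kappa> n"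
  by (rule harm_lincomb(2))

section \<open>Orthogonality of spherical h-harmonics\<close>

text \<open>
  Integrating \<open>h_laplacian \<kappa> P = 0\<close> by parts gives the integral of \<open>\<Sum>i. x $ i * dunkl \<kappa> i P x\<close>, which
  by Euler's identity and reflection invariance is \<open>n\<close> times the integral of \<open>P\<close>.
\<close>

lemma integral_harm_zero:
  fixes \<kappa> :: "real ^ 'n"
  assumes \<kappa>: "\<And>i. 0 \<le> \<kappa> $ i" and P: "P \<in> h_harm \<kappa> n" and n: "n > 0"
  shows "(\<integral>x. P x \<partial>hmeasure \<kappa>) = 0"
proof -
  have Ph: "P \<in> hpoly n" and L: "\<And>x. h_laplacian \<kappa> P x = 0" using P by (auto simp: h_harm_def)
  obtain C where C: "C > 0" "\<And>R i. R \<in> hpoly (n - 1) \<Longrightarrow> (\<integral>x. dunkl \<kappa> i R x \<partial>hmeasure \<kappa>) = C * (\<integral>x. x $ i * R x \<partial>hmeasure \<kappa>)"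
    using hmeasure_by_parts[OF \<kappa>, of "n - 1"] by blast
  note ih = integrable_hmeasure_continuous[OF \<kappa> continuous_hpoly]
  have i1: "integrable (hmeasure \<kappa>) (\<lambda>x. x $ i * dunkl \<kappa> i P x)" for i
    by (rule ih[OF hpoly_mult[OF hpoly_coord dunkl_hpoly[OF Ph]]])
  have "0 = (\<integral>x. h_laplacian \<kappa> P x \<partial>hmeasure \<kappa>)" by (simp add: L)
  also have "\<dots> = (\<Sum>i\<in>UNIV. \<integral>x. dunkl \<kappa> i (dunkl \<kappa> i P) x \<partial>hmeasure \<kappa>)"
    unfolding h_laplacian_def
    by (rule Bochner_Integration.integral_sum) (rule ih[OF dunkl_hpoly[OF dunkl_hpoly[OF Ph]]])
  also have "\<dots> = C * (\<Sum>i\<in>UNIV. \<integral>x. x $ i * dunkl \<kappa> i P x \<partial>hmeasure \<kappa>)"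
    by (simp add: C(2)[OF dunkl_hpoly[OF Ph]] sum_distrib_left)
  also have "(\<Sum>i\<in>UNIV. \<integral>x. x $ i * dunkl \<kappa> i P x \<partial>hmeasure \<kappa>) = (\<integral>x. (\<Sum>i\<in>UNIV. x $ i * dunkl \<kappa> i P x) \<partial>hmeasure \<kappa>)"
    by (rule Bochner_Integration.integral_sum[symmetric]) (rule i1)
  also have "\<dots> = (\<integral>x. real n * P x + (\<Sum>i\<in>UNIV. \<kappa> $ i * (P x - P (coord_refl i x))) \<partial>hmeasure \<kappa>)"
    by (simp only: euler_dunkl[OF Ph])
  also have "\<dots> = real n * (\<integral>x. P x \<partial>hmeasure \<kappa>) + (\<Sum>i\<in>UNIV. \<kappa> $ i * ((\<integral>x. P x \<partial>hmeasure \<kappa>) - (\<integral>x. P (coord_refl i x) \<partial>hmeasure \<kappa>)))"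
    using ih[OF Ph] ih[OF hpoly_refl[OF Ph]] by simp
  also have "\<dots> = real n * (\<integral>x. P x \<partial>hmeasure \<kappa>)"
    by (simp add: integral_hmeasure_refl[OF \<kappa> continuous_hpoly[OF Ph]])
  finally show ?thesis using C(1) n by simp
qed

text \<open>
  Integration by parts trades a factor \<open>x $ i\<close> of the monomial for a Dunkl operator on the remaining
  product. The Leibniz rule leaves monomials of lower degree against h-harmonics whose degree has
  dropped by at most one, so the strict inequality of degrees is preserved in the induction.
\<close>

lemma xpow_harm_orthogonal:
  fixes \<kappa> :: "real ^ 'n"
  assumes \<kappa>: "\<And>i. 0 \<le> \<kappa> $ i"
  shows "P \<in> h_harm \<kappa> n \<Longrightarrow> sum \<alpha> UNIV < n \<Longrightarrow> (\<integral>x. xpow \<alpha> x * P x \<partial>hmeasure \<kappa>) = 0"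
proof (induction "sum \<alpha> UNIV" arbitrary: \<alpha> P n rule: less_induct)
  case less
  show ?case
  proof (cases "\<forall>i. \<alpha> i = 0")
    case True
    then have "xpow \<alpha> = (\<lambda>x. 1)" by (simp add: xpow_def fun_eq_iff)
    then show ?thesis using integral_harm_zero[OF \<kappa> less.prems(1)] less.prems(2) by simp
  next
    case False
    then obtain i where i: "\<alpha> i > 0" by auto
    define \<beta> where "\<beta> = \<alpha>(i := \<alpha> i - 1)"
    have sa: "sum \<alpha> UNIV = Suc (sum \<beta> UNIV)"
      using i by (simp add: \<beta>_def sum.remove[of UNIV i])
    have xa: "xpow \<alpha> x = x $ i * xpow \<beta> x" for x
      using i by (cases "\<alpha> i") (auto simp: \<beta>_def xpow_split[of _ x i])
    have Ph: "P \<in> hpoly n" using less.prems by (simp add: h_harm_def)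
    let ?R = "\<lambda>x. xpow \<beta> x * P x"
    let ?\<gamma> = "\<beta>(i := \<beta> i - 1)"
    have R: "?R \<in> hpoly (sum \<beta> UNIV + n)" by (intro hpoly_mult hpoly.monomial Ph refl)
    obtain C where C: "C > 0" "(\<integral>x. dunkl \<kappa> i ?R x \<partial>hmeasure \<kappa>) = C * (\<integral>x. x $ i * ?R x \<partial>hmeasure \<kappa>)"
      using hmeasure_by_parts[OF \<kappa>, of "sum \<beta> UNIV + n"] R by blast
    note ih = integrable_hmeasure_continuous[OF \<kappa> continuous_hpoly]
    have int: "integrable (hmeasure \<kappa>) (\<lambda>x. xpow \<delta> x * Q x)" if "Q \<in> hpoly k" for \<delta> Q k
      by (rule ih[OF hpoly_mult[OF hpoly.monomial[OF refl] that]])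
    have D: "(\<integral>x. xpow \<beta> x * dunkl \<kappa> i P x \<partial>hmeasure \<kappa>) = 0"
      using less.prems sa by (intro less.hyps[of _ _ "n - 1"] harm_dunkl) auto
    have g: "\<beta> i = 0 \<or> (\<integral>x. xpow ?\<gamma> x * Q x \<partial>hmeasure \<kappa>) = 0" if "Q \<in> h_harm \<kappa> n" for Q
    proof (cases "\<beta> i = 0")
      case False
      then have "sum \<beta> UNIV = Suc (sum ?\<gamma> UNIV)" by (simp add: sum.remove[of UNIV i])
      then show ?thesis using less.prems sa that by (intro disjI2 less.hyps[of _ _ n]) auto
    qed simp
    have "(\<integral>x. dunkl \<kappa> i ?R x \<partial>hmeasure \<kappa>) = (\<integral>x. xpow \<beta> x * dunkl \<kappa> i P x \<partial>hmeasure \<kappa>)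
       + real (\<beta> i) * (\<integral>x. xpow ?\<gamma> x * P x \<partial>hmeasure \<kappa>)
       + (if odd (\<beta> i) then 2 * \<kappa> $ i else 0) * (\<integral>x. xpow ?\<gamma> x * P (coord_refl i x) \<partial>hmeasure \<kappa>)"
      unfolding dunkl_xpow_mult[OF Ph]
      using int[OF dunkl_hpoly[OF Ph]] int[OF Ph] int[OF hpoly_refl[OF Ph]] by simp
    also have "\<dots> = 0"
      using D g[OF less.prems(1)] g[OF harm_refl[OF less.prems(1), of i]] by (cases "\<beta> i = 0") simp_all
    finally have "(\<integral>x. x $ i * ?R x \<partial>hmeasure \<kappa>) = 0" using C by simp
    then show ?thesis by (simp only: xa mult.assoc)
  qed
qed

lemma hpoly_harm_orthogonal:
  fixes \<kappa> :: "real ^ 'n"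
  assumes \<kappa>: "\<And>i. 0 \<le> \<kappa> $ i" and P: "P \<in> h_harm \<kappa> n" and f: "f \<in> hpoly m" and mn: "m < n"
  shows "(\<integral>x. f x * P x \<partial>hmeasure \<kappa>) = 0"
  using f
proof induction
  case (monomial \<alpha>) then show ?case using xpow_harm_orthogonal[OF \<kappa> P] mn by simp
next
  case (add f g)
  have Ph: "P \<in> hpoly n" using P by (simp add: h_harm_def)
  note ih = integrable_hmeasure_continuous[OF \<kappa> continuous_hpoly[OF hpoly_mult[OF _ Ph]]]
  show ?case using add ih[OF add(1)] ih[OF add(2)] by (simp add: distrib_right)
qed (auto simp: mult.assoc)

lemma harm_orthogonal:
  fixes \<kappa> :: "real ^ 'n"
  assumes \<kappa>: "\<And>i. 0 \<le> \<kappa> $ i" and P: "P \<in> h_harm \<kappa> n" and Q: "Q \<in> h_harm \<kappa> m" and mn: "m \<noteq> n"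
  shows "(\<integral>x. P x * Q x \<partial>hmeasure \<kappa>) = 0"
proof (cases "m < n")
  case True
  then show ?thesis
    using hpoly_harm_orthogonal[OF \<kappa> P, of Q m] Q by (simp add: h_harm_def mult.commute)
next
  case False
  then show ?thesis
    using hpoly_harm_orthogonal[OF \<kappa> Q, of P n] P mn by (simp add: h_harm_def)
qed

section \<open>Reproducing kernels and symmetry of the means\<close>

interpretation real_fun: vector_space "\<lambda>(c :: real) (f :: 'a \<Rightarrow> real) x. c * f x"
  by unfold_locales (auto simp: fun_eq_iff algebra_simps)

lemma finite_multiindices: "finite {\<alpha> :: 'n::finite \<Rightarrow> nat. sum \<alpha> UNIV = k}"
proof (rule finite_subset)
  show "{\<alpha> :: 'n \<Rightarrow> nat. sum \<alpha> UNIV = k} \<subseteq> PiE UNIV (\<lambda>_. {..k})"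
    by (auto simp: PiE_iff member_le_sum)
qed (intro finite_PiE, auto)

lemma hpoly_span: "hpoly k \<subseteq> real_fun.span (xpow ` {\<alpha> :: 'n::finite \<Rightarrow> nat. sum \<alpha> UNIV = k})"
proof
  fix f :: "real ^ 'n \<Rightarrow> real" assume "f \<in> hpoly k"
  then show "f \<in> real_fun.span (xpow ` {\<alpha> :: 'n \<Rightarrow> nat. sum \<alpha> UNIV = k})"
  proof induction
    case zero
    show ?case using real_fun.span_zero by (simp add: zero_fun_def)
  next
    case (monomial \<alpha>)
    then show ?case by (intro real_fun.span_base) auto
  next
    case (add f g)
    from real_fun.span_add[OF add(3,4)] show ?case by (simp add: plus_fun_def)
  next
    case (scale f c)
    from real_fun.span_scale[OF scale(2)] show ?case .
  qed
qed

definition orthonormal :: "real ^ 'n \<Rightarrow> (real ^ 'n \<Rightarrow> real) set \<Rightarrow> bool" where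
  "orthonormal \<kappa> E \<longleftrightarrow> (\<forall>e\<in>E. \<forall>e'\<in>E. (\<integral>x. e x * e' x \<partial>hmeasure \<kappa>) = (if e = e' then 1 else 0))"

lemma sum_fun_apply: "(\<Sum>a\<in>A. f a) x = (\<Sum>a\<in>A. f a x :: real)"
  by (induction A rule: infinite_finite_induct) auto

text \<open>
  Orthonormal sets are linearly independent, and the monomials of degree \<open>n\<close> span.
\<close>

lemma orthonormal_card:
  fixes \<kappa> :: "real ^ 'n"
  assumes \<kappa>: "\<And>i. 0 \<le> \<kappa> $ i" and E: "E \<subseteq> hpoly n" and o: "orthonormal \<kappa> E"
  shows "finite E \<and> card E \<le> card {\<alpha> :: 'n \<Rightarrow> nat. sum \<alpha> UNIV = n}"
proof -
  have "\<not> real_fun.dependent E"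
  proof
    assume "real_fun.dependent E"
    then obtain S u v where S: "finite S" "S \<subseteq> E" "v \<in> S" "u v \<noteq> 0" "(\<Sum>v\<in>S. (\<lambda>x. u v * v x)) = 0"
      unfolding real_fun.dependent_explicit by blast
    have z: "(\<Sum>w\<in>S. u w * w x) = 0" for x
      using fun_cong[OF S(5), of x] by (simp add: sum_fun_apply)
    note ih = integrable_hmeasure_continuous[OF \<kappa> continuous_hpoly[OF hpoly_mult]]
    have "0 = (\<integral>x. (\<Sum>w\<in>S. u w * w x) * v x \<partial>hmeasure \<kappa>)" by (simp add: z)
    also have "\<dots> = (\<integral>x. (\<Sum>w\<in>S. u w * (w x * v x)) \<partial>hmeasure \<kappa>)"
      by (simp add: sum_distrib_right mult.assoc)
    also have "\<dots> = (\<Sum>w\<in>S. u w * (\<integral>x. w x * v x \<partial>hmeasure \<kappa>))"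
      using S E by (subst Bochner_Integration.integral_sum) (auto intro!: ih)
    also have "\<dots> = (\<Sum>w\<in>S. if w = v then u w else 0)"
    proof (rule sum.cong)
      fix w assume "w \<in> S"
      then have "w \<in> E" "v \<in> E" using S by auto
      then show "u w * (\<integral>x. w x * v x \<partial>hmeasure \<kappa>) = (if w = v then u w else 0)"
        using o by (simp add: orthonormal_def)
    qed simp
    also have "\<dots> = u v" using S by simp
    finally show False using S by simp
  qed
  then have "finite E \<and> card E \<le> card (xpow ` {\<alpha> :: 'n \<Rightarrow> nat. sum \<alpha> UNIV = n})"
    using E hpoly_span by (intro real_fun.independent_span_bound) (auto simp: finite_multiindices)
  moreover have "card (xpow ` {\<alpha> :: 'n \<Rightarrow> nat. sum \<alpha> UNIV = n}) \<le> card {\<alpha> :: 'n \<Rightarrow> nat. sum \<alpha> UNIV = n}"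
    by (rule card_image_le[OF finite_multiindices])
  ultimately show ?thesis by linarith
qed

lemma hpoly_definite:
  fixes \<kappa> :: "real ^ 'n"
  assumes \<kappa>: "\<And>i. 0 \<le> \<kappa> $ i" and f: "f \<in> hpoly n" and z: "(\<integral>x. f x * f x \<partial>hmeasure \<kappa>) = 0"
  shows "f = (\<lambda>x. 0)"
proof
  fix x :: "real ^ 'n"
  have s: "f y = 0" if "y \<in> sphere 0 1" for y
    using hmeasure_definite[of "\<lambda>x. f x * f x" \<kappa> y] \<kappa> z that continuous_hpoly[OF f]
    by (auto intro!: continuous_intros)
  define y where "y = (if x = 0 then axis undefined 1 else sgn x)"
  have "y \<in> sphere 0 1" by (simp add: y_def norm_sgn norm_axis_1)
  moreover have "x = norm x *\<^sub>R y" by (simp add: y_def sgn_div_norm)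
  ultimately show "f x = 0" using hpoly_homogeneous[OF f, of "norm x" y] s by simp
qed

text \<open>
  An orthonormal set of maximal cardinality is a basis: the normalised remainder of any other element
  would enlarge it.
\<close>

lemma harm_orthonormal_basis:
  fixes \<kappa> :: "real ^ 'n"
  assumes \<kappa>: "\<And>i. 0 \<le> \<kappa> $ i"
  obtains E where "finite E" "E \<subseteq> h_harm \<kappa> n" "orthonormal \<kappa> E"
    "\<And>P. P \<in> h_harm \<kappa> n \<Longrightarrow> P = (\<lambda>x. \<Sum>e\<in>E. (\<integral>y. P y * e y \<partial>hmeasure \<kappa>) * e x)"
proof -
  let ?good = "\<lambda>E. E \<subseteq> h_harm \<kappa> n \<and> orthonormal \<kappa> E"
  have hh: "h_harm \<kappa> n \<subseteq> hpoly n" by (auto simp: h_harm_def)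
  have bd: "finite E \<and> card E \<le> card {\<alpha> :: 'n \<Rightarrow> nat. sum \<alpha> UNIV = n}" if "?good E" for E
    using that hh by (intro orthonormal_card[OF \<kappa>]) auto
  have "?good {}" by (simp add: orthonormal_def)
  then obtain E where E: "?good E" and max: "\<And>E'. ?good E' \<Longrightarrow> card E' \<le> card E"
    using ex_has_greatest_nat[of ?good "{}" card "Suc (card {\<alpha> :: 'n \<Rightarrow> nat. sum \<alpha> UNIV = n})"] bd
    by (metis (no_types, lifting) less_Suc_eq_le)
  have fin: "finite E" using bd[OF E] by simp
  have EH: "e \<in> hpoly n" if "e \<in> E" for e using E hh that by auto
  note ih = integrable_hmeasure_continuous[OF \<kappa> continuous_hpoly[OF hpoly_mult]]
  show ?thesis
  proof (rule that[OF fin])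
    fix P assume P: "P \<in> h_harm \<kappa> n"
    define c where "c e = (\<integral>y. P y * e y \<partial>hmeasure \<kappa>)" for e
    define w where "w x = P x + (-1) * (\<Sum>e\<in>E. c e * e x)" for x
    have wV: "w \<in> h_harm \<kappa> n" unfolding w_def[abs_def]
      by (intro harm_lincomb(1) P harm_scale harm_sum fin) (use E in auto)
    have Ph: "P \<in> hpoly n" and wh: "w \<in> hpoly n" using P wV hh by auto
    have orth: "(\<integral>x. w x * e x \<partial>hmeasure \<kappa>) = 0" if e: "e \<in> E" for e
    proof -
      have "(\<integral>x. w x * e x \<partial>hmeasure \<kappa>) = (\<integral>x. P x * e x - (\<Sum>e'\<in>E. c e' * (e' x * e x)) \<partial>hmeasure \<kappa>)"
        unfolding w_def by (simp add: left_diff_distrib sum_distrib_right mult.assoc)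
      also have "\<dots> = c e - (\<integral>x. (\<Sum>e'\<in>E. c e' * (e' x * e x)) \<partial>hmeasure \<kappa>)"
        unfolding c_def using ih[OF Ph EH[OF e]] ih[OF EH EH[OF e]]
        by (subst Bochner_Integration.integral_diff) auto
      also have "(\<integral>x. (\<Sum>e'\<in>E. c e' * (e' x * e x)) \<partial>hmeasure \<kappa>) = (\<Sum>e'\<in>E. c e' * (\<integral>x. e' x * e x \<partial>hmeasure \<kappa>))"
        using ih[OF EH EH[OF e]] by (subst Bochner_Integration.integral_sum) auto
      also have "\<dots> = (\<Sum>e'\<in>E. if e' = e then c e' else 0)"
        using E e by (intro sum.cong) (auto simp: orthonormal_def)
      also have "\<dots> = c e" using e fin by simp
      finally show ?thesis by simp
    qed
    have "w = (\<lambda>x. 0)"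
    proof (rule ccontr)
      assume wn: "w \<noteq> (\<lambda>x. 0)"
      define N where "N = (\<integral>x. w x * w x \<partial>hmeasure \<kappa>)"
      have "N \<noteq> 0" using hpoly_definite[OF \<kappa> wh] wn by (auto simp: N_def)
      moreover have "N \<ge> 0" unfolding N_def by (rule Bochner_Integration.integral_nonneg) simp
      ultimately have N: "N > 0" by simp
      define v where "v x = (1 / sqrt N) * w x" for x
      have vV: "v \<in> h_harm \<kappa> n" unfolding v_def[abs_def] by (rule harm_scale[OF wV])
      have vv: "(\<integral>x. v x * v x \<partial>hmeasure \<kappa>) = 1"
      proof -
        have "v x * v x = (1 / N) * (w x * w x)" for x using N by (simp add: v_def)
        then have "(\<integral>x. v x * v x \<partial>hmeasure \<kappa>) = (1 / N) * N" unfolding N_def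
          by (simp only: Bochner_Integration.integral_mult_right_zero)
        then show ?thesis using N by simp
      qed
      have ve: "(\<integral>x. v x * e x \<partial>hmeasure \<kappa>) = 0" "(\<integral>x. e x * v x \<partial>hmeasure \<kappa>) = 0" if "e \<in> E" for e
      proof -
        have "v x * e x = (1 / sqrt N) * (w x * e x)" for x by (simp add: v_def)
        then show "(\<integral>x. v x * e x \<partial>hmeasure \<kappa>) = 0" using orth[OF that]
          by (simp only: Bochner_Integration.integral_mult_right_zero)
        then show "(\<integral>x. e x * v x \<partial>hmeasure \<kappa>) = 0" by (simp add: mult.commute)
      qed
      have "v \<notin> E" using ve vv by force
      moreover have "?good (insert v E)"
        using E vV vv ve \<open>v \<notin> E\<close> by (auto simp: orthonormal_def)
      from max[OF this] have "card (insert v E) \<le> card E" .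
      ultimately show False using fin by simp
    qed
    then have px: "P x = (\<Sum>e\<in>E. c e * e x)" for x
    proof -
      have "w x = 0" using \<open>w = (\<lambda>x. 0)\<close> by simp
      then show ?thesis unfolding w_def by simp
    qed
    show "P = (\<lambda>x. \<Sum>e\<in>E. (\<integral>y. P y * e y \<partial>hmeasure \<kappa>) * e x)"
      by (rule ext) (rule px[unfolded c_def])
  qed (use E in auto)
qed

lemma integrable_mult_continuous:
  fixes \<kappa> :: "real ^ 'n" and f g :: "real ^ 'n \<Rightarrow> real"
  assumes \<kappa>: "\<And>i. 0 \<le> \<kappa> $ i" and f: "integrable (hmeasure \<kappa>) f" and g: "continuous_on (sphere 0 1) g"
  shows "integrable (hmeasure \<kappa>) (\<lambda>x. f x * g x)"
proof -
  obtain B where B: "B > 0" "\<And>x. x \<in> sphere 0 1 \<Longrightarrow> \<bar>g x\<bar> \<le> B"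
    using continuous_sphere_bounded[OF g] by blast
  show ?thesis
  proof (rule Bochner_Integration.integrable_bound[of _ "\<lambda>x. B * \<bar>f x\<bar>"])
    show "integrable (hmeasure \<kappa>) (\<lambda>x. B * \<bar>f x\<bar>)" using f by simp
    show "(\<lambda>x. f x * g x) \<in> borel_measurable (hmeasure \<kappa>)"
      using f continuous_measurable_hmeasure[OF g] by (intro borel_measurable_times) auto
    show "AE x in hmeasure \<kappa>. norm (f x * g x) \<le> norm (B * \<bar>f x\<bar>)"
    proof (rule AE_I2)
      fix x assume "x \<in> space (hmeasure \<kappa>)"
      then have "\<bar>f x\<bar> * \<bar>g x\<bar> \<le> \<bar>f x\<bar> * B" using B by (intro mult_left_mono) auto
      then show "norm (f x * g x) \<le> norm (B * \<bar>f x\<bar>)" using B by (simp add: abs_mult mult.commute)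
    qed
  qed
qed

text \<open>
  The kernel \<open>\<Sum>e\<in>E. e x * e y\<close> reproduces h-harmonics, and it is the only one that does: the
  difference of two reproducing kernels is an h-harmonic orthogonal to itself. This resolves the
  definite description in \<open>repr_kernel\<close>.
\<close>

lemma h_proj_basis:
  fixes \<kappa> :: "real ^ 'n"
  assumes \<kappa>: "\<And>i. 0 \<le> \<kappa> $ i"
  shows "\<exists>E. finite E \<and> E \<subseteq> h_harm \<kappa> n \<and>
    (\<forall>P\<in>h_harm \<kappa> n. \<forall>x. P x = (\<Sum>e\<in>E. (\<integral>y. P y * e y \<partial>hmeasure \<kappa>) * e x)) \<and>
    (\<forall>f x. integrable (hmeasure \<kappa>) f \<longrightarrow> x \<in> sphere 0 1 \<longrightarrow>
        h_proj \<kappa> n f x = (\<Sum>e\<in>E. (\<integral>y. f y * e y \<partial>hmeasure \<kappa>) * e x))"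
proof -
  obtain E where E: "finite E" "E \<subseteq> h_harm \<kappa> n" "orthonormal \<kappa> E"
    "\<And>P. P \<in> h_harm \<kappa> n \<Longrightarrow> P = (\<lambda>x. \<Sum>e\<in>E. (\<integral>y. P y * e y \<partial>hmeasure \<kappa>) * e x)"
    using harm_orthonormal_basis[OF \<kappa>, of n] by blast
  have hh: "h_harm \<kappa> n \<subseteq> hpoly n" by (auto simp: h_harm_def)
  have cont: "continuous_on (sphere 0 1) e" if "e \<in> h_harm \<kappa> n" for e
    using continuous_hpoly that hh by blast
  let ?K = "\<lambda>x y. \<Sum>e\<in>E. e x * e y"
  have KV: "?K x \<in> h_harm \<kappa> n" for x
    using E by (intro harm_sum) (auto intro!: harm_scale)
  have iK: "(\<integral>y. f y * ?K x y \<partial>hmeasure \<kappa>) = (\<Sum>e\<in>E. (\<integral>y. f y * e y \<partial>hmeasure \<kappa>) * e x)"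
    if f: "integrable (hmeasure \<kappa>) f" for f x
  proof -
    have "(\<integral>y. f y * ?K x y \<partial>hmeasure \<kappa>) = (\<integral>y. (\<Sum>e\<in>E. e x * (f y * e y)) \<partial>hmeasure \<kappa>)"
      by (simp add: sum_distrib_left mult.left_commute)
    also have "\<dots> = (\<Sum>e\<in>E. e x * (\<integral>y. f y * e y \<partial>hmeasure \<kappa>))"
      using E(2) integrable_mult_continuous[OF \<kappa> f cont]
      by (subst Bochner_Integration.integral_sum) auto
    finally show ?thesis by (simp add: mult.commute)
  qed
  have rc: "(\<integral>y. f y * restrict g (sphere 0 1) y \<partial>hmeasure \<kappa>) = (\<integral>y. f y * g y \<partial>hmeasure \<kappa>)"
    for f g :: "real ^ 'n \<Rightarrow> real"
    by (rule Bochner_Integration.integral_cong) auto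
  have rc2: "(\<integral>y. restrict g (sphere 0 1) y * f y \<partial>hmeasure \<kappa>) = (\<integral>y. g y * f y \<partial>hmeasure \<kappa>)"
    for f g :: "real ^ 'n \<Rightarrow> real"
    by (rule Bochner_Integration.integral_cong) auto
  have ker: "repr_kernel \<kappa> n x = restrict (?K x) (sphere 0 1)" if x: "x \<in> sphere 0 1" for x
    unfolding repr_kernel_def
  proof (rule the_equality)
    have "g x = (\<integral>y. g y * restrict (?K x) (sphere 0 1) y \<partial>hmeasure \<kappa>)" if g: "g \<in> h_harmonics \<kappa> n" for g :: "real ^ 'n \<Rightarrow> real"
    proof -
      obtain P where P: "P \<in> h_harm \<kappa> n" "g = restrict P (sphere 0 1)"
        using g by (auto simp: h_harmonics_eq)
      have "(\<integral>y. g y * restrict (?K x) (sphere 0 1) y \<partial>hmeasure \<kappa>) = (\<integral>y. P y * ?K x y \<partial>hmeasure \<kappa>)"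
        unfolding rc P(2) rc2 ..
      also have "\<dots> = P x"
        using iK[OF integrable_hmeasure_continuous[OF \<kappa> cont[OF P(1)]], of x] fun_cong[OF E(4)[OF P(1)], of x] by simp
      finally show ?thesis using P(2) x by simp
    qed
    then show "restrict (?K x) (sphere 0 1) \<in> h_harmonics \<kappa> n \<and>
        (\<forall>g\<in>h_harmonics \<kappa> n. g x = (\<integral>y. g y * restrict (?K x) (sphere 0 1) y \<partial>hmeasure \<kappa>))"
      using KV by (auto simp: h_harmonics_eq)
    note K = this
    fix k assume k: "k \<in> h_harmonics \<kappa> n \<and> (\<forall>g\<in>h_harmonics \<kappa> n. g x = (\<integral>y. g y * k y \<partial>hmeasure \<kappa>))"
    then obtain Q where Q: "Q \<in> h_harm \<kappa> n" "k = restrict Q (sphere 0 1)"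
      by (auto simp: h_harmonics_eq)
    define d where "d y = Q y + (-1) * ?K x y" for y
    have d: "d \<in> h_harm \<kappa> n" unfolding d_def[abs_def] by (intro harm_lincomb(1) Q harm_scale KV)
    then have dr: "restrict d (sphere 0 1) \<in> h_harmonics \<kappa> n" by (auto simp: h_harmonics_eq)
    have "(\<integral>y. d y * Q y \<partial>hmeasure \<kappa>) = (\<integral>y. restrict d (sphere 0 1) y * k y \<partial>hmeasure \<kappa>)"
      unfolding Q(2) rc rc2 ..
    also have "\<dots> = restrict d (sphere 0 1) x" by (rule bspec[OF conjunct2[OF k] dr, symmetric])
    also have "\<dots> = (\<integral>y. restrict d (sphere 0 1) y * restrict (?K x) (sphere 0 1) y \<partial>hmeasure \<kappa>)"
      using K dr by blast
    also have "\<dots> = (\<integral>y. d y * ?K x y \<partial>hmeasure \<kappa>)"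
      unfolding rc rc2 ..
    finally have eq: "(\<integral>y. d y * Q y \<partial>hmeasure \<kappa>) = (\<integral>y. d y * ?K x y \<partial>hmeasure \<kappa>)" .
    have id: "integrable (hmeasure \<kappa>) (\<lambda>y. d y * P y)" if "P \<in> h_harm \<kappa> n" for P
      using integrable_mult_continuous[OF \<kappa> integrable_hmeasure_continuous[OF \<kappa> cont[OF d]] cont[OF that]] .
    have "(\<integral>y. d y * d y \<partial>hmeasure \<kappa>) = (\<integral>y. d y * Q y - d y * ?K x y \<partial>hmeasure \<kappa>)"
      by (rule Bochner_Integration.integral_cong) (auto simp: d_def algebra_simps)
    also have "\<dots> = 0"
      using Bochner_Integration.integral_diff[OF id[OF Q(1)] id[OF KV[of x]]] eq by simp
    finally have "d = (\<lambda>y. 0)" using hpoly_definite[OF \<kappa>, of d n] d hh by auto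
    then have "Q = ?K x" by (auto simp: d_def fun_eq_iff)
    then show "k = restrict (?K x) (sphere 0 1)" using Q(2) by simp
  qed
  have "h_proj \<kappa> n f x = (\<Sum>e\<in>E. (\<integral>y. f y * e y \<partial>hmeasure \<kappa>) * e x)"
    if "integrable (hmeasure \<kappa>) f" "x \<in> sphere 0 1" for f x
    unfolding h_proj_def ker[OF that(2)] rc iK[OF that(1)] ..
  moreover have "P x = (\<Sum>e\<in>E. (\<integral>y. P y * e y \<partial>hmeasure \<kappa>) * e x)" if "P \<in> h_harm \<kappa> n" for P x
    by (rule fun_cong[OF E(4)[OF that]])
  ultimately show ?thesis using E(1,2) by (intro exI[of _ E]) auto
qed

lemma h_proj_properties:
  fixes \<kappa> :: "real ^ 'n"
  assumes \<kappa>: "\<And>i. 0 \<le> \<kappa> $ i"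
  shows "\<exists>E. finite E \<and> (\<forall>e\<in>E. continuous_on (sphere 0 1) e) \<and>
    (\<forall>f x. integrable (hmeasure \<kappa>) f \<longrightarrow> x \<in> sphere 0 1 \<longrightarrow>
        h_proj \<kappa> n f x = (\<Sum>e\<in>E. (\<integral>y. f y * e y \<partial>hmeasure \<kappa>) * e x))"
proof -
  obtain E where E: "finite E" "E \<subseteq> h_harm \<kappa> n"
    "\<forall>f x. integrable (hmeasure \<kappa>) f \<longrightarrow> x \<in> sphere 0 1 \<longrightarrow>
        h_proj \<kappa> n f x = (\<Sum>e\<in>E. (\<integral>y. f y * e y \<partial>hmeasure \<kappa>) * e x)"
    using h_proj_basis[OF \<kappa>, of n] by auto
  have "continuous_on (sphere 0 1) e" if "e \<in> E" for e
    using that E(2) continuous_hpoly[of e n] by (auto simp: h_harm_def)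
  then show ?thesis using E(1,3) by blast
qed

lemma continuous_h_proj:
  fixes \<kappa> :: "real ^ 'n"
  assumes \<kappa>: "\<And>i. 0 \<le> \<kappa> $ i" and f: "integrable (hmeasure \<kappa>) f"
  shows "continuous_on (sphere 0 1) (h_proj \<kappa> n f)"
proof -
  obtain E where E: "finite E" "\<forall>e\<in>E. continuous_on (sphere 0 1) e"
    "\<And>x. x \<in> sphere 0 1 \<Longrightarrow> h_proj \<kappa> n f x = (\<Sum>e\<in>E. (\<integral>y. f y * e y \<partial>hmeasure \<kappa>) * e x)"
    using h_proj_properties[OF \<kappa>, of n] f by blast
  have "continuous_on (sphere 0 1) (\<lambda>x. \<Sum>e\<in>E. (\<integral>y. f y * e y \<partial>hmeasure \<kappa>) * e x)"
    using E(2) by (auto intro!: continuous_intros)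
  then show ?thesis by (subst continuous_on_cong[OF refl E(3)]) auto
qed

lemma continuous_cesaro_mean:
  fixes \<kappa> :: "real ^ 'n"
  assumes \<kappa>: "\<And>i. 0 \<le> \<kappa> $ i" and f: "integrable (hmeasure \<kappa>) f"
  shows "continuous_on (sphere 0 1) (cesaro_mean \<kappa> \<delta> n f)"
  unfolding cesaro_mean_def by (intro continuous_intros continuous_h_proj[OF \<kappa> f])

lemma h_proj_symmetric:
  fixes \<kappa> :: "real ^ 'n"
  assumes \<kappa>: "\<And>i. 0 \<le> \<kappa> $ i" and f: "integrable (hmeasure \<kappa>) f" and g: "integrable (hmeasure \<kappa>) g"
  shows "(\<integral>x. g x * h_proj \<kappa> n f x \<partial>hmeasure \<kappa>) = (\<integral>x. f x * h_proj \<kappa> n g x \<partial>hmeasure \<kappa>)"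
proof -
  obtain E where E: "finite E" "\<forall>e\<in>E. continuous_on (sphere 0 1) e"
    "\<And>f x. integrable (hmeasure \<kappa>) f \<Longrightarrow> x \<in> sphere 0 1 \<Longrightarrow> h_proj \<kappa> n f x = (\<Sum>e\<in>E. (\<integral>y. f y * e y \<partial>hmeasure \<kappa>) * e x)"
    using h_proj_properties[OF \<kappa>, of n] by blast
  have *: "(\<integral>x. g x * h_proj \<kappa> n f x \<partial>hmeasure \<kappa>) = (\<Sum>e\<in>E. (\<integral>y. f y * e y \<partial>hmeasure \<kappa>) * (\<integral>y. g y * e y \<partial>hmeasure \<kappa>))"
    if f: "integrable (hmeasure \<kappa>) f" and g: "integrable (hmeasure \<kappa>) g" for f g
  proof -
    have "(\<integral>x. g x * h_proj \<kappa> n f x \<partial>hmeasure \<kappa>) = (\<integral>x. (\<Sum>e\<in>E. (\<integral>y. f y * e y \<partial>hmeasure \<kappa>) * (g x * e x)) \<partial>hmeasure \<kappa>)"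
      by (rule Bochner_Integration.integral_cong) (auto simp: E(3)[OF f] sum_distrib_left mult.left_commute)
    also have "\<dots> = (\<Sum>e\<in>E. (\<integral>y. f y * e y \<partial>hmeasure \<kappa>) * (\<integral>y. g y * e y \<partial>hmeasure \<kappa>))"
      using E(2) integrable_mult_continuous[OF \<kappa> g] by (subst Bochner_Integration.integral_sum) auto
    finally show ?thesis .
  qed
  show ?thesis unfolding *[OF f g] *[OF g f] by (simp add: mult.commute)
qed

lemma cesaro_mean_symmetric:
  fixes \<kappa> :: "real ^ 'n"
  assumes \<kappa>: "\<And>i. 0 \<le> \<kappa> $ i" and f: "integrable (hmeasure \<kappa>) f" and g: "integrable (hmeasure \<kappa>) g"
  shows "(\<integral>x. g x * cesaro_mean \<kappa> \<delta> n f x \<partial>hmeasure \<kappa>) = (\<integral>x. f x * cesaro_mean \<kappa> \<delta> n g x \<partial>hmeasure \<kappa>)"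
proof -
  have *: "(\<integral>x. g x * cesaro_mean \<kappa> \<delta> n f x \<partial>hmeasure \<kappa>) =
     inverse (cesaro_coeff \<delta> n) * (\<Sum>j\<le>n. cesaro_coeff \<delta> (n - j) * (\<integral>x. g x * h_proj \<kappa> j f x \<partial>hmeasure \<kappa>))"
    if f: "integrable (hmeasure \<kappa>) f" and g: "integrable (hmeasure \<kappa>) g" for f g
  proof -
    have "(\<integral>x. g x * cesaro_mean \<kappa> \<delta> n f x \<partial>hmeasure \<kappa>) =
      (\<integral>x. inverse (cesaro_coeff \<delta> n) * (\<Sum>j\<le>n. cesaro_coeff \<delta> (n - j) * (g x * h_proj \<kappa> j f x)) \<partial>hmeasure \<kappa>)"
      unfolding cesaro_mean_def by (simp add: sum_distrib_left mult.left_commute)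
    also have "\<dots> = inverse (cesaro_coeff \<delta> n) * (\<Sum>j\<le>n. cesaro_coeff \<delta> (n - j) * (\<integral>x. g x * h_proj \<kappa> j f x \<partial>hmeasure \<kappa>))"
      using integrable_mult_continuous[OF \<kappa> g continuous_h_proj[OF \<kappa> f]]
      by (simp add: Bochner_Integration.integral_sum)
    finally show ?thesis .
  qed
  show ?thesis unfolding *[OF f g] *[OF g f] by (simp add: h_proj_symmetric[OF \<kappa> f g])
qed

lemma h_proj_bound:
  fixes \<kappa> :: "real ^ 'n"
  assumes \<kappa>: "\<And>i. 0 \<le> \<kappa> $ i"
  shows "\<exists>K\<ge>0. \<forall>f x. integrable (hmeasure \<kappa>) f \<longrightarrow> x \<in> sphere 0 1 \<longrightarrow>
     \<bar>h_proj \<kappa> n f x\<bar> \<le> K * (\<integral>y. \<bar>f y\<bar> \<partial>hmeasure \<kappa>)"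
proof -
  obtain E where E: "finite E" "\<forall>e\<in>E. continuous_on (sphere 0 1) e"
    "\<And>f x. integrable (hmeasure \<kappa>) f \<Longrightarrow> x \<in> sphere 0 1 \<Longrightarrow> h_proj \<kappa> n f x = (\<Sum>e\<in>E. (\<integral>y. f y * e y \<partial>hmeasure \<kappa>) * e x)"
    using h_proj_properties[OF \<kappa>, of n] by blast
  have "\<forall>e\<in>E. \<exists>B>0. \<forall>x\<in>sphere 0 1. \<bar>e x\<bar> \<le> B"
    using E(2) continuous_sphere_bounded by metis
  then obtain B where B: "\<And>e. e \<in> E \<Longrightarrow> B e > 0" "\<And>e x. e \<in> E \<Longrightarrow> x \<in> sphere 0 1 \<Longrightarrow> \<bar>e x\<bar> \<le> B e"
    by metis
  show ?thesis
  proof (intro exI[of _ "\<Sum>e\<in>E. B e * B e"] conjI allI impI)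
    show "0 \<le> (\<Sum>e\<in>E. B e * B e)" by (intro sum_nonneg) auto
    fix f :: "real ^ 'n \<Rightarrow> real" and x :: "real ^ 'n" assume f: "integrable (hmeasure \<kappa>) f" and x: "x \<in> sphere 0 1"
    let ?I = "\<integral>y. \<bar>f y\<bar> \<partial>hmeasure \<kappa>"
    have I: "\<bar>\<integral>y. f y * e y \<partial>hmeasure \<kappa>\<bar> \<le> B e * ?I" if e: "e \<in> E" for e
    proof -
      have i: "integrable (hmeasure \<kappa>) (\<lambda>y. f y * e y)"
        using integrable_mult_continuous[OF \<kappa> f] E(2) e by blast
      have "\<bar>\<integral>y. f y * e y \<partial>hmeasure \<kappa>\<bar> \<le> (\<integral>y. \<bar>f y * e y\<bar> \<partial>hmeasure \<kappa>)"
        by (rule integral_abs_bound)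
      also have "\<dots> \<le> (\<integral>y. B e * \<bar>f y\<bar> \<partial>hmeasure \<kappa>)"
      proof (rule integral_mono)
        fix y assume "y \<in> space (hmeasure \<kappa>)"
        then have "\<bar>f y\<bar> * \<bar>e y\<bar> \<le> \<bar>f y\<bar> * B e" using B(2)[OF e] by (intro mult_left_mono) auto
        then show "\<bar>f y * e y\<bar> \<le> B e * \<bar>f y\<bar>" by (simp add: abs_mult mult.commute)
      qed (use i f in auto)
      finally show ?thesis by simp
    qed
    have I0: "?I \<ge> 0" by (rule Bochner_Integration.integral_nonneg) simp
    have "\<bar>h_proj \<kappa> n f x\<bar> \<le> (\<Sum>e\<in>E. \<bar>(\<integral>y. f y * e y \<partial>hmeasure \<kappa>) * e x\<bar>)"
      unfolding E(3)[OF f x] by (rule sum_abs)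
    also have "\<dots> \<le> (\<Sum>e\<in>E. (B e * ?I) * B e)"
      unfolding abs_mult using I B(2) B(1)[THEN less_imp_le] x I0
      by (intro sum_mono mult_mono) (auto intro!: mult_nonneg_nonneg)
    also have "\<dots> = (\<Sum>e\<in>E. B e * B e) * ?I"
      by (simp only: sum_distrib_right) (simp add: mult_ac)
    finally show "\<bar>h_proj \<kappa> n f x\<bar> \<le> (\<Sum>e\<in>E. B e * B e) * ?I" .
  qed
qed

lemma cesaro_mean_bound:
  fixes \<kappa> :: "real ^ 'n"
  assumes \<kappa>: "\<And>i. 0 \<le> \<kappa> $ i"
  shows "\<exists>K\<ge>0. \<forall>f x. integrable (hmeasure \<kappa>) f \<longrightarrow> x \<in> sphere 0 1 \<longrightarrow>
     \<bar>cesaro_mean \<kappa> \<delta> n f x\<bar> \<le> K * (\<integral>y. \<bar>f y\<bar> \<partial>hmeasure \<kappa>)"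
proof -
  obtain K where K: "\<And>j. K j \<ge> 0" "\<And>j f x. integrable (hmeasure \<kappa>) f \<Longrightarrow> x \<in> sphere 0 1 \<Longrightarrow>
     \<bar>h_proj \<kappa> j f x\<bar> \<le> K j * (\<integral>y. \<bar>f y\<bar> \<partial>hmeasure \<kappa>)"
    using h_proj_bound[OF \<kappa>] by metis
  let ?K = "\<bar>inverse (cesaro_coeff \<delta> n)\<bar> * (\<Sum>j\<le>n. \<bar>cesaro_coeff \<delta> (n - j)\<bar> * K j)"
  show ?thesis
  proof (intro exI[of _ ?K] conjI allI impI)
    show "0 \<le> ?K" by (intro mult_nonneg_nonneg sum_nonneg K abs_ge_zero)
    fix f :: "real ^ 'n \<Rightarrow> real" and x :: "real ^ 'n" assume f: "integrable (hmeasure \<kappa>) f" and x: "x \<in> sphere 0 1"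
    let ?I = "\<integral>y. \<bar>f y\<bar> \<partial>hmeasure \<kappa>"
    have "\<bar>cesaro_mean \<kappa> \<delta> n f x\<bar> = \<bar>inverse (cesaro_coeff \<delta> n)\<bar> * \<bar>\<Sum>j\<le>n. cesaro_coeff \<delta> (n - j) * h_proj \<kappa> j f x\<bar>"
      by (simp add: cesaro_mean_def abs_mult)
    also have "\<dots> \<le> \<bar>inverse (cesaro_coeff \<delta> n)\<bar> * (\<Sum>j\<le>n. \<bar>cesaro_coeff \<delta> (n - j)\<bar> * (K j * ?I))"
      by (intro mult_left_mono order_trans[OF sum_abs] sum_mono) (auto simp: abs_mult intro!: mult_left_mono K f x)
    also have "\<dots> = ?K * ?I" by (simp add: sum_distrib_right mult.assoc)
    finally show "\<bar>cesaro_mean \<kappa> \<delta> n f x\<bar> \<le> ?K * ?I" .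
  qed
qed

section \<open>The Gegenbauer-Poisson kernel\<close>

text \<open>
  The coefficients of \<open>(n + l) / l\<close> times the Gegenbauer polynomial of degree \<open>n\<close> and index \<open>l\<close>.
\<close>

definition zcoef :: "real \<Rightarrow> nat \<Rightarrow> nat \<Rightarrow> real" where
  "zcoef l n k = (l + n) / l * ((-1) ^ k * pochhammer l (n - k) * 2 ^ (n - 2 * k) / (fact (n - 2 * k) * fact k))"

definition zpoly :: "real \<Rightarrow> nat \<Rightarrow> real \<Rightarrow> real" where
  "zpoly l n t = (\<Sum>k\<le>n div 2. zcoef l n k * t ^ (n - 2 * k))"

text \<open>
  The Poisson kernel of Gegenbauer expansions. Its argument \<open>r\<close> is complex because the lower bound
  for the means is obtained away from the real axis.
\<close>

definition gpoisson :: "real \<Rightarrow> real \<Rightarrow> complex \<Rightarrow> complex" where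
  "gpoisson l t r = (1 - r\<^sup>2) * (1 - 2 * of_real t * r + r\<^sup>2) powr (- of_real (l + 1))"

lemma norm_powr_of_real: "z \<noteq> 0 \<Longrightarrow> norm (z powr of_real x) = norm z powr x" for z :: complex
  by (simp add: powr_def norm_exp_eq_Re[symmetric] exp_of_real[symmetric])

lemma kernel_base_factor:
  fixes r :: complex
  assumes "\<bar>t\<bar> \<le> 1"
  obtains a where "norm a = 1" "Re a = t" "1 - 2 * of_real t * r + r\<^sup>2 = (1 - r * a) * (1 - r * cnj a)"
proof -
  define a where "a = Complex t (sqrt (1 - t\<^sup>2))"
  have t: "t\<^sup>2 \<le> 1" using assms by (simp add: abs_square_le_1)
  have n: "norm a = 1" using t by (simp add: a_def cmod_def)
  have "a * cnj a = 1" using n by (simp add: complex_norm_square[symmetric])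
  moreover have "a + cnj a = 2 * of_real t" by (simp add: a_def complex_eq_iff)
  moreover have "(1 - r * a) * (1 - r * cnj a) = 1 - r * (a + cnj a) + r\<^sup>2 * (a * cnj a)"
    by (simp add: power2_eq_square algebra_simps)
  ultimately show ?thesis using n by (intro that[of a]) (auto simp: a_def)
qed

lemma kernel_base_norm:
  fixes r :: complex
  assumes "\<bar>t\<bar> \<le> 1" "norm r \<le> 1"
  shows "(1 - norm r)\<^sup>2 \<le> norm (1 - 2 * of_real t * r + r\<^sup>2)"
proof -
  obtain a where a: "norm a = 1" "1 - 2 * of_real t * r + r\<^sup>2 = (1 - r * a) * (1 - r * cnj a)"
    using kernel_base_factor[OF assms(1)] by metis
  have "1 - norm r \<le> norm (1 - r * a)" "1 - norm r \<le> norm (1 - r * cnj a)"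
    using norm_triangle_ineq2[of 1 "r * a"] norm_triangle_ineq2[of 1 "r * cnj a"] a
    by (simp_all add: norm_mult)
  then have "(1 - norm r) * (1 - norm r) \<le> norm (1 - r * a) * norm (1 - r * cnj a)"
    using assms by (intro mult_mono) auto
  then show ?thesis by (simp only: power2_eq_square[of "1 - norm r"] a(2) norm_mult)
qed

text \<open>
  The base is a product of two numbers in the open right half-plane, so its argument stays away from
  \<open>\<pi>\<close> and the principal power is holomorphic on the disc.
\<close>

lemma kernel_base_nonpos:
  fixes r :: complex
  assumes "\<bar>t\<bar> \<le> 1" "norm r < 1"
  shows "1 - 2 * of_real t * r + r\<^sup>2 \<notin> \<real>\<^sub>\<le>\<^sub>0"
proof
  assume "1 - 2 * of_real t * r + r\<^sup>2 \<in> \<real>\<^sub>\<le>\<^sub>0"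
  then have im: "2 * Im r * (Re r - t) = 0" and re: "1 - 2 * t * Re r + (Re r)\<^sup>2 - (Im r)\<^sup>2 \<le> 0"
    by (auto simp: complex_nonpos_Reals_iff power2_eq_square algebra_simps)
  have n: "(Re r)\<^sup>2 + (Im r)\<^sup>2 < 1"
    using assms(2) unfolding cmod_power2[symmetric] by (simp add: abs_square_less_1)
  from im consider "Im r = 0" | "Re r = t" by auto
  then show False
  proof cases
    case 1
    have "\<bar>t * Re r\<bar> \<le> 1 * \<bar>Re r\<bar>" unfolding abs_mult using assms(1) by (intro mult_right_mono) auto
    moreover have "0 < (1 - \<bar>Re r\<bar>)\<^sup>2"
      using n 1 by (simp add: abs_square_less_1) 
    ultimately show False using re 1 by (simp add: power2_eq_square algebra_simps abs_le_iff)
  next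
    case 2
    then show False using re n by (simp add: power2_eq_square)
  qed
qed

lemma gpoisson_holomorphic:
  assumes "\<bar>t\<bar> \<le> 1"
  shows "gpoisson l t holomorphic_on ball 0 1"
  unfolding gpoisson_def[abs_def]
  using kernel_base_nonpos[OF assms] by (intro holomorphic_intros) auto

lemma gpoisson_norm_le:
  assumes "\<bar>t\<bar> \<le> 1" "norm r < 1" "l > 0"
  shows "norm (gpoisson l t r) \<le> 2 * (1 - norm r) powr (- 2 * (l + 1))"
proof -
  let ?b = "1 - 2 * of_real t * r + r\<^sup>2"
  have nz: "?b \<noteq> 0" using kernel_base_nonpos[OF assms(1,2)] by auto
  have "norm (?b powr (- of_real (l + 1))) = norm ?b powr (- (l + 1))"
    using norm_powr_of_real[OF nz, of "- (l + 1)"] by simp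
  also have "\<dots> \<le> ((1 - norm r)\<^sup>2) powr (- (l + 1))"
    using kernel_base_norm[OF assms(1), of r] assms by (intro powr_mono2') auto
  also have "(1 - norm r)\<^sup>2 = (1 - norm r) powr 2" using assms by simp
  also have "((1 - norm r) powr 2) powr (- (l + 1)) = (1 - norm r) powr (- 2 * (l + 1))"
    by (simp add: powr_powr)
  finally have 1: "norm (?b powr (- of_real (l + 1))) \<le> (1 - norm r) powr (- 2 * (l + 1))" .
  have "norm (1 - r\<^sup>2) \<le> 1 + norm (r\<^sup>2)" using norm_triangle_ineq4[of 1 "r\<^sup>2"] by simp
  also have "\<dots> \<le> 2" using assms by (simp add: norm_power power_le_one)
  finally show ?thesis unfolding gpoisson_def norm_mult using 1 by (intro mult_mono) auto
qed

lemma fps_shifted_power_nth: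
  fixes c :: complex
  shows "fps_nth ((fps_X + fps_const c) ^ i) m = (if m \<le> i then of_nat (i choose m) * c ^ (i - m) else 0)"
proof -
  have "(fps_X + fps_const c) ^ i = (\<Sum>k\<le>i. of_nat (i choose k) * fps_X ^ k * fps_const c ^ (i - k))"
    by (rule binomial_ring)
  also have "\<dots> = (\<Sum>k\<le>i. fps_X ^ k * fps_const (of_nat (i choose k) * c ^ (i - k)))"
    by (intro sum.cong) (auto simp: fps_const_power fps_of_nat[symmetric] mult_ac)
  finally have "fps_nth ((fps_X + fps_const c) ^ i) m = (\<Sum>k\<le>i. fps_nth (fps_X ^ k * fps_const (of_nat (i choose k) * c ^ (i - k))) m)"
    by (simp add: fps_sum_nth)
  also have "\<dots> = (\<Sum>k\<le>i. if k = m then of_nat (i choose k) * c ^ (i - k) else 0)"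
    by (intro sum.cong) (auto simp: fps_X_power_mult_nth)
  finally show ?thesis by simp
qed

text \<open>
  Gegenbauer polynomials; the index \<open>m\<close> is a real parameter and \<open>n\<close> is the degree.
\<close>

definition gegen :: "real \<Rightarrow> nat \<Rightarrow> real \<Rightarrow> real" where
  "gegen m n t = (\<Sum>k\<le>n div 2. (-1) ^ k * pochhammer m (n - k) * (2 * t) ^ (n - 2 * k) / (fact k * fact (n - 2 * k)))"

text \<open>
  The binomial series composed with \<open>r * (r - 2 * t)\<close> is the power \<open>(1 - 2 * t * r + r\<^sup>2) powr (- m)\<close>.
\<close>

lemma gegen_fps_nth:
  fixes m t :: real
  shows "fps_nth (fps_binomial (- of_real m :: complex) oo (fps_X * (fps_X + fps_const (- 2 * of_real t)))) n = of_real (gegen m n t)"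
proof -
  let ?c = "- of_real m :: complex"
  have "fps_nth (fps_binomial ?c oo (fps_X * (fps_X + fps_const (- 2 * of_real t)))) n
     = (\<Sum>i=0..n. (?c gchoose i) * fps_nth (fps_X ^ i * (fps_X + fps_const (- 2 * of_real t)) ^ i) n)"
    by (simp add: fps_compose_nth power_mult_distrib)
  also have "\<dots> = (\<Sum>i=0..n. if n - i \<le> i then (?c gchoose i) * (of_nat (i choose (n - i)) * (- 2 * of_real t) ^ (i - (n - i))) else 0)"
    by (intro sum.cong) (auto simp: fps_X_power_mult_nth fps_shifted_power_nth)
  also have "\<dots> = (\<Sum>k\<le>n. if k \<le> n - k then (?c gchoose (n - k)) * (of_nat ((n - k) choose k) * (- 2 * of_real t) ^ (n - k - k)) else 0)"
    by (rule sum.reindex_bij_witness[of _ "\<lambda>k. n - k" "\<lambda>k. n - k"]) auto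
  also have "\<dots> = (\<Sum>k\<le>n div 2. (?c gchoose (n - k)) * (of_nat ((n - k) choose k) * (- 2 * of_real t) ^ (n - k - k)))"
    by (rule sum.mono_neutral_cong_right) auto
  also have "\<dots> = (\<Sum>k\<le>n div 2. of_real ((-1) ^ k * pochhammer m (n - k) * (2 * t) ^ (n - 2 * k) / (fact k * fact (n - 2 * k))))"
  proof (rule sum.cong)
    fix k assume k: "k \<in> {..n div 2}"
    then have kn: "2 * k \<le> n" by auto
    have "?c gchoose (n - k) = of_real ((-1) ^ (n - k) * pochhammer m (n - k) / fact (n - k))"
      by (simp add: gbinomial_pochhammer pochhammer_of_real)
    moreover have "(of_nat ((n - k) choose k) :: complex) = of_real (fact (n - k) / (fact k * fact (n - 2 * k)))"
      using kn binomial_fact[of k "n - k", where ?'a = real]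
      by (metis (no_types, lifting) add_leE diff_diff_left mult_2 of_real_of_nat_eq le_diff_conv2)
    moreover have "(- 2 * of_real t :: complex) ^ (n - k - k) = of_real ((-1) ^ (n - 2 * k) * (2 * t) ^ (n - 2 * k))"
    proof -
      have e: "n - k - k = n - 2 * k" by simp
      have "(- 2 * of_real t :: complex) ^ (n - k - k) = of_real ((-1 * (2 * t)) ^ (n - 2 * k))"
        unfolding e by simp
      then show ?thesis by (simp only: power_mult_distrib[of "-1" "2 * t"])
    qed
    moreover have "(-1 :: real) ^ (n - k) * (-1) ^ (n - 2 * k) = (-1) ^ k"
    proof -
      have "(-1 :: real) ^ (n - k) * (-1) ^ (n - 2 * k) = (-1) ^ (2 * (n - 2 * k) + k)"
        using le_Suc_ex[OF kn] by (auto simp: power_add[symmetric] intro!: arg_cong2[where f=power])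
      then show ?thesis by (simp add: power_add)
    qed
    moreover define X where "X = (2 * t) ^ (n - 2 * k)"
    moreover have "((-1) ^ (n - k) * pochhammer m (n - k) / fact (n - k)) *
        ((fact (n - k) / (fact k * fact (n - 2 * k))) * ((-1) ^ (n - 2 * k) * X)) =
        ((-1) ^ (n - k) * (-1) ^ (n - 2 * k)) * (pochhammer m (n - k) * X / (fact k * fact (n - 2 * k)))"
      by simp
    ultimately show "(?c gchoose (n - k)) * (of_nat ((n - k) choose k) * (- 2 * of_real t) ^ (n - k - k)) =
      of_real ((-1) ^ k * pochhammer m (n - k) * (2 * t) ^ (n - 2 * k) / (fact k * fact (n - 2 * k)))"
      by (simp only: of_real_mult[symmetric]) simp
  qed simp
  finally show ?thesis by (simp add: gegen_def)
qed

text \<open>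
  The contiguity relation of Gegenbauer polynomials, which on the level of generating functions is the
  multiplication by \<open>1 - r\<^sup>2\<close>.
\<close>

lemma zpoly_gegen:
  assumes "l > 0"
  shows "zpoly l n t = gegen (l + 1) n t - (if n < 2 then 0 else gegen (l + 1) (n - 2) t)"
proof -
  let ?g = "\<lambda>n k. (-1) ^ k * pochhammer (l + 1) (n - k) * (2 * t) ^ (n - 2 * k) / (fact k * fact (n - 2 * k))"
  have P: "(l + n) / l * pochhammer l (n - k) = pochhammer (l + 1) (n - k) + real k * pochhammer (l + 1) (n - k - 1)" if "2 * k \<le> n" for n k
  proof (cases "n - k")
    case 0
    with that have "n = 0" "k = 0" by auto
    then show ?thesis using assms by simp
  next
    case (Suc j)
    have nk: "real n = real (Suc j) + real k" using Suc by linarith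
    have "pochhammer l (Suc j) = l * pochhammer (l + 1) j" by (rule pochhammer_rec)
    moreover have "pochhammer (l + 1) (Suc j) = pochhammer (l + 1) j * (l + 1 + j)" by (simp add: pochhammer_Suc)
    moreover have "(l + n) / l * (l * pochhammer (l + 1) j) = (l + n) * pochhammer (l + 1) j"
      using assms by simp
    ultimately show ?thesis using Suc by (simp add: nk algebra_simps)
  qed
  show ?thesis
  proof (cases "n < 2")
    case True
    then have "n = 0 \<or> n = 1" by auto
    then show ?thesis using assms by (auto simp: zpoly_def gegen_def zcoef_def pochhammer_Suc field_simps)
  next
    case False
    define m where "m = n - 2"
    have n: "n = m + 2" using False by (simp add: m_def)
    have d: "n div 2 = Suc (m div 2)" by (simp add: n)
    have "zpoly l n t = (\<Sum>k\<le>n div 2. ?g n k + (if k = 0 then 0 else - ?g m (k - 1)))"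
      unfolding zpoly_def
    proof (rule sum.cong)
      fix k assume "k \<in> {..n div 2}"
      then have kn: "2 * k \<le> n" by auto
      have "zcoef l n k * t ^ (n - 2 * k) = (-1) ^ k * ((l + n) / l * pochhammer l (n - k)) * (2 * t) ^ (n - 2 * k) / (fact k * fact (n - 2 * k))"
        by (simp add: zcoef_def power_mult_distrib mult_ac)
      also have "\<dots> = ?g n k + (-1) ^ k * real k * pochhammer (l + 1) (n - k - 1) * (2 * t) ^ (n - 2 * k) / (fact k * fact (n - 2 * k))"
        unfolding P[OF kn] by (simp add: algebra_simps add_divide_distrib)
      also have "(-1) ^ k * real k * pochhammer (l + 1) (n - k - 1) * (2 * t) ^ (n - 2 * k) / (fact k * fact (n - 2 * k)) = (if k = 0 then 0 else - ?g m (k - 1))"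
      proof (cases k)
        case (Suc j)
        have e: "n - k - 1 = m - j" "n - 2 * k = m - 2 * j" using Suc by (auto simp: n)
        have "real (Suc j) / fact (Suc j) = 1 / fact j"
          by (simp add: fact_Suc del: of_nat_Suc)
        moreover have "(-1) ^ Suc j * real (Suc j) * pochhammer (l + 1) (m - j) * (2 * t) ^ (m - 2 * j) / (fact (m - 2 * j) * fact (Suc j))
          = ((-1) ^ Suc j * pochhammer (l + 1) (m - j) * (2 * t) ^ (m - 2 * j) / fact (m - 2 * j)) * (real (Suc j) / fact (Suc j))"
          by (simp only: times_divide_times_eq) (simp only: mult_ac)
        ultimately show ?thesis unfolding e unfolding Suc by simp
      qed simp
      finally show "zcoef l n k * t ^ (n - 2 * k) = ?g n k + (if k = 0 then 0 else - ?g m (k - 1))" .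
    qed simp
    also have "\<dots> = gegen (l + 1) n t + (\<Sum>k\<le>Suc (m div 2). if k = 0 then 0 else - ?g m (k - 1))"
      by (simp add: sum.distrib gegen_def d)
    also have "(\<Sum>k\<le>Suc (m div 2). if k = 0 then 0 else - ?g m (k - 1)) = - gegen (l + 1) m t"
      by (subst sum.atMost_Suc_shift) (simp add: gegen_def sum_negf)
    finally show ?thesis using False by (simp add: m_def)
  qed
qed

lemma gpoisson_fps:
  assumes l: "l > 0"
  shows "gpoisson l t has_fps_expansion Abs_fps (\<lambda>n. of_real (zpoly l n t))"
proof -
  let ?c = "- of_real (l + 1) :: complex"
  let ?G = "fps_X * (fps_X + fps_const (- 2 * of_real t)) :: complex fps"
  let ?F = "fps_binomial ?c oo ?G"
  have G: "(\<lambda>r. r * (r + (- 2 * of_real t))) has_fps_expansion ?G"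
    by (intro fps_expansion_intros)
  have "((\<lambda>x. (1 + x) powr ?c) \<circ> (\<lambda>r. r * (r + (- 2 * of_real t)))) has_fps_expansion ?F"
    by (rule has_fps_expansion_compose[OF has_fps_expansion_binomial_complex G]) (simp add: fps_mult_nth)
  moreover have "(\<lambda>r. 1 - r ^ 2 :: complex) has_fps_expansion (1 - fps_X ^ 2)"
    by (intro fps_expansion_intros)
  ultimately have "(\<lambda>r. (1 - r ^ 2) * ((\<lambda>x. (1 + x) powr ?c) \<circ> (\<lambda>r. r * (r + (- 2 * of_real t)))) r) has_fps_expansion (1 - fps_X ^ 2) * ?F"
    by (intro has_fps_expansion_mult)
  moreover have "(\<lambda>r. (1 - r ^ 2) * ((\<lambda>x. (1 + x) powr ?c) \<circ> (\<lambda>r. r * (r + (- 2 * of_real t)))) r) = gpoisson l t"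
    by (auto simp: gpoisson_def fun_eq_iff power2_eq_square algebra_simps)
  moreover have "(1 - fps_X ^ 2) * ?F = Abs_fps (\<lambda>n. of_real (zpoly l n t))"
  proof (rule fps_ext)
    fix n
    have "fps_nth ((1 - fps_X ^ 2) * ?F) n = fps_nth ?F n - fps_nth (fps_X ^ 2 * ?F) n"
      by (simp add: left_diff_distrib)
    also have "\<dots> = of_real (zpoly l n t)"
      unfolding zpoly_gegen[OF l] fps_X_power_mult_nth gegen_fps_nth[of "l + 1" t] by simp
    finally show "fps_nth ((1 - fps_X ^ 2) * ?F) n = fps_nth (Abs_fps (\<lambda>n. of_real (zpoly l n t))) n" by simp
  qed
  ultimately show ?thesis by simp
qed

lemma zpoly_generating_function:
  assumes l: "l > 0" and t: "\<bar>t\<bar> \<le> 1" and r: "norm r < 1"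
  shows "(\<lambda>n. of_real (zpoly l n t) * r ^ n) sums gpoisson l t r"
proof -
  have "(\<lambda>n. (deriv ^^ n) (gpoisson l t) 0 / fact n * (r - 0) ^ n) sums gpoisson l t r"
    using r by (intro holomorphic_power_series[OF gpoisson_holomorphic[OF t]]) auto
  then show ?thesis using fps_nth_fps_expansion[OF gpoisson_fps[OF l, of t]] by simp
qed

text \<open>
  Cauchy's inequality on the circle of radius \<open>\<rho>\<close>. Taking \<open>\<rho>\<close> close to one makes the series converge at
  every radius below one, uniformly in \<open>t\<close>.
\<close>

lemma zpoly_bound:
  assumes l: "l > 0" and t: "\<bar>t\<bar> \<le> 1" and \<rho>: "0 < \<rho>" "\<rho> < 1"
  shows "\<bar>zpoly l n t\<bar> \<le> 2 * (1 - \<rho>) powr (- 2 * (l + 1)) / \<rho> ^ n"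
proof -
  have sub: "cball 0 \<rho> \<subseteq> ball (0 :: complex) 1" "ball 0 \<rho> \<subseteq> ball (0 :: complex) 1" using \<rho> by auto
  have "norm ((deriv ^^ n) (gpoisson l t) 0) \<le> fact n * (2 * (1 - \<rho>) powr (- 2 * (l + 1))) / \<rho> ^ n"
  proof (rule Cauchy_inequality)
    show "gpoisson l t holomorphic_on ball 0 \<rho>"
      by (rule holomorphic_on_subset[OF gpoisson_holomorphic[OF t] sub(2)])
    show "continuous_on (cball 0 \<rho>) (gpoisson l t)"
      by (rule holomorphic_on_imp_continuous_on[OF holomorphic_on_subset[OF gpoisson_holomorphic[OF t] sub(1)]])
    show "norm (gpoisson l t x) \<le> 2 * (1 - \<rho>) powr (- 2 * (l + 1))" if "norm (0 - x) = \<rho>" for x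
      using gpoisson_norm_le[OF t _ l, of x] that \<rho> by simp
  qed (use \<rho> in auto)
  moreover have "(deriv ^^ n) (gpoisson l t) 0 = of_real (zpoly l n t) * fact n"
    using fps_nth_fps_expansion[OF gpoisson_fps[OF l, of t], of n] by simp
  ultimately have "fact n * \<bar>zpoly l n t\<bar> \<le> fact n * (2 * (1 - \<rho>) powr (- 2 * (l + 1)) / \<rho> ^ n)"
    by (simp add: norm_mult mult.commute[of _ "fact n"])
  then show ?thesis by (rule mult_left_le_imp_le) simp
qed


section \<open>The measure in the Poisson kernel\<close>

lemma nn_integral_powr_from_0:
  assumes "a > (-1 :: real)" "c \<ge> 0"
  shows "(\<integral>\<^sup>+x. ennreal (indicator {0..c} x * x powr a) \<partial>lborel) = ennreal (c powr (a + 1) / (a + 1))"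
proof (rule nn_integral_has_integral_lborel)
  have "((\<lambda>x. if x \<in> {0..c} then x powr a else 0) has_integral (c powr (a + 1) / (a + 1))) UNIV"
    unfolding has_integral_restrict_UNIV by (rule has_integral_powr_from_0[OF assms])
  then show "((\<lambda>x. indicator {0..c} x * x powr a) has_integral (c powr (a + 1) / (a + 1))) UNIV"
    by (rule has_integral_eq[rotated]) (auto simp: indicator_def)
qed auto

lemma nn_integral_powr_to_inf:
  assumes "e < (-1 :: real)" "a > 0"
  shows "(\<integral>\<^sup>+x. ennreal (indicator {a..} x * x powr e) \<partial>lborel) = ennreal (- (a powr (e + 1)) / (e + 1))"
proof (rule nn_integral_has_integral_lborel)
  have "((\<lambda>x. if x \<in> {a..} then x powr e else 0) has_integral (- (a powr (e + 1)) / (e + 1))) UNIV"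
    unfolding has_integral_restrict_UNIV by (rule has_integral_powr_to_inf[OF assms])
  then show "((\<lambda>x. indicator {a..} x * x powr e) has_integral (- (a powr (e + 1)) / (e + 1))) UNIV"
    by (rule has_integral_eq[rotated]) (auto simp: indicator_def)
qed auto

lemma nn_integral_reflect_unit:
  assumes [measurable]: "f \<in> borel_measurable (borel :: real measure)"
  shows "(\<integral>\<^sup>+u. f (1 - u) \<partial>lborel) = (\<integral>\<^sup>+x. f x \<partial>lborel)"
  using nn_integral_real_affine[of f "-1" 1] by simp

lemma nn_integral_even_unit:
  fixes f :: "real \<Rightarrow> real"
  assumes [measurable]: "f \<in> borel_measurable borel"
  shows "(\<integral>\<^sup>+u. ennreal (indicator {-1..1} u * f (1 - \<bar>u\<bar>)) \<partial>lborel) \<le> 2 * (\<integral>\<^sup>+x. ennreal (indicator {0..1} x * f x) \<partial>lborel)"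
proof -
  let ?g = "\<lambda>x. ennreal (indicator {0..1} x * f x)"
  have "(\<integral>\<^sup>+u. ennreal (indicator {-1..1} u * f (1 - \<bar>u\<bar>)) \<partial>lborel) \<le> (\<integral>\<^sup>+u. ?g (1 - u) + ?g (1 - (- u)) \<partial>lborel)"
    by (intro nn_integral_mono) (auto simp: indicator_def abs_if)
  also have "\<dots> = (\<integral>\<^sup>+u. ?g (1 - u) \<partial>lborel) + (\<integral>\<^sup>+u. ?g (1 - (- u)) \<partial>lborel)"
    by (intro nn_integral_add) auto
  also have "(\<integral>\<^sup>+u. ?g (1 - (- u)) \<partial>lborel) = (\<integral>\<^sup>+u. ?g (1 - u) \<partial>lborel)"
    using nn_integral_real_affine[of "\<lambda>u. ?g (1 - u)" "-1" 0] by simp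
  also have "(\<integral>\<^sup>+u. ?g (1 - u) \<partial>lborel) = (\<integral>\<^sup>+x. ?g x \<partial>lborel)"
    by (rule nn_integral_reflect_unit) measurable
  finally show ?thesis by (simp add: mult_2)
qed

text \<open>
  The distribution of the parameter that averages Gegenbauer kernels of index \<open>l = s + k\<close> into the
  kernel for the weight \<open>\<bar>x $ i\<bar> powr (2 * k)\<close>. The moment recursion makes the averaged polynomials
  h-harmonic; the mass near \<open>1\<close> enters the lower bound for the kernel, and the last clause the upper
  bound. For \<open>k > 0\<close> the measure has density proportional to \<open>(1 - u\<^sup>2) powr (k - 1)\<close> on \<open>[-1, 1]\<close>;
  for \<open>k = 0\<close> this degenerates to the point mass at \<open>1\<close>.
\<close>

definition zonal_measure :: "real \<Rightarrow> real \<Rightarrow> real measure \<Rightarrow> bool" where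
  "zonal_measure k s \<nu> \<longleftrightarrow> sets \<nu> = sets borel \<and> emeasure \<nu> UNIV = 1 \<and> (AE u in \<nu>. \<bar>u\<bar> \<le> 1) \<and>
     (\<forall>a. (real (a + 2) + (if odd a then 2 * k else 0)) * (real (a + 1) + (if even a then 2 * k else 0)) * (\<integral>u. u ^ (a + 2) \<partial>\<nu>)
        = real (a + 2) * real (a + 1) * (\<integral>u. u ^ a \<partial>\<nu>)) \<and>
     (\<exists>c>0. \<forall>v\<in>{0<..1}. c * v powr k \<le> measure \<nu> {1 - v..1}) \<and>
     (\<exists>C>0. \<forall>e\<in>{0<..1}. (\<integral>\<^sup>+u. ennreal ((e\<^sup>2 + (1 - \<bar>u\<bar>)) powr (- (s + k + 1))) \<partial>\<nu>) \<le> ennreal (C * e powr (- 2 * s - 2)))"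

lemma zonal_measure_zero:
  assumes s: "s > 0"
  shows "\<exists>\<nu>. zonal_measure 0 s \<nu>"
proof -
  let ?\<nu> = "distr (count_space (UNIV :: unit set)) borel (\<lambda>_. 1 :: real)"
  have I: "(\<integral>u. f u \<partial>?\<nu>) = f 1" if "f \<in> borel_measurable borel" for f :: "real \<Rightarrow> real"
    using that by (subst integral_distr) (auto simp: lebesgue_integral_count_space_finite)
  have N: "(\<integral>\<^sup>+u. f u \<partial>?\<nu>) = f 1" if "f \<in> borel_measurable borel" for f :: "real \<Rightarrow> ennreal"
    using that by (subst nn_integral_distr) (auto simp: nn_integral_count_space_finite)
  have E: "emeasure ?\<nu> A = 1" if "A \<in> sets borel" "1 \<in> A" for A
    using that by (subst emeasure_distr) auto
  have "(e\<^sup>2) powr (- s - 1) = e powr (- 2 * s - 2)" if "e > 0" for e :: real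
  proof -
    have "(e\<^sup>2) powr (- s - 1) = (e powr 2) powr (- s - 1)" using that by simp
    then show ?thesis by (simp add: powr_powr algebra_simps)
  qed
  then have "zonal_measure 0 s ?\<nu>"
    unfolding zonal_measure_def
  proof (intro conjI)
    show "AE u in ?\<nu>. \<bar>u\<bar> \<le> 1" by (subst AE_distr_iff) auto
    show "\<exists>c>0. \<forall>v\<in>{0<..1}. c * v powr 0 \<le> measure ?\<nu> {1 - v..1}"
      by (intro exI[of _ 1]) (auto simp: measure_def E)
    show "\<exists>C>0. \<forall>e\<in>{0<..1}. (\<integral>\<^sup>+u. ennreal ((e\<^sup>2 + (1 - \<bar>u\<bar>)) powr (- (s + 0 + 1))) \<partial>?\<nu>) \<le> ennreal (C * e powr (- 2 * s - 2))"
    proof (intro exI[of _ 1] conjI ballI)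
      fix e :: real assume e: "e \<in> {0<..1}"
      have "(\<integral>\<^sup>+u. ennreal ((e\<^sup>2 + (1 - \<bar>u\<bar>)) powr (- (s + 0 + 1))) \<partial>?\<nu>) = ennreal ((e\<^sup>2) powr (- s - 1))"
      proof -
        have "- (s + 0 + 1) = - s - 1" by simp
        then show ?thesis by (simp only:) (subst N, auto)
      qed
      also have "(e\<^sup>2) powr (- s - 1) = e powr (- 2 * s - 2)"
      proof -
        have "(e\<^sup>2) powr (- s - 1) = (e powr 2) powr (- s - 1)" using e by simp
        then show ?thesis by (simp add: powr_powr algebra_simps)
      qed
      finally show "(\<integral>\<^sup>+u. ennreal ((e\<^sup>2 + (1 - \<bar>u\<bar>)) powr (- (s + 0 + 1))) \<partial>?\<nu>) \<le> ennreal (1 * e powr (- 2 * s - 2))"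
        by simp
    qed simp
  qed (auto simp: I E)
  then show ?thesis by blast
qed

lemma jacobi_weight_compare:
  assumes "\<bar>u\<bar> \<le> (1 :: real)"
  shows "min 1 (2 powr (k - 1)) * (1 - \<bar>u\<bar>) powr (k - 1) \<le> (1 - u\<^sup>2) powr (k - 1)"
    and "(1 - u\<^sup>2) powr (k - 1) \<le> max 1 (2 powr (k - 1)) * (1 - \<bar>u\<bar>) powr (k - 1)"
proof -
  have "1 - u\<^sup>2 = (1 + \<bar>u\<bar>) * (1 - \<bar>u\<bar>)" by (simp add: power2_eq_square algebra_simps abs_if)
  then have e: "(1 - u\<^sup>2) powr (k - 1) = (1 + \<bar>u\<bar>) powr (k - 1) * (1 - \<bar>u\<bar>) powr (k - 1)"
    using assms by (simp add: powr_mult)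
  have "min 1 (2 powr (k - 1)) \<le> (1 + \<bar>u\<bar>) powr (k - 1) \<and> (1 + \<bar>u\<bar>) powr (k - 1) \<le> max 1 (2 powr (k - 1))"
  proof (cases "k \<ge> 1")
    case True
    have "1 \<le> (1 + \<bar>u\<bar>) powr (k - 1)" using True by (intro ge_one_powr_ge_zero) auto
    moreover have "(1 + \<bar>u\<bar>) powr (k - 1) \<le> 2 powr (k - 1)" using True assms by (intro powr_mono2) auto
    ultimately show ?thesis by auto
  next
    case False
    have "(1 + \<bar>u\<bar>) powr (k - 1) \<le> 1 powr (k - 1)" using False by (intro powr_mono2') auto
    moreover have "2 powr (k - 1) \<le> (1 + \<bar>u\<bar>) powr (k - 1)" using False assms by (intro powr_mono2') auto
    ultimately show ?thesis by auto
  qed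
  then show "min 1 (2 powr (k - 1)) * (1 - \<bar>u\<bar>) powr (k - 1) \<le> (1 - u\<^sup>2) powr (k - 1)"
    "(1 - u\<^sup>2) powr (k - 1) \<le> max 1 (2 powr (k - 1)) * (1 - \<bar>u\<bar>) powr (k - 1)"
    unfolding e by (auto intro: mult_right_mono)
qed

lemma zonal_measure_pos:
  assumes k: "k > 0" and s: "s > 0"
  shows "\<exists>\<nu>. zonal_measure k s \<nu>"
proof -
  define W where "W u = indicator {-1..1} u * (1 - u\<^sup>2) powr (k - 1)" for u :: real
  define m where "m = min 1 (2 powr (k - 1))"
  define M where "M = max 1 (2 powr (k - 1))"
  have mM: "m > 0" "M > 0" by (auto simp: m_def M_def)
  have W0: "W u \<ge> 0" for u by (simp add: W_def)
  have Wm[measurable]: "W \<in> borel_measurable borel" unfolding W_def by measurable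
  have Wz: "W u = 0" if "\<bar>u\<bar> > 1" for u using that by (auto simp: W_def indicator_def)
  have Wu: "W u \<le> M * (indicator {-1..1} u * (1 - \<bar>u\<bar>) powr (k - 1))" for u
    using jacobi_weight_compare(2)[of u k] by (auto simp: W_def M_def indicator_def)
  have Wl: "m * (indicator {-1..1} u * (1 - \<bar>u\<bar>) powr (k - 1)) \<le> W u" for u
    using jacobi_weight_compare(1)[of u k] by (auto simp: W_def m_def indicator_def)
  have up: "(\<integral>\<^sup>+u. ennreal (f (1 - \<bar>u\<bar>) * W u) \<partial>lborel) \<le> ennreal M * (2 * (\<integral>\<^sup>+x. ennreal (indicator {0..1} x * (f x * x powr (k - 1))) \<partial>lborel))"
    if [measurable]: "f \<in> borel_measurable borel" and f0: "\<And>x. f x \<ge> 0" for f :: "real \<Rightarrow> real"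
  proof -
    have "(\<integral>\<^sup>+u. ennreal (f (1 - \<bar>u\<bar>) * W u) \<partial>lborel) \<le> (\<integral>\<^sup>+u. ennreal M * ennreal (indicator {-1..1} u * (f (1 - \<bar>u\<bar>) * (1 - \<bar>u\<bar>) powr (k - 1))) \<partial>lborel)"
    proof (rule nn_integral_mono)
      fix u
      have "f (1 - \<bar>u\<bar>) * W u \<le> f (1 - \<bar>u\<bar>) * (M * (indicator {-1..1} u * (1 - \<bar>u\<bar>) powr (k - 1)))"
        by (intro mult_left_mono Wu f0)
      then show "ennreal (f (1 - \<bar>u\<bar>) * W u) \<le> ennreal M * ennreal (indicator {-1..1} u * (f (1 - \<bar>u\<bar>) * (1 - \<bar>u\<bar>) powr (k - 1)))"
        using mM f0 by (subst ennreal_mult'[symmetric]) (auto intro!: ennreal_leI simp: mult_ac)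
    qed
    also have "\<dots> = ennreal M * (\<integral>\<^sup>+u. ennreal (indicator {-1..1} u * (f (1 - \<bar>u\<bar>) * (1 - \<bar>u\<bar>) powr (k - 1))) \<partial>lborel)"
      by (rule nn_integral_cmult) measurable
    also have "\<dots> \<le> ennreal M * (2 * (\<integral>\<^sup>+x. ennreal (indicator {0..1} x * (f x * x powr (k - 1))) \<partial>lborel))"
      by (intro mult_left_mono nn_integral_even_unit[of "\<lambda>x. f x * x powr (k - 1)"]) auto
    finally show ?thesis .
  qed
  have fin: "(\<integral>\<^sup>+u. ennreal (W u) \<partial>lborel) < \<infinity>"
  proof -
    have "(\<integral>\<^sup>+u. ennreal (W u) \<partial>lborel) \<le> ennreal M * (2 * (\<integral>\<^sup>+x. ennreal (indicator {0..1} x * x powr (k - 1)) \<partial>lborel))"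
      using up[of "\<lambda>_. 1"] by simp
    also have "\<dots> < \<infinity>"
      using k by (subst nn_integral_powr_from_0) (auto simp: ennreal_mult_less_top)
    finally show ?thesis .
  qed
  have iW: "integrable lborel W"
    using fin W0 by (intro integrableI_bounded) (auto simp: abs_of_nonneg)
  have low: "ennreal (m * (v powr k / k)) \<le> (\<integral>\<^sup>+u. ennreal (indicator {1 - v..1} u * W u) \<partial>lborel)" if v: "v \<in> {0<..1}" for v
  proof -
    have "ennreal (m * (v powr k / k)) = ennreal m * (\<integral>\<^sup>+x. ennreal (indicator {0..v} x * x powr (k - 1)) \<partial>lborel)"
      using v k mM by (subst nn_integral_powr_from_0) (auto simp: ennreal_mult'[symmetric])
    also have "\<dots> = (\<integral>\<^sup>+x. ennreal m * ennreal (indicator {0..v} x * x powr (k - 1)) \<partial>lborel)"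
      by (rule nn_integral_cmult[symmetric]) measurable
    also have "\<dots> = (\<integral>\<^sup>+u. ennreal m * ennreal (indicator {0..v} (1 - u) * (1 - u) powr (k - 1)) \<partial>lborel)"
      by (rule nn_integral_reflect_unit[symmetric]) measurable
    also have "\<dots> \<le> (\<integral>\<^sup>+u. ennreal (indicator {1 - v..1} u * W u) \<partial>lborel)"
    proof (rule nn_integral_mono)
      fix u :: real
      have "m * (indicator {0..v} (1 - u) * (1 - u) powr (k - 1)) \<le> indicator {1 - v..1} u * W u"
        using Wl[of u] v by (auto simp: indicator_def abs_if split: if_splits)
      then show "ennreal m * ennreal (indicator {0..v} (1 - u) * (1 - u) powr (k - 1)) \<le> ennreal (indicator {1 - v..1} u * W u)"
        using mM by (subst ennreal_mult'[symmetric]) (auto intro!: ennreal_leI)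
    qed
    finally show ?thesis .
  qed
  define Z where "Z = (\<integral>u. W u \<partial>lborel)"
  have nnZ: "(\<integral>\<^sup>+u. ennreal (W u) \<partial>lborel) = ennreal Z"
    unfolding Z_def by (rule nn_integral_eq_integral[OF iW]) (simp add: W0)
  have Z: "Z > 0"
  proof -
    have "ennreal (m * (1 powr k / k)) \<le> (\<integral>\<^sup>+u. ennreal (indicator {1 - 1..1} u * W u) \<partial>lborel)" by (rule low) simp
    also have "\<dots> \<le> (\<integral>\<^sup>+u. ennreal (W u) \<partial>lborel)"
      by (intro nn_integral_mono ennreal_leI) (auto simp: indicator_def W0)
    finally have "ennreal (m * (1 powr k / k)) \<le> ennreal Z" unfolding nnZ .
    moreover have "m * (1 powr k / k) > 0" using mM k by simp
    ultimately show ?thesis by (metis ennreal_le_iff2 not_le order.trans less_le_trans)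
  qed
  define \<nu> where "\<nu> = density lborel (\<lambda>u. ennreal (W u / Z))"
  have sets: "sets \<nu> = sets borel" by (simp add: \<nu>_def)
  have WZ: "0 \<le> W u / Z" for u using W0 Z by simp
  have nn: "(\<integral>\<^sup>+u. ennreal (f u) \<partial>\<nu>) = ennreal (1 / Z) * (\<integral>\<^sup>+u. ennreal (f u * W u) \<partial>lborel)"
    if [measurable]: "f \<in> borel_measurable borel" and f0: "\<And>x. f x \<ge> 0" for f
  proof -
    have "(\<integral>\<^sup>+u. ennreal (f u) \<partial>\<nu>) = (\<integral>\<^sup>+u. ennreal (W u / Z) * ennreal (f u) \<partial>lborel)"
      unfolding \<nu>_def by (rule nn_integral_density) measurable
    also have "\<dots> = (\<integral>\<^sup>+u. ennreal (1 / Z) * ennreal (f u * W u) \<partial>lborel)"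
      using f0 W0 Z WZ by (intro nn_integral_cong) (simp add: ennreal_mult'[symmetric] mult.commute)
    also have "\<dots> = ennreal (1 / Z) * (\<integral>\<^sup>+u. ennreal (f u * W u) \<partial>lborel)"
      by (rule nn_integral_cmult) measurable
    finally show ?thesis .
  qed
  have one: "emeasure \<nu> UNIV = 1"
  proof -
    have "emeasure \<nu> UNIV = (\<integral>\<^sup>+u. ennreal 1 \<partial>\<nu>)" using sets_eq_imp_space_eq[OF sets] by simp
    also have "\<dots> = ennreal (1 / Z) * (\<integral>\<^sup>+u. ennreal (W u) \<partial>lborel)" by (subst nn) auto
    also have "\<dots> = 1" unfolding nnZ using Z by (simp add: ennreal_mult'[symmetric])
    finally show ?thesis .
  qed
  have AE1: "AE u in \<nu>. \<bar>u\<bar> \<le> 1"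
    unfolding \<nu>_def
  proof (subst AE_density)
    show "AE x in lborel. 0 < ennreal (W x / Z) \<longrightarrow> \<bar>x\<bar> \<le> 1"
    proof (rule AE_I2, rule impI, rule ccontr)
      fix x assume "0 < ennreal (W x / Z)" "\<not> \<bar>x\<bar> \<le> 1"
      then show False using Wz[of x] by simp
    qed
  qed measurable
  have bo: "(\<integral>u. u ^ a \<partial>\<nu>) = (\<integral>u. u ^ a * W u \<partial>lborel) / Z" for a
  proof -
    have "(\<integral>u. u ^ a \<partial>\<nu>) = (\<integral>u. (W u / Z) *\<^sub>R u ^ a \<partial>lborel)"
      unfolding \<nu>_def by (rule integral_density) (auto simp: WZ)
    also have "\<dots> = (\<integral>u. (1 / Z) * (u ^ a * W u) \<partial>lborel)" by (simp add: mult_ac)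
    finally show ?thesis by simp
  qed
  have ipw: "integrable lborel (\<lambda>u. u ^ a * W u)" for a
  proof (rule Bochner_Integration.integrable_bound[OF iW])
    show "AE u in lborel. norm (u ^ a * W u) \<le> norm (W u)"
    proof (rule AE_I2)
      fix u
      show "norm (u ^ a * W u) \<le> norm (W u)"
      proof (cases "\<bar>u\<bar> \<le> 1")
        case True
        then have "\<bar>u ^ a\<bar> * \<bar>W u\<bar> \<le> 1 * \<bar>W u\<bar>"
          by (intro mult_right_mono) (auto simp: power_abs power_le_one)
        then show ?thesis by (simp add: abs_mult)
      qed (simp add: Wz)
    qed
  qed measurable
  define J where "J a = (\<integral>u. u ^ a * W u \<partial>lborel)" for a :: nat
  have odd0: "J a = 0" if "odd a" for a
  proof -
    have "J a = (\<integral>u. (- u) ^ a * W (- u) \<partial>lborel)"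
      unfolding J_def using lborel_integral_real_affine[of "-1" "\<lambda>u. u ^ a * W u" 0] by simp
    also have "(\<lambda>u. (- u) ^ a * W (- u)) = (\<lambda>u. - (u ^ a * W u))"
      using that by (auto simp: W_def indicator_def fun_eq_iff)
    also have "(\<integral>u. - (u ^ a * W u) \<partial>lborel) = - J a" by (simp add: J_def)
    finally show ?thesis by simp
  qed
  \<comment> \<open>Integration of the derivative of \<open>u ^ (a + 1) * (1 - u\<^sup>2) powr k\<close>, which vanishes at both ends.\<close>
  have rec: "(real a + 1) * J a = (real a + 1 + 2 * k) * J (a + 2)" for a
  proof -
    let ?F = "\<lambda>u :: real. u ^ (a + 1) * (1 - u\<^sup>2) powr k"
    let ?f = "\<lambda>u :: real. (1 - u\<^sup>2) powr (k - 1) * ((real a + 1) * u ^ a - (real a + 1 + 2 * k) * u ^ (a + 2))"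
    have "(?f has_integral (?F 1 - ?F (-1))) {-1..1}"
    proof (rule fundamental_theorem_of_calculus_interior)
      show "continuous_on {-1..1} ?F"
        using k by (intro continuous_intros continuous_on_powr') (auto simp: abs_square_le_1 abs_le_iff)
      fix u :: real assume u: "u \<in> {-1<..<1}"
      then have p: "1 - u\<^sup>2 > 0" by (simp add: abs_square_less_1 abs_less_iff)
      have "((\<lambda>u. (1 - u\<^sup>2) powr k) has_real_derivative k * (1 - u\<^sup>2) powr (k - 1) * (- 2 * u)) (at u)"
        by (rule DERIV_chain2[where f="\<lambda>z. z powr k" and g="\<lambda>u. 1 - u\<^sup>2", OF has_real_derivative_powr[OF p]])
           (auto intro!: derivative_eq_intros)
      moreover have "((\<lambda>u. u ^ (a + 1)) has_real_derivative (real a + 1) * u ^ a) (at u)"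
        using DERIV_pow[of "a + 1" u UNIV] by (simp add: add.commute)
      ultimately have "(?F has_real_derivative (real a + 1) * u ^ a * (1 - u\<^sup>2) powr k + k * (1 - u\<^sup>2) powr (k - 1) * (- 2 * u) * u ^ (a + 1)) (at u)"
        by (rule DERIV_mult[rotated])
      moreover have "(1 - u\<^sup>2) powr k = (1 - u\<^sup>2) powr (k - 1) * (1 - u\<^sup>2)"
        using p powr_add[of "1 - u\<^sup>2" "k - 1" 1] by simp
      ultimately have "(?F has_real_derivative (real a + 1) * u ^ a * ((1 - u\<^sup>2) powr (k - 1) * (1 - u\<^sup>2)) + k * (1 - u\<^sup>2) powr (k - 1) * (- 2 * u) * u ^ (a + 1)) (at u)"
        by simp
      then have "(?F has_real_derivative ?f u) (at u)"
        by (rule DERIV_cong) (simp add: algebra_simps power2_eq_square)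
      then show "(?F has_vector_derivative ?f u) (at u)"
        by (simp add: has_real_derivative_iff_has_vector_derivative)
    qed simp
    then have h: "integral {-1..1} ?f = 0" using k by (simp add: integral_unique)
    have e: "indicator {-1..1} u *\<^sub>R ?f u = (real a + 1) * (u ^ a * W u) - (real a + 1 + 2 * k) * (u ^ (a + 2) * W u)" for u
      by (simp add: W_def algebra_simps)
    have "set_integrable lborel {-1..1} ?f"
      unfolding set_integrable_def e by (intro Bochner_Integration.integrable_diff integrable_mult_right ipw)
    from set_borel_integral_eq_integral(2)[OF this]
    have "(\<integral>u. (real a + 1) * (u ^ a * W u) - (real a + 1 + 2 * k) * (u ^ (a + 2) * W u) \<partial>lborel) = 0"
      unfolding set_lebesgue_integral_def e h .
    then show ?thesis
      unfolding J_def using ipw[of a] ipw[of "a + 2"] by (subst (asm) Bochner_Integration.integral_diff) auto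
  qed
  have mom: "(real (a + 2) + (if odd a then 2 * k else 0)) * (real (a + 1) + (if even a then 2 * k else 0)) * (\<integral>u. u ^ (a + 2) \<partial>\<nu>)
        = real (a + 2) * real (a + 1) * (\<integral>u. u ^ a \<partial>\<nu>)" for a
  proof (cases "even a")
    case True
    have "real (a + 2) * (real (a + 1) + 2 * k) * J (a + 2) = real (a + 2) * ((real a + 1 + 2 * k) * J (a + 2))"
      by simp
    also have "\<dots> = real (a + 2) * ((real a + 1) * J a)" unfolding rec ..
    also have "\<dots> = real (a + 2) * real (a + 1) * J a" by simp
    finally have "real (a + 2) * (real (a + 1) + 2 * k) * J (a + 2) / Z = real (a + 2) * real (a + 1) * J a / Z"
      by (rule arg_cong)
    then show ?thesis using True by (simp only: bo J_def[symmetric] times_divide_eq_right) simp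
  next
    case False
    then show ?thesis using odd0[of a] odd0[of "a + 2"] by (simp only: bo J_def[symmetric]) simp
  qed
  have tail: "m / (k * Z) * v powr k \<le> measure \<nu> {1 - v..1}" if v: "v \<in> {0<..1}" for v
  proof -
    have "ennreal (m / (k * Z) * v powr k) = ennreal (1 / Z) * ennreal (m * (v powr k / k))"
      using mM k Z by (simp add: ennreal_mult'[symmetric] field_simps)
    also have "\<dots> \<le> ennreal (1 / Z) * (\<integral>\<^sup>+u. ennreal (indicator {1 - v..1} u * W u) \<partial>lborel)"
      by (intro mult_left_mono low[OF v]) simp
    also have "\<dots> = (\<integral>\<^sup>+u. ennreal (indicator {1 - v..1} u) \<partial>\<nu>)"
      by (subst nn) auto
    also have "\<dots> = emeasure \<nu> {1 - v..1}" by (simp add: ennreal_indicator sets)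
    also have "\<dots> = ennreal (measure \<nu> {1 - v..1})"
    proof -
      have "finite_measure \<nu>"
        by (rule finite_measureI) (use one sets_eq_imp_space_eq[OF sets] in simp)
      then show ?thesis by (rule finite_measure.emeasure_eq_measure)
    qed
    finally show ?thesis by (simp add: ennreal_le_iff)
  qed
  \<comment> \<open>The integral over \<open>x = 1 - \<bar>u\<bar>\<close> is split at \<open>x = e\<^sup>2\<close>, where the two summands of the base balance.\<close>
  have N4: "(\<integral>\<^sup>+u. ennreal ((e\<^sup>2 + (1 - \<bar>u\<bar>)) powr (- (s + k + 1))) \<partial>\<nu>) \<le> ennreal ((2 * M / Z) * (1 / k + 1 / (s + 1)) * e powr (- 2 * s - 2))"
    if e: "e \<in> {0<..1}" for e
  proof -
    let ?l = "- (s + k + 1)"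
    have e2: "e\<^sup>2 > 0" using e by simp
    have pw: "(e\<^sup>2) powr a = e powr (2 * a)" for a
    proof -
      have "(e\<^sup>2) powr a = (e powr 2) powr a" using e by simp
      then show ?thesis by (simp add: powr_powr)
    qed
    let ?A = "\<lambda>x. (e\<^sup>2) powr ?l * (indicator {0..e\<^sup>2} x * x powr (k - 1))"
    let ?B = "\<lambda>x. indicator {e\<^sup>2..} x * x powr (- s - 2)"
    have "(\<integral>\<^sup>+x. ennreal (indicator {0..1} x * ((e\<^sup>2 + x) powr ?l * x powr (k - 1))) \<partial>lborel) \<le> (\<integral>\<^sup>+x. ennreal (?A x) + ennreal (?B x) \<partial>lborel)"
    proof (rule nn_integral_mono)
      fix x :: real
      have "indicator {0..1} x * ((e\<^sup>2 + x) powr ?l * x powr (k - 1)) \<le> ?A x + ?B x"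
      proof (cases "0 < x \<and> x \<le> 1")
        case x: True
        show ?thesis
        proof (cases "x \<le> e\<^sup>2")
          case True
          have "(e\<^sup>2 + x) powr ?l \<le> (e\<^sup>2) powr ?l" using x e2 k s by (intro powr_mono2') auto
          then have "(e\<^sup>2 + x) powr ?l * x powr (k - 1) \<le> (e\<^sup>2) powr ?l * x powr (k - 1)" by (intro mult_right_mono) auto
          then have "indicator {0..1} x * ((e\<^sup>2 + x) powr ?l * x powr (k - 1)) \<le> ?A x"
            using True x by (simp add: indicator_def)
          moreover have "0 \<le> ?B x" by simp
          ultimately show ?thesis by linarith
        next
          case False
          have "(e\<^sup>2 + x) powr ?l \<le> x powr ?l" using x e2 k s by (intro powr_mono2') auto
          then have "(e\<^sup>2 + x) powr ?l * x powr (k - 1) \<le> x powr ?l * x powr (k - 1)" by (intro mult_right_mono) auto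
          also have "\<dots> = x powr (- s - 2)" by (simp add: powr_add[symmetric])
          finally show ?thesis using False x by (simp add: indicator_def)
        qed
      next
        case False
        then have "x = 0 \<or> x \<notin> {0..1}" by auto
        then show ?thesis by (auto simp: indicator_def)
      qed
      then show "ennreal (indicator {0..1} x * ((e\<^sup>2 + x) powr ?l * x powr (k - 1))) \<le> ennreal (?A x) + ennreal (?B x)"
        by (simp only: ennreal_plus[symmetric, OF mult_nonneg_nonneg[OF powr_ge_zero mult_nonneg_nonneg[OF indicator_pos_le powr_ge_zero]]
              mult_nonneg_nonneg[OF indicator_pos_le powr_ge_zero]] ennreal_leI)
    qed
    also have "\<dots> = (\<integral>\<^sup>+x. ennreal (?A x) \<partial>lborel) + (\<integral>\<^sup>+x. ennreal (?B x) \<partial>lborel)"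
      by (rule nn_integral_add) auto
    also have "(\<integral>\<^sup>+x. ennreal (?A x) \<partial>lborel) = ennreal ((e\<^sup>2) powr ?l) * ennreal ((e\<^sup>2) powr (k - 1 + 1) / (k - 1 + 1))"
      using k e2 by (subst nn_integral_powr_from_0[symmetric]) (auto simp: ennreal_mult' nn_integral_cmult)
    also have "\<dots> = ennreal (e powr (- 2 * s - 2) * (1 / k))"
    proof -
      have e: "2 * - (s + k + 1) + 2 * (k - 1 + 1) = - 2 * s - 2" by simp
      have "(e\<^sup>2) powr ?l * (e\<^sup>2) powr (k - 1 + 1) = e powr (- 2 * s - 2)"
        by (simp only: powr_add[symmetric] pw e)
      then have "(e\<^sup>2) powr ?l * ((e\<^sup>2) powr (k - 1 + 1) / (k - 1 + 1)) = e powr (- 2 * s - 2) * (1 / k)"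
        by (simp only: times_divide_eq_right) simp
      then show ?thesis by (simp only: ennreal_mult'[OF powr_ge_zero, symmetric])
    qed
    also have "(\<integral>\<^sup>+x. ennreal (?B x) \<partial>lborel) = ennreal (- ((e\<^sup>2) powr (- s - 2 + 1)) / (- s - 2 + 1))"
      using s e2 by (intro nn_integral_powr_to_inf) auto
    also have "- ((e\<^sup>2) powr (- s - 2 + 1)) / (- s - 2 + 1) = e powr (- 2 * s - 2) * (1 / (s + 1))"
    proof -
      have "2 * (- s - 2 + 1) = - 2 * s - 2" by simp
      then have "(e\<^sup>2) powr (- s - 2 + 1) = e powr (- 2 * s - 2)" by (simp only: pw)
      moreover have "- s - 2 + 1 = - (s + 1)" by simp
      ultimately show ?thesis by (simp only: minus_divide_divide) simp
    qed
    also have "ennreal (e powr (- 2 * s - 2) * (1 / k)) + ennreal (e powr (- 2 * s - 2) * (1 / (s + 1))) =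
       ennreal (e powr (- 2 * s - 2) * (1 / k + 1 / (s + 1)))"
      using k s by (subst ennreal_plus[symmetric]) (auto simp: distrib_left)
    finally have I: "(\<integral>\<^sup>+x. ennreal (indicator {0..1} x * ((e\<^sup>2 + x) powr ?l * x powr (k - 1))) \<partial>lborel) \<le> ennreal (e powr (- 2 * s - 2) * (1 / k + 1 / (s + 1)))" .
    have "(\<integral>\<^sup>+u. ennreal ((e\<^sup>2 + (1 - \<bar>u\<bar>)) powr ?l) \<partial>\<nu>) = ennreal (1 / Z) * (\<integral>\<^sup>+u. ennreal ((e\<^sup>2 + (1 - \<bar>u\<bar>)) powr ?l * W u) \<partial>lborel)"
      by (rule nn) auto
    also have "\<dots> \<le> ennreal (1 / Z) * (ennreal M * (2 * ennreal (e powr (- 2 * s - 2) * (1 / k + 1 / (s + 1)))))"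
      using up[of "\<lambda>x. (e\<^sup>2 + x) powr ?l"] I
      by (intro mult_left_mono order_trans[OF up[of "\<lambda>x. (e\<^sup>2 + x) powr ?l"]] mult_left_mono) auto
    also have "\<dots> = ennreal ((2 * M / Z) * (1 / k + 1 / (s + 1)) * e powr (- 2 * s - 2))"
    proof -
      have *: "ennreal a * (ennreal b * (2 * ennreal x)) = ennreal (a * (b * (2 * x)))" if "0 \<le> a" "0 \<le> b" for a b x :: real
        using that by (simp add: ennreal_mult')
      have "1 / Z * (M * (2 * (e powr (- 2 * s - 2) * (1 / k + 1 / (s + 1))))) = (2 * M / Z) * (1 / k + 1 / (s + 1)) * e powr (- 2 * s - 2)"
        by (simp only: times_divide_eq_left times_divide_eq_right mult_1_left mult_ac)
      then show ?thesis using mM Z by (simp only: * less_imp_le divide_nonneg_nonneg zero_le_one)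
    qed
    finally show ?thesis .
  qed
  have "zonal_measure k s \<nu>"
    unfolding zonal_measure_def
    using sets one AE1 mom tail N4 mM k s Z
    by (intro conjI allI exI[of _ "m / (k * Z)"] exI[of _ "(2 * M / Z) * (1 / k + 1 / (s + 1))"] ballI)
       (auto intro!: mult_pos_pos add_pos_pos divide_pos_pos)
  then show ?thesis by blast
qed

lemma zonal_measure_exists: "k \<ge> 0 \<Longrightarrow> s > 0 \<Longrightarrow> \<exists>\<nu>. zonal_measure k s \<nu>"
  using zonal_measure_zero zonal_measure_pos by (cases "k = 0") auto


section \<open>Size of the zonal Poisson kernel\<close>

lemma exp_taylor1:
  fixes z :: complex
  assumes "\<bar>Re z\<bar> \<le> 1"
  shows "norm (exp z - 1) \<le> 3 * norm z" "norm (exp z - 1 - z) \<le> 3 * (norm z)\<^sup>2"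
proof -
  have e: "exp \<bar>Re z\<bar> \<le> 3" using assms exp_le exp_le_cancel_iff order_trans by blast
  have "norm (exp z - 1) \<le> exp \<bar>Re z\<bar> * norm z" using Taylor_exp[of z 0] by simp
  also have "\<dots> \<le> 3 * norm z" using e by (intro mult_right_mono) auto
  finally show "norm (exp z - 1) \<le> 3 * norm z" .
  have "norm (exp z - 1 - z) \<le> exp \<bar>Re z\<bar> * (norm z)\<^sup>2"
    using Taylor_exp[of z 1] by (simp add: numeral_2_eq_2 diff_diff_eq)
  also have "\<dots> \<le> 3 * (norm z)\<^sup>2" using e by (intro mult_right_mono) auto
  finally show "norm (exp z - 1 - z) \<le> 3 * (norm z)\<^sup>2" .
qed

text \<open>
  The argument of \<open>z powr (- m)\<close> is at most one in modulus, and the cosine is at least \<open>1 / 2\<close> there.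
\<close>

lemma Re_powr_sector:
  assumes m: "m > 0" and z: "Re z > 0" "m * \<bar>Im z\<bar> \<le> Re z"
  shows "norm z powr (- m) / 2 \<le> Re (z powr (- of_real m))"
proof -
  have nz: "z \<noteq> 0" using z by auto
  have im: "Im (Ln z) = arctan (Im z / Re z)"
    using z(1) by (simp add: Im_Ln_eq[OF nz])
  have "\<bar>Im (Ln z)\<bar> \<le> \<bar>Im z / Re z\<bar>" unfolding im by (rule abs_arctan_le)
  also have "\<dots> \<le> 1 / m" using z m by (simp add: abs_divide field_simps)
  finally have a: "\<bar>m * Im (Ln z)\<bar> \<le> 1" using m by (simp add: abs_mult field_simps)
  have "cos (pi / 3) \<le> cos \<bar>m * Im (Ln z)\<bar>"
    by (rule cos_monotone_0_pi_le) (use a pi_gt3 in auto)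
  then have c: "1 / 2 \<le> cos (m * Im (Ln z))" by (simp add: cos_60)
  have "Re (z powr (- of_real m)) = exp (- m * ln (norm z)) * cos (m * Im (Ln z))"
    using nz by (simp add: powr_def Re_exp)
  also have "exp (- m * ln (norm z)) = norm z powr (- m)" using nz by (simp add: powr_def)
  finally show ?thesis using c mult_left_mono[OF c, of "norm z powr (- m)"] by simp
qed

lemma powr_mult_right_half_plane:
  assumes "Re z > 0" "Re w > 0"
  shows "(z * w) powr c = z powr c * (w powr c :: complex)"
proof -
  have nz: "z \<noteq> 0" "w \<noteq> 0" using assms by auto
  have "\<bar>Im (Ln z)\<bar> < pi / 2" "\<bar>Im (Ln w)\<bar> < pi / 2" using assms Re_Ln_pos_lt nz by auto
  then have "Ln (z * w) = Ln z + Ln w" using nz by (intro Ln_times_simple) auto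
  then show ?thesis using nz by (simp add: powr_def exp_add distrib_left)
qed

definition zker :: "real \<Rightarrow> real measure \<Rightarrow> real \<Rightarrow> complex \<Rightarrow> complex" where
  "zker l \<nu> t r = (LINT u:{-1..1}|\<nu>. gpoisson l (t * u) r)"

lemma zker_integrand:
  assumes s: "sets \<nu> = sets borel" and e: "emeasure \<nu> UNIV = 1"
    and t: "\<bar>t\<bar> \<le> 1" and r: "norm r < 1"
  shows "set_integrable \<nu> {-1..1} (\<lambda>u. gpoisson l (t * u) r)"
proof -
  have tu: "\<bar>t * u\<bar> \<le> 1" if "u \<in> {-1..1}" for u
  proof -
    have "\<bar>t\<bar> * \<bar>u\<bar> \<le> 1 * 1" using t that by (intro mult_mono) auto
    then show ?thesis by (simp add: abs_mult)
  qed
  have c: "continuous_on {-1..1} (\<lambda>u. gpoisson l (t * u) r)"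
  proof -
    have "continuous_on {-1..1} (\<lambda>u. (1 - 2 * of_real (t * u) * r + r\<^sup>2) powr (- of_real (l + 1)))"
    proof (rule continuous_on_compose2[where g="\<lambda>z :: complex. z powr (- of_real (l + 1))" and t="- \<real>\<^sub>\<le>\<^sub>0"])
      show "continuous_on (- \<real>\<^sub>\<le>\<^sub>0) (\<lambda>z :: complex. z powr (- of_real (l + 1)))"
        by (intro holomorphic_on_imp_continuous_on holomorphic_intros) auto
      show "continuous_on {-1..1} (\<lambda>u. 1 - 2 * of_real (t * u) * r + r\<^sup>2)"
        by (intro continuous_intros)
      show "(\<lambda>u. 1 - 2 * of_real (t * u) * r + r\<^sup>2) ` {-1..1} \<subseteq> - \<real>\<^sub>\<le>\<^sub>0"
        using kernel_base_nonpos[OF tu r] by auto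
    qed
    then show ?thesis unfolding gpoisson_def by (rule continuous_on_mult[OF continuous_on_const])
  qed
  then obtain B where B: "\<And>u. u \<in> {-1..1} \<Longrightarrow> norm (gpoisson l (t * u) r) \<le> B"
    using compact_imp_bounded[OF compact_continuous_image[OF c compact_Icc]] unfolding bounded_iff by blast
  interpret finite_measure \<nu>
    by (rule finite_measureI) (use e sets_eq_imp_space_eq[OF s] in simp)
  have B0: "0 \<le> B" using B[of 0] by (meson atLeastAtMost_iff le_minus_one_simps(1) norm_ge_zero order_trans zero_le_one)
  show ?thesis
    unfolding set_integrable_def
  proof (rule integrable_const_bound[of _ B])
    show "AE u in \<nu>. norm (indicator {-1..1} u *\<^sub>R gpoisson l (t * u) r) \<le> B"
      using B B0 by (auto simp: indicator_def)
    have "(\<lambda>u. indicator {-1..1} u *\<^sub>R gpoisson l (t * u) r) \<in> borel_measurable borel"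
      by (rule borel_measurable_continuous_on_indicator[OF _ c]) auto
    then show "(\<lambda>u. indicator {-1..1} u *\<^sub>R gpoisson l (t * u) r) \<in> borel_measurable \<nu>"
      using s by (simp cong: measurable_cong_sets)
  qed
qed

text \<open>
  Write \<open>r = exp (- w) * q\<close> with \<open>q = t - \<i> * y\<close> of modulus one and \<open>w = e * (2 - \<i> * K)\<close>. Then the base of
  the Gegenbauer kernel is \<open>2 * r * t * (C + (1 - u))\<close> with \<open>C = (cosh w - 1) + \<i> * (y / t) * sinh w\<close>,
  which is close to \<open>(y / t) * e * (K + 2 * \<i>)\<close>. For large \<open>K\<close> the argument of \<open>C + (1 - u)\<close> is so small
  for all \<open>u \<le> 1\<close> that its power \<open>- l - 1\<close> has real part comparable with its modulus. The values of \<open>u\<close>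
  with \<open>1 - u \<le> norm C\<close>, which have mass at least a multiple of \<open>norm C powr k\<close>, then contribute
  \<open>norm C powr (- s - 1)\<close>, and the factor \<open>1 - r\<^sup>2\<close> is of size \<open>y\<close>.
\<close>

lemma zker_lower:
  assumes k: "k \<ge> 0" and s: "s > 0" and \<nu>: "zonal_measure k s \<nu>"
  shows "\<exists>K>0. \<exists>M>0. \<exists>c>0. \<forall>e>0. \<forall>t>0. \<forall>y. t\<^sup>2 + y\<^sup>2 = 1 \<longrightarrow> M * e \<le> y \<longrightarrow> y \<le> 1 / 2 \<longrightarrow>
     c * (y * (y * e) powr (- s - 1)) \<le> norm (zker (s + k) \<nu> t (exp (- (of_real e * Complex 2 (- K))) * Complex t (- y)))"
proof -
  define l where "l = s + k"
  define m where "m = l + 1"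
  have m: "m > 1" using k s by (simp add: m_def l_def)
  \<comment> \<open>Chosen so that \<open>m\<close> times the bound \<open>3 * (T * e)\<close> for \<open>\<bar>Im C\<bar>\<close> equals the lower bound \<open>(K - 1) * (T * e)\<close> for \<open>Re C\<close>.\<close>
  define K where "K = 1 + 3 * m"
  have K: "K > 4" using m by (simp add: K_def)
  \<comment> \<open>Makes the quadratic error \<open>6 * (norm w)\<^sup>2 = M * e\<^sup>2\<close> at most \<open>y * e\<close>.\<close>
  define M where "M = 6 * (4 + K\<^sup>2)"
  have sets: "sets \<nu> = sets borel" and one: "emeasure \<nu> UNIV = 1"
    using \<nu> by (auto simp: zonal_measure_def)
  interpret finite_measure \<nu>
    by (rule finite_measureI) (use one sets_eq_imp_space_eq[OF sets] in simp)
  obtain c0 where c0: "c0 > 0" "\<And>v. v \<in> {0<..1} \<Longrightarrow> c0 * v powr k \<le> measure \<nu> {1 - v..1}"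
    using \<nu> by (auto simp: zonal_measure_def)
  define c where "c = 2 powr (- m) * (2 powr (- m) / 2 * c0) * (2 * (K + 3)) powr (- s - 1)"
  have main: "c * (y * (y * e) powr (- s - 1)) \<le> norm (zker l \<nu> t (exp (- (of_real e * Complex 2 (- K))) * Complex t (- y)))"
    if e: "e > 0" and t: "t > 0" and ty: "t\<^sup>2 + y\<^sup>2 = 1" and My: "M * e \<le> y" and y2: "y \<le> 1 / 2" for e t y
  proof -
    define w where "w = of_real e * Complex 2 (- K)"
    define q where "q = Complex t (- y)"
    define r where "r = exp (- w) * q"
    define T where "T = y / t"
    have K2: "K\<^sup>2 > 16" using power_strict_mono[of 4 K 2] K by simp
    have M0: "M > 0" by (simp add: M_def add_pos_nonneg)
    have y0: "y > 0" using My e M0 by (smt (verit) mult_pos_pos)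
    have y4: "y\<^sup>2 \<le> 1 / 4" using power_mono[OF y2, of 2] y0 by (simp add: power2_eq_square)
    have th: "t \<ge> 1 / 2"
    proof (rule ccontr)
      assume "\<not> 1 / 2 \<le> t"
      then have "t\<^sup>2 < (1 / 2)\<^sup>2" using t by (intro power_strict_mono) auto
      then show False using ty y4 by (simp add: power2_eq_square)
    qed
    have t1: "t \<le> 1"
    proof (rule ccontr)
      assume "\<not> t \<le> 1"
      then have "1\<^sup>2 < t\<^sup>2" by (intro power_strict_mono) auto
      then have "1 < t\<^sup>2" by simp
      then show False using ty zero_le_power2[of y] by linarith
    qed
    have T: "y \<le> T" "T \<le> 2 * y" "T \<le> 1"
    proof -
      show "y \<le> T" using t t1 y0 by (simp add: T_def field_simps mult_left_le)
      have "y / t \<le> y / (1 / 2)" using th y0 t by (intro divide_left_mono) auto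
      then show "T \<le> 2 * y" by (simp add: T_def)
      then show "T \<le> 1" using y2 by linarith
    qed
    have eM: "e * M \<le> 1 / 2" using My y2 by (simp add: mult.commute)
    have KM: "K \<le> K\<^sup>2 / 4" using K by (simp add: power2_eq_square)
    have "6 * (e * (4 + K\<^sup>2)) = e * M" by (simp add: M_def)
    then have eK: "e * (4 + K\<^sup>2) \<le> 1 / 12" using eM by linarith
    have eK1: "e * K \<le> 1 / 12" "e \<le> 1 / 48" "e * (K + 3) \<le> 1"
    proof -
      have "e * K \<le> e * (4 + K\<^sup>2)" "e * 4 \<le> e * (4 + K\<^sup>2)"
        using e KM K2 by (auto intro!: mult_left_mono)
      then show "e * K \<le> 1 / 12" "e \<le> 1 / 48" using eK by linarith+
      then show "e * (K + 3) \<le> 1" by (simp add: distrib_left)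
    qed
    have nw: "(norm w)\<^sup>2 = e\<^sup>2 * (4 + K\<^sup>2)" by (simp add: w_def norm_mult power_mult_distrib cmod_def distrib_left)
    have Rw: "Re w = 2 * e" "Im w = - e * K" by (simp_all add: w_def)
    have nw1: "norm w \<le> e * (K + 2)"
      using cmod_le[of w] e K Rw by (simp add: abs_mult distrib_left)
    have q: "norm q = 1" "q \<noteq> 0" "cnj q * q = 1"
    proof -
      show nq: "norm q = 1" using ty by (simp add: q_def cmod_def)
      then show "q \<noteq> 0" by auto
      show "cnj q * q = 1" using nq by (simp add: mult.commute complex_norm_square[symmetric])
    qed
    have nr: "norm r = exp (- 2 * e)" by (simp add: r_def norm_mult q Rw norm_exp_eq_Re)
    have nr1: "norm r < 1" using e by (simp add: nr)
    have r0: "r \<noteq> 0" using q by (simp add: r_def)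
    define C where "C = (cosh w - 1) + \<i> * of_real T * sinh w"
    have base: "1 - 2 * of_real (t * u) * r + r\<^sup>2 = (2 * r * of_real t) * (C + of_real (1 - u))" for u
    proof -
      have ir: "inverse r = exp w * cnj q"
        using q by (intro inverse_unique) (simp add: r_def exp_minus field_simps)
      have "r + inverse r = 2 * of_real t * cosh w + 2 * \<i> * of_real y * sinh w"
        unfolding ir unfolding r_def cosh_def sinh_def
        by (simp add: q_def complex_eq_iff scaleR_conv_of_real algebra_simps)
      also have "\<dots> = 2 * of_real t * (C + 1)"
        using t by (simp add: C_def T_def algebra_simps)
      finally have "r * (r + inverse r) = r * (2 * of_real t * (C + 1))" by simp
      then have "r\<^sup>2 + 1 = r * (2 * of_real t * (C + 1))"
        using r0 by (simp add: distrib_left power2_eq_square)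
      then show ?thesis by (simp add: algebra_simps)
    qed
    have Cw: "norm (C - of_real (T * e) * Complex K 2) \<le> T * e"
    proof -
      have a: "\<bar>Re w\<bar> \<le> 1" "\<bar>Re (- w)\<bar> \<le> 1" using Rw eK1 e by auto
      have "sinh w - w = ((exp w - 1 - w) - (exp (- w) - 1 - (- w))) / 2"
        by (simp add: sinh_def scaleR_conv_of_real field_simps)
      then have "norm (sinh w - w) = norm ((exp w - 1 - w) - (exp (- w) - 1 - (- w))) / 2"
        by (simp only: norm_divide norm_numeral)
      also have "\<dots> \<le> (norm (exp w - 1 - w) + norm (exp (- w) - 1 - (- w))) / 2"
        by (rule divide_right_mono[OF norm_triangle_ineq4]) simp
      finally have "norm (sinh w - w) \<le> (norm (exp w - 1 - w) + norm (exp (- w) - 1 - (- w))) / 2" .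
      then have sh: "norm (sinh w - w) \<le> 3 * (norm w)\<^sup>2"
        using exp_taylor1(2)[OF a(1)] exp_taylor1(2)[OF a(2)] by simp
      have "cosh w - 1 = ((exp w - 1 - w) + (exp (- w) - 1 - (- w))) / 2"
        by (simp add: cosh_def scaleR_conv_of_real field_simps)
      then have "norm (cosh w - 1) = norm ((exp w - 1 - w) + (exp (- w) - 1 - (- w))) / 2"
        by (simp only: norm_divide norm_numeral)
      also have "\<dots> \<le> (norm (exp w - 1 - w) + norm (exp (- w) - 1 - (- w))) / 2"
        by (rule divide_right_mono[OF norm_triangle_ineq]) simp
      finally have "norm (cosh w - 1) \<le> (norm (exp w - 1 - w) + norm (exp (- w) - 1 - (- w))) / 2" .
      then have ch: "norm (cosh w - 1) \<le> 3 * (norm w)\<^sup>2"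
        using exp_taylor1(2)[OF a(1)] exp_taylor1(2)[OF a(2)] by simp
      have "C - of_real (T * e) * Complex K 2 = (cosh w - 1) + \<i> * of_real T * (sinh w - w)"
        by (simp add: C_def w_def complex_eq_iff algebra_simps)
      then have "norm (C - of_real (T * e) * Complex K 2) \<le> norm (cosh w - 1) + norm (\<i> * of_real T * (sinh w - w))"
        by (simp only: norm_triangle_ineq)
      also have "norm (\<i> * of_real T * (sinh w - w)) = T * norm (sinh w - w)"
        using T y0 by (simp add: norm_mult)
      also have "\<dots> \<le> 1 * (3 * (norm w)\<^sup>2)" using sh T y0 by (intro mult_mono) auto
      finally have "norm (C - of_real (T * e) * Complex K 2) \<le> 6 * (norm w)\<^sup>2" using ch by linarith
      also have "\<dots> = (M * e) * e" unfolding nw M_def by (simp add: power2_eq_square algebra_simps)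
      also have "\<dots> \<le> T * e" using My T e by (intro mult_right_mono) auto
      finally show ?thesis .
    qed
    have Te: "T * e > 0" using T y0 e by (simp add: mult_pos_pos)
    have ReC: "T * e * (K - 1) \<le> Re C"
      using abs_Re_le_cmod[of "C - of_real (T * e) * Complex K 2"] Cw by (simp add: algebra_simps abs_le_iff)
    have ImC: "\<bar>Im C\<bar> \<le> 3 * (T * e)"
      using abs_Im_le_cmod[of "C - of_real (T * e) * Complex K 2"] Cw by (simp add: algebra_simps abs_le_iff)
    have nC: "norm C \<le> T * e * (K + 3)"
    proof -
      have "norm (of_real (T * e) * Complex K 2) \<le> T * e * (K + 2)"
        unfolding norm_mult norm_of_real abs_of_pos[OF Te]
        using Te K cmod_le[of "Complex K 2"] by (intro mult_left_mono) auto
      moreover have "norm C \<le> norm (of_real (T * e) * Complex K 2) + norm (C - of_real (T * e) * Complex K 2)"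
        using norm_triangle_ineq[of "of_real (T * e) * Complex K 2" "C - of_real (T * e) * Complex K 2"] by simp
      ultimately show ?thesis using Cw by (simp add: algebra_simps)
    qed
    have C0: "Re C > 0" using ReC Te K by (smt (verit) mult_pos_pos)
    have nC0: "norm C > 0" using C0 by auto
    have nC1: "norm C \<le> 1"
    proof -
      have "T * (e * (K + 3)) \<le> 1 * 1" using T eK1 y0 e K by (intro mult_mono) auto
      then show ?thesis using nC by (simp add: mult.assoc)
    qed
    have Rr: "Re (2 * r * of_real t) > 0"
    proof -
      have "Re r = exp (- 2 * e) * (t * cos (e * K) + y * sin (e * K))"
        by (simp add: r_def q_def Re_exp Im_exp Rw algebra_simps)
      moreover have "cos (e * K) > 0" using eK1 e K pi_gt3 by (intro cos_gt_zero_pi) (auto intro: less_le_trans[of _ 0])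
      moreover have "sin (e * K) \<ge> 0" using eK1 e K pi_gt3 by (intro sin_ge_zero) auto
      ultimately show ?thesis using t y0 by (auto intro!: mult_pos_pos add_pos_nonneg)
    qed
    let ?P = "\<lambda>u. (C + of_real (1 - u)) powr (- of_real m)"
    let ?A = "(1 - r\<^sup>2) * (2 * r * of_real t) powr (- of_real m)"
    have gp: "gpoisson l (t * u) r = ?A * ?P u" if "u \<le> 1" for u
    proof -
      have "Re (C + of_real (1 - u)) > 0" using C0 that by simp
      then show ?thesis
        unfolding gpoisson_def m_def[symmetric] base by (simp only: powr_mult_right_half_plane[OF Rr]) (simp only: mult.assoc)
    qed
    have A0: "norm ?A \<ge> y * 2 powr (- m)"
    proof -
      have "norm (2 * r * of_real t) \<le> 2" using mult_mono[of "norm r" 1 t 1] nr1 t t1 by (simp add: norm_mult)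
      moreover have nz: "2 * r * of_real t \<noteq> 0" using r0 t by simp
      ultimately have "2 powr (- m) \<le> norm (2 * r * of_real t) powr (- m)"
        using m by (intro powr_mono2') auto
      also have "\<dots> = norm ((2 * r * of_real t) powr (- of_real m))"
        using norm_powr_of_real[OF nz, of "- m"] by simp
      finally have a: "2 powr (- m) \<le> norm ((2 * r * of_real t) powr (- of_real m))" .
      have "1 - q\<^sup>2 = q * (cnj q - q)" using q(3) by (simp add: algebra_simps power2_eq_square)
      moreover have "norm (cnj q - q) = 2 * y"
      proof -
        have "cnj q - q = of_real (2 * y) * \<i>" by (simp add: q_def complex_eq_iff)
        then show ?thesis using y0 by (simp only: norm_mult norm_of_real) simp
      qed
      ultimately have n1: "norm (1 - q\<^sup>2) = 2 * y" by (simp add: norm_mult q)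
      have "r\<^sup>2 = exp (- 2 * w) * q\<^sup>2" by (simp add: r_def power_mult_distrib exp_double[symmetric])
      then have "1 - r\<^sup>2 = (1 - q\<^sup>2) - (exp (- 2 * w) - 1) * q\<^sup>2" by (simp add: algebra_simps)
      then have "norm (1 - r\<^sup>2) \<ge> norm (1 - q\<^sup>2) - norm ((exp (- 2 * w) - 1) * q\<^sup>2)"
        using norm_triangle_ineq2 by metis
      moreover have "norm ((exp (- 2 * w) - 1) * q\<^sup>2) \<le> 3 * norm (- 2 * w)"
        using exp_taylor1(1)[of "- 2 * w"] Rw eK1 e by (simp add: norm_mult norm_power q)
      moreover have "3 * norm (- 2 * w) \<le> y"
      proof -
        have "3 * norm (- 2 * w) \<le> 6 * (e * (K + 2))" using nw1 by (simp add: norm_mult)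
        also have "\<dots> \<le> 6 * (e * (4 + K\<^sup>2))" using e KM K2 by (intro mult_left_mono) auto
        also have "\<dots> = M * e" by (simp add: M_def)
        finally show ?thesis using My by linarith
      qed
      ultimately have "y \<le> norm (1 - r\<^sup>2)" using n1 by linarith
      then show ?thesis unfolding norm_mult using a y0 by (intro mult_mono) auto
    qed
    have An: "?A \<noteq> 0" using A0 y0 by (smt (verit) mult_pos_pos norm_zero powr_gt_zero)
    have t11: "\<bar>t\<bar> \<le> 1" using t t1 by simp
    have gi: "set_integrable \<nu> {-1..1} (\<lambda>u. gpoisson l (t * u) r)"
      by (rule zker_integrand[OF sets one t11 nr1])
    have "set_integrable \<nu> {-1..1} (\<lambda>u. (1 / ?A) * gpoisson l (t * u) r)"
      by (rule set_integrable_mult_right) (use gi in simp)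
    then have Pi: "set_integrable \<nu> {-1..1} ?P"
      by (rule set_integrable_cong[THEN iffD1, rotated -1]) (use An gp in auto)
    have "zker l \<nu> t r = (LINT u:{-1..1}|\<nu>. ?A * ?P u)"
      unfolding zker_def by (rule set_lebesgue_integral_cong) (use gp sets in auto)
    also have "\<dots> = ?A * (LINT u:{-1..1}|\<nu>. ?P u)"
      by (rule set_integral_mult_right)
    finally have zk: "norm (zker l \<nu> t r) = norm ?A * norm (LINT u:{-1..1}|\<nu>. ?P u)" by (simp only: norm_mult)
    have "(2 * norm C) powr (- m) / 2 * (c0 * norm C powr k) \<le> (2 * norm C) powr (- m) / 2 * measure \<nu> {1 - norm C..1}"
      using c0(2)[of "norm C"] nC0 nC1 by (intro mult_left_mono) auto
    also have "\<dots> = (\<integral>u. indicator {1 - norm C..1} u * ((2 * norm C) powr (- m) / 2) \<partial>\<nu>)"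
      using sets by (simp add: measure_def)
    also have "\<dots> \<le> (\<integral>u. Re (indicator {-1..1} u *\<^sub>R ?P u) \<partial>\<nu>)"
    proof (rule integral_mono)
      show "integrable \<nu> (\<lambda>u. indicator {1 - norm C..1} u * ((2 * norm C) powr (- m) / 2))"
        using sets by (intro integrable_mult_left integrable_real_indicator) (auto simp: less_top[symmetric])
      show "integrable \<nu> (\<lambda>u. Re (indicator {-1..1} u *\<^sub>R ?P u))"
        using Pi unfolding set_integrable_def by (rule integrable_Re)
      fix u
      have sec: "norm (C + of_real (1 - u)) powr (- m) / 2 \<le> Re (?P u)" if u: "u \<le> 1"
      proof (rule Re_powr_sector)
        show "Re (C + of_real (1 - u)) > 0" using C0 u by simp
        have "m * \<bar>Im C\<bar> \<le> m * (3 * (T * e))" using ImC m by (intro mult_left_mono) auto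
        also have "\<dots> = T * e * (K - 1)" by (simp add: K_def)
        finally have "m * \<bar>Im C\<bar> \<le> Re C" using ReC by linarith
        then show "m * \<bar>Im (C + of_real (1 - u))\<bar> \<le> Re (C + of_real (1 - u))" using u by simp
      qed (use m in simp)
      show "indicator {1 - norm C..1} u * ((2 * norm C) powr (- m) / 2) \<le> Re (indicator {-1..1} u *\<^sub>R ?P u)"
      proof (cases "u \<in> {1 - norm C..1}")
        case True
        have "norm (C + of_real (1 - u)) \<le> 2 * norm C"
          using norm_triangle_ineq[of C "of_real (1 - u)"] True by (simp del: of_real_diff)
        moreover have "norm (C + of_real (1 - u)) > 0"
          using C0 True by (auto simp: complex_eq_iff)
        ultimately have "(2 * norm C) powr (- m) \<le> norm (C + of_real (1 - u)) powr (- m)"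
          using m by (intro powr_mono2') auto
        then show ?thesis using sec True nC1 by auto
      next
        case False
        show ?thesis
        proof (cases "u \<in> {-1..1}")
          case True
          have "0 \<le> norm (C + of_real (1 - u)) powr (- m) / 2" by simp
          also have "\<dots> \<le> Re (?P u)" using sec True by simp
          finally show ?thesis using False True by simp
        qed (use False in simp)
      qed
    qed
    also have "\<dots> = Re (LINT u:{-1..1}|\<nu>. ?P u)"
      unfolding set_lebesgue_integral_def using Pi unfolding set_integrable_def by (rule integral_Re)
    also have "\<dots> \<le> norm (LINT u:{-1..1}|\<nu>. ?P u)" by (rule complex_Re_le_cmod)
    finally have I: "(2 * norm C) powr (- m) / 2 * (c0 * norm C powr k) \<le> norm (LINT u:{-1..1}|\<nu>. ?P u)" .
    have "(2 * norm C) powr (- m) / 2 * (c0 * norm C powr k) = 2 powr (- m) / 2 * c0 * norm C powr (- s - 1)"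
    proof -
      have "norm C powr (- m) * norm C powr k = norm C powr (- s - 1)"
        by (simp add: powr_add[symmetric] m_def l_def)
      then show ?thesis by (simp add: powr_mult mult_ac)
    qed
    moreover have "(2 * (K + 3)) powr (- s - 1) * (y * e) powr (- s - 1) \<le> norm C powr (- s - 1)"
    proof -
      have "T * e * (K + 3) \<le> (2 * y) * e * (K + 3)" using T e K by (intro mult_right_mono) auto
      then have "norm C \<le> (2 * (K + 3)) * (y * e)" using nC by (simp add: algebra_simps)
      then have "((2 * (K + 3)) * (y * e)) powr (- s - 1) \<le> norm C powr (- s - 1)"
        using nC0 s by (intro powr_mono2') auto
      then show ?thesis using K y0 e by (simp add: powr_mult)
    qed
    ultimately have I2: "2 powr (- m) / 2 * c0 * ((2 * (K + 3)) powr (- s - 1) * (y * e) powr (- s - 1)) \<le> norm (LINT u:{-1..1}|\<nu>. ?P u)"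
      using I c0(1) by (smt (verit) mult_left_mono mult_nonneg_nonneg powr_ge_zero divide_nonneg_nonneg)
    have "(y * 2 powr (- m)) * (2 powr (- m) / 2 * c0 * ((2 * (K + 3)) powr (- s - 1) * (y * e) powr (- s - 1))) \<le> norm (zker l \<nu> t r)"
      unfolding zk using A0 I2 c0(1) by (intro mult_mono) auto
    then show ?thesis by (simp add: c_def r_def w_def q_def mult_ac)
  qed
  have "c > 0" using c0(1) K by (simp add: c_def)
  moreover have "M > 0" by (simp add: M_def add_pos_nonneg)
  ultimately show ?thesis
    using main K unfolding l_def by (intro exI[of _ K] exI[of _ M] exI[of _ c] conjI allI impI) auto
qed


definition rpoisson :: "real \<Rightarrow> real \<Rightarrow> real \<Rightarrow> real" where
  "rpoisson l t r = (1 - r\<^sup>2) * (1 - 2 * t * r + r\<^sup>2) powr (- (l + 1))"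

lemma gpoisson_of_real:
  assumes "\<bar>t\<bar> \<le> 1" "\<bar>r\<bar> < 1"
  shows "gpoisson l t (of_real r) = of_real (rpoisson l t r)"
proof -
  have "0 \<le> (r - t)\<^sup>2 + (1 - t\<^sup>2)" using assms by (intro add_nonneg_nonneg) (auto simp: abs_square_le_1)
  then have b: "0 \<le> 1 - 2 * t * r + r\<^sup>2" by (simp add: power2_eq_square algebra_simps)
  have "(1 - 2 * of_real t * of_real r + (of_real r)\<^sup>2 :: complex) = of_real (1 - 2 * t * r + r\<^sup>2)" by simp
  moreover have "(of_real (1 - 2 * t * r + r\<^sup>2) :: complex) powr (of_real (- (l + 1))) = of_real ((1 - 2 * t * r + r\<^sup>2) powr (- (l + 1)))"
    by (rule powr_of_real[OF b])
  ultimately show ?thesis unfolding gpoisson_def rpoisson_def by simp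
qed

lemma rpoisson_nonneg: "\<bar>r\<bar> \<le> 1 \<Longrightarrow> 0 \<le> rpoisson l t r"
  unfolding rpoisson_def by (intro mult_nonneg_nonneg) (auto simp: abs_square_le_1)

text \<open>
  On the real axis the kernel is nonnegative, \<open>1 - r\<^sup>2\<close> is at most \<open>2 * e\<close>, and the base is at least
  \<open>(e\<^sup>2 + (1 - \<bar>u\<bar>)) / 4\<close>; the last clause of \<open>zonal_measure\<close> is tailored to this.
\<close>

lemma zker_real:
  assumes \<nu>: "zonal_measure k s \<nu>" and k: "k \<ge> 0" and s: "s > 0"
  shows "\<exists>C>0. \<forall>e\<in>{0<..1}. \<forall>t. \<bar>t\<bar> \<le> 1 \<longrightarrow>
    (\<exists>x. zker (s + k) \<nu> t (of_real (exp (- e))) = of_real x \<and> 0 \<le> x \<and> x \<le> C * e powr (- (2 * s + 1)))"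
proof -
  have sets: "sets \<nu> = sets borel" and one: "emeasure \<nu> UNIV = 1"
    using \<nu> by (auto simp: zonal_measure_def)
  obtain C where C: "C > 0" "\<And>e. e \<in> {0<..1} \<Longrightarrow> (\<integral>\<^sup>+u. ennreal ((e\<^sup>2 + (1 - \<bar>u\<bar>)) powr (- (s + k + 1))) \<partial>\<nu>) \<le> ennreal (C * e powr (- 2 * s - 2))"
    using \<nu> by (auto simp: zonal_measure_def)
  define l where "l = s + k"
  define D where "D = 2 * (1 / 4) powr (- (l + 1)) * C"
  have D: "D > 0" using C by (simp add: D_def)
  have main: "\<exists>x. zker l \<nu> t (of_real (exp (- e))) = of_real x \<and> 0 \<le> x \<and> x \<le> D * e powr (- (2 * s + 1))"
    if e: "e \<in> {0<..1}" and t: "\<bar>t\<bar> \<le> 1" for e t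
  proof -
    define r where "r = exp (- e)"
    have r: "0 < r" "r < 1" "1 / 3 \<le> r"
    proof -
      show "0 < r" "r < 1" using e by (auto simp: r_def)
      have "exp e \<le> 3" by (rule order_trans[OF _ exp_le]) (use e in simp)
      then show "1 / 3 \<le> r" by (simp add: r_def exp_minus field_simps)
    qed
    have r1: "1 - r \<le> e" using exp_ge_add_one_self[of "- e"] by (simp add: r_def)
    have r2: "e / 2 \<le> 1 - r"
    proof -
      have "r \<le> 1 / (1 + e)"
        using exp_ge_add_one_self[of e] e by (simp add: r_def exp_minus divide_simps)
      also have "1 / (1 + e) \<le> 1 - e / 2"
      proof -
        have "1 \<le> (1 - e / 2) * (1 + e)" using e mult_left_mono[of e 1 e] by (simp add: algebra_simps)
        then show ?thesis using e by (simp add: pos_divide_le_eq)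
      qed
      finally show ?thesis by simp
    qed
    let ?x = "LINT u:{-1..1}|\<nu>. rpoisson l (t * u) r"
    have tu: "\<bar>t * u\<bar> \<le> \<bar>u\<bar>" for u
      using mult_right_mono[OF t, of "\<bar>u\<bar>"] by (simp add: abs_mult)
    have eq: "zker l \<nu> t (of_real r) = of_real ?x"
    proof -
      have "zker l \<nu> t (of_real r) = (LINT u:{-1..1}|\<nu>. of_real (rpoisson l (t * u) r))"
        unfolding zker_def
      proof (rule set_lebesgue_integral_cong)
        show "\<forall>u. u \<in> {-1..1} \<longrightarrow> gpoisson l (t * u) (of_real r) = of_real (rpoisson l (t * u) r)"
        proof (intro allI impI)
          fix u :: real assume "u \<in> {-1..1}"
          then have "\<bar>t * u\<bar> \<le> 1" using tu[of u] by auto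
          then show "gpoisson l (t * u) (of_real r) = of_real (rpoisson l (t * u) r)"
            using r by (intro gpoisson_of_real) auto
        qed
      qed (use sets in auto)
      also have "\<dots> = of_real ?x" by (rule set_integral_complex_of_real)
      finally show ?thesis .
    qed
    have x0: "0 \<le> ?x"
      unfolding set_lebesgue_integral_def
      by (rule Bochner_Integration.integral_nonneg) (use r in \<open>auto intro!: mult_nonneg_nonneg rpoisson_nonneg\<close>)
    have pt: "indicator {-1..1} u *\<^sub>R rpoisson l (t * u) r \<le> 2 * e * ((1 / 4) powr (- (l + 1)) * (e\<^sup>2 + (1 - \<bar>u\<bar>)) powr (- (s + k + 1)))" for u
    proof (cases "u \<in> {-1..1}")
      case True
      have a: "1 - \<bar>u\<bar> \<le> 1 - t * u" using tu[of u] by (simp add: abs_le_iff)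
      have a0: "0 \<le> 1 - \<bar>u\<bar>" using True by auto
      have "(1 / 3) * (1 - \<bar>u\<bar>) \<le> r * (1 - t * u)" using a a0 r by (intro mult_mono) auto
      moreover have "(e / 2)\<^sup>2 \<le> (1 - r)\<^sup>2" using r2 e by (intro power_mono) auto
      moreover have "1 - 2 * (t * u) * r + r\<^sup>2 = (1 - r)\<^sup>2 + 2 * (r * (1 - t * u))" by (simp add: power2_eq_square algebra_simps)
      ultimately have b: "(1 / 4) * (e\<^sup>2 + (1 - \<bar>u\<bar>)) \<le> 1 - 2 * (t * u) * r + r\<^sup>2"
        using a0 by (simp add: power_divide)
      have e2: "e\<^sup>2 + (1 - \<bar>u\<bar>) > 0" using e a0 by (intro add_pos_nonneg) auto
      have "(1 - 2 * (t * u) * r + r\<^sup>2) powr (- (l + 1)) \<le> ((1 / 4) * (e\<^sup>2 + (1 - \<bar>u\<bar>))) powr (- (l + 1))"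
        using b e2 s k by (intro powr_mono2') (auto simp: l_def)
      also have "\<dots> = (1 / 4) powr (- (l + 1)) * (e\<^sup>2 + (1 - \<bar>u\<bar>)) powr (- (l + 1))"
        by (rule powr_mult)
      finally have p: "(1 - 2 * (t * u) * r + r\<^sup>2) powr (- (l + 1)) \<le> (1 / 4) powr (- (l + 1)) * (e\<^sup>2 + (1 - \<bar>u\<bar>)) powr (- (l + 1))" .
      have "1 - r\<^sup>2 = (1 - r) * (1 + r)" by (simp add: power2_eq_square algebra_simps)
      also have "\<dots> \<le> e * 2" using r r1 by (intro mult_mono) auto
      finally have "1 - r\<^sup>2 \<le> 2 * e" by simp
      moreover have "0 \<le> 1 - r\<^sup>2" using r by (simp add: power_le_one)
      ultimately have "rpoisson l (t * u) r \<le> 2 * e * ((1 / 4) powr (- (l + 1)) * (e\<^sup>2 + (1 - \<bar>u\<bar>)) powr (- (l + 1)))"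
        unfolding rpoisson_def using p e by (intro mult_mono) auto
      then show ?thesis using True by (simp add: l_def)
    next
      case False
      then show ?thesis using e by simp
    qed
    have "(\<integral>\<^sup>+u. ennreal (indicator {-1..1} u *\<^sub>R rpoisson l (t * u) r) \<partial>\<nu>)
       \<le> (\<integral>\<^sup>+u. ennreal (2 * e * (1 / 4) powr (- (l + 1))) * ennreal ((e\<^sup>2 + (1 - \<bar>u\<bar>)) powr (- (s + k + 1))) \<partial>\<nu>)"
      using pt e by (intro nn_integral_mono) (auto simp: ennreal_mult'[symmetric] mult.assoc intro!: ennreal_leI)
    also have "\<dots> = ennreal (2 * e * (1 / 4) powr (- (l + 1))) * (\<integral>\<^sup>+u. ennreal ((e\<^sup>2 + (1 - \<bar>u\<bar>)) powr (- (s + k + 1))) \<partial>\<nu>)"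
    proof (rule nn_integral_cmult)
      have "(\<lambda>u. ennreal ((e\<^sup>2 + (1 - \<bar>u\<bar>)) powr (- (s + k + 1)))) \<in> borel_measurable borel" by measurable
      then show "(\<lambda>u. ennreal ((e\<^sup>2 + (1 - \<bar>u\<bar>)) powr (- (s + k + 1)))) \<in> borel_measurable \<nu>"
        using sets by (simp cong: measurable_cong_sets)
    qed
    also have "\<dots> \<le> ennreal (2 * e * (1 / 4) powr (- (l + 1))) * ennreal (C * e powr (- 2 * s - 2))"
      by (intro mult_left_mono C(2) e) simp
    also have "\<dots> = ennreal (2 * e * (1 / 4) powr (- (l + 1)) * (C * e powr (- 2 * s - 2)))"
      using e by (intro ennreal_mult'[symmetric]) auto
    finally have nn: "(\<integral>\<^sup>+u. ennreal (indicator {-1..1} u *\<^sub>R rpoisson l (t * u) r) \<partial>\<nu>) \<le> ennreal (2 * e * (1 / 4) powr (- (l + 1)) * (C * e powr (- 2 * s - 2)))" .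
    have "?x \<le> 2 * e * (1 / 4) powr (- (l + 1)) * (C * e powr (- 2 * s - 2))"
      unfolding set_lebesgue_integral_def
    proof (rule integral_real_bounded)
      show "0 \<le> 2 * e * (1 / 4) powr (- (l + 1)) * (C * e powr (- 2 * s - 2))" using e C by simp
    qed (rule nn)
    also have "\<dots> = D * (e powr 1 * e powr (- 2 * s - 2))"
      using e by (simp add: D_def mult_ac)
    also have "e powr 1 * e powr (- 2 * s - 2) = e powr (- (2 * s + 1))"
    proof -
      have "1 + (- 2 * s - 2) = - (2 * s + 1)" by simp
      then show ?thesis by (simp only: powr_add[symmetric])
    qed
    finally show ?thesis using eq x0 unfolding r_def[symmetric] by blast
  qed
  show ?thesis using main D unfolding l_def by (intro exI[of _ D]) auto
qed

section \<open>Zonal h-harmonics\<close>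

lemma norm_sq_hpoly: "(\<lambda>x :: real ^ 'n. ((norm x)\<^sup>2) ^ m) \<in> hpoly (2 * m)"
proof -
  have "(\<lambda>x :: real ^ 'n. \<Sum>i\<in>UNIV. x $ i ^ 2) \<in> hpoly 2"
    by (rule hpoly_sum) (use hpoly_power[OF hpoly_coord, of _ 2] in auto)
  moreover have "(norm x)\<^sup>2 = (\<Sum>i\<in>UNIV. x $ i ^ 2)" for x :: "real ^ 'n"
    by (simp add: norm_vec_def L2_set_def sum_nonneg)
  ultimately have "(\<lambda>x :: real ^ 'n. (norm x)\<^sup>2) \<in> hpoly 2" by simp
  from hpoly_power[OF this, of m] show ?thesis by (simp add: mult.commute)
qed

definition zmono :: "'n \<Rightarrow> nat \<Rightarrow> nat \<Rightarrow> real ^ 'n \<Rightarrow> real" where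
  "zmono i a m x = x $ i ^ a * ((norm x)\<^sup>2) ^ m"

lemma zmono_hpoly: "zmono i a m \<in> hpoly (a + 2 * m)"
  using hpoly_mult[OF hpoly_power[OF hpoly_coord, of i a] norm_sq_hpoly, of m] by (simp add: zmono_def[abs_def])

lemma norm_sq_axis:
  "(norm (x + t *\<^sub>R axis i 1 :: real ^ 'n))\<^sup>2 = (norm x)\<^sup>2 + 2 * t * x $ i + t\<^sup>2"
  unfolding power2_norm_eq_inner
  by (simp add: inner_add_left inner_add_right inner_axis inner_axis' inner_axis_axis power2_eq_square algebra_simps)

lemma norm_sq_power_deriv:
  "axis_diff i (\<lambda>x :: real ^ 'n. ((norm x)\<^sup>2) ^ m)"
  "partial_deriv i (\<lambda>x :: real ^ 'n. ((norm x)\<^sup>2) ^ m) x = 2 * real m * x $ i * ((norm x)\<^sup>2) ^ (m - 1)"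
proof -
  have "((\<lambda>t. ((norm (x + t *\<^sub>R axis i 1))\<^sup>2) ^ m) has_real_derivative 2 * real m * x $ i * ((norm x)\<^sup>2) ^ (m - 1)) (at 0)" for x :: "real ^ 'n"
    unfolding norm_sq_axis by (auto intro!: derivative_eq_intros)
  from axis_diffI[OF this]
  show "axis_diff i (\<lambda>x :: real ^ 'n. ((norm x)\<^sup>2) ^ m)"
  "partial_deriv i (\<lambda>x :: real ^ 'n. ((norm x)\<^sup>2) ^ m) x = 2 * real m * x $ i * ((norm x)\<^sup>2) ^ (m - 1)"
    by auto
qed

lemma dunkl_zmono_same:
  "dunkl \<kappa> i (zmono i a m) x = dunkl_coeff (\<kappa> $ i) a * zmono i (a - 1) m x + 2 * real m * zmono i (a + 1) (m - 1) x"
  using dunkl_power_mult_even[OF norm_sq_power_deriv(1)[of i m], of \<kappa> a x]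
  by (simp add: zmono_def[abs_def] norm_sq_power_deriv(2))

text \<open>A second coordinate is kept explicit because differentiating twice brings it in.\<close>

lemma dunkl_zmono_other:
  assumes ij: "j \<noteq> i"
  shows "dunkl \<kappa> j (\<lambda>x. x $ j ^ b * zmono i a m x) x =
     dunkl_coeff (\<kappa> $ j) b * (x $ j ^ (b - 1) * zmono i a m x) + 2 * real m * (x $ j ^ (b + 1) * zmono i a (m - 1) x)"
proof -
  have "((\<lambda>t. zmono i a m (x + t *\<^sub>R axis j 1)) has_real_derivative 2 * real m * x $ j * zmono i a (m - 1) x) (at 0)" for x :: "real ^ 'a"
  proof -
    have "((\<lambda>t. x $ i ^ a * ((norm (x + t *\<^sub>R axis j 1))\<^sup>2) ^ m) has_real_derivative x $ i ^ a * partial_deriv j (\<lambda>x. ((norm x)\<^sup>2) ^ m) x) (at 0)"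
      by (intro DERIV_cmult axis_diffD norm_sq_power_deriv)
    moreover have z: "zmono i a m (x + t *\<^sub>R axis j 1) = x $ i ^ a * ((norm (x + t *\<^sub>R axis j 1))\<^sup>2) ^ m" for t
      using ij by (simp add: zmono_def axis_def)
    ultimately show ?thesis unfolding z by (simp add: zmono_def norm_sq_power_deriv(2) mult_ac)
  qed
  note d = axis_diffI[OF this]
  have r: "zmono i a m (coord_refl j x) = zmono i a m x" for x :: "real ^ 'a"
    using ij by (simp add: zmono_def coord_refl_nth)
  show ?thesis
    using dunkl_power_mult_even[OF d(1) r, of \<kappa> b x] by (simp add: d(2) algebra_simps)
qed

text \<open>
  The h-Laplacian maps the span of these functions into itself, which reduces the construction of zonal
  h-harmonics to a two-term recursion for coefficients.
\<close>

lemma h_laplacian_zmono: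
  fixes \<kappa> :: "real ^ 'n"
  shows "h_laplacian \<kappa> (zmono i a m) x =
     dunkl_coeff (\<kappa> $ i) a * dunkl_coeff (\<kappa> $ i) (a - 1) * zmono i (a - 2) m x
     + 4 * real m * (real m + real a + (real CARD('n) - 2) / 2 + (\<Sum>j\<in>UNIV. \<kappa> $ j)) * zmono i a (m - 1) x"
proof -
  let ?e = "dunkl_coeff (\<kappa> $ i)"
  have pm: "(norm x)\<^sup>2 * ((norm x)\<^sup>2) ^ (m - 2) * (real m * (real m - 1)) = ((norm x)\<^sup>2) ^ (m - 1) * (real m * (real m - 1))"
  proof (cases "m \<le> 1")
    case True
    then have "real m * (real m - 1) = 0" by (cases m) auto
    then show ?thesis by simp
  next
    case False
    then have "m - 1 = Suc (m - 2)" by simp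
    then show ?thesis by simp
  qed
  have other: "dunkl \<kappa> j (dunkl \<kappa> j (zmono i a m)) x =
      2 * real m * ((1 + 2 * \<kappa> $ j) * zmono i a (m - 1) x) + 4 * (real m * (real m - 1)) * ((x $ j)\<^sup>2 * zmono i a (m - 2) x)"
    if "j \<noteq> i" for j
  proof -
    have "dunkl \<kappa> j (zmono i a m) = (\<lambda>x. (2 * real m) * (x $ j ^ 1 * zmono i a (m - 1) x))"
      using dunkl_zmono_other[OF that, of \<kappa> 0 a m] by (simp add: fun_eq_iff)
    moreover have "axis_diff j (\<lambda>x. x $ j ^ 1 * zmono i a (m - 1) x)"
      by (rule hpoly_axis_diff[OF hpoly_mult[OF hpoly_power[OF hpoly_coord] zmono_hpoly]])
    ultimately have "dunkl \<kappa> j (dunkl \<kappa> j (zmono i a m)) x = 2 * real m * dunkl \<kappa> j (\<lambda>x. x $ j ^ 1 * zmono i a (m - 1) x) x"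
      by (simp only: dunkl_cmult)
    also have "dunkl \<kappa> j (\<lambda>x. x $ j ^ 1 * zmono i a (m - 1) x) x = (1 + 2 * \<kappa> $ j) * zmono i a (m - 1) x + 2 * real (m - 1) * ((x $ j)\<^sup>2 * zmono i a (m - 2) x)"
      unfolding dunkl_zmono_other[OF that] by (simp add: dunkl_coeff_def numeral_2_eq_2)
    finally show ?thesis by (cases m) (auto simp: algebra_simps)
  qed
  have same: "dunkl \<kappa> i (dunkl \<kappa> i (zmono i a m)) x =
      ?e a * ?e (a - 1) * zmono i (a - 2) m x + 2 * real m * ((?e a + ?e (a + 1)) * zmono i a (m - 1) x)
      + 4 * (real m * (real m - 1)) * ((x $ i)\<^sup>2 * zmono i a (m - 2) x)"
  proof -
    have "dunkl \<kappa> i (zmono i a m) = (\<lambda>x. ?e a * zmono i (a - 1) m x + (2 * real m) * zmono i (a + 1) (m - 1) x)"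
      by (simp add: dunkl_zmono_same fun_eq_iff)
    then have "dunkl \<kappa> i (dunkl \<kappa> i (zmono i a m)) x = ?e a * dunkl \<kappa> i (zmono i (a - 1) m) x + (2 * real m) * dunkl \<kappa> i (zmono i (a + 1) (m - 1)) x"
      by (simp only: dunkl_add dunkl_cmult hpoly_axis_diff[OF zmono_hpoly])
    also have "?e a * dunkl \<kappa> i (zmono i (a - 1) m) x = ?e a * ?e (a - 1) * zmono i (a - 2) m x + 2 * real m * (?e a * zmono i a (m - 1) x)"
      unfolding dunkl_zmono_same by (cases a) (auto simp: algebra_simps numeral_2_eq_2)
    also have "(2 * real m) * dunkl \<kappa> i (zmono i (a + 1) (m - 1)) x = 2 * real m * (?e (a + 1) * zmono i a (m - 1) x) + 4 * (real m * (real m - 1)) * ((x $ i)\<^sup>2 * zmono i a (m - 2) x)"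
      unfolding dunkl_zmono_same by (cases m) (auto simp: zmono_def algebra_simps power2_eq_square numeral_2_eq_2)
    finally show ?thesis by (simp add: algebra_simps)
  qed
  let ?Z = "zmono i a (m - 1) x"
  have ee: "?e a + ?e (a + 1) = 2 * real a + (1 + 2 * \<kappa> $ i)" by (auto simp: dunkl_coeff_def)
  have "h_laplacian \<kappa> (zmono i a m) x = (\<Sum>j\<in>UNIV. 2 * real m * ((1 + 2 * \<kappa> $ j) * ?Z) + 4 * (real m * (real m - 1)) * ((x $ j)\<^sup>2 * zmono i a (m - 2) x)
      + (if j = i then ?e a * ?e (a - 1) * zmono i (a - 2) m x + 4 * real m * real a * ?Z else 0))"
    unfolding h_laplacian_def
  proof (rule sum.cong)
    fix j
    show "dunkl \<kappa> j (dunkl \<kappa> j (zmono i a m)) x = 2 * real m * ((1 + 2 * \<kappa> $ j) * ?Z) + 4 * (real m * (real m - 1)) * ((x $ j)\<^sup>2 * zmono i a (m - 2) x)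
      + (if j = i then ?e a * ?e (a - 1) * zmono i (a - 2) m x + 4 * real m * real a * ?Z else 0)"
    proof (cases "j = i")
      case True
      show ?thesis unfolding True same ee by (simp add: algebra_simps)
    qed (simp add: other)
  qed simp
  also have "\<dots> = 2 * real m * ((real CARD('n) + 2 * (\<Sum>j\<in>UNIV. \<kappa> $ j)) * ?Z)
      + 4 * (real m * (real m - 1)) * ((norm x)\<^sup>2 * zmono i a (m - 2) x)
      + (?e a * ?e (a - 1) * zmono i (a - 2) m x + 4 * real m * real a * ?Z)"
  proof -
    have n: "(norm x)\<^sup>2 = (\<Sum>j\<in>UNIV. (x $ j)\<^sup>2)" by (simp add: norm_vec_def L2_set_def sum_nonneg)
    have "(\<Sum>j\<in>UNIV. 2 * real m * ((1 + 2 * \<kappa> $ j) * ?Z)) = 2 * real m * ((\<Sum>j\<in>UNIV. 1 + 2 * \<kappa> $ j) * ?Z)"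
      by (simp only: sum_distrib_left sum_distrib_right)
    moreover have "(\<Sum>j\<in>UNIV. 1 + 2 * \<kappa> $ j) = real CARD('n) + 2 * (\<Sum>j\<in>UNIV. \<kappa> $ j)"
      by (simp add: sum.distrib sum_distrib_left)
    moreover have "(\<Sum>j\<in>UNIV. 4 * (real m * (real m - 1)) * ((x $ j)\<^sup>2 * zmono i a (m - 2) x)) = 4 * (real m * (real m - 1)) * ((norm x)\<^sup>2 * zmono i a (m - 2) x)"
      unfolding n by (simp only: sum_distrib_left sum_distrib_right)
    ultimately show ?thesis by (simp add: sum.distrib)
  qed
  also have "4 * (real m * (real m - 1)) * ((norm x)\<^sup>2 * zmono i a (m - 2) x) = 4 * (real m * (real m - 1)) * ?Z"
  proof -
    have "4 * (real m * (real m - 1)) * ((norm x)\<^sup>2 * zmono i a (m - 2) x) = 4 * x $ i ^ a * ((norm x)\<^sup>2 * ((norm x)\<^sup>2) ^ (m - 2) * (real m * (real m - 1)))"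
      by (simp only: zmono_def mult_ac)
    also have "\<dots> = 4 * (real m * (real m - 1)) * ?Z" unfolding pm by (simp only: zmono_def mult_ac)
    finally show ?thesis .
  qed
  finally have L: "h_laplacian \<kappa> (zmono i a m) x = 2 * real m * ((real CARD('n) + 2 * (\<Sum>j\<in>UNIV. \<kappa> $ j)) * ?Z)
      + 4 * (real m * (real m - 1)) * ?Z + (?e a * ?e (a - 1) * zmono i (a - 2) m x + 4 * real m * real a * ?Z)" .
  have "4 * real m * (real m + real a + (real CARD('n) - 2) / 2 + (\<Sum>j\<in>UNIV. \<kappa> $ j)) =
      4 * (real m * (real m - 1)) + 4 * real m * real a + 2 * real m * (real CARD('n) + 2 * (\<Sum>j\<in>UNIV. \<kappa> $ j))"
    by (simp add: field_simps)
  then show ?thesis unfolding L by (simp only: distrib_right mult.assoc)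
qed

text \<open>
  The average over \<open>u\<close> of the homogeneous extensions of \<open>x \<mapsto> zpoly l n (x $ i * u)\<close>.
\<close>

definition zfun :: "real \<Rightarrow> real measure \<Rightarrow> 'n \<Rightarrow> nat \<Rightarrow> real ^ 'n \<Rightarrow> real" where
  "zfun l \<nu> i n x = (\<Sum>m\<le>n div 2. zcoef l n m * (\<integral>u. u ^ (n - 2 * m) \<partial>\<nu>) * zmono i (n - 2 * m) m x)"

lemma zfun_hpoly: "zfun l \<nu> i n \<in> hpoly n"
  unfolding zfun_def[abs_def]
proof (rule hpoly_sum)
  fix m assume "m \<in> {..n div 2}"
  then have "n - 2 * m + 2 * m = n" by auto
  then have "zmono i (n - 2 * m) m \<in> hpoly n" using zmono_hpoly[of i "n - 2 * m" m] by simp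
  then show "(\<lambda>x. zcoef l n m * (\<integral>u. u ^ (n - 2 * m) \<partial>\<nu>) * zmono i (n - 2 * m) m x) \<in> hpoly n" by (rule hpoly.scale)
qed simp

text \<open>
  After applying the h-Laplacian, the part of each term that comes from differentiating the power of
  \<open>x $ i\<close> cancels against the radial part of the next term. The moment recursion is exactly what converts
  the factors \<open>dunkl_coeff\<close> into those of the classical Gegenbauer recursion.
\<close>

lemma zfun_harm:
  fixes \<kappa> :: "real ^ 'n"
  assumes \<nu>: "zonal_measure (\<kappa> $ i) s \<nu>" and l: "l = (real CARD('n) - 2) / 2 + (\<Sum>j\<in>UNIV. \<kappa> $ j)" and l0: "l > 0"
  shows "zfun l \<nu> i n \<in> h_harm \<kappa> n"
proof -
  define M where "M a = (\<integral>u. u ^ a \<partial>\<nu>)" for a :: nat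
  let ?e = "dunkl_coeff (\<kappa> $ i)"
  have mom: "?e (a + 2) * ?e (a + 1) * M (a + 2) = real (a + 2) * real (a + 1) * M a" for a
    using \<nu> unfolding zonal_measure_def M_def dunkl_coeff_def by simp
  have "h_laplacian \<kappa> (zfun l \<nu> i n) x = 0" for x
  proof -
    let ?c = "\<lambda>m. zcoef l n m * M (n - 2 * m)"
    let ?t = "\<lambda>m. ?c m * (?e (n - 2 * m) * ?e (n - 2 * m - 1) * zmono i (n - 2 * m - 2) m x)"
    let ?b = "\<lambda>m. ?c m * (4 * real m * (real m + real (n - 2 * m) + l) * zmono i (n - 2 * m) (m - 1) x)"
    have "h_laplacian \<kappa> (zfun l \<nu> i n) x = (\<Sum>m\<le>n div 2. h_laplacian \<kappa> (\<lambda>x. ?c m * zmono i (n - 2 * m) m x) x)"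
      unfolding zfun_def[abs_def] M_def
    proof (rule h_laplacian_sum[of _ _ n])
      fix m assume "m \<in> {..n div 2}"
      then have "n - 2 * m + 2 * m = n" by auto
      then show "(\<lambda>x. zcoef l n m * (\<integral>u. u ^ (n - 2 * m) \<partial>\<nu>) * zmono i (n - 2 * m) m x) \<in> hpoly n"
        using hpoly.scale[OF zmono_hpoly[of i "n - 2 * m" m]] by simp
    qed simp
    also have "\<dots> = (\<Sum>m\<le>n div 2. ?t m + ?b m)"
      unfolding h_laplacian_cmult[OF zmono_hpoly] h_laplacian_zmono l
      by (intro sum.cong refl) (simp only: distrib_left add.assoc)
    also have "\<dots> = (\<Sum>m\<le>n div 2. ?t m) + (\<Sum>m\<le>n div 2. ?b m)" by (rule sum.distrib)
    also have "(\<Sum>m\<le>n div 2. ?t m) = (\<Sum>m<n div 2. ?t m)"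
    proof -
      have "?t (n div 2) = 0"
      proof -
        have "n - 2 * (n div 2) = 0 \<or> n - 2 * (n div 2) = 1" by presburger
        then show ?thesis by auto
      qed
      then show ?thesis by (simp add: lessThan_Suc_atMost[symmetric])
    qed
    also have "(\<Sum>m\<le>n div 2. ?b m) = (\<Sum>m<n div 2. ?b (Suc m))"
      by (subst sum.atMost_shift) simp
    also have "(\<Sum>m<n div 2. ?t m) + (\<Sum>m<n div 2. ?b (Suc m)) = (\<Sum>m<n div 2. ?t m + ?b (Suc m))"
      by (rule sum.distrib[symmetric])
    also have "\<dots> = 0"
    proof (rule sum.neutral, rule ballI)
      fix m assume "m \<in> {..<n div 2}"
      then have "2 + 2 * m \<le> n" by auto
      then obtain a' where "n = 2 + 2 * m + a'" using le_Suc_ex by blast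
      then obtain a where a: "n = a + 2 + 2 * m" by (metis add.commute add.left_commute)
      have ea: "n - 2 * m = a + 2" "n - 2 * m - 1 = a + 1" "n - 2 * m - 2 = a" "n - 2 * Suc m = a" "n - m = Suc (a + m + 1)" "n - Suc m = a + m + 1"
        using a by auto
      have f: "fact (a + 2) = real (a + 2) * (real (a + 1) * fact a)" by (simp add: fact_Suc algebra_simps)
      define q where "q = (l + n) / l * ((-1) ^ m * pochhammer l (a + m + 1) * 2 ^ a)"
      have z1: "zcoef l n m = q * (l + real (a + m + 1)) * 4 / (fact (a + 2) * fact m)"
        unfolding zcoef_def ea q_def pochhammer_Suc by (simp add: algebra_simps)
      have z2: "zcoef l n (Suc m) = - q / (fact a * (real (Suc m) * fact m))"
        unfolding zcoef_def ea q_def fact_Suc by simp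
      have "?t m = (q * (l + real (a + m + 1)) * 4 / (fact (a + 2) * fact m)) * (?e (a + 2) * ?e (a + 1) * M (a + 2)) * zmono i a m x"
        unfolding z1 ea(3) unfolding ea(2) unfolding ea(1) by (simp only: mult_ac)
      also have "\<dots> = q * (l + real (a + m + 1)) * 4 * M a / (fact a * fact m) * zmono i a m x"
        unfolding mom f by simp
      finally have 1: "?t m = q * (l + real (a + m + 1)) * 4 * M a / (fact a * fact m) * zmono i a m x" .
      have "?b (Suc m) = - q / (fact a * (real (Suc m) * fact m)) * M a * (4 * real (Suc m) * (real (Suc m) + real a + l) * zmono i a m x)"
        unfolding ea z2 by simp
      also have "\<dots> = - (q * (l + real (a + m + 1)) * 4 * M a / (fact a * fact m) * zmono i a m x)"
      proof -
        have "real (Suc m) + real a + l = l + real (a + m + 1)" by simp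
        moreover have "- q / (fact a * (real (Suc m) * fact m)) * M a * (4 * real (Suc m) * y * z) = - (q * y * 4 * M a / (fact a * fact m) * z)" for y z
          by (simp add: divide_simps del: of_nat_Suc)
        ultimately show ?thesis by simp
      qed
      finally show "?t m + ?b (Suc m) = 0" using 1 by simp
    qed
    finally show ?thesis .
  qed
  then show ?thesis by (simp add: h_harm_def zfun_hpoly)
qed

lemma zonal_moment_integrable:
  assumes \<nu>: "zonal_measure k s \<nu>"
  shows "integrable \<nu> (\<lambda>u. u ^ a)"
proof -
  have sets: "sets \<nu> = sets borel" and one: "emeasure \<nu> UNIV = 1" and ae: "AE u in \<nu>. \<bar>u\<bar> \<le> 1"
    using \<nu> by (auto simp: zonal_measure_def)
  interpret finite_measure \<nu>
    by (rule finite_measureI) (use one sets_eq_imp_space_eq[OF sets] in simp)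
  show ?thesis
  proof (rule integrable_const_bound[of _ 1])
    show "AE u in \<nu>. norm (u ^ a) \<le> 1" using ae by eventually_elim (simp add: power_abs power_le_one)
    show "(\<lambda>u. u ^ a) \<in> borel_measurable \<nu>"
      using sets by (simp cong: measurable_cong_sets)
  qed
qed

lemma zfun_sphere:
  assumes \<nu>: "zonal_measure k s \<nu>" and x: "norm x = 1"
  shows "zfun l \<nu> i n x = (LINT u:{-1..1}|\<nu>. zpoly l n (x $ i * u))"
proof -
  have sets: "sets \<nu> = sets borel" and ae: "AE u in \<nu>. \<bar>u\<bar> \<le> 1"
    using \<nu> by (auto simp: zonal_measure_def)
  have "zfun l \<nu> i n x = (\<Sum>m\<le>n div 2. \<integral>u. zcoef l n m * x $ i ^ (n - 2 * m) * u ^ (n - 2 * m) \<partial>\<nu>)"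
    by (simp add: zfun_def zmono_def x mult_ac)
  also have "\<dots> = (\<integral>u. (\<Sum>m\<le>n div 2. zcoef l n m * x $ i ^ (n - 2 * m) * u ^ (n - 2 * m)) \<partial>\<nu>)"
    by (rule Bochner_Integration.integral_sum[symmetric]) (intro integrable_mult_right zonal_moment_integrable[OF \<nu>])
  also have "\<dots> = (\<integral>u. zpoly l n (x $ i * u) \<partial>\<nu>)"
    by (simp add: zpoly_def power_mult_distrib mult_ac)
  also have "\<dots> = (\<integral>u. indicator {-1..1} u *\<^sub>R zpoly l n (x $ i * u) \<partial>\<nu>)"
  proof (rule integral_cong_AE)
    have c: "continuous_on UNIV (\<lambda>u. zpoly l n (x $ i * u))" unfolding zpoly_def by (intro continuous_intros)
    have "(\<lambda>u. zpoly l n (x $ i * u)) \<in> borel_measurable borel"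
      by (rule borel_measurable_continuous_onI[OF c])
    then show "(\<lambda>u. zpoly l n (x $ i * u)) \<in> borel_measurable \<nu>" using sets by (simp cong: measurable_cong_sets)
    have "(\<lambda>u. indicator {-1..1} u *\<^sub>R zpoly l n (x $ i * u)) \<in> borel_measurable borel"
      by (rule borel_measurable_continuous_on_indicator[OF _ continuous_on_subset[OF c]]) auto
    then show "(\<lambda>u. indicator {-1..1} u *\<^sub>R zpoly l n (x $ i * u)) \<in> borel_measurable \<nu>" using sets by (simp cong: measurable_cong_sets)
    show "AE u in \<nu>. zpoly l n (x $ i * u) = indicator {-1..1} u *\<^sub>R zpoly l n (x $ i * u)"
      using ae by eventually_elim (auto simp: indicator_def)
  qed
  finally show ?thesis by (simp add: set_lebesgue_integral_def)
qed

lemma coord_le_1: "norm x = 1 \<Longrightarrow> \<bar>x $ i * u\<bar> \<le> \<bar>u\<bar>" for x :: "real ^ 'n"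
  using component_le_norm_cart[of x i] mult_right_mono[of "\<bar>x $ i\<bar>" 1 "\<bar>u\<bar>"] by (simp add: abs_mult)

lemma zfun_bound:
  assumes \<nu>: "zonal_measure k s \<nu>" and x: "norm x = 1" and l: "l > 0" and \<rho>: "0 < \<rho>" "\<rho> < 1"
  shows "\<bar>zfun l \<nu> i n x\<bar> \<le> 2 * (1 - \<rho>) powr (- 2 * (l + 1)) / \<rho> ^ n"
proof -
  let ?B = "2 * (1 - \<rho>) powr (- 2 * (l + 1)) / \<rho> ^ n"
  have sets: "sets \<nu> = sets borel" and one: "emeasure \<nu> UNIV = 1"
    using \<nu> by (auto simp: zonal_measure_def)
  interpret finite_measure \<nu>
    by (rule finite_measureI) (use one sets_eq_imp_space_eq[OF sets] in simp)
  have m1: "measure \<nu> UNIV = 1" using one by (simp add: measure_def)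
  have B0: "0 \<le> ?B" using \<rho> by simp
  have "norm (\<integral>u. indicator {-1..1} u *\<^sub>R zpoly l n (x $ i * u) \<partial>\<nu>) \<le> (\<integral>u. norm (indicator {-1..1} u *\<^sub>R zpoly l n (x $ i * u)) \<partial>\<nu>)"
    by (rule integral_norm_bound)
  also have "\<dots> \<le> (\<integral>u. ?B \<partial>\<nu>)"
  proof (rule integral_mono)
    have c: "continuous_on UNIV (\<lambda>u. zpoly l n (x $ i * u))" unfolding zpoly_def by (intro continuous_intros)
    have m: "(\<lambda>u. indicator {-1..1} u *\<^sub>R zpoly l n (x $ i * u)) \<in> borel_measurable borel"
      by (rule borel_measurable_continuous_on_indicator[OF _ continuous_on_subset[OF c]]) auto
    show b: "norm (indicator {-1..1} u *\<^sub>R zpoly l n (x $ i * u)) \<le> ?B" for u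
    proof (cases "u \<in> {-1..1}")
      case True
      then have "\<bar>x $ i * u\<bar> \<le> 1" using coord_le_1[OF x, of i u] by auto
      then show ?thesis using zpoly_bound[OF l _ \<rho>] True by simp
    qed (use B0 in simp)
    have "integrable \<nu> (\<lambda>u. indicator {-1..1} u *\<^sub>R zpoly l n (x $ i * u))"
      using m sets b by (intro integrable_const_bound[of _ ?B] AE_I2) (simp_all cong: measurable_cong_sets)
    then show "integrable \<nu> (\<lambda>u. norm (indicator {-1..1} u *\<^sub>R zpoly l n (x $ i * u)))"
      by (rule integrable_norm)
  qed simp
  also have "\<dots> = ?B" using m1 sets_eq_imp_space_eq[OF sets] by simp
  finally show ?thesis unfolding zfun_sphere[OF \<nu> x] set_lebesgue_integral_def by simp
qed

lemma zfun_summable: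
  fixes r :: "'b :: {real_normed_field, banach}"
  assumes \<nu>: "zonal_measure k s \<nu>" and x: "norm x = 1" and l: "l > 0" and r: "norm r < 1"
  shows "summable (\<lambda>n. norm (of_real (zfun l \<nu> i n x) * r ^ n))"
proof -
  define \<rho> where "\<rho> = (1 + norm r) / 2"
  have \<rho>: "0 < \<rho>" "\<rho> < 1" "norm r < \<rho>" using r norm_ge_zero[of r] by (auto simp: \<rho>_def simp del: norm_ge_zero)
  have "summable (\<lambda>n. 2 * (1 - \<rho>) powr (- 2 * (l + 1)) * (norm r / \<rho>) ^ n)"
    using \<rho> by (intro summable_mult summable_geometric) simp
  then show ?thesis
  proof (rule summable_comparison_test'[where N=0])
    fix n
    have "\<bar>zfun l \<nu> i n x\<bar> * norm r ^ n \<le> 2 * (1 - \<rho>) powr (- 2 * (l + 1)) / \<rho> ^ n * norm r ^ n"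
      by (intro mult_right_mono zfun_bound[OF \<nu> x l \<rho>(1,2)]) simp
    then show "norm (norm (of_real (zfun l \<nu> i n x) * r ^ n)) \<le> 2 * (1 - \<rho>) powr (- 2 * (l + 1)) * (norm r / \<rho>) ^ n"
      by (simp add: norm_mult norm_power power_divide)
  qed
qed

text \<open>
  Summation and the average over \<open>u\<close> may be exchanged because the bound of \<open>zpoly_bound\<close> is uniform in \<open>u\<close>.
\<close>

lemma zfun_generating:
  fixes x :: "real ^ 'n"
  assumes \<nu>: "zonal_measure k s \<nu>" and x: "norm x = 1" and l: "l > 0" and r: "norm r < 1"
  shows "(\<lambda>n. of_real (zfun l \<nu> i n x) * r ^ n) sums zker l \<nu> (x $ i) r"
proof -
  have sets: "sets \<nu> = sets borel" and one: "emeasure \<nu> UNIV = 1"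
    using \<nu> by (auto simp: zonal_measure_def)
  interpret finite_measure \<nu>
    by (rule finite_measureI) (use one sets_eq_imp_space_eq[OF sets] in simp)
  have m1: "measure \<nu> UNIV = 1" using one by (simp add: measure_def)
  define \<rho> where "\<rho> = (1 + norm r) / 2"
  have \<rho>: "0 < \<rho>" "\<rho> < 1" "norm r < \<rho>" using r norm_ge_zero[of r] by (auto simp: \<rho>_def simp del: norm_ge_zero)
  let ?f = "\<lambda>n u. indicator {-1..1} u *\<^sub>R (of_real (zpoly l n (x $ i * u)) * r ^ n)"
  let ?B = "\<lambda>n. 2 * (1 - \<rho>) powr (- 2 * (l + 1)) * (norm r / \<rho>) ^ n"
  have B0: "0 \<le> ?B n" for n using \<rho> by simp
  have sB: "summable ?B" using \<rho> by (intro summable_mult summable_geometric) simp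
  have tu: "\<bar>x $ i * u\<bar> \<le> 1" if "u \<in> {-1..1}" for u using coord_le_1[OF x, of i u] that by auto
  have b: "norm (?f n u) \<le> ?B n" for n u
  proof (cases "u \<in> {-1..1}")
    case True
    have "\<bar>zpoly l n (x $ i * u)\<bar> * norm r ^ n \<le> 2 * (1 - \<rho>) powr (- 2 * (l + 1)) / \<rho> ^ n * norm r ^ n"
      by (intro mult_right_mono zpoly_bound[OF l tu[OF True] \<rho>(1,2)]) simp
    then show ?thesis using True by (simp add: norm_mult norm_power power_divide)
  qed (use B0 in simp)
  have m: "?f n \<in> borel_measurable \<nu>" for n
  proof -
    have "continuous_on {-1..1} (\<lambda>u. of_real (zpoly l n (x $ i * u)) * r ^ n)"
      unfolding zpoly_def by (intro continuous_intros)
    then have "?f n \<in> borel_measurable borel"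
      by (intro borel_measurable_continuous_on_indicator) auto
    then show ?thesis using sets by (simp cong: measurable_cong_sets)
  qed
  have int: "integrable \<nu> (?f n)" for n
    using b m by (intro integrable_const_bound[of _ "?B n"] AE_I2) auto
  have sums: "(\<lambda>n. \<integral>u. ?f n u \<partial>\<nu>) sums (\<integral>u. (\<Sum>n. ?f n u) \<partial>\<nu>)"
  proof (rule sums_integral[OF int])
    show "AE u in \<nu>. summable (\<lambda>n. norm (?f n u))"
      by (rule AE_I2, rule summable_comparison_test'[OF sB]) (use b in simp)
    have nb: "norm (\<integral>u. norm (?f n u) \<partial>\<nu>) \<le> ?B n" for n
    proof -
      have "(\<integral>u. norm (?f n u) \<partial>\<nu>) \<le> (\<integral>u. ?B n \<partial>\<nu>)"
        using b int by (intro integral_mono integrable_norm) auto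
      then show ?thesis using m1 sets_eq_imp_space_eq[OF sets] by simp
    qed
    show "summable (\<lambda>n. \<integral>u. norm (?f n u) \<partial>\<nu>)"
      by (rule summable_comparison_test'[OF sB, where N=0]) (rule nb)
  qed
  have "(\<Sum>n. ?f n u) = indicator {-1..1} u *\<^sub>R gpoisson l (x $ i * u) r" for u
  proof (cases "u \<in> {-1..1}")
    case True
    then show ?thesis using sums_unique[OF zpoly_generating_function[OF l tu[OF True] r]] by simp
  qed simp
  moreover have "(\<integral>u. ?f n u \<partial>\<nu>) = of_real (zfun l \<nu> i n x) * r ^ n" for n
  proof -
    have "(\<integral>u. ?f n u \<partial>\<nu>) = (\<integral>u. of_real (indicator {-1..1} u *\<^sub>R zpoly l n (x $ i * u)) * r ^ n \<partial>\<nu>)"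
      by (rule Bochner_Integration.integral_cong) (auto simp: indicator_def)
    also have "\<dots> = of_real (\<integral>u. indicator {-1..1} u *\<^sub>R zpoly l n (x $ i * u) \<partial>\<nu>) * r ^ n"
      by (simp only: integral_mult_left_zero integral_complex_of_real)
    finally show ?thesis unfolding zfun_sphere[OF \<nu> x] set_lebesgue_integral_def .
  qed
  ultimately show ?thesis using sums by (simp add: zker_def set_lebesgue_integral_def)
qed


section \<open>The Poisson kernel at a vertex as a test function\<close>

lemma cesaro_coeff_pos:
  assumes "\<delta> > -1"
  shows "cesaro_coeff \<delta> n > 0"
proof -
  have "cesaro_coeff \<delta> n = (\<Prod>i=0..<n. (\<delta> + 1 + real i)) / fact n"
    unfolding cesaro_coeff_def gbinomial_prod_rev
    by (intro arg_cong2[where f="(/)"] prod.reindex_bij_witness[of _ "\<lambda>i. n - 1 - i" "\<lambda>i. n - 1 - i"]) (auto simp: of_nat_diff)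
  moreover have "(\<Prod>i=0..<n. (\<delta> + 1 + real i)) > 0" using assms by (intro prod_pos) auto
  ultimately show ?thesis by simp
qed

text \<open>
  The binomial series, since the coefficients are binomial coefficients of \<open>- (\<delta> + 1)\<close> up to sign.
\<close>

lemma cesaro_coeff_sums:
  fixes z :: complex
  assumes "norm z < 1"
  shows "(\<lambda>n. of_real (cesaro_coeff \<delta> n) * z ^ n) sums ((1 - z) powr (- of_real (\<delta> + 1)))"
proof -
  have "(\<lambda>n. ((- of_real (\<delta> + 1)) gchoose n) * (- z) ^ n) sums (1 + (- z)) powr (- of_real (\<delta> + 1))"
    using assms by (intro gen_binomial_complex) simp
  moreover have "((- of_real (\<delta> + 1)) gchoose n) * (- z) ^ n = of_real (cesaro_coeff \<delta> n) * z ^ n" for n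
  proof -
    have "((- (\<delta> + 1)) gchoose n) = (-1) ^ n * cesaro_coeff \<delta> n"
      unfolding cesaro_coeff_def by (subst gbinomial_minus) (simp add: algebra_simps)
    then have "(of_real ((- (\<delta> + 1)) gchoose n) :: complex) = (-1) ^ n * of_real (cesaro_coeff \<delta> n)" by simp
    moreover have "(of_real ((- (\<delta> + 1)) gchoose n) :: complex) = (- of_real (\<delta> + 1)) gchoose n"
      by (simp add: gbinomial_prod_rev)
    ultimately have G: "((- of_real (\<delta> + 1)) gchoose n) = (-1) ^ n * (of_real (cesaro_coeff \<delta> n) :: complex)" by simp
    have "((- of_real (\<delta> + 1)) gchoose n) * (- z) ^ n = ((-1) ^ n * (-1) ^ n) * (of_real (cesaro_coeff \<delta> n) * z ^ n)"
      by (simp only: G power_minus[of z n] mult_ac)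
    also have "(-1 :: complex) ^ n * (-1) ^ n = 1" by (simp flip: power_mult_distrib)
    finally show ?thesis by simp
  qed
  ultimately show ?thesis by simp
qed

lemma cesaro_coeff_real_sums:
  assumes "\<bar>r\<bar> < 1"
  shows "(\<lambda>n. cesaro_coeff \<delta> n * r ^ n) sums ((1 - r) powr (- (\<delta> + 1)))"
proof -
  have "(\<lambda>n. of_real (cesaro_coeff \<delta> n) * (of_real r :: complex) ^ n) sums ((1 - of_real r) powr (- of_real (\<delta> + 1)))"
    using assms by (intro cesaro_coeff_sums) simp
  moreover have "((1 - of_real r :: complex) powr (- of_real (\<delta> + 1))) = of_real ((1 - r) powr (- (\<delta> + 1)))"
    using powr_of_real[of "1 - r" "- (\<delta> + 1)"] assms by simp
  moreover have "(\<lambda>n. of_real (cesaro_coeff \<delta> n) * (of_real r :: complex) ^ n) = (\<lambda>n. of_real (cesaro_coeff \<delta> n * r ^ n))" by simp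
  ultimately show ?thesis by (simp only: sums_of_real_iff)
qed

text \<open>
  The index \<open>l\<close> belongs to the Gegenbauer kernels and \<open>s\<close> governs the size of their average near the
  vertex; for \<open>\<kappa> $ i\<close> minimal, \<open>s\<close> is \<open>sigma_index \<kappa>\<close>.
\<close>

locale vertex_kernel =
  fixes \<kappa> :: "real ^ 'n" and i :: 'n and s l :: real and \<nu> :: "real measure"
  assumes kap: "\<And>j. 0 \<le> \<kappa> $ j"
    and l_def: "l = (real CARD('n) - 2) / 2 + (\<Sum>j\<in>UNIV. \<kappa> $ j)"
    and s_def: "s = l - \<kappa> $ i" and s_pos: "s > 0"
    and zonal: "zonal_measure (\<kappa> $ i) s \<nu>"
begin

abbreviation "\<mu> \<equiv> hmeasure \<kappa>"
abbreviation "Z \<equiv> zfun l \<nu> i"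

lemma l_pos: "l > 0" using s_def s_pos kap[of i] by linarith

lemma Z_harm: "Z n \<in> h_harm \<kappa> n"
  by (rule zfun_harm[OF zonal l_def l_pos])

lemma Z_continuous: "continuous_on A (Z n)"
  by (rule continuous_hpoly[OF zfun_hpoly])

lemma Z_0: "Z 0 x = 1"
proof -
  have sets: "sets \<nu> = sets borel" and one: "emeasure \<nu> UNIV = 1"
    using zonal by (auto simp: zonal_measure_def)
  have "measure \<nu> UNIV = 1" using one by (simp add: measure_def)
  then show ?thesis using l_pos sets_eq_imp_space_eq[OF sets] by (simp add: zfun_def zcoef_def zmono_def)
qed

text \<open>
  The Poisson kernel of the h-harmonic expansion with pole at the vertex and radius \<open>exp (- e)\<close>.
\<close>

definition F :: "real \<Rightarrow> real ^ 'n \<Rightarrow> real" where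
  "F e x = (\<Sum>n. Z n x * exp (- e) ^ n)"

lemma F_summable:
  assumes "e > 0" "norm x = 1"
  shows "summable (\<lambda>n. \<bar>Z n x * exp (- e) ^ n\<bar>)"
  using zfun_summable[OF zonal assms(2) l_pos, of "exp (- e) :: real" i] assms(1) by simp

lemma F_sums: "e > 0 \<Longrightarrow> norm x = 1 \<Longrightarrow> (\<lambda>n. Z n x * exp (- e) ^ n) sums F e x"
  unfolding F_def using summable_rabs_cancel[OF F_summable] by (rule summable_sums)

text \<open>
  The bound on zonal functions is used at the geometric mean \<open>exp (- e / 2)\<close> of the radius and one.
\<close>

lemma F_majorant:
  assumes e: "e > 0"
  shows "\<exists>B. summable B \<and> (\<forall>n x. norm x = 1 \<longrightarrow> \<bar>Z n x * exp (- e) ^ n\<bar> \<le> B n)"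
proof -
  define \<rho> where "\<rho> = exp (- e / 2)"
  have \<rho>: "0 < \<rho>" "\<rho> < 1" "exp (- e) = \<rho> * \<rho>" using e by (auto simp: \<rho>_def exp_add[symmetric])
  show ?thesis
  proof (intro exI[of _ "\<lambda>n. 2 * (1 - \<rho>) powr (- 2 * (l + 1)) * \<rho> ^ n"] conjI allI impI)
    show "summable (\<lambda>n. 2 * (1 - \<rho>) powr (- 2 * (l + 1)) * \<rho> ^ n)"
      using \<rho> by (intro summable_mult summable_geometric) simp
    fix n and x :: "real ^ 'n" assume x: "norm x = 1"
    have "\<bar>Z n x\<bar> * exp (- e) ^ n \<le> 2 * (1 - \<rho>) powr (- 2 * (l + 1)) / \<rho> ^ n * exp (- e) ^ n"
      by (intro mult_right_mono zfun_bound[OF zonal x l_pos \<rho>(1,2)]) simp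
    also have "\<dots> = 2 * (1 - \<rho>) powr (- 2 * (l + 1)) * \<rho> ^ n"
      unfolding \<rho>(3) using \<rho>(1) by (simp add: power_mult_distrib)
    finally show "\<bar>Z n x * exp (- e) ^ n\<bar> \<le> 2 * (1 - \<rho>) powr (- 2 * (l + 1)) * \<rho> ^ n" by (simp add: abs_mult)
  qed
qed

lemma F_continuous:
  assumes e: "e > 0"
  shows "continuous_on (sphere 0 1) (F e)"
proof -
  obtain B where B: "summable B" "\<And>n x. norm x = 1 \<Longrightarrow> \<bar>Z n x * exp (- e) ^ n\<bar> \<le> B n"
    using F_majorant[OF e] by blast
  have "uniform_limit (sphere 0 1) (\<lambda>N x. \<Sum>n<N. Z n x * exp (- e) ^ n) (\<lambda>x. \<Sum>n. Z n x * exp (- e) ^ n) sequentially"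
    by (rule Weierstrass_m_test[OF _ B(1)]) (use B(2) in auto)
  then have "continuous_on (sphere 0 1) (\<lambda>x. \<Sum>n. Z n x * exp (- e) ^ n)"
    by (rule uniform_limit_theorem[rotated]) (auto intro!: always_eventually continuous_intros Z_continuous)
  then show ?thesis by (simp add: F_def[abs_def])
qed

lemma F_integral:
  assumes e: "e > 0" and g: "continuous_on (sphere 0 1) g"
  shows "(\<lambda>n. (\<integral>x. Z n x * g x \<partial>\<mu>) * exp (- e) ^ n) sums (\<integral>x. F e x * g x \<partial>\<mu>)"
proof -
  interpret finite_measure \<mu> by (rule finite_measure_hmeasure[OF kap])
  obtain B where B: "summable B" "\<And>n x. norm x = 1 \<Longrightarrow> \<bar>Z n x * exp (- e) ^ n\<bar> \<le> B n"
    using F_majorant[OF e] by blast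
  obtain b where b: "b > 0" "\<And>x. x \<in> sphere 0 1 \<Longrightarrow> \<bar>g x\<bar> \<le> b"
    using continuous_sphere_bounded[OF g] by blast
  let ?f = "\<lambda>n x. Z n x * exp (- e) ^ n * g x"
  have bd: "\<bar>?f n x\<bar> \<le> B n * b" if "norm x = 1" for n x
    unfolding abs_mult[of _ "g x"] using B(2)[OF that, of n] b(2)[of x] that
    by (intro mult_mono) (auto intro: order_trans[OF abs_ge_zero])
  have sB: "summable (\<lambda>n. B n * b)" using B(1) by (rule summable_mult2)
  have c: "continuous_on (sphere 0 1) (?f n)" for n by (intro continuous_intros Z_continuous g)
  have int: "integrable \<mu> (?f n)" for n by (rule integrable_hmeasure_continuous[OF kap c])
  have one: "measure \<mu> (sphere 0 1) = 1" using emeasure_hmeasure_space[OF kap] by (simp add: measure_def)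
  have "(\<lambda>n. \<integral>x. ?f n x \<partial>\<mu>) sums (\<integral>x. (\<Sum>n. ?f n x) \<partial>\<mu>)"
  proof (rule sums_integral[OF int])
    show "AE x in \<mu>. summable (\<lambda>n. norm (?f n x))"
      by (rule AE_I2, rule summable_comparison_test'[OF sB, where N=0]) (use bd in simp)
    have nb: "norm (\<integral>x. norm (?f n x) \<partial>\<mu>) \<le> B n * b" for n
    proof -
      have "(\<integral>x. norm (?f n x) \<partial>\<mu>) \<le> (\<integral>x. B n * b \<partial>\<mu>)"
        using bd by (intro integral_mono integrable_norm int) auto
      then show ?thesis by (simp add: one)
    qed
    show "summable (\<lambda>n. \<integral>x. norm (?f n x) \<partial>\<mu>)"
      by (rule summable_comparison_test'[OF sB, where N=0]) (rule nb)
  qed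
  moreover have "(\<integral>x. (\<Sum>n. ?f n x) \<partial>\<mu>) = (\<integral>x. F e x * g x \<partial>\<mu>)"
  proof (rule Bochner_Integration.integral_cong)
    fix x assume "x \<in> space \<mu>"
    then have "norm x = 1" by simp
    from sums_mult2[OF F_sums[OF e this], of "g x"] show "(\<Sum>n. ?f n x) = F e x * g x"
      by (rule sums_unique[symmetric])
  qed simp
  moreover have "(\<integral>x. ?f n x \<partial>\<mu>) = (\<integral>x. Z n x * g x \<partial>\<mu>) * exp (- e) ^ n" for n
  proof -
    have "?f n x = (Z n x * g x) * exp (- e) ^ n" for x by simp
    then show ?thesis by (simp only: integral_mult_left_zero)
  qed
  ultimately show ?thesis by simp
qed

lemma F_integral_one:
  assumes e: "e > 0"
  shows "(\<integral>x. F e x \<partial>\<mu>) = 1"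
proof -
  have z: "(\<integral>x. Z n x \<partial>\<mu>) = (if n = 0 then 1 else 0)" for n
  proof (cases "n = 0")
    case True
    have "measure \<mu> (sphere 0 1) = 1" using emeasure_hmeasure_space[OF kap] by (simp add: measure_def)
    then show ?thesis using True by (simp add: Z_0)
  next
    case False
    then show ?thesis using integral_harm_zero[OF kap Z_harm, of n] by simp
  qed
  have "(\<lambda>n. (\<integral>x. Z n x * 1 \<partial>\<mu>) * exp (- e) ^ n) sums (\<integral>x. F e x * 1 \<partial>\<mu>)"
    by (rule F_integral[OF e]) simp
  then have "(\<lambda>n. if n = 0 then 1 else 0) sums (\<integral>x. F e x \<partial>\<mu>)"
    by (simp add: z if_distrib[of "\<lambda>a. a * _"] cong: if_cong)
  moreover have "(\<lambda>n. if n = 0 then 1 else 0 :: real) sums 1"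
    using sums_single[of 0 "\<lambda>_. 1 :: real"] by simp
  ultimately show ?thesis by (rule sums_unique2)
qed

text \<open>
  By orthogonality a basis element of degree \<open>n\<close> sees only the \<open>n\<close>-th term of \<open>F e\<close>.
\<close>

lemma h_proj_F:
  assumes e: "e > 0" and x: "x \<in> sphere 0 1"
  shows "h_proj \<kappa> n (F e) x = exp (- e) ^ n * Z n x"
proof -
  obtain E where E: "finite E" "E \<subseteq> h_harm \<kappa> n"
    "\<forall>P\<in>h_harm \<kappa> n. \<forall>x. P x = (\<Sum>e\<in>E. (\<integral>y. P y * e y \<partial>\<mu>) * e x)"
    "\<forall>f x. integrable \<mu> f \<longrightarrow> x \<in> sphere 0 1 \<longrightarrow> h_proj \<kappa> n f x = (\<Sum>e\<in>E. (\<integral>y. f y * e y \<partial>\<mu>) * e x)"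
    using h_proj_basis[OF kap, of n] by auto
  have I: "(\<integral>y. F e y * g y \<partial>\<mu>) = exp (- e) ^ n * (\<integral>y. Z n y * g y \<partial>\<mu>)" if g: "g \<in> h_harm \<kappa> n" for g
  proof -
    have "g \<in> hpoly n" using g by (simp add: h_harm_def)
    then have "(\<lambda>m. (\<integral>x. Z m x * g x \<partial>\<mu>) * exp (- e) ^ m) sums (\<integral>x. F e x * g x \<partial>\<mu>)"
      by (intro F_integral[OF e] continuous_hpoly)
    moreover have "(\<integral>x. Z m x * g x \<partial>\<mu>) * exp (- e) ^ m = (if m = n then (\<integral>x. Z m x * g x \<partial>\<mu>) * exp (- e) ^ m else 0)" for m
      using harm_orthogonal[OF kap Z_harm[of m] g] by auto
    ultimately have "(\<lambda>m. if m = n then (\<integral>x. Z m x * g x \<partial>\<mu>) * exp (- e) ^ m else 0) sums (\<integral>x. F e x * g x \<partial>\<mu>)"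
      by simp
    then have "(\<integral>x. F e x * g x \<partial>\<mu>) = (\<integral>x. Z n x * g x \<partial>\<mu>) * exp (- e) ^ n"
      using sums_single[of n "\<lambda>m. (\<integral>x. Z m x * g x \<partial>\<mu>) * exp (- e) ^ m"] by (rule sums_unique2)
    then show ?thesis by simp
  qed
  have "h_proj \<kappa> n (F e) x = (\<Sum>g\<in>E. (\<integral>y. F e y * g y \<partial>\<mu>) * g x)"
    using E(4) integrable_hmeasure_continuous[OF kap F_continuous[OF e]] x by blast
  also have "\<dots> = (\<Sum>g\<in>E. exp (- e) ^ n * ((\<integral>y. Z n y * g y \<partial>\<mu>) * g x))"
    using E(2) by (intro sum.cong) (auto simp: I)
  also have "\<dots> = exp (- e) ^ n * Z n x"
    by (simp only: sum_distrib_left[symmetric] E(3)[rule_format, OF Z_harm, symmetric])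
  finally show ?thesis .
qed

lemma F_eq_zker:
  assumes e: "e > 0" and x: "norm x = 1"
  shows "zker l \<nu> (x $ i) (of_real (exp (- e))) = of_real (F e x)"
proof -
  have "(\<lambda>n. of_real (Z n x) * of_real (exp (- e)) ^ n) sums zker l \<nu> (x $ i) (of_real (exp (- e)))"
    using e by (intro zfun_generating[OF zonal x l_pos]) simp
  moreover have "(\<lambda>n. of_real (Z n x) * of_real (exp (- e)) ^ n :: complex) sums of_real (F e x)"
    using F_sums[OF e x] by (subst (asm) sums_of_real_iff[symmetric, where 'a=complex]) simp
  ultimately show ?thesis by (rule sums_unique2)
qed

lemma F_bounds: "\<exists>C>0. \<forall>e\<in>{0<..1}. \<forall>x\<in>sphere 0 1. 0 \<le> F e x \<and> F e x \<le> C * e powr (- (2 * s + 1))"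
proof -
  have sl: "s + \<kappa> $ i = l" using s_def by simp
  obtain C where C: "C > 0" "\<forall>e\<in>{0<..1}. \<forall>t. \<bar>t\<bar> \<le> 1 \<longrightarrow>
    (\<exists>x. zker l \<nu> t (of_real (exp (- e))) = of_real x \<and> 0 \<le> x \<and> x \<le> C * e powr (- (2 * s + 1)))"
    using zker_real[OF zonal kap s_pos] unfolding sl by blast
  have "0 \<le> F e x \<and> F e x \<le> C * e powr (- (2 * s + 1))" if e: "e \<in> {0<..1}" and x: "x \<in> sphere 0 1" for e x
  proof -
    have n: "norm x = 1" using x by simp
    have "\<bar>x $ i\<bar> \<le> 1" using component_le_norm_cart[of x i] n by simp
    then obtain y where "zker l \<nu> (x $ i) (of_real (exp (- e))) = of_real y" "0 \<le> y" "y \<le> C * e powr (- (2 * s + 1))"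
      using C(2) e by blast
    moreover have "zker l \<nu> (x $ i) (of_real (exp (- e))) = of_real (F e x)" using F_eq_zker[OF _ n] e by simp
    ultimately show ?thesis by (metis of_real_eq_iff)
  qed
  then show ?thesis using C(1) by blast
qed

lemma cesaro_F:
  assumes \<delta>: "\<delta> > -1" and e: "e > 0" and x: "norm x = 1"
  shows "cesaro_coeff \<delta> n * cesaro_mean \<kappa> \<delta> n (F e) x = (\<Sum>j\<le>n. cesaro_coeff \<delta> (n - j) * (exp (- e) ^ j * Z j x))"
  using cesaro_coeff_pos[OF \<delta>, of n] h_proj_F[OF e, of x] x by (simp add: cesaro_mean_def)

text \<open>
  Cesaro summation is a convolution, so the generating function is the Cauchy product of the binomial
  series and the expansion of the Poisson kernel.
\<close>

lemma cesaro_F_sums: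
  fixes z :: complex
  assumes \<delta>: "\<delta> > -1" and e: "e > 0" and x: "norm x = 1" and z: "norm z < 1"
  shows "(\<lambda>n. of_real (cesaro_coeff \<delta> n * cesaro_mean \<kappa> \<delta> n (F e) x) * z ^ n) sums
      ((1 - z) powr (- of_real (\<delta> + 1)) * zker l \<nu> (x $ i) (of_real (exp (- e)) * z))"
    and "summable (\<lambda>n. norm (of_real (cesaro_coeff \<delta> n * cesaro_mean \<kappa> \<delta> n (F e) x) * z ^ n))"
proof -
  let ?a = "\<lambda>n. of_real (cesaro_coeff \<delta> n) * z ^ n"
  let ?b = "\<lambda>n. of_real (Z n x) * (of_real (exp (- e)) * z) ^ n"
  have ez: "norm (of_real (exp (- e)) * z) < 1"
    using z e mult_strict_mono[of "exp (- e)" 1 "norm z" 1] by (simp add: norm_mult)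
  have sb: "summable (\<lambda>n. norm (?b n))" by (rule zfun_summable[OF zonal x l_pos ez])
  have na: "norm (?a n) = cesaro_coeff \<delta> n * norm z ^ n" for n
    using cesaro_coeff_pos[OF \<delta>, of n] by (simp add: norm_mult norm_power)
  have sa: "summable (\<lambda>n. norm (?a n))"
    unfolding na using cesaro_coeff_real_sums[of "norm z" \<delta>] z by (auto intro: sums_summable)
  have conv: "(\<Sum>k\<le>n. ?a k * ?b (n - k)) = of_real (cesaro_coeff \<delta> n * cesaro_mean \<kappa> \<delta> n (F e) x) * z ^ n" for n
  proof -
    have "(\<Sum>k\<le>n. ?a k * ?b (n - k)) = (\<Sum>j\<le>n. ?a (n - j) * ?b j)"
      by (rule sum.reindex_bij_witness[of _ "\<lambda>k. n - k" "\<lambda>k. n - k"]) auto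
    also have "\<dots> = (\<Sum>j\<le>n. of_real (cesaro_coeff \<delta> (n - j) * (exp (- e) ^ j * Z j x)) * z ^ n)"
    proof (rule sum.cong)
      fix j assume "j \<in> {..n}"
      then have "z ^ (n - j) * z ^ j = z ^ n" by (simp flip: power_add)
      then show "?a (n - j) * ?b j = of_real (cesaro_coeff \<delta> (n - j) * (exp (- e) ^ j * Z j x)) * z ^ n"
        by (simp add: power_mult_distrib)
    qed simp
    finally show ?thesis unfolding cesaro_F[OF \<delta> e x] by (simp add: sum_distrib_right)
  qed
  have suma: "suminf ?a = (1 - z) powr (- of_real (\<delta> + 1))"
    using cesaro_coeff_sums[OF z] by (rule sums_unique[symmetric])
  have sumb: "suminf ?b = zker l \<nu> (x $ i) (of_real (exp (- e)) * z)"
    using zfun_generating[OF zonal x l_pos ez] by (rule sums_unique[symmetric])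
  show "(\<lambda>n. of_real (cesaro_coeff \<delta> n * cesaro_mean \<kappa> \<delta> n (F e) x) * z ^ n) sums
      ((1 - z) powr (- of_real (\<delta> + 1)) * zker l \<nu> (x $ i) (of_real (exp (- e)) * z))"
    using Cauchy_product_sums[OF sa sb] unfolding conv suma sumb .
  have "summable (\<lambda>n. \<Sum>k\<le>n. norm (?a k) * norm (?b (n - k)))"
    using summable_Cauchy_product[of "\<lambda>n. norm (?a n)" "\<lambda>n. norm (?b n)"] sa sb by simp
  then show "summable (\<lambda>n. norm (of_real (cesaro_coeff \<delta> n * cesaro_mean \<kappa> \<delta> n (F e) x) * z ^ n))"
  proof (rule summable_comparison_test'[where N=0])
    fix n
    show "norm (norm (of_real (cesaro_coeff \<delta> n * cesaro_mean \<kappa> \<delta> n (F e) x) * z ^ n)) \<le> (\<Sum>k\<le>n. norm (?a k) * norm (?b (n - k)))"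
      unfolding conv[symmetric] by (simp only: real_norm_def abs_norm_cancel, rule order_trans[OF norm_sum], intro sum_mono) (simp only: norm_mult order_refl)
  qed
qed

text \<open>
  The generating function is evaluated at a complex point, depending on \<open>x\<close>, at which the Poisson kernel
  does not cancel. Its modulus there is at most the sum of the moduli of the terms.
\<close>

lemma cesaro_F_lower:
  assumes \<delta>: "\<delta> > -1"
  shows "\<exists>M>0. \<exists>c>0. \<forall>e\<in>{0<..1}. \<forall>x\<in>sphere 0 1. \<forall>y. x $ i > 0 \<longrightarrow> (x $ i)\<^sup>2 + y\<^sup>2 = 1 \<longrightarrow> M * e \<le> y \<longrightarrow> y \<le> 1 / 2 \<longrightarrow>
     summable (\<lambda>n. cesaro_coeff \<delta> n * exp (- e) ^ n * \<bar>cesaro_mean \<kappa> \<delta> n (F e) x\<bar>) \<and>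
     c * (e powr (- s - 1) * y powr (- \<delta> - s - 1)) \<le> (\<Sum>n. cesaro_coeff \<delta> n * exp (- e) ^ n * \<bar>cesaro_mean \<kappa> \<delta> n (F e) x\<bar>)"
proof -
  have sl: "s + \<kappa> $ i = l" using s_def by simp
  obtain K M c where K: "K > 0" "M > 0" "c > 0" and low: "\<And>e t y. e > 0 \<Longrightarrow> t > 0 \<Longrightarrow> t\<^sup>2 + y\<^sup>2 = 1 \<Longrightarrow> M * e \<le> y \<Longrightarrow> y \<le> 1 / 2 \<Longrightarrow>
     c * (y * (y * e) powr (- s - 1)) \<le> norm (zker l \<nu> t (exp (- (of_real e * Complex 2 (- K))) * Complex t (- y)))"
    using zker_lower[OF kap s_pos zonal] unfolding sl by metis
  define A where "A = 3 * (1 + K) / M + 2"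
  have A: "A > 0" using K by (simp add: A_def add_pos_pos)
  have main: "summable (\<lambda>n. cesaro_coeff \<delta> n * exp (- e) ^ n * \<bar>cesaro_mean \<kappa> \<delta> n (F e) x\<bar>) \<and>
     A powr (- \<delta> - 1) * c * (e powr (- s - 1) * y powr (- \<delta> - s - 1)) \<le> (\<Sum>n. cesaro_coeff \<delta> n * exp (- e) ^ n * \<bar>cesaro_mean \<kappa> \<delta> n (F e) x\<bar>)"
    if e: "e \<in> {0<..1}" and xs: "x \<in> sphere 0 1" and x0: "x $ i > 0" and xy: "(x $ i)\<^sup>2 + y\<^sup>2 = 1" and My: "M * e \<le> y" and y2: "y \<le> 1 / 2" for e x y
  proof -
    have x: "norm x = 1" using xs by simp
    have e0: "e > 0" and e1: "e \<le> 1" using e by auto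
    have y0: "y > 0" using My K e0 by (smt (verit) mult_pos_pos)
    define t where "t = x $ i"
    define q where "q = Complex t (- y)"
    \<comment> \<open>With this choice \<open>exp (- e) * z\<close> is the point at which \<open>zker_lower\<close> evaluates the kernel, while \<open>norm z = exp (- e)\<close>.\<close>
    define z where "z = exp (of_real e * Complex (-1) K) * q"
    have nq: "norm q = 1" using xy by (simp add: q_def t_def cmod_def)
    have nz: "norm z = exp (- e)" by (simp add: z_def norm_mult nq norm_exp_eq_Re)
    have z1: "norm z < 1" using e0 nz by simp
    have t1: "t \<le> 1" using component_le_norm_cart[of x i] x by (simp add: t_def)
    have ez: "of_real (exp (- e)) * z = exp (- (of_real e * Complex 2 (- K))) * Complex t (- y)"
    proof -
      have "of_real (exp (- e)) * exp (of_real e * Complex (-1) K) = exp (- (of_real e * Complex 2 (- K)))"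
        unfolding exp_of_real[symmetric] exp_add[symmetric] by (rule arg_cong[where f=exp]) (simp add: complex_eq_iff)
      then show ?thesis by (simp only: z_def q_def mult.assoc[symmetric])
    qed
    have n1: "norm (1 - z) \<le> A * y"
    proof -
      have "1 - z = (1 - q) - (exp (of_real e * Complex (-1) K) - 1) * q" by (simp add: z_def algebra_simps)
      then have "norm (1 - z) \<le> norm (1 - q) + norm ((exp (of_real e * Complex (-1) K) - 1) * q)"
        by (simp only: norm_triangle_ineq4)
      moreover have "norm (1 - q) \<le> 2 * y"
      proof -
        have "norm (1 - q) \<le> \<bar>1 - t\<bar> + \<bar>y\<bar>" using cmod_le[of "1 - q"] by (simp add: q_def)
        moreover have "1 - t \<le> y"
        proof -
          have "1 - t \<le> (1 - t) * (1 + t)" using t1 x0 by (simp add: t_def mult_le_cancel_left1)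
          also have "\<dots> = y * y" using xy by (simp add: t_def power2_eq_square algebra_simps)
          also have "\<dots> \<le> 1 * y" using y0 y2 by (intro mult_right_mono) auto
          finally show ?thesis by simp
        qed
        ultimately show ?thesis using t1 y0 by linarith
      qed
      moreover have "norm ((exp (of_real e * Complex (-1) K) - 1) * q) \<le> 3 * (1 + K) / M * y"
      proof -
        have "norm (exp (of_real e * Complex (-1) K) - 1) \<le> 3 * norm (of_real e * Complex (-1) K)"
          by (rule exp_taylor1) (use e0 e1 in simp)
        also have "norm (of_real e * Complex (-1) K) \<le> e * (1 + K)"
          unfolding norm_mult using cmod_le[of "Complex (-1) K"] K e0 by simp
        also have "3 * (e * (1 + K)) = 3 * (1 + K) / M * (M * e)" using K by simp
        also have "\<dots> \<le> 3 * (1 + K) / M * y" using My K by (intro mult_left_mono) auto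
        finally show ?thesis by (simp add: norm_mult nq)
      qed
      ultimately show ?thesis by (simp add: A_def distrib_right)
    qed
    have z0: "1 - z \<noteq> 0" using z1 by auto
    have "A powr (- \<delta> - 1) * y powr (- \<delta> - 1) = (A * y) powr (- \<delta> - 1)" by (simp add: powr_mult)
    also have "\<dots> \<le> norm (1 - z) powr (- \<delta> - 1)" using n1 z0 \<delta> by (intro powr_mono2') auto
    also have "\<dots> = norm ((1 - z) powr (- of_real (\<delta> + 1)))"
      using norm_powr_of_real[OF z0, of "- (\<delta> + 1)"] by simp
    finally have P: "A powr (- \<delta> - 1) * y powr (- \<delta> - 1) \<le> norm ((1 - z) powr (- of_real (\<delta> + 1)))" .
    have L: "c * (y * (y * e) powr (- s - 1)) \<le> norm (zker l \<nu> t (of_real (exp (- e)) * z))"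
      unfolding ez by (rule low) (use e0 x0 xy My y2 in \<open>auto simp: t_def\<close>)
    note S = cesaro_F_sums[OF \<delta> e0 x z1]
    have nn: "norm (of_real (cesaro_coeff \<delta> n * cesaro_mean \<kappa> \<delta> n (F e) x) * z ^ n) = cesaro_coeff \<delta> n * exp (- e) ^ n * \<bar>cesaro_mean \<kappa> \<delta> n (F e) x\<bar>" for n
      using cesaro_coeff_pos[OF \<delta>, of n] by (simp add: norm_mult norm_power nz abs_mult)
    have "A powr (- \<delta> - 1) * y powr (- \<delta> - 1) * (c * (y * (y * e) powr (- s - 1))) \<le> norm ((1 - z) powr (- of_real (\<delta> + 1))) * norm (zker l \<nu> t (of_real (exp (- e)) * z))"
      using P L y0 K by (intro mult_mono) auto
    also have "\<dots> = norm (\<Sum>n. of_real (cesaro_coeff \<delta> n * cesaro_mean \<kappa> \<delta> n (F e) x) * z ^ n)"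
      by (simp only: sums_unique[OF S(1), symmetric] norm_mult t_def)
    also have "\<dots> \<le> (\<Sum>n. norm (of_real (cesaro_coeff \<delta> n * cesaro_mean \<kappa> \<delta> n (F e) x) * z ^ n))"
      by (rule summable_norm[OF S(2)])
    also have "A powr (- \<delta> - 1) * y powr (- \<delta> - 1) * (c * (y * (y * e) powr (- s - 1))) = A powr (- \<delta> - 1) * c * (e powr (- s - 1) * y powr (- \<delta> - s - 1))"
    proof -
      have "y powr (- \<delta> - 1) * (y powr 1 * y powr (- s - 1)) = y powr (- \<delta> - s - 1)"
        by (simp only: powr_add[symmetric]) (simp add: algebra_simps)
      then have "y powr (- \<delta> - 1) * (y * y powr (- s - 1)) = y powr (- \<delta> - s - 1)" using y0 by simp
      then show ?thesis by (simp add: powr_mult mult_ac)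
    qed
    finally show ?thesis using S(2) unfolding nn by simp
  qed
  show ?thesis
    using main K A by (intro exI[of _ M] exI[of _ "A powr (- \<delta> - 1) * c"] conjI) auto
qed

end

section \<open>The gliding hump\<close>

text \<open>
  The coefficient \<open>c k\<close> is made small compared with the bounds of the rows chosen before, so that new
  columns hardly disturb old rows. Only then are \<open>\<tau> k\<close> and \<open>f k\<close> chosen, with an entry large enough to
  beat, after multiplication by \<open>c k\<close>, all contributions of the old columns to the new row.
\<close>

lemma gliding_hump:
  fixes a :: "'a \<Rightarrow> 'b \<Rightarrow> real"
  assumes rows: "\<And>\<tau>. \<tau> \<in> Y \<Longrightarrow> \<exists>b. \<forall>f\<in>X. \<bar>a \<tau> f\<bar> \<le> b"
    and columns: "\<And>f. f \<in> X \<Longrightarrow> \<exists>b. \<forall>\<tau>\<in>Y. \<bar>a \<tau> f\<bar> \<le> b"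
    and unbounded: "\<And>B. \<exists>\<tau>\<in>Y. \<exists>f\<in>X. a \<tau> f > B"
  obtains c :: "nat \<Rightarrow> real" and f \<tau> where "\<And>k. 0 < c k" "\<And>k. c k \<le> (1 / 2) ^ Suc k"
    "\<And>k. f k \<in> X" "\<And>k. \<tau> k \<in> Y" "\<And>k. real k \<le> \<bar>\<Sum>j. c j * a (\<tau> k) (f j)\<bar>"
proof -
  obtain b0 where b0: "\<And>\<tau> f. \<tau> \<in> Y \<Longrightarrow> f \<in> X \<Longrightarrow> \<bar>a \<tau> f\<bar> \<le> b0 \<tau>"
    using rows by metis
  define b where "b = (\<lambda>\<tau>. max 0 (b0 \<tau>))"
  have b: "\<And>\<tau> f. \<tau> \<in> Y \<Longrightarrow> f \<in> X \<Longrightarrow> \<bar>a \<tau> f\<bar> \<le> b \<tau>" "\<And>\<tau>. b \<tau> \<ge> 0"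
    using b0 by (force simp: b_def le_max_iff_disj)+
  obtain B0 where B0: "\<And>\<tau> f. \<tau> \<in> Y \<Longrightarrow> f \<in> X \<Longrightarrow> \<bar>a \<tau> f\<bar> \<le> B0 f"
    using columns by metis
  define B where "B = (\<lambda>\<tau>. max 0 (B0 \<tau>))"
  have B: "\<And>\<tau> f. \<tau> \<in> Y \<Longrightarrow> f \<in> X \<Longrightarrow> \<bar>a \<tau> f\<bar> \<le> B f" "\<And>f. B f \<ge> 0"
    using B0 by (force simp: B_def le_max_iff_disj)+
  \<comment> \<open>In the recursion \<open>R\<close> accumulates row bounds and \<open>S\<close> the weighted column bounds.\<close>
  define c where "c = (\<lambda>k R :: real. (1 / 2) ^ Suc k / (1 + R))"
  define P where "P = (\<lambda>(k::nat) (f, \<tau>, R, S). f \<in> X \<and> \<tau> \<in> Y \<and> R \<ge> (0::real) \<and> S \<ge> (0::real) \<and>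
     c k R * a \<tau> f \<ge> real k + 1 + S)"
  define Q where "Q = (\<lambda>k (f, \<tau>, R, S) (f' :: 'b, \<tau>' :: 'a, R', S'). R' = R + b \<tau> \<and> S' = S + c k R * B f)"
  have ex: "\<exists>f \<tau>. P k (f, \<tau>, R, S)" if "R \<ge> 0" "S \<ge> 0" for k R S
  proof -
    have c: "c k R > 0" using that by (simp add: c_def)
    obtain \<tau> f where t: "\<tau> \<in> Y" "f \<in> X" "a \<tau> f > (real k + 1 + S) / c k R" using unbounded by meson
    then have "c k R * a \<tau> f \<ge> real k + 1 + S" using c by (simp add: field_simps)
    then show ?thesis using t that by (auto simp: P_def)
  qed
  have "\<exists>z. \<forall>k. P k (z k) \<and> Q k (z k) (z (Suc k))"
  proof (rule dependent_nat_choice)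
    show "\<exists>x. P 0 x" using ex[of 0 0 0] by blast
    fix x k assume x: "P k x"
    obtain f \<tau> R S where [simp]: "x = (f, \<tau>, R, S)" using prod_cases4 by blast
    have "R + b \<tau> \<ge> 0" "S + c k R * B f \<ge> 0" using x b B by (auto simp: P_def c_def)
    from ex[OF this, of "Suc k"] show "\<exists>y. P (Suc k) y \<and> Q k x y" by (force simp: Q_def)
  qed
  then obtain z where z: "\<And>k. P k (z k)" "\<And>k. Q k (z k) (z (Suc k))" by blast
  define f where "f = (\<lambda>k. fst (z k))"
  define \<tau> where "\<tau> = (\<lambda>k. fst (snd (z k)))"
  define R where "R = (\<lambda>k. fst (snd (snd (z k))))"
  define S where "S = (\<lambda>k. snd (snd (snd (z k))))"
  have ze: "z k = (f k, \<tau> k, R k, S k)" for k by (simp add: f_def \<tau>_def R_def S_def)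
  have p: "f k \<in> X" "\<tau> k \<in> Y" "R k \<ge> 0" "S k \<ge> 0" "c k (R k) * a (\<tau> k) (f k) \<ge> real k + 1 + S k" for k
    using z(1)[of k] by (auto simp: P_def ze)
  have q: "R (Suc k) = R k + b (\<tau> k)" "S (Suc k) = S k + c k (R k) * B (f k)" for k
    using z(2)[of k] by (auto simp: Q_def ze)
  define C where "C = (\<lambda>k. c k (R k))"
  have C0: "C k > 0" for k using p(3)[of k] by (simp add: C_def c_def)
  have C1: "C k \<le> (1 / 2) ^ Suc k" for k
    using p(3)[of k] unfolding C_def c_def by (intro divide_left_mono[where b=1, simplified] mult_pos_pos) auto
  have Rsum: "R k \<ge> (\<Sum>j<k. b (\<tau> j))" for k
    by (induction k) (use q p in \<open>auto\<close>)
  have Ssum: "S k \<ge> (\<Sum>j<k. C j * B (f j))" for k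
    by (induction k) (use q p in \<open>auto simp: C_def\<close>)
  have row: "C j * b (\<tau> k) \<le> (1 / 2) ^ Suc j" if "k < j" for j k
  proof -
    have "b (\<tau> k) \<le> (\<Sum>m<j. b (\<tau> m))" using that b(2) by (intro member_le_sum) auto
    then have "b (\<tau> k) \<le> 1 + R j" using Rsum[of j] by linarith
    then have "(1 / 2) ^ Suc j * (b (\<tau> k) / (1 + R j)) \<le> (1 / 2) ^ Suc j * 1"
      using p(3)[of j] by (intro mult_left_mono) (auto simp: divide_le_eq)
    then show ?thesis by (simp add: C_def c_def)
  qed
  have geo: "summable (\<lambda>k. (1 / 2 :: real) ^ Suc k)" by (simp add: summable_geometric)
  show thesis
  proof (rule that[OF C0 C1 p(1) p(2)])
    fix k
    let ?t = "\<lambda>j. C j * a (\<tau> k) (f j)"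
    have abs: "\<bar>?t j\<bar> \<le> C j * b (\<tau> k)" "\<bar>?t j\<bar> \<le> C j * B (f j)" for j
      using C0[of j] b(1)[OF p(2)[of k] p(1)[of j]] B(1)[OF p(2)[of k] p(1)[of j]]
      by (auto simp: abs_mult intro!: mult_left_mono)
    have "\<bar>?t j\<bar> \<le> b (\<tau> k) * (1 / 2) ^ Suc j" for j
      using abs(1)[of j] mult_right_mono[OF C1[of j] b(2)[of "\<tau> k"]] by (simp add: mult.commute)
    then have sm: "summable (\<lambda>j. \<bar>?t j\<bar>)"
      by (intro summable_comparison_test'[OF summable_mult[OF geo, of "b (\<tau> k)"], where N=0]) simp
    have sm1: "summable ?t" by (rule summable_rabs_cancel[OF sm])
    have "(\<Sum>j. ?t j) = (\<Sum>j. ?t (j + Suc k)) + (\<Sum>j<Suc k. ?t j)" by (rule suminf_split_initial_segment[OF sm1])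
    moreover have "\<bar>\<Sum>j<k. ?t j\<bar> \<le> S k"
      by (rule order_trans[OF sum_abs order_trans[OF sum_mono Ssum]]) (use abs(2) in auto)
    moreover have "\<bar>\<Sum>j. ?t (j + Suc k)\<bar> \<le> 1"
    proof -
      have s2: "summable (\<lambda>j. \<bar>?t (j + Suc k)\<bar>)" using sm by (subst summable_iff_shift[of "\<lambda>j. \<bar>?t j\<bar>"])
      have "\<bar>\<Sum>j. ?t (j + Suc k)\<bar> \<le> (\<Sum>j. \<bar>?t (j + Suc k)\<bar>)" by (rule summable_rabs[OF s2])
      also have "\<dots> \<le> (\<Sum>j. (1 / 2) ^ Suc j)"
      proof (rule suminf_le[OF _ s2 geo])
        fix j
        have "\<bar>?t (j + Suc k)\<bar> \<le> (1 / 2) ^ Suc (j + Suc k)" using abs(1)[of "j + Suc k"] row[of k "j + Suc k"] by simp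
        also have "\<dots> \<le> (1 / 2) ^ Suc j" by (rule power_decreasing) auto
        finally show "\<bar>?t (j + Suc k)\<bar> \<le> (1 / 2) ^ Suc j" .
      qed
      also have "\<dots> = 1" using power_half_series sums_unique by metis
      finally show ?thesis .
    qed
    moreover have "?t k \<ge> real k + 1 + S k" using p(5)[of k] by (simp add: C_def)
    ultimately show "real k \<le> \<bar>\<Sum>j. ?t j\<bar>" by (simp only: sum.lessThan_Suc)
  qed
qed

text \<open>
  A power with exponent at least one lies above its tangent at \<open>S\<close>.
\<close>

lemma powr_tangent:
  fixes a S p :: real
  assumes "p \<ge> 1" "a \<ge> 0" "S > 0"
  shows "p * S powr (p - 1) * a \<le> a powr p + (p - 1) * S powr p"
proof (cases "p = 1")
  case False
  then have p: "p > 1" using assms by simp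
  have "a * S powr (p - 1) \<le> a powr p / p + (S powr (p - 1)) powr (p / (p - 1)) / (p / (p - 1))"
    using p assms by (intro Youngs_inequality) (auto simp: field_simps)
  also have "(S powr (p - 1)) powr (p / (p - 1)) = S powr p" using p by (simp add: powr_powr)
  finally have "p * (a * S powr (p - 1)) \<le> p * (a powr p / p + S powr p / (p / (p - 1)))"
    using p by (intro mult_left_mono) auto
  also have "p * (a powr p / p + S powr p / (p / (p - 1))) = a powr p + (p - 1) * S powr p"
    using p by (simp add: distrib_left)
  finally show ?thesis by (simp add: mult_ac)
qed (use assms in auto)

text \<open>
  Jensen's inequality for countably many weights of total mass at most one, obtained by summing the
  tangent inequality at the weighted mean.
\<close>

lemma powr_suminf_le:
  fixes a c :: "nat \<Rightarrow> real"
  assumes p: "p \<ge> 1" and c: "\<And>k. c k \<ge> 0" "summable c" "suminf c \<le> 1" and a: "\<And>k. a k \<ge> 0"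
    and s1: "summable (\<lambda>k. c k * a k)" and s2: "summable (\<lambda>k. c k * a k powr p)"
  shows "(\<Sum>k. c k * a k) powr p \<le> (\<Sum>k. c k * a k powr p)"
proof (cases "(\<Sum>k. c k * a k) > 0")
  case True
  define S where "S = (\<Sum>k. c k * a k)"
  have S: "S > 0" using True by (simp add: S_def)
  have "(\<Sum>k. (p * S powr (p - 1)) * (c k * a k)) \<le> (\<Sum>k. c k * a k powr p + ((p - 1) * S powr p) * c k)"
  proof (rule suminf_le)
    fix k
    have "c k * (p * S powr (p - 1) * a k) \<le> c k * (a k powr p + (p - 1) * S powr p)"
      by (intro mult_left_mono powr_tangent p a S c(1))
    then show "(p * S powr (p - 1)) * (c k * a k) \<le> c k * a k powr p + ((p - 1) * S powr p) * c k"
      by (simp add: algebra_simps)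
  qed (intro summable_mult summable_add s1 s2 c)+
  also have "\<dots> = (\<Sum>k. c k * a k powr p) + ((p - 1) * S powr p) * suminf c"
    by (simp only: suminf_add[OF s2 summable_mult[OF c(2)], symmetric] suminf_mult[OF c(2)])
  also have "(\<Sum>k. (p * S powr (p - 1)) * (c k * a k)) = (p * S powr (p - 1)) * S"
    by (simp only: suminf_mult[OF s1] S_def)
  also have "\<dots> = p * S powr p" using S by (simp add: powr_diff)
  also have "(p - 1) * S powr p * suminf c \<le> (p - 1) * S powr p"
    using p c(3) suminf_nonneg[OF c(2) c(1)] by (intro mult_right_le_one_le) auto
  finally have "p * S powr p \<le> (\<Sum>k. c k * a k powr p) + (p - 1) * S powr p" by simp
  then show ?thesis by (simp add: S_def algebra_simps)
next
  case False
  have "(\<Sum>k. c k * a k) \<ge> 0" by (intro suminf_nonneg s1 mult_nonneg_nonneg c a)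
  then have "(\<Sum>k. c k * a k) = 0" using False by simp
  moreover have "(\<Sum>k. c k * a k powr p) \<ge> 0" by (intro suminf_nonneg s2 mult_nonneg_nonneg c) auto
  ultimately show ?thesis by simp
qed

lemma AE_summable_series:
  fixes f :: "nat \<Rightarrow> 'a \<Rightarrow> real"
  assumes int: "\<And>k. integrable M (f k)" and nn: "\<And>k x. x \<in> space M \<Longrightarrow> 0 \<le> f k x" and c: "\<And>k. 0 \<le> c k" "summable c"
    and le: "\<And>k. (\<integral>x. f k x \<partial>M) \<le> K"
  shows "AE x in M. summable (\<lambda>k. c k * f k x)" "summable (\<lambda>k. \<integral>x. c k * f k x \<partial>M)"
proof -
  have meas: "\<And>k. (\<lambda>x. ennreal (c k * f k x)) \<in> borel_measurable M" using int by (auto intro!: measurable_compose[OF _ measurable_ennreal] borel_measurable_times dest: borel_measurable_integrable)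
  have nni: "(\<integral>x. f k x \<partial>M) \<ge> 0" for k using nn by (intro Bochner_Integration.integral_nonneg) auto
  have s: "summable (\<lambda>k. c k * (\<integral>x. f k x \<partial>M))"
    by (rule summable_comparison_test'[OF summable_mult2[OF c(2), of K], where N=0])
      (use c le nni in \<open>auto simp: abs_mult intro!: mult_left_mono\<close>)
  then show "summable (\<lambda>k. \<integral>x. c k * f k x \<partial>M)" by simp
  have "(\<integral>\<^sup>+x. (\<Sum>k. ennreal (c k * f k x)) \<partial>M) = (\<Sum>k. \<integral>\<^sup>+x. ennreal (c k * f k x) \<partial>M)"
    by (rule nn_integral_suminf[OF meas])
  also have "\<dots> = (\<Sum>k. ennreal (c k * (\<integral>x. f k x \<partial>M)))"
    using int nn c by (subst nn_integral_eq_integral) (auto intro!: AE_I2)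
  also have "\<dots> \<noteq> top" by (rule ennreal_suminf_neq_top[OF s]) (use c nni in auto)
  finally have "AE x in M. (\<Sum>k. ennreal (c k * f k x)) \<noteq> \<infinity>"
    by (intro nn_integral_PInf_AE borel_measurable_suminf_order meas) simp
  then show "AE x in M. summable (\<lambda>k. c k * f k x)"
    using nn c by (elim AE_mp) (auto intro!: AE_I2 summable_suminf_not_top)
qed

lemma integrable_series:
  fixes f :: "nat \<Rightarrow> 'a \<Rightarrow> real" and h :: "'a \<Rightarrow> real"
  assumes int: "\<And>k. integrable M (f k)" and c: "\<And>k. 0 \<le> c k" "summable c"
    and le: "\<And>k. (\<integral>x. \<bar>f k x\<bar> \<partial>M) \<le> K"
    and h: "h \<in> borel_measurable M" "\<And>x. x \<in> space M \<Longrightarrow> \<bar>h x\<bar> \<le> H"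
  shows "integrable M (\<lambda>x. (\<Sum>k. c k * f k x) * h x)"
    "(\<integral>x. (\<Sum>k. c k * f k x) * h x \<partial>M) = (\<Sum>k. c k * (\<integral>x. f k x * h x \<partial>M))"
proof -
  have inth: "integrable M (\<lambda>x. f k x * h x)" for k
    by (rule Bochner_Integration.integrable_bound[of M "\<lambda>x. H * f k x"])
      (use int h in \<open>auto simp: abs_mult mult.commute[of H] intro!: AE_I2 mult_left_mono order_trans[OF _ abs_ge_self[of H]]\<close>)
  have inta: "integrable M (\<lambda>x. \<bar>f k x\<bar> * \<bar>h x\<bar>)" for k
    using integrable_abs[OF inth[of k]] by (simp add: abs_mult)
  have le': "(\<integral>x. \<bar>f k x * h x\<bar> \<partial>M) \<le> \<bar>H\<bar> * K" for k
  proof -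
    have "(\<integral>x. \<bar>f k x * h x\<bar> \<partial>M) \<le> (\<integral>x. \<bar>H\<bar> * \<bar>f k x\<bar> \<partial>M)"
      using inta[of k] int h by (intro integral_mono) (auto simp: abs_mult mult.commute[of "\<bar>H\<bar>"] intro!: mult_left_mono order_trans[OF _ abs_ge_self[of H]])
    also have "\<dots> \<le> \<bar>H\<bar> * K" using le by (simp add: mult_left_mono)
    finally show ?thesis .
  qed
  have ae: "AE x in M. summable (\<lambda>k. norm (c k * (f k x * h x)))"
    and sm: "summable (\<lambda>k. \<integral>x. norm (c k * (f k x * h x)) \<partial>M)"
    using AE_summable_series[where f = "\<lambda>k x. \<bar>f k x * h x\<bar>" and K = "\<bar>H\<bar> * K" and c = c and M = M] inta c le'
    by (auto simp: abs_mult)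
  have ae0: "AE x in M. summable (\<lambda>k. c k * f k x)"
  proof -
    have "AE x in M. summable (\<lambda>k. c k * \<bar>f k x\<bar>)"
      using AE_summable_series(1)[where f = "\<lambda>k x. \<bar>f k x\<bar>" and K = "K" and c = c and M = M] int c le by auto
    moreover have "summable (\<lambda>k. c k * f k x)" if "summable (\<lambda>k. c k * \<bar>f k x\<bar>)" for x
      by (rule summable_rabs_cancel) (use that c in \<open>auto simp: abs_mult\<close>)
    ultimately show ?thesis by (elim AE_mp) (auto intro!: AE_I2)
  qed
  have eq: "AE x in M. (\<Sum>k. c k * (f k x * h x)) = (\<Sum>k. c k * f k x) * h x"
    using ae0 by (elim AE_mp) (auto intro!: AE_I2 simp: suminf_mult2 mult.assoc)
  have i: "integrable M (\<lambda>x. \<Sum>k. c k * (f k x * h x))"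
    by (rule integrable_suminf[OF _ ae sm]) (use inth in auto)
  have m: "(\<lambda>x. (\<Sum>k. c k * f k x) * h x) \<in> borel_measurable M"
    using int h by (auto intro!: borel_measurable_times borel_measurable_suminf dest: borel_measurable_integrable)
  show "integrable M (\<lambda>x. (\<Sum>k. c k * f k x) * h x)" by (rule integrable_cong_AE_imp[OF i m]) (use eq in auto)
  have "(\<integral>x. (\<Sum>k. c k * f k x) * h x \<partial>M) = (\<integral>x. (\<Sum>k. c k * (f k x * h x)) \<partial>M)"
    by (rule integral_cong_AE) (use m i eq in \<open>auto dest: borel_measurable_integrable\<close>)
  also have "\<dots> = (\<Sum>k. \<integral>x. c k * (f k x * h x) \<partial>M)"
    by (rule integral_suminf[OF _ ae sm]) (use inth in auto)
  finally show "(\<integral>x. (\<Sum>k. c k * f k x) * h x \<partial>M) = (\<Sum>k. c k * (\<integral>x. f k x * h x \<partial>M))" by simp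
qed


section \<open>Divergence from unbounded pairings\<close>

definition converges_in_Lp :: "real ^ 'n \<Rightarrow> ereal \<Rightarrow> real \<Rightarrow> (real ^ 'n \<Rightarrow> real) \<Rightarrow> bool" where
  "converges_in_Lp \<kappa> p \<delta> f \<longleftrightarrow>
     (\<exists>g\<in>Lp_space \<kappa> p. (\<lambda>n. Lp_norm \<kappa> p (\<lambda>x. cesaro_mean \<kappa> \<delta> n f x - g x)) \<longlonglongrightarrow> 0)"

lemma abs_le_one_plus_powr: "p \<ge> 1 \<Longrightarrow> \<bar>a\<bar> \<le> 1 + \<bar>a\<bar> powr p" for a :: real
proof (cases "\<bar>a\<bar> \<le> 1")
  case False
  assume "p \<ge> 1"
  then have "\<bar>a\<bar> powr 1 \<le> \<bar>a\<bar> powr p" using False by (intro powr_mono) auto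
  then show ?thesis by simp
qed (simp add: add_increasing2)

lemma powr_add_le: "p \<ge> 0 \<Longrightarrow> \<bar>a - b\<bar> powr p \<le> 2 powr p * (\<bar>a\<bar> powr p + \<bar>b\<bar> powr p)" for a b :: real
proof -
  assume p: "p \<ge> 0"
  have "\<bar>a - b\<bar> powr p \<le> (2 * max \<bar>a\<bar> \<bar>b\<bar>) powr p" using p by (intro powr_mono2) auto
  also have "\<dots> = 2 powr p * max \<bar>a\<bar> \<bar>b\<bar> powr p" by (simp add: powr_mult)
  also have "max \<bar>a\<bar> \<bar>b\<bar> powr p \<le> \<bar>a\<bar> powr p + \<bar>b\<bar> powr p" by (simp add: max_def)
  finally show ?thesis by simp
qed

lemma continuous_on_Sup_bound:
  assumes "continuous_on (sphere 0 1) f" "x \<in> sphere (0 :: real ^ 'n) 1"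
  shows "\<bar>f x\<bar> \<le> (SUP x\<in>sphere 0 1. \<bar>f x :: real\<bar>)"
proof (rule cSUP_upper[OF assms(2)])
  show "bdd_above ((\<lambda>x. \<bar>f x\<bar>) ` sphere 0 1)"
    using continuous_sphere_bounded[OF assms(1)] by (metis bdd_aboveI2)
qed

lemma space_mass_one:
  assumes "\<And>i. 0 \<le> (\<kappa> :: real ^ 'n) $ i"
  shows "(\<integral>x. c \<partial>hmeasure \<kappa>) = (c :: real)"
  using emeasure_hmeasure_space[OF assms] by (simp add: measure_def)

text \<open>
  The test functions \<open>G\<close> are described by a form of Young's inequality in which \<open>W\<close> stands for the
  conjugate power of \<open>G\<close>, or for zero if \<open>p = 1\<close> and \<open>G\<close> is bounded by one. It is applied to the limit
  and to the differences from it.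
\<close>

lemma convergent_imp_weakly_bounded:
  fixes \<kappa> :: "real ^ 'n"
  assumes \<kappa>: "\<And>i. 0 \<le> \<kappa> $ i" and p: "p \<ge> 1" and f: "integrable (hmeasure \<kappa>) f"
    and conv: "converges_in_Lp \<kappa> (ereal p) \<delta> f"
  shows "\<exists>B. \<forall>n G W. continuous_on (sphere 0 1) G \<longrightarrow> continuous_on (sphere 0 1) W \<longrightarrow>
     (\<forall>a. \<forall>x\<in>sphere 0 1. \<bar>a * G x\<bar> \<le> \<bar>a\<bar> powr p + W x) \<longrightarrow> (\<integral>x. W x \<partial>hmeasure \<kappa>) \<le> 1 \<longrightarrow>
     \<bar>\<integral>x. G x * cesaro_mean \<kappa> \<delta> n f x \<partial>hmeasure \<kappa>\<bar> \<le> B"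
proof -
  let ?\<mu> = "hmeasure \<kappa>"
  obtain g where g: "g \<in> Lp_space \<kappa> (ereal p)" and lim: "(\<lambda>n. Lp_norm \<kappa> (ereal p) (\<lambda>x. cesaro_mean \<kappa> \<delta> n f x - g x)) \<longlonglongrightarrow> 0"
    using conv by (auto simp: converges_in_Lp_def)
  have gm: "g \<in> borel_measurable ?\<mu>" and gi: "integrable ?\<mu> (\<lambda>x. \<bar>g x\<bar> powr p)"
    using g by (auto simp: Lp_space_def)
  define I where "I = (\<lambda>n. \<integral>x. \<bar>cesaro_mean \<kappa> \<delta> n f x - g x\<bar> powr p \<partial>?\<mu>)"
  have I0: "I n \<ge> 0" for n by (simp add: I_def)
  from lim have "(\<lambda>n. I n powr (1 / p)) \<longlonglongrightarrow> 0" by (simp add: Lp_norm_def I_def)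
  then have "Bseq (\<lambda>n. I n powr (1 / p))" by (rule convergent_imp_Bseq[OF convergentI])
  then obtain K where K: "\<And>n. I n powr (1 / p) \<le> K" by (auto simp: Bseq_def)
  have IK: "I n \<le> K powr p" for n
  proof -
    have "I n = (I n powr (1 / p)) powr p" using p I0 by (simp add: powr_powr)
    also have "\<dots> \<le> K powr p" using K p by (intro powr_mono2) auto
    finally show ?thesis .
  qed
  have Sc: "continuous_on (sphere 0 1) (cesaro_mean \<kappa> \<delta> n f)" for n by (rule continuous_cesaro_mean[OF \<kappa> f])
  have Sm: "cesaro_mean \<kappa> \<delta> n f \<in> borel_measurable ?\<mu>" for n by (rule continuous_measurable_hmeasure[OF Sc])
  have Sp: "integrable ?\<mu> (\<lambda>x. \<bar>cesaro_mean \<kappa> \<delta> n f x\<bar> powr p)" for n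
    using p by (intro integrable_hmeasure_continuous[OF \<kappa>] continuous_on_powr' continuous_intros Sc) auto
  have ui: "integrable ?\<mu> (\<lambda>x. \<bar>cesaro_mean \<kappa> \<delta> n f x - g x\<bar> powr p)" for n
  proof (rule Bochner_Integration.integrable_bound)
    show "integrable ?\<mu> (\<lambda>x. 2 powr p * (\<bar>cesaro_mean \<kappa> \<delta> n f x\<bar> powr p + \<bar>g x\<bar> powr p))"
      using Sp gi by simp
    show "(\<lambda>x. \<bar>cesaro_mean \<kappa> \<delta> n f x - g x\<bar> powr p) \<in> borel_measurable ?\<mu>" using Sm gm by measurable
    show "AE x in ?\<mu>. norm (\<bar>cesaro_mean \<kappa> \<delta> n f x - g x\<bar> powr p) \<le> norm (2 powr p * (\<bar>cesaro_mean \<kappa> \<delta> n f x\<bar> powr p + \<bar>g x\<bar> powr p))"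
      using p by (intro AE_I2) (auto intro!: powr_add_le order_trans[OF powr_add_le abs_ge_self])
  qed
  have "\<bar>\<integral>x. G x * cesaro_mean \<kappa> \<delta> n f x \<partial>?\<mu>\<bar> \<le> (\<integral>x. \<bar>g x\<bar> powr p \<partial>?\<mu>) + K powr p + 2"
    if G: "continuous_on (sphere 0 1) G" and W: "continuous_on (sphere 0 1) W" and
      GW: "\<And>a x. x \<in> sphere 0 1 \<Longrightarrow> \<bar>a * G x\<bar> \<le> \<bar>a\<bar> powr p + W x" and W1: "(\<integral>x. W x \<partial>?\<mu>) \<le> 1" for n G W
  proof -
    let ?u = "\<lambda>x. cesaro_mean \<kappa> \<delta> n f x - g x"
    have Wi: "integrable ?\<mu> W" by (rule integrable_hmeasure_continuous[OF \<kappa> W])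
    have "\<bar>\<integral>x. G x * cesaro_mean \<kappa> \<delta> n f x \<partial>?\<mu>\<bar> \<le> (\<integral>x. \<bar>G x * cesaro_mean \<kappa> \<delta> n f x\<bar> \<partial>?\<mu>)" by simp
    also have "\<dots> \<le> (\<integral>x. (\<bar>g x\<bar> powr p + W x) + (\<bar>?u x\<bar> powr p + W x) \<partial>?\<mu>)"
    proof (rule integral_mono)
      show "integrable ?\<mu> (\<lambda>x. \<bar>G x * cesaro_mean \<kappa> \<delta> n f x\<bar>)"
        by (intro integrable_hmeasure_continuous[OF \<kappa>] continuous_intros G Sc)
      show "integrable ?\<mu> (\<lambda>x. (\<bar>g x\<bar> powr p + W x) + (\<bar>?u x\<bar> powr p + W x))"
        by (intro Bochner_Integration.integrable_add gi ui Wi)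
      fix x assume "x \<in> space ?\<mu>"
      then have x: "x \<in> sphere 0 1" by simp
      have "G x * cesaro_mean \<kappa> \<delta> n f x = g x * G x + ?u x * G x" by (simp add: algebra_simps)
      then show "\<bar>G x * cesaro_mean \<kappa> \<delta> n f x\<bar> \<le> (\<bar>g x\<bar> powr p + W x) + (\<bar>?u x\<bar> powr p + W x)"
        using GW[OF x, of "g x"] GW[OF x, of "?u x"] by linarith
    qed
    also have "\<dots> = ((\<integral>x. \<bar>g x\<bar> powr p \<partial>?\<mu>) + (\<integral>x. W x \<partial>?\<mu>)) + (I n + (\<integral>x. W x \<partial>?\<mu>))"
      unfolding I_def using gi ui Wi by simp
    finally show ?thesis using W1 IK[of n] by linarith
  qed
  then show ?thesis by (intro exI[of _ "(\<integral>x. \<bar>g x\<bar> powr p \<partial>?\<mu>) + K powr p + 2"]) blast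
qed

lemma uniformly_convergent_imp_weakly_bounded:
  fixes \<kappa> :: "real ^ 'n"
  assumes \<kappa>: "\<And>i. 0 \<le> \<kappa> $ i" and f: "integrable (hmeasure \<kappa>) f"
    and conv: "converges_in_Lp \<kappa> \<infinity> \<delta> f"
  shows "\<exists>B. \<forall>n G. continuous_on (sphere 0 1) G \<longrightarrow> (\<integral>x. \<bar>G x\<bar> \<partial>hmeasure \<kappa>) \<le> 1 \<longrightarrow>
     \<bar>\<integral>x. G x * cesaro_mean \<kappa> \<delta> n f x \<partial>hmeasure \<kappa>\<bar> \<le> B"
proof -
  let ?\<mu> = "hmeasure \<kappa>"
  define N where "N = (\<lambda>n g. Lp_norm \<kappa> \<infinity> (\<lambda>x. cesaro_mean \<kappa> \<delta> n f x - g x))"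
  obtain g where g: "continuous_on (sphere 0 1) g" and lim: "(\<lambda>n. N n g) \<longlonglongrightarrow> 0"
    using conv by (auto simp: converges_in_Lp_def N_def Lp_space_def)
  from lim have "Bseq (\<lambda>n. N n g)" by (rule convergent_imp_Bseq[OF convergentI])
  then obtain K where K: "\<And>n. \<bar>N n g\<bar> \<le> K" by (auto simp: Bseq_def)
  obtain B where B: "B > 0" "\<And>x. x \<in> sphere 0 1 \<Longrightarrow> \<bar>g x\<bar> \<le> B" using continuous_sphere_bounded[OF g] by blast
  have K0: "K \<ge> 0" using K[of 0] by linarith
  have Sc: "continuous_on (sphere 0 1) (cesaro_mean \<kappa> \<delta> n f)" for n by (rule continuous_cesaro_mean[OF \<kappa> f])
  have Sb: "\<bar>cesaro_mean \<kappa> \<delta> n f x\<bar> \<le> B + K" if x: "x \<in> sphere 0 1" for n x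
  proof -
    have "\<bar>cesaro_mean \<kappa> \<delta> n f x - g x\<bar> \<le> N n g"
      unfolding N_def Lp_norm_def using continuous_on_Sup_bound[OF continuous_on_diff[OF Sc g] x] by simp
    then show ?thesis using K[of n] B(2)[OF x] by linarith
  qed
  have "\<bar>\<integral>x. G x * cesaro_mean \<kappa> \<delta> n f x \<partial>?\<mu>\<bar> \<le> B + K"
    if G: "continuous_on (sphere 0 1) G" and G1: "(\<integral>x. \<bar>G x\<bar> \<partial>?\<mu>) \<le> 1" for n G
  proof -
    have "\<bar>\<integral>x. G x * cesaro_mean \<kappa> \<delta> n f x \<partial>?\<mu>\<bar> \<le> (\<integral>x. \<bar>G x * cesaro_mean \<kappa> \<delta> n f x\<bar> \<partial>?\<mu>)" by simp
    also have "\<dots> \<le> (\<integral>x. (B + K) * \<bar>G x\<bar> \<partial>?\<mu>)"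
      by (rule integral_mono) (auto intro!: integrable_hmeasure_continuous[OF \<kappa>] continuous_intros G Sc mult_left_mono Sb
        simp: abs_mult mult.commute[of "B + K"])
    also have "\<dots> \<le> (B + K) * 1" using mult_left_mono[OF G1, of "B + K"] B(1) K0 by simp
    finally show ?thesis by simp
  qed
  then show ?thesis by (intro exI[of _ "B + K"]) blast
qed

lemma cesaro_mean_row_bound:
  fixes \<kappa> :: "real ^ 'n"
  assumes \<kappa>: "\<And>i. 0 \<le> \<kappa> $ i" and G: "integrable (hmeasure \<kappa>) G"
  shows "\<exists>b. \<forall>f. integrable (hmeasure \<kappa>) f \<longrightarrow> (\<integral>x. \<bar>f x\<bar> \<partial>hmeasure \<kappa>) \<le> 2 \<longrightarrow>
     \<bar>\<integral>x. G x * cesaro_mean \<kappa> \<delta> n f x \<partial>hmeasure \<kappa>\<bar> \<le> b"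
proof -
  obtain K where K: "K \<ge> 0" "\<And>f x. integrable (hmeasure \<kappa>) f \<Longrightarrow> x \<in> sphere 0 1 \<Longrightarrow>
     \<bar>cesaro_mean \<kappa> \<delta> n f x\<bar> \<le> K * (\<integral>y. \<bar>f y\<bar> \<partial>hmeasure \<kappa>)" using cesaro_mean_bound[OF \<kappa>] by blast
  have "\<bar>\<integral>x. G x * cesaro_mean \<kappa> \<delta> n f x \<partial>hmeasure \<kappa>\<bar> \<le> (\<integral>x. \<bar>G x\<bar> * (K * 2) \<partial>hmeasure \<kappa>)"
    if f: "integrable (hmeasure \<kappa>) f" and f2: "(\<integral>x. \<bar>f x\<bar> \<partial>hmeasure \<kappa>) \<le> 2" for f
  proof -
    have "\<bar>\<integral>x. G x * cesaro_mean \<kappa> \<delta> n f x \<partial>hmeasure \<kappa>\<bar> \<le> (\<integral>x. \<bar>G x * cesaro_mean \<kappa> \<delta> n f x\<bar> \<partial>hmeasure \<kappa>)" by simp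
    also have "\<dots> \<le> (\<integral>x. \<bar>G x\<bar> * (K * 2) \<partial>hmeasure \<kappa>)"
    proof (rule integral_mono)
      show "integrable (hmeasure \<kappa>) (\<lambda>x. \<bar>G x * cesaro_mean \<kappa> \<delta> n f x\<bar>)"
        by (intro integrable_abs integrable_mult_continuous[OF \<kappa> G] continuous_cesaro_mean[OF \<kappa> f])
      show "integrable (hmeasure \<kappa>) (\<lambda>x. \<bar>G x\<bar> * (K * 2))" using G by simp
      fix x assume "x \<in> space (hmeasure \<kappa>)"
      then have "\<bar>cesaro_mean \<kappa> \<delta> n f x\<bar> \<le> K * 2" using K(2)[OF f, of x] mult_left_mono[OF f2 K(1)] by simp
      then show "\<bar>G x * cesaro_mean \<kappa> \<delta> n f x\<bar> \<le> \<bar>G x\<bar> * (K * 2)" by (simp add: abs_mult mult_left_mono)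
    qed
    finally show ?thesis .
  qed
  then show ?thesis by blast
qed

lemma geometric_weights_sum:
  fixes c :: "nat \<Rightarrow> real"
  assumes "\<And>k. 0 < c k" "\<And>k. c k \<le> (1 / 2) ^ Suc k"
  shows "summable c" "suminf c \<le> 1"
proof -
  show s: "summable c" by (rule summable_comparison_test'[where N=0 and g="\<lambda>k. (1 / 2) ^ Suc k"])
    (use assms in \<open>auto simp: summable_geometric less_imp_le\<close>)
  have "suminf c \<le> (\<Sum>k. (1 / 2) ^ Suc k)" by (rule suminf_le[OF assms(2) s]) (simp add: summable_geometric)
  then show "suminf c \<le> 1" using power_half_series sums_unique by metis
qed

text \<open>
  By symmetry the mean can be moved to the continuous test function, after which pairing with an
  infinite series of functions is term by term and the gliding hump applies.
\<close>

lemma divergence_from_unbounded_pairings: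
  fixes \<kappa> :: "real ^ 'n" and X Y :: "(real ^ 'n \<Rightarrow> real) set"
  assumes \<kappa>: "\<And>i. 0 \<le> \<kappa> $ i"
    and X: "\<And>f. f \<in> X \<Longrightarrow> continuous_on (sphere 0 1) f \<and> (\<integral>x. \<bar>f x\<bar> \<partial>hmeasure \<kappa>) \<le> 2"
    and Y: "\<And>G. G \<in> Y \<Longrightarrow> continuous_on (sphere 0 1) G"
    and series: "\<And>c f. (\<And>k. f k \<in> X) \<Longrightarrow> (\<And>k. 0 < c k) \<Longrightarrow> (\<And>k. c k \<le> (1 / 2) ^ Suc k) \<Longrightarrow>
        (\<lambda>x. \<Sum>k. c k * f k x) \<in> Lp_space \<kappa> p"
    and X_Lp: "X \<subseteq> Lp_space \<kappa> p"
    and weak: "\<And>f. integrable (hmeasure \<kappa>) f \<Longrightarrow> converges_in_Lp \<kappa> p \<delta> f \<Longrightarrow>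
        \<exists>B. \<forall>n. \<forall>G\<in>Y. \<bar>\<integral>x. G x * cesaro_mean \<kappa> \<delta> n f x \<partial>hmeasure \<kappa>\<bar> \<le> B"
    and unbounded: "\<And>B. \<exists>n. \<exists>f\<in>X. \<exists>G\<in>Y. (\<integral>x. G x * cesaro_mean \<kappa> \<delta> n f x \<partial>hmeasure \<kappa>) > B"
  shows "\<exists>f\<in>Lp_space \<kappa> p. \<not> converges_in_Lp \<kappa> p \<delta> f"
proof (rule ccontr)
  assume "\<not> ?thesis"
  then have conv: "\<And>f. f \<in> Lp_space \<kappa> p \<Longrightarrow> converges_in_Lp \<kappa> p \<delta> f" by blast
  let ?\<mu> = "hmeasure \<kappa>"
  define a where "a = (\<lambda>(n, G) f. \<integral>x. G x * cesaro_mean \<kappa> \<delta> n f x \<partial>?\<mu>)"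
  have Xi: "integrable ?\<mu> f" if "f \<in> X" for f using X[OF that] by (intro integrable_hmeasure_continuous[OF \<kappa>]) simp
  have Yi: "integrable ?\<mu> G" if "G \<in> Y" for G using Y[OF that] by (intro integrable_hmeasure_continuous[OF \<kappa>])
  have rows: "\<exists>b. \<forall>f\<in>X. \<bar>a \<tau> f\<bar> \<le> b" if "\<tau> \<in> UNIV \<times> Y" for \<tau>
  proof -
    obtain n G where \<tau>: "\<tau> = (n, G)" "G \<in> Y" using \<open>\<tau> \<in> UNIV \<times> Y\<close> by blast
    show ?thesis using cesaro_mean_row_bound[OF \<kappa> Yi[OF \<tau>(2)], of \<delta> n] Xi X by (auto simp: a_def \<tau>)
  qed
  have columns: "\<exists>b. \<forall>\<tau>\<in>UNIV \<times> Y. \<bar>a \<tau> f\<bar> \<le> b" if "f \<in> X" for f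
    using weak[OF Xi[OF that] conv] X_Lp that by (auto simp: a_def)
  have unb: "\<exists>\<tau>\<in>UNIV \<times> Y. \<exists>f\<in>X. a \<tau> f > B" for B using unbounded[of B] by (auto simp: a_def)
  obtain c f \<tau> where c: "\<And>k. 0 < c k" "\<And>k. c k \<le> (1 / 2) ^ Suc k" and f: "\<And>k. f k \<in> X" and
    \<tau>: "\<And>k. \<tau> k \<in> (UNIV :: nat set) \<times> Y" and big: "\<And>k. real k \<le> \<bar>\<Sum>j. c j * a (\<tau> k) (f j)\<bar>"
    by (rule gliding_hump[of "UNIV \<times> Y" X a]) (assumption | rule rows columns unb that)+
  have cs: "summable c" by (rule geometric_weights_sum(1)[OF c])
  define h where "h = (\<lambda>x. \<Sum>k. c k * f k x)"
  have hL: "h \<in> Lp_space \<kappa> p" unfolding h_def by (rule series[OF f c])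
  have ser: "integrable ?\<mu> (\<lambda>x. h x * g x)" "(\<integral>x. h x * g x \<partial>?\<mu>) = (\<Sum>k. c k * (\<integral>x. f k x * g x \<partial>?\<mu>))"
    if g: "continuous_on (sphere 0 1) g" for g
  proof -
    obtain B where B: "\<And>x. x \<in> sphere 0 1 \<Longrightarrow> \<bar>g x\<bar> \<le> B" using continuous_sphere_bounded[OF g] by blast
    show "integrable ?\<mu> (\<lambda>x. h x * g x)" "(\<integral>x. h x * g x \<partial>?\<mu>) = (\<Sum>k. c k * (\<integral>x. f k x * g x \<partial>?\<mu>))"
      unfolding h_def using X f
      by (intro integrable_series[of ?\<mu> f c 2 g B] Xi continuous_measurable_hmeasure[OF g] cs less_imp_le[OF c(1)] B; simp)+
  qed
  have hi: "integrable ?\<mu> h" using ser(1)[of "\<lambda>_. 1"] by simp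
  obtain B where B: "\<And>n G. G \<in> Y \<Longrightarrow> \<bar>\<integral>x. G x * cesaro_mean \<kappa> \<delta> n h x \<partial>?\<mu>\<bar> \<le> B"
    using weak[OF hi conv[OF hL]] by blast
  obtain k :: nat where k: "real k > B" using reals_Archimedean2 by blast
  obtain n G where nG: "\<tau> k = (n, G)" "G \<in> Y" using \<tau>[of k] by blast
  have "(\<integral>x. G x * cesaro_mean \<kappa> \<delta> n h x \<partial>?\<mu>) = (\<integral>x. h x * cesaro_mean \<kappa> \<delta> n G x \<partial>?\<mu>)"
    by (rule cesaro_mean_symmetric[OF \<kappa> hi Yi[OF nG(2)]])
  also have "\<dots> = (\<Sum>j. c j * (\<integral>x. f j x * cesaro_mean \<kappa> \<delta> n G x \<partial>?\<mu>))"
    by (rule ser(2)[OF continuous_cesaro_mean[OF \<kappa> Yi[OF nG(2)]]])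
  also have "\<dots> = (\<Sum>j. c j * a (\<tau> k) (f j))"
    by (simp add: nG a_def cesaro_mean_symmetric[OF \<kappa> Xi[OF f] Yi[OF nG(2)]])
  finally show False using big[of k] B[OF nG(2), of n] k by simp
qed

text \<open>
  The series constructed by the gliding hump stays in \<open>L^p\<close> by convexity of the power.
\<close>

theorem divergence_finite_exponent:
  fixes \<kappa> :: "real ^ 'n"
  assumes \<kappa>: "\<And>i. 0 \<le> \<kappa> $ i" and p: "p \<ge> 1"
    and unbounded: "\<And>B. \<exists>n f G W. continuous_on (sphere 0 1) f \<and> (\<integral>x. \<bar>f x\<bar> powr p \<partial>hmeasure \<kappa>) \<le> 1 \<and>
      continuous_on (sphere 0 1) G \<and> continuous_on (sphere 0 1) W \<and>
      (\<forall>a. \<forall>x\<in>sphere 0 1. \<bar>a * G x\<bar> \<le> \<bar>a\<bar> powr p + W x) \<and> (\<integral>x. W x \<partial>hmeasure \<kappa>) \<le> 1 \<and>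
      (\<integral>x. G x * cesaro_mean \<kappa> \<delta> n f x \<partial>hmeasure \<kappa>) > B"
  shows "\<exists>f\<in>Lp_space \<kappa> (ereal p). \<not> converges_in_Lp \<kappa> (ereal p) \<delta> f"
proof -
  let ?\<mu> = "hmeasure \<kappa>"
  define X :: "(real ^ 'n \<Rightarrow> real) set" where "X = {f. continuous_on (sphere 0 1) f \<and> (\<integral>x. \<bar>f x\<bar> powr p \<partial>?\<mu>) \<le> 1}"
  define Y :: "(real ^ 'n \<Rightarrow> real) set" where "Y = {G. continuous_on (sphere 0 1) G \<and> (\<exists>W. continuous_on (sphere 0 1) W \<and>
      (\<forall>a. \<forall>x\<in>sphere 0 1. \<bar>a * G x\<bar> \<le> \<bar>a\<bar> powr p + W x) \<and> (\<integral>x. W x \<partial>?\<mu>) \<le> 1)}"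
  have pi: "integrable ?\<mu> (\<lambda>x. \<bar>f x\<bar> powr p)" if "f \<in> X" for f
    using that p by (intro integrable_hmeasure_continuous[OF \<kappa>] continuous_on_powr' continuous_intros) (auto simp: X_def)
  have Xc: "continuous_on (sphere 0 1) f" if "f \<in> X" for f using that by (simp add: X_def)
  have Xi: "integrable ?\<mu> f" if "f \<in> X" for f by (rule integrable_hmeasure_continuous[OF \<kappa> Xc[OF that]])
  have X2: "(\<integral>x. \<bar>f x\<bar> \<partial>?\<mu>) \<le> 2" if f: "f \<in> X" for f
  proof -
    have one: "integrable ?\<mu> (\<lambda>x. 1 :: real)" by (intro integrable_hmeasure_continuous[OF \<kappa>] continuous_intros)
    have "(\<integral>x. \<bar>f x\<bar> \<partial>?\<mu>) \<le> (\<integral>x. 1 + \<bar>f x\<bar> powr p \<partial>?\<mu>)"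
      by (intro integral_mono Bochner_Integration.integrable_add one pi f integrable_abs Xi abs_le_one_plus_powr p)
    also have "\<dots> = 1 + (\<integral>x. \<bar>f x\<bar> powr p \<partial>?\<mu>)"
      by (simp only: Bochner_Integration.integral_add[OF one pi[OF f]] space_mass_one[OF \<kappa>])
    finally show ?thesis using f by (simp add: X_def)
  qed
  show ?thesis
  proof (rule divergence_from_unbounded_pairings[OF \<kappa>, of X Y])
    show "continuous_on (sphere 0 1) f \<and> (\<integral>x. \<bar>f x\<bar> \<partial>?\<mu>) \<le> 2" if "f \<in> X" for f
      using Xc[OF that] X2[OF that] by simp
    show "continuous_on (sphere 0 1) G" if "G \<in> Y" for G using that by (simp add: Y_def)
    show "X \<subseteq> Lp_space \<kappa> (ereal p)"
      using pi Xi by (auto simp: Lp_space_def dest: borel_measurable_integrable)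
    show "\<exists>B. \<forall>n. \<forall>G\<in>Y. \<bar>\<integral>x. G x * cesaro_mean \<kappa> \<delta> n f x \<partial>?\<mu>\<bar> \<le> B"
      if "integrable ?\<mu> f" "converges_in_Lp \<kappa> (ereal p) \<delta> f" for f
      using convergent_imp_weakly_bounded[OF \<kappa> p that] unfolding Y_def by blast
    show "\<exists>n. \<exists>f\<in>X. \<exists>G\<in>Y. (\<integral>x. G x * cesaro_mean \<kappa> \<delta> n f x \<partial>?\<mu>) > B" for B
      using unbounded[of B] unfolding X_def Y_def by blast
    fix c :: "nat \<Rightarrow> real" and f :: "nat \<Rightarrow> real ^ 'n \<Rightarrow> real" assume f: "\<And>k. f k \<in> X" and c: "\<And>k. 0 < c k" "\<And>k. c k \<le> (1 / 2) ^ Suc k"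
    have c0: "\<And>k. 0 \<le> c k" using c(1) less_imp_le by blast
    note cs = geometric_weights_sum[of c, OF c]
    have m: "(\<lambda>x. \<Sum>k. c k * f k x) \<in> borel_measurable ?\<mu>"
      using Xi[OF f] by (auto intro!: borel_measurable_suminf dest: borel_measurable_integrable)
    have fp: "(\<integral>x. \<bar>f k x\<bar> powr p \<partial>?\<mu>) \<le> 1" for k using f[of k] by (simp add: X_def)
    have a1: "AE x in ?\<mu>. summable (\<lambda>k. c k * \<bar>f k x\<bar>)"
      by (rule AE_summable_series(1)[of ?\<mu> "\<lambda>k x. \<bar>f k x\<bar>" c 2]) (use Xi f X2 c0 cs in auto)
    have a2: "AE x in ?\<mu>. summable (\<lambda>k. c k * \<bar>f k x\<bar> powr p)" "summable (\<lambda>k. \<integral>x. c k * \<bar>f k x\<bar> powr p \<partial>?\<mu>)"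
      by (rule AE_summable_series[of ?\<mu> "\<lambda>k x. \<bar>f k x\<bar> powr p" c 1]; use pi f fp c0 cs in simp)+
    have i: "integrable ?\<mu> (\<lambda>x. \<Sum>k. c k * \<bar>f k x\<bar> powr p)"
      by (rule integrable_suminf) (use a2 pi[OF f] c0 in \<open>auto simp: abs_mult\<close>)
    have pw: "\<bar>\<Sum>k. c k * f k x\<bar> powr p \<le> (\<Sum>k. c k * \<bar>f k x\<bar> powr p)"
      if s1: "summable (\<lambda>k. c k * \<bar>f k x\<bar>)" and s2: "summable (\<lambda>k. c k * \<bar>f k x\<bar> powr p)" for x
    proof -
      have "\<bar>\<Sum>k. c k * f k x\<bar> \<le> (\<Sum>k. \<bar>c k * f k x\<bar>)"
        by (rule summable_rabs) (use s1 c0 in \<open>simp add: abs_mult\<close>)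
      also have "\<dots> = (\<Sum>k. c k * \<bar>f k x\<bar>)" using c0 by (simp add: abs_mult)
      finally have "\<bar>\<Sum>k. c k * f k x\<bar> powr p \<le> (\<Sum>k. c k * \<bar>f k x\<bar>) powr p" using p by (intro powr_mono2) auto
      also have "\<dots> \<le> (\<Sum>k. c k * \<bar>f k x\<bar> powr p)" by (rule powr_suminf_le[OF p c0 cs abs_ge_zero s1 s2])
      finally show ?thesis .
    qed
    have "integrable ?\<mu> (\<lambda>x. \<bar>\<Sum>k. c k * f k x\<bar> powr p)"
    proof (rule Bochner_Integration.integrable_bound[OF i])
      show "(\<lambda>x. \<bar>\<Sum>k. c k * f k x\<bar> powr p) \<in> borel_measurable ?\<mu>" using m by measurable
      show "AE x in ?\<mu>. norm (\<bar>\<Sum>k. c k * f k x\<bar> powr p) \<le> norm (\<Sum>k. c k * \<bar>f k x\<bar> powr p)"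
        using a1 a2(1)
      proof eventually_elim
        case (elim x)
        then show ?case using pw[OF elim] by simp
      qed
    qed
    then show "(\<lambda>x. \<Sum>k. c k * f k x) \<in> Lp_space \<kappa> (ereal p)" using m by (simp add: Lp_space_def)
  qed
qed

theorem divergence_uniform:
  fixes \<kappa> :: "real ^ 'n"
  assumes \<kappa>: "\<And>i. 0 \<le> \<kappa> $ i"
    and unbounded: "\<And>B. \<exists>n f G. continuous_on (sphere 0 1) f \<and> (\<forall>x\<in>sphere 0 1. \<bar>f x\<bar> \<le> 1) \<and>
      continuous_on (sphere 0 1) G \<and> (\<integral>x. \<bar>G x\<bar> \<partial>hmeasure \<kappa>) \<le> 1 \<and>
      (\<integral>x. G x * cesaro_mean \<kappa> \<delta> n f x \<partial>hmeasure \<kappa>) > B"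
  shows "\<exists>f\<in>Lp_space \<kappa> \<infinity>. \<not> converges_in_Lp \<kappa> \<infinity> \<delta> f"
proof -
  let ?\<mu> = "hmeasure \<kappa>"
  define X :: "(real ^ 'n \<Rightarrow> real) set" where "X = {f. continuous_on (sphere 0 1) f \<and> (\<forall>x\<in>sphere 0 1. \<bar>f x\<bar> \<le> 1)}"
  define Y :: "(real ^ 'n \<Rightarrow> real) set" where "Y = {G. continuous_on (sphere 0 1) G \<and> (\<integral>x. \<bar>G x\<bar> \<partial>?\<mu>) \<le> 1}"
  show ?thesis
  proof (rule divergence_from_unbounded_pairings[OF \<kappa>, of X Y])
    show "continuous_on (sphere 0 1) f \<and> (\<integral>x. \<bar>f x\<bar> \<partial>?\<mu>) \<le> 2" if f: "f \<in> X" for f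
    proof -
      have "(\<integral>x. \<bar>f x\<bar> \<partial>?\<mu>) \<le> (\<integral>x. 1 \<partial>?\<mu>)"
        using f by (intro integral_mono integrable_hmeasure_continuous[OF \<kappa>] continuous_intros) (auto simp: X_def)
      then show ?thesis using f by (simp only: space_mass_one[OF \<kappa>]) (simp add: X_def)
    qed
    show "continuous_on (sphere 0 1) G" if "G \<in> Y" for G using that by (simp add: Y_def)
    show "X \<subseteq> Lp_space \<kappa> \<infinity>" by (auto simp: Lp_space_def X_def)
    show "\<exists>B. \<forall>n. \<forall>G\<in>Y. \<bar>\<integral>x. G x * cesaro_mean \<kappa> \<delta> n f x \<partial>?\<mu>\<bar> \<le> B"
      if "integrable ?\<mu> f" "converges_in_Lp \<kappa> \<infinity> \<delta> f" for f
      using uniformly_convergent_imp_weakly_bounded[OF \<kappa> that] unfolding Y_def by blast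
    show "\<exists>n. \<exists>f\<in>X. \<exists>G\<in>Y. (\<integral>x. G x * cesaro_mean \<kappa> \<delta> n f x \<partial>?\<mu>) > B" for B
      using unbounded[of B] unfolding X_def Y_def by blast
    fix c :: "nat \<Rightarrow> real" and f :: "nat \<Rightarrow> real ^ 'n \<Rightarrow> real" assume f: "\<And>k. f k \<in> X" and c: "\<And>k. 0 < c k" "\<And>k. c k \<le> (1 / 2) ^ Suc k"
    note cs = geometric_weights_sum[of c, OF c]
    have "uniform_limit (sphere 0 1) (\<lambda>N x. \<Sum>k<N. c k * f k x) (\<lambda>x. \<Sum>k. c k * f k x) sequentially"
    proof (rule Weierstrass_m_test[OF _ cs(1)])
      fix k x assume "x \<in> sphere (0 :: real ^ 'n) 1"
      then have "\<bar>f k x\<bar> \<le> 1" using f[of k] by (simp add: X_def)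
      then show "norm (c k * f k x) \<le> c k" using c(1)[of k] by (simp add: abs_mult)
    qed
    then have "continuous_on (sphere 0 1) (\<lambda>x. \<Sum>k. c k * f k x)"
      by (rule uniform_limit_theorem[rotated])
        (use f in \<open>auto simp: X_def intro!: always_eventually continuous_intros\<close>)
    then show "(\<lambda>x. \<Sum>k. c k * f k x) \<in> Lp_space \<kappa> \<infinity>" by (simp add: Lp_space_def)
  qed
qed

section \<open>Mass of the weight near a vertex\<close>

text \<open>
  On the sphere, the sine of the angle between \<open>x\<close> and axis \<open>i\<close>.
\<close>

definition polar_sine :: "'n \<Rightarrow> real ^ 'n \<Rightarrow> real" where
  "polar_sine i x = sqrt (1 - (x $ i)\<^sup>2)"

definition ramp :: "real \<Rightarrow> real" where
  "ramp t = max 0 (min 1 t)"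

text \<open>
  A continuous cutoff to the region around the vertex where the lower bound for the means is
  available.
\<close>

definition cutoff :: "'n \<Rightarrow> real \<Rightarrow> real ^ 'n \<Rightarrow> real" where
  "cutoff i m x = ramp (polar_sine i x / m - 1) * ramp (2 - 4 * polar_sine i x) * ramp (4 * x $ i - 1)"

text \<open>
  Agrees with \<open>polar_sine\<close> wherever \<open>cutoff i m\<close> is positive, and has continuous negative powers.
\<close>

definition trunc_sine :: "'n \<Rightarrow> real \<Rightarrow> real ^ 'n \<Rightarrow> real" where
  "trunc_sine i m x = max (polar_sine i x) m"

lemma cutoff_bounds: "0 \<le> cutoff i m x" "cutoff i m x \<le> 1"
  unfolding cutoff_def ramp_def by (auto intro!: mult_nonneg_nonneg mult_le_one)

lemma cutoff_pos_imp:
  assumes "cutoff i m x > 0" "m > 0"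
  shows "x $ i > 0" "m \<le> polar_sine i x" "polar_sine i x \<le> 1 / 2"
proof -
  have r: "ramp t > 0 \<longleftrightarrow> t > 0" for t by (auto simp: ramp_def)
  have "ramp t \<ge> 0" for t by (simp add: ramp_def)
  then have "ramp (polar_sine i x / m - 1) > 0 \<and> ramp (2 - 4 * polar_sine i x) > 0 \<and> ramp (4 * x $ i - 1) > 0"
    using assms(1) unfolding cutoff_def by (metis less_le mult_eq_0_iff)
  then show "x $ i > 0" "m \<le> polar_sine i x" "polar_sine i x \<le> 1 / 2"
    using assms(2) by (auto simp: r field_simps)
qed

lemma cutoff_eq_1:
  "m > 0 \<Longrightarrow> 2 * m \<le> polar_sine i x \<Longrightarrow> polar_sine i x \<le> 1 / 4 \<Longrightarrow> 1 / 2 \<le> x $ i \<Longrightarrow> cutoff i m x = 1"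
  by (simp add: cutoff_def ramp_def field_simps)

lemma continuous_cutoff [continuous_intros]: "m > 0 \<Longrightarrow> continuous_on S (cutoff i m)"
  unfolding cutoff_def ramp_def polar_sine_def by (intro continuous_intros) auto

lemma trunc_sine_pos: "m > 0 \<Longrightarrow> trunc_sine i m x > 0"
  by (simp add: trunc_sine_def)

lemma continuous_trunc_sine_powr [continuous_intros]:
  "m > 0 \<Longrightarrow> continuous_on S (\<lambda>x. trunc_sine i m x powr a)"
  unfolding trunc_sine_def polar_sine_def by (intro continuous_intros) auto

lemma measure_vertex_box:
  fixes i :: "'n :: finite" and r :: real
  assumes r: "r > 0"
  defines "Q \<equiv> box (\<chi> j. if j = i then 1 / 2 else r) (\<chi> j. if j = i then 3 / 4 else 2 * r)"
  shows "measure lborel Q = r ^ (CARD('n) - 1) / 4"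
proof -
  let ?l = "\<chi> j. if j = i then 1 / 2 else r" and ?u = "\<chi> j. if j = i then 3 / 4 else 2 * r"
  have "measure lborel Q = measure lborel (cbox ?l ?u)" unfolding Q_def by (simp add: measure_lborel_box_eq measure_lborel_cbox_eq)
  also have "\<dots> = (\<Prod>j\<in>UNIV. ?u $ j - ?l $ j)"
    using r by (intro content_cbox_cart) (auto simp: interval_ne_empty_cart)
  also have "\<dots> = (\<Prod>j\<in>UNIV. if j = i then 1 / 4 else r)" by (intro prod.cong) auto
  also have "\<dots> = (1 / 4) * (\<Prod>j\<in>UNIV - {i}. r)"
    by (subst prod.remove[of UNIV i]) auto
  finally show ?thesis by (simp add: card_Diff_singleton)
qed

lemma exists_other_index:
  assumes "2 \<le> CARD('n)"
  shows "\<exists>j :: 'n :: finite. j \<noteq> i"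
proof (rule ccontr)
  assume "\<nexists>j. j \<noteq> i"
  then have "UNIV = {i}" by auto
  then have "CARD('n) = card {i}" by simp
  then show False using assms by simp
qed

text \<open>
  Boxes in place of spherical shells make the volume and the disjointness trivial. The bound on \<open>r\<close>
  keeps the box inside the ball and its directions within \<open>polar_sine \<le> 1 / 4\<close>.
\<close>

lemma weight_on_vertex_box:
  fixes \<kappa> :: "real ^ 'n" and i :: 'n and x :: "real ^ 'n" and r :: real
  assumes \<kappa>: "\<And>j. 0 \<le> \<kappa> $ j" and r: "0 < r" "r \<le> 1 / (16 * real CARD('n))"
    and x: "x \<in> box (\<chi> j. if j = i then 1 / 2 else r) (\<chi> j. if j = i then 3 / 4 else 2 * r)"
    and N: "2 \<le> CARD('n)"
  defines "\<tau> \<equiv> (\<Sum>j\<in>UNIV. \<kappa> $ j) - \<kappa> $ i"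
  shows "x \<in> pball" "1 / 2 \<le> sgn x $ i" "r \<le> polar_sine i (sgn x)"
    "polar_sine i (sgn x) \<le> 4 * real CARD('n) * r"
    "((1 / 2) powr (\<kappa> $ i) * r powr \<tau>)\<^sup>2 \<le> hw2 \<kappa> (sgn x)"
proof -
  have xi: "1 / 2 < x $ i" "x $ i < 3 / 4" using x[unfolded mem_box_cart, rule_format, of i] by auto
  have xj: "r < x $ j" "x $ j < 2 * r" if "j \<noteq> i" for j using x[unfolded mem_box_cart, rule_format, of j] that by auto
  have rN: "16 * (real CARD('n) * r) \<le> 1" using r by (simp add: field_simps)
  have "norm x \<le> (\<Sum>j\<in>UNIV. \<bar>x $ j\<bar>)" by (rule norm_le_l1_cart)
  also have "\<dots> = \<bar>x $ i\<bar> + (\<Sum>j\<in>UNIV - {i}. \<bar>x $ j\<bar>)" by (rule sum.remove) auto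
  also have "(\<Sum>j\<in>UNIV - {i}. \<bar>x $ j\<bar>) \<le> (\<Sum>j\<in>UNIV - {i}. 2 * r)"
    by (intro sum_mono) (use xj r in \<open>fastforce simp: abs_if\<close>)
  also have "\<dots> \<le> real CARD('n) * (2 * r)" using r by (simp add: card_Diff_singleton)
  finally have n1: "norm x < 1" using xi rN by (simp add: abs_if split: if_splits)
  have n2: "norm x \<ge> 1 / 2" using component_le_norm_cart[of x i] xi by simp
  have n0: "norm x > 0" using n2 by linarith
  show "x \<in> pball" using n1 n0 by auto
  have sj: "sgn x $ j = x $ j / norm x" for j by (simp add: sgn_div_norm divide_inverse_commute)
  show si: "1 / 2 \<le> sgn x $ i" using xi n1 n0 by (simp add: sj field_simps)
  let ?q = "\<Sum>j\<in>UNIV - {i}. (x $ j)\<^sup>2"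
  have nx: "(norm x)\<^sup>2 = (x $ i)\<^sup>2 + ?q"
  proof -
    have "(norm x)\<^sup>2 = (\<Sum>j\<in>UNIV. (x $ j)\<^sup>2)" by (simp add: norm_vec_def L2_set_def sum_nonneg)
    then show ?thesis by (subst (asm) sum.remove[of UNIV i]) auto
  qed
  have "1 - (sgn x $ i)\<^sup>2 = ?q / (norm x)\<^sup>2" 
  proof -
    have "1 - (x $ i)\<^sup>2 / (norm x)\<^sup>2 = ((norm x)\<^sup>2 - (x $ i)\<^sup>2) / (norm x)\<^sup>2"
      using n0 by (simp add: diff_divide_distrib)
    then show ?thesis unfolding sj power_divide by (simp add: nx)
  qed
  then have ps: "polar_sine i (sgn x) = sqrt ?q / norm x" using n0 by (simp add: polar_sine_def real_sqrt_divide)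
  obtain j where j: "j \<noteq> i" using exists_other_index[OF N] by blast
  have "r\<^sup>2 \<le> (x $ j)\<^sup>2" using xj[OF j] r by (intro power_mono) auto
  also have "\<dots> \<le> ?q" using j by (intro member_le_sum) auto
  finally have "r \<le> sqrt ?q" using r by (intro real_le_rsqrt)
  moreover have "sqrt ?q * norm x \<le> sqrt ?q * 1" using n1 by (intro mult_left_mono) (auto intro: sum_nonneg)
  then have "sqrt ?q \<le> sqrt ?q / norm x" using n0 by (simp add: field_simps)
  ultimately show "r \<le> polar_sine i (sgn x)" by (simp add: ps)
  have "sqrt ?q \<le> (\<Sum>j\<in>UNIV - {i}. \<bar>x $ j\<bar>)"
    using L2_set_le_sum_abs[of "\<lambda>j. x $ j" "UNIV - {i}"] by (simp add: L2_set_def)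
  also have "\<dots> \<le> (\<Sum>j\<in>UNIV - {i}. 2 * r)"
    by (intro sum_mono) (use xj r in \<open>fastforce simp: abs_if\<close>)
  also have "\<dots> \<le> real CARD('n) * (2 * r)" using r by (simp add: card_Diff_singleton)
  finally have "sqrt ?q \<le> real CARD('n) * (2 * r)" .
  also have "\<dots> \<le> (4 * real CARD('n) * r) * norm x" using mult_left_mono[OF n2, of "4 * real CARD('n) * r"] r by simp
  finally show "polar_sine i (sgn x) \<le> 4 * real CARD('n) * r" using n0 by (simp add: ps divide_le_eq)
  have "(1 / 2) powr (\<kappa> $ i) * r powr \<tau> = (\<Prod>j\<in>UNIV. if j = i then (1 / 2) powr (\<kappa> $ i) else r powr (\<kappa> $ j))"
  proof -
    have "\<tau> = (\<Sum>j\<in>UNIV - {i}. \<kappa> $ j)" by (simp add: \<tau>_def sum_diff1)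
    then have "r powr \<tau> = (\<Prod>j\<in>UNIV - {i}. r powr (\<kappa> $ j))" using r by (simp add: powr_sum)
    then show ?thesis by (subst prod.remove[of UNIV i]) auto
  qed
  also have "\<dots> \<le> hweight \<kappa> (sgn x)"
    unfolding hweight_def
  proof (rule prod_mono, safe)
    fix j
    show "0 \<le> (if j = i then (1 / 2) powr (\<kappa> $ i) else r powr (\<kappa> $ j))" by simp
    have "r powr (\<kappa> $ j) \<le> \<bar>sgn x $ j\<bar> powr (\<kappa> $ j)" if "j \<noteq> i"
    proof (rule powr_mono2)
      have "r * norm x \<le> x $ j" using mult_left_le[of "norm x" r] n1 r xj(1)[OF that] by linarith
      then show "r \<le> \<bar>sgn x $ j\<bar>" using n0 by (simp add: sj pos_le_divide_eq)
    qed (use \<kappa> r in auto)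
    moreover have "(1 / 2) powr (\<kappa> $ i) \<le> \<bar>sgn x $ i\<bar> powr (\<kappa> $ i)"
      using si \<kappa> by (intro powr_mono2) auto
    ultimately show "(if j = i then (1 / 2) powr (\<kappa> $ i) else r powr (\<kappa> $ j)) \<le> (if \<kappa> $ j = 0 then 1 else \<bar>sgn x $ j\<bar> powr (\<kappa> $ j))"
      using r by auto
  qed
  finally show "((1 / 2) powr (\<kappa> $ i) * r powr \<tau>)\<^sup>2 \<le> hw2 \<kappa> (sgn x)"
    unfolding hw2_def by (intro power_mono) auto
qed

text \<open>
  Consider the boxes with \<open>r\<close> running through a geometric progression of ratio \<open>1 / 2\<close>. The volume
  \<open>r ^ (N - 1) / 4\<close>, the weight, of order \<open>r powr (D - N + 1)\<close>, and the integrand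
  \<open>r powr (- D)\<close> multiply to a constant, so the integral grows with the number of boxes admitted by the
  cutoff.
\<close>

lemma vertex_integral_unbounded:
  fixes \<kappa> :: "real ^ 'n" and i :: 'n
  assumes \<kappa>: "\<And>j. 0 \<le> \<kappa> $ j" and N: "2 \<le> CARD('n)"
    and D: "D = real CARD('n) - 1 + 2 * ((\<Sum>j\<in>UNIV. \<kappa> $ j) - \<kappa> $ i)"
  shows "\<exists>m0>0. \<forall>m\<in>{0<..m0}. B \<le> (\<integral>x. cutoff i m x * trunc_sine i m x powr (- D) \<partial>hmeasure \<kappa>)"
proof -
  define \<tau> where "\<tau> = (\<Sum>j\<in>UNIV. \<kappa> $ j) - \<kappa> $ i"
  have \<tau>0: "\<tau> \<ge> 0" unfolding \<tau>_def using \<kappa> member_le_sum[of i UNIV "\<lambda>j. \<kappa> $ j"] by simp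
  have D0: "D > 0" using D N \<tau>0 by (simp add: \<tau>_def)
  define n where "n = CARD('n) - 1"
  have n: "real n = real CARD('n) - 1" using N by (simp add: n_def of_nat_diff)
  define rr :: "nat \<Rightarrow> real" where "rr = (\<lambda>k. 1 / (16 * real CARD('n)) * (1 / 2) ^ k)"
  have rr: "0 < rr k" "rr k \<le> 1 / (16 * real CARD('n))" for k
    by (auto simp: rr_def field_simps)
  define Q where "Q = (\<lambda>k. box (\<chi> j. if j = i then 1 / 2 else rr k) (\<chi> j. if j = i then 3 / 4 else 2 * rr k) :: (real ^ 'n) set)"
  define C where "C = ((1 / 2) powr (\<kappa> $ i))\<^sup>2 * (4 * real CARD('n)) powr (- D)"
  have C: "C > 0" by (simp add: C_def)
  define A where "A = a_const \<kappa> * real CARD('n)"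
  have A: "A > 0" using a_const_pos[OF \<kappa>] by (simp add: A_def)
  obtain K :: nat where K: "B \<le> real K * (A * C / 4)"
    using reals_Archimedean3[of "A * C / 4"] A C by (metis divide_pos_pos less_imp_le mult_pos_pos zero_less_numeral)
  have "B \<le> (\<integral>x. cutoff i m x * trunc_sine i m x powr (- D) \<partial>hmeasure \<kappa>)" if m: "m \<in> {0<..rr K / 2}" for m
  proof -
    have m0: "m > 0" using m by simp
    let ?f = "\<lambda>x. cutoff i m x * trunc_sine i m x powr (- D)"
    let ?g = "\<lambda>x. indicator pball x * (hw2 \<kappa> (sgn x) * ?f (sgn x))"
    let ?h = "\<lambda>x. \<Sum>k<K. C / rr k ^ n * indicator (Q k) x"
    have fc: "continuous_on S ?f" for S using m0 by (intro continuous_intros)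
    have "?f \<in> borel_measurable (restrict_space borel (sphere 0 1))"
      by (rule borel_measurable_continuous_on_restrict[OF fc])
    then have eq: "(\<integral>x. ?f x \<partial>hmeasure \<kappa>) = A * (\<integral>x. ?g x \<partial>lborel)"
      unfolding A_def by (rule integral_hmeasure[OF \<kappa>])
    have f0: "?f x \<ge> 0" for x using cutoff_bounds(1)[of i m x] by simp
    have gint: "integrable lborel ?g"
    proof -
      have c: "continuous_on UNIV (\<lambda>x. hw2 \<kappa> x * ?f x)" by (intro continuous_on_mult continuous_hw2[OF \<kappa>] fc)
      obtain H where H: "H > 0" "\<And>x. x \<in> sphere 0 1 \<Longrightarrow> \<bar>hw2 \<kappa> x * ?f x\<bar> \<le> H"
        using continuous_sphere_bounded[OF continuous_on_subset[OF c subset_UNIV]] by blast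
      show ?thesis
      proof (rule Bochner_Integration.integrable_bound)
        show "integrable lborel (\<lambda>x. H * indicator (ball 0 1) x :: real)"
          by (intro integrable_mult_right integrable_real_indicator) (auto simp: emeasure_lborel_ball_finite[unfolded infinity_ennreal_def])
        show "?g \<in> borel_measurable lborel" using borel_measurable_pball_sgn[OF c] by simp
        have "norm (sgn x) = 1" if "x \<in> pball" for x :: "real ^ 'n" using that by (simp add: norm_sgn)
        then show "AE x in lborel. norm (?g x) \<le> norm (H * indicator (ball 0 1) x :: real)"
          using H by (intro AE_I2) (auto simp: indicator_def abs_mult[symmetric] simp del: abs_mult)
      qed
    qed
    have qint: "integrable lborel (\<lambda>x. C / rr k ^ n * indicator (Q k) x :: real)" for k
      unfolding Q_def by (intro integrable_mult_right integrable_real_indicator) (auto simp: emeasure_lborel_box_finite[unfolded infinity_ennreal_def])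
    have le: "?h x \<le> ?g x" for x
    proof (cases "\<exists>k<K. x \<in> Q k")
      case False
      then have "?h x = 0" by (intro sum.neutral) (auto simp: indicator_def)
      then show ?thesis using f0[of "sgn x"] hw2_nonneg[of \<kappa> "sgn x"] by simp
    next
      case True
      then obtain k where k: "k < K" "x \<in> Q k" by blast
      let ?r = "rr k"
      obtain j where j: "j \<noteq> i" using exists_other_index[OF N] by blast
      have disj: "x \<notin> Q k'" if "k' \<noteq> k" for k'
      proof
        assume "x \<in> Q k'"
        then have "rr k' < x $ j" "x $ j < 2 * rr k'" "rr k < x $ j" "x $ j < 2 * rr k"
          using k(2) j unfolding Q_def mem_box_cart by (auto dest!: spec[of _ j])
        then have "rr k' < 2 * rr k" "rr k < 2 * rr k'" by auto
        then have a: "(1 / 2 :: real) ^ k' < 2 * (1 / 2) ^ k" "(1 / 2 :: real) ^ k < 2 * (1 / 2) ^ k'"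
          by (auto simp: rr_def field_simps)
        have "2 * (1 / 2 :: real) ^ p \<le> (1 / 2) ^ q" if "q < p" for p q
          using power_decreasing[of "Suc q" p "1 / 2 :: real"] that by simp
        then show False using a \<open>k' \<noteq> k\<close> by (metis linorder_neqE_nat not_less)
      qed
      have "?h x = (\<Sum>l<K. if l = k then C / ?r ^ n else 0)"
        using k disj by (intro sum.cong) (auto simp: indicator_def)
      then have h: "?h x = C / ?r ^ n" using k by simp
      note w = weight_on_vertex_box[OF \<kappa> rr k(2)[unfolded Q_def] N]
      have "2 * m \<le> rr K" using m by simp
      also have "rr K \<le> ?r" unfolding rr_def using k by (intro mult_left_mono power_decreasing) auto
      finally have rm: "2 * m \<le> ?r" .
      have "4 * real CARD('n) * ?r \<le> 1 / 4" using rr[of k] by (simp add: field_simps)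
      then have cut: "cutoff i m (sgn x) = 1" using w rm m0 by (intro cutoff_eq_1) auto
      have "trunc_sine i m (sgn x) = polar_sine i (sgn x)" using w rm m0 by (simp add: trunc_sine_def)
      moreover have "(4 * real CARD('n) * ?r) powr (- D) \<le> polar_sine i (sgn x) powr (- D)"
        using w rr[of k] D0 by (intro powr_mono2') auto
      ultimately have ts: "(4 * real CARD('n) * ?r) powr (- D) \<le> trunc_sine i m (sgn x) powr (- D)" by simp
      have "C / ?r ^ n = ((1 / 2) powr (\<kappa> $ i) * ?r powr \<tau>)\<^sup>2 * (4 * real CARD('n) * ?r) powr (- D)"
      proof -
        have "- D = - real n - 2 * \<tau>" by (simp add: D n \<tau>_def algebra_simps)
        then have "?r powr (- D) = ?r powr (- real n - 2 * \<tau>)" by simp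
        also have "\<dots> = inverse (?r ^ n) * inverse (?r powr \<tau>) ^ 2"
        proof -
          have "?r powr (- real n - 2 * \<tau>) = ?r powr (- real n) * (?r powr (- \<tau>) * ?r powr (- \<tau>))"
            by (simp only: powr_add[symmetric]) simp
          then show ?thesis using rr(1)[of k] by (simp add: powr_minus powr_realpow power2_eq_square)
        qed
        finally show ?thesis using rr(1)[of k]
          by (simp add: C_def powr_mult power_mult_distrib field_simps)
      qed
      also have "\<dots> \<le> hw2 \<kappa> (sgn x) * trunc_sine i m (sgn x) powr (- D)"
        using w(5) ts by (intro mult_mono) (auto simp: \<tau>_def hw2_nonneg)
      finally show ?thesis using h cut w(1) by simp
    qed
    have "real K * (C / 4) = (\<Sum>k<K. C / rr k ^ n * measure lborel (Q k))"
      using rr(1) by (simp add: Q_def measure_vertex_box n_def less_imp_neq[symmetric])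
    also have "\<dots> = (\<Sum>k<K. \<integral>x. C / rr k ^ n * indicator (Q k) x \<partial>lborel)"
      by (simp add: Q_def)
    also have "\<dots> = (\<integral>x. ?h x \<partial>lborel)" by (rule Bochner_Integration.integral_sum[symmetric]) (rule qint)
    also have "\<dots> \<le> (\<integral>x. ?g x \<partial>lborel)"
      by (intro integral_mono gint Bochner_Integration.integrable_sum qint le)
    finally have "A * (real K * (C / 4)) \<le> (\<integral>x. ?f x \<partial>hmeasure \<kappa>)"
      unfolding eq using A by (intro mult_left_mono) auto
    then show ?thesis using K by (simp add: mult_ac)
  qed
  then show ?thesis using rr(1)[of K] by (intro exI[of _ "rr K / 2"]) auto
qed


section \<open>Large Cesaro means near a vertex\<close>

lemma cesaro_mean_scale: "cesaro_mean \<kappa> \<delta> n (\<lambda>x. a * f x) x = a * cesaro_mean \<kappa> \<delta> n f x"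
  by (simp add: cesaro_mean_def h_proj_def mult.assoc sum_distrib_left mult.left_commute[of _ a])

context vertex_kernel
begin

text \<open>
  Suppose all the integrals were small. Summing them against the generating weights, whose total is
  \<open>(1 - exp (- e)) powr (- \<delta> - 1)\<close>, contradicts the pointwise lower bound. The inequality
  \<open>\<delta> \<le> \<delta>c\<close> enters through \<open>M * e \<le> y\<close>: the surplus power \<open>y powr (\<delta>c - \<delta>)\<close> is at least
  \<open>(M * e) powr (\<delta>c - \<delta>)\<close>, which compensates the change in the total of the weights.
\<close>

lemma some_cesaro_mean_large:
  assumes \<delta>: "0 < \<delta>" "\<delta> \<le> \<delta>c" and \<delta>c: "\<delta>c \<le> s"
  shows "\<exists>M>0. \<exists>c>0. \<forall>e\<in>{0<..1}. let \<Lambda> = (\<integral>x. cutoff i (M * e) x * trunc_sine i (M * e) x powr (- (2 * s + 1)) \<partial>\<mu>) in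
     \<Lambda> > 0 \<longrightarrow> (\<exists>n. c * e powr (- (s - \<delta>c)) * \<Lambda> < (\<integral>x. \<bar>cesaro_mean \<kappa> \<delta> n (F e) x\<bar> *
        (cutoff i (M * e) x * trunc_sine i (M * e) x powr (- (s - \<delta>c))) \<partial>\<mu>))"
proof -
  obtain M c where M: "M > 0" and c: "c > 0" and low: "\<forall>e\<in>{0<..1}. \<forall>x\<in>sphere 0 1. \<forall>y. x $ i > 0 \<longrightarrow> (x $ i)\<^sup>2 + y\<^sup>2 = 1 \<longrightarrow> M * e \<le> y \<longrightarrow> y \<le> 1 / 2 \<longrightarrow>
     summable (\<lambda>n. cesaro_coeff \<delta> n * exp (- e) ^ n * \<bar>cesaro_mean \<kappa> \<delta> n (F e) x\<bar>) \<and>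
     c * (e powr (- s - 1) * y powr (- \<delta> - s - 1)) \<le> (\<Sum>n. cesaro_coeff \<delta> n * exp (- e) ^ n * \<bar>cesaro_mean \<kappa> \<delta> n (F e) x\<bar>)"
  proof -
    have "\<delta> > - 1" using \<delta> by simp
    from cesaro_F_lower[OF this] show thesis using that by blast
  qed
  define c2 where "c2 = c * M powr (\<delta>c - \<delta>) / 2 powr (\<delta> + 1)"
  have c2: "c2 > 0" using c M by (simp add: c2_def)
  have main2: "\<exists>n. c2 / 2 * e powr (- (s - \<delta>c)) * \<Lambda> < (\<integral>x. \<bar>cesaro_mean \<kappa> \<delta> n (F e) x\<bar> * (cutoff i (M * e) x * trunc_sine i (M * e) x powr (- (s - \<delta>c))) \<partial>\<mu>)"
    if e: "e \<in> {0<..1}" and \<Lambda>: "\<Lambda> = (\<integral>x. cutoff i (M * e) x * trunc_sine i (M * e) x powr (- (2 * s + 1)) \<partial>\<mu>)" "\<Lambda> > 0" for e \<Lambda>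
  proof (rule ccontr)
    assume neg: "\<nexists>n. c2 / 2 * e powr (- (s - \<delta>c)) * \<Lambda> < (\<integral>x. \<bar>cesaro_mean \<kappa> \<delta> n (F e) x\<bar> * (cutoff i (M * e) x * trunc_sine i (M * e) x powr (- (s - \<delta>c))) \<partial>\<mu>)"
    define m where "m = M * e"
    have e0: "e > 0" "e \<le> 1" using e by auto
    have m0: "m > 0" using M e0 by (simp add: m_def)
    define \<phi> where "\<phi> = (\<lambda>x. cutoff i m x * trunc_sine i m x powr (- (s - \<delta>c)))"
    define t where "t = c2 / 2 * e powr (- (s - \<delta>c)) * \<Lambda>"
    have t0: "t > 0" using c2 e0 \<Lambda>(2) by (simp add: t_def)
    define I where "I = (\<lambda>n. \<integral>x. \<bar>cesaro_mean \<kappa> \<delta> n (F e) x\<bar> * \<phi> x \<partial>\<mu>)"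
    have It: "I n \<le> t" for n using neg by (auto simp: I_def t_def \<phi>_def m_def not_less)
    define A where "A = (\<lambda>n. cesaro_coeff \<delta> n * exp (- e) ^ n)"
    have A0: "A n \<ge> 0" for n using cesaro_coeff_pos[of \<delta> n] \<delta> by (simp add: A_def)
    have As: "A sums ((1 - exp (- e)) powr (- (\<delta> + 1)))"
      unfolding A_def using e0 by (intro cesaro_coeff_real_sums) simp
    define L where "L = c * M powr (\<delta>c - \<delta>) * e powr (\<delta>c - \<delta> - s - 1)"
    have L0: "L > 0" using c M e0 by (simp add: L_def)
    have Fi: "integrable \<mu> (F e)" by (rule integrable_hmeasure_continuous[OF kap F_continuous[OF e0(1)]])
    have \<phi>c: "continuous_on (sphere 0 1) \<phi>" unfolding \<phi>_def by (intro continuous_intros m0)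
    have \<phi>0: "\<phi> x \<ge> 0" for x by (simp add: \<phi>_def cutoff_bounds)
    have termc: "continuous_on (sphere 0 1) (\<lambda>x. \<bar>cesaro_mean \<kappa> \<delta> n (F e) x\<bar> * \<phi> x)" for n
      by (intro continuous_intros continuous_cesaro_mean[OF kap Fi] \<phi>c)
    have termi: "integrable \<mu> (\<lambda>x. A n * (\<bar>cesaro_mean \<kappa> \<delta> n (F e) x\<bar> * \<phi> x))" for n
      by (intro integrable_mult_right integrable_hmeasure_continuous[OF kap termc])
    have lamc: "continuous_on (sphere 0 1) (\<lambda>x. L * (cutoff i m x * trunc_sine i m x powr (- (2 * s + 1))))"
      by (intro continuous_intros m0)
    have lami: "integrable \<mu> (\<lambda>x. L * (cutoff i m x * trunc_sine i m x powr (- (2 * s + 1))))"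
      by (rule integrable_hmeasure_continuous[OF kap lamc])
    have pw: "ennreal (L * (cutoff i m x * trunc_sine i m x powr (- (2 * s + 1)))) \<le>
        (\<Sum>n. ennreal (A n * (\<bar>cesaro_mean \<kappa> \<delta> n (F e) x\<bar> * \<phi> x)))" if x: "x \<in> sphere 0 1" for x
    proof (cases "cutoff i m x > 0")
      case False
      then have "cutoff i m x = 0" using cutoff_bounds(1)[of i m x] by simp
      then show ?thesis by simp
    next
      case True
      let ?y = "polar_sine i x"
      note cp = cutoff_pos_imp[OF True m0]
      have "norm (x $ i) \<le> norm x" by (rule component_le_norm_cart[of x i, folded real_norm_def])
      then have "(x $ i)\<^sup>2 \<le> 1" using x by (simp add: abs_square_le_1)
      then have xy: "(x $ i)\<^sup>2 + ?y\<^sup>2 = 1" by (simp add: polar_sine_def)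
      have tr: "trunc_sine i m x = ?y" using cp by (simp add: trunc_sine_def)
      have y0: "?y > 0" using cp m0 by linarith
      let ?S = "\<Sum>n. cesaro_coeff \<delta> n * exp (- e) ^ n * \<bar>cesaro_mean \<kappa> \<delta> n (F e) x\<bar>"
      have sm: "summable (\<lambda>n. A n * \<bar>cesaro_mean \<kappa> \<delta> n (F e) x\<bar>)"
        and S: "c * (e powr (- s - 1) * ?y powr (- \<delta> - s - 1)) \<le> (\<Sum>n. A n * \<bar>cesaro_mean \<kappa> \<delta> n (F e) x\<bar>)"
        using low[rule_format, OF e x cp(1) xy cp(2)[unfolded m_def] cp(3)] by (auto simp: A_def)
      have "m powr (\<delta>c - \<delta>) * ?y powr (- \<delta>c - s - 1) \<le> ?y powr (\<delta>c - \<delta>) * ?y powr (- \<delta>c - s - 1)"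
        using cp m0 \<delta> by (intro mult_right_mono powr_mono2) auto
      also have "\<dots> = ?y powr (- \<delta> - s - 1)"
      proof -
        have ex: "(\<delta>c - \<delta>) + (- \<delta>c - s - 1) = - \<delta> - s - 1" by simp
        show ?thesis by (simp only: powr_add[symmetric] ex)
      qed
      finally have y1: "m powr (\<delta>c - \<delta>) * ?y powr (- \<delta>c - s - 1) \<le> ?y powr (- \<delta> - s - 1)" .
      have "L * ?y powr (- \<delta>c - s - 1) = c * (e powr (- s - 1) * (m powr (\<delta>c - \<delta>) * ?y powr (- \<delta>c - s - 1)))"
      proof -
        have ex: "(- s - 1) + (\<delta>c - \<delta>) = \<delta>c - \<delta> - s - 1" by simp
        have "e powr (\<delta>c - \<delta> - s - 1) = e powr (- s - 1) * e powr (\<delta>c - \<delta>)" by (simp only: powr_add[symmetric] ex)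
        then show ?thesis using M e0 by (simp add: L_def m_def powr_mult mult_ac)
      qed
      also have "\<dots> \<le> c * (e powr (- s - 1) * ?y powr (- \<delta> - s - 1))" using y1 c by (intro mult_left_mono) auto
      also note S
      finally have L1: "L * ?y powr (- \<delta>c - s - 1) \<le> (\<Sum>n. A n * \<bar>cesaro_mean \<kappa> \<delta> n (F e) x\<bar>)" .
      have "?y powr (- (2 * s + 1)) = ?y powr (- \<delta>c - s - 1) * ?y powr (- (s - \<delta>c))" by (simp flip: powr_add)
      then have "L * (cutoff i m x * trunc_sine i m x powr (- (2 * s + 1))) = (L * ?y powr (- \<delta>c - s - 1)) * \<phi> x"
        by (simp add: \<phi>_def tr)
      also have "\<dots> \<le> (\<Sum>n. A n * \<bar>cesaro_mean \<kappa> \<delta> n (F e) x\<bar>) * \<phi> x" by (rule mult_right_mono[OF L1 \<phi>0])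
      also have "\<dots> = (\<Sum>n. A n * (\<bar>cesaro_mean \<kappa> \<delta> n (F e) x\<bar> * \<phi> x))"
        using suminf_mult2[OF sm, of "\<phi> x"] by (simp add: mult.assoc)
      finally have "ennreal (L * (cutoff i m x * trunc_sine i m x powr (- (2 * s + 1)))) \<le> ennreal (\<Sum>n. A n * (\<bar>cesaro_mean \<kappa> \<delta> n (F e) x\<bar> * \<phi> x))"
        by (rule ennreal_leI)
      also have "\<dots> = (\<Sum>n. ennreal (A n * (\<bar>cesaro_mean \<kappa> \<delta> n (F e) x\<bar> * \<phi> x)))"
        using summable_mult2[OF sm, of "\<phi> x"] A0 \<phi>0 by (intro suminf_ennreal2[symmetric]) (auto simp: mult.assoc)
      finally show ?thesis .
    qed
    have "ennreal (L * \<Lambda>) = (\<integral>\<^sup>+x. ennreal (L * (cutoff i m x * trunc_sine i m x powr (- (2 * s + 1)))) \<partial>\<mu>)"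
      using L0 by (subst nn_integral_eq_integral[OF lami]) (auto simp: \<Lambda> m_def cutoff_bounds)
    also have "\<dots> \<le> (\<integral>\<^sup>+x. (\<Sum>n. ennreal (A n * (\<bar>cesaro_mean \<kappa> \<delta> n (F e) x\<bar> * \<phi> x))) \<partial>\<mu>)"
      by (rule nn_integral_mono) (use pw in auto)
    also have "\<dots> = (\<Sum>n. \<integral>\<^sup>+x. ennreal (A n * (\<bar>cesaro_mean \<kappa> \<delta> n (F e) x\<bar> * \<phi> x)) \<partial>\<mu>)"
      by (rule nn_integral_suminf) (intro measurable_compose[OF _ measurable_ennreal] borel_measurable_integrable termi)
    also have "\<dots> = (\<Sum>n. ennreal (A n * I n))"
      using A0 \<phi>0 by (subst nn_integral_eq_integral[OF termi]) (auto simp: I_def)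
    also have "\<dots> \<le> (\<Sum>n. ennreal (A n * t))" using It A0 by (intro suminf_le ennreal_leI mult_left_mono) auto
    also have "\<dots> = ennreal ((1 - exp (- e)) powr (- (\<delta> + 1)) * t)"
      using sums_mult2[OF As, of t] A0 t0 by (intro suminf_ennreal_eq) auto
    finally have main: "L * \<Lambda> \<le> (1 - exp (- e)) powr (- (\<delta> + 1)) * t" using t0 by (simp add: ennreal_le_iff)
    have "e / 2 \<le> 1 - exp (- e)"
    proof -
      have "exp (- e) \<le> 1 / (1 + e)" using exp_ge_add_one_self[of e] e0 by (simp add: exp_minus inverse_eq_divide frac_le)
      also have "\<dots> \<le> 1 - e / 2"
      proof -
        have "(1 - e / 2) * (1 + e) = 1 + (e - e * e) / 2" by (simp add: field_simps)
        moreover have "e * e \<le> e" using e0 by (intro mult_left_le) auto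
        ultimately have "1 \<le> (1 - e / 2) * (1 + e)" by simp
        then show ?thesis using e0 by (subst pos_divide_le_eq) auto
      qed
      finally show ?thesis by simp
    qed
    then have "(1 - exp (- e)) powr (- (\<delta> + 1)) \<le> (e / 2) powr (- (\<delta> + 1))" using e0 \<delta> by (intro powr_mono2') auto
    also have "\<dots> = 2 powr (\<delta> + 1) * e powr (- (\<delta> + 1))" using e0 by (simp only: powr_divide powr_minus) (simp add: field_simps)
    finally have "L * \<Lambda> \<le> 2 powr (\<delta> + 1) * e powr (- (\<delta> + 1)) * t" using main t0 by (meson mult_right_mono order_trans less_imp_le)
    also have "\<dots> = c * M powr (\<delta>c - \<delta>) / 2 * (e powr (- (\<delta> + 1)) * e powr (- (s - \<delta>c))) * \<Lambda>"
      by (simp add: t_def c2_def)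
    also have "e powr (- (\<delta> + 1)) * e powr (- (s - \<delta>c)) = e powr (\<delta>c - \<delta> - s - 1)"
      by (simp flip: powr_add add: algebra_simps)
    also have "c * M powr (\<delta>c - \<delta>) / 2 * e powr (\<delta>c - \<delta> - s - 1) * \<Lambda> = L * \<Lambda> / 2" by (simp add: L_def)
    finally show False using L0 \<Lambda>(2) by (simp add: zero_less_mult_iff)
  qed
  show ?thesis unfolding Let_def
  proof (rule exI[of _ M], rule conjI[OF M], rule exI[of _ "c2 / 2"], intro conjI ballI impI)
    show "c2 / 2 > 0" using c2 by simp
  qed (rule main2[OF _ refl])
qed

text \<open>
  The quotient \<open>u / (\<bar>u\<bar> + \<eta>)\<close> is a continuous substitute for the sign of \<open>u\<close> and loses at most \<open>\<eta>\<close>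
  pointwise.
\<close>

lemma smoothed_sign:
  fixes u \<phi> :: "real ^ 'n \<Rightarrow> real"
  assumes u: "continuous_on (sphere 0 1) u" and \<phi>: "continuous_on (sphere 0 1) \<phi>" "\<And>x. \<phi> x \<ge> 0" and t: "t < (\<integral>x. \<bar>u x\<bar> * \<phi> x \<partial>\<mu>)"
  obtains g where "continuous_on (sphere 0 1) g" "\<And>x. \<bar>g x\<bar> \<le> \<phi> x" "t < (\<integral>x. g x * u x \<partial>\<mu>)"
proof -
  define d where "d = (\<integral>x. \<bar>u x\<bar> * \<phi> x \<partial>\<mu>) - t"
  define J where "J = (\<integral>x. \<phi> x \<partial>\<mu>)"
  have J: "J \<ge> 0" unfolding J_def by (intro Bochner_Integration.integral_nonneg \<phi>(2))
  define \<eta> where "\<eta> = d / (2 * (1 + J))"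
  have d: "d > 0" using t by (simp add: d_def)
  have \<eta>: "\<eta> > 0" using d J by (simp add: \<eta>_def)
  have "\<eta> * J \<le> d / 2" using d J by (simp add: \<eta>_def field_simps)
  then have \<eta>J: "\<eta> * J < d" using d by linarith
  define g where "g = (\<lambda>x. \<phi> x * (u x / (\<bar>u x\<bar> + \<eta>)))"
  have gc: "continuous_on (sphere 0 1) g"
    unfolding g_def by (intro continuous_intros u \<phi>(1)) (use \<eta> in \<open>smt (verit) abs_ge_zero\<close>)
  have "\<bar>g x\<bar> \<le> \<phi> x" for x
  proof -
    have "\<bar>u x / (\<bar>u x\<bar> + \<eta>)\<bar> \<le> 1" using \<eta> by (simp add: abs_divide)
    from mult_left_le[OF this \<phi>(2)[of x]] show ?thesis
      by (simp only: g_def abs_mult abs_of_nonneg[OF \<phi>(2)])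
  qed
  moreover have "t < (\<integral>x. g x * u x \<partial>\<mu>)"
  proof -
    have i1: "integrable \<mu> (\<lambda>x. \<bar>u x\<bar> * \<phi> x)" and i2: "integrable \<mu> (\<lambda>x. \<eta> * \<phi> x)" and i3: "integrable \<mu> (\<lambda>x. g x * u x)"
      by (intro integrable_hmeasure_continuous[OF kap] continuous_intros u \<phi>(1) gc)+
    have "(\<integral>x. \<bar>u x\<bar> * \<phi> x - \<eta> * \<phi> x \<partial>\<mu>) \<le> (\<integral>x. g x * u x \<partial>\<mu>)"
    proof (intro integral_mono Bochner_Integration.integrable_diff i1 i2 i3)
      fix x
      have "\<bar>u x\<bar> - \<eta> \<le> u x * u x / (\<bar>u x\<bar> + \<eta>)"
      proof -
        have "(\<bar>u x\<bar> - \<eta>) * (\<bar>u x\<bar> + \<eta>) = u x * u x - \<eta> * \<eta>" by (simp add: algebra_simps)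
        also have "\<dots> \<le> u x * u x" by simp
        finally show ?thesis using \<eta> by (simp add: pos_le_divide_eq add_nonneg_pos)
      qed
      then have "(\<bar>u x\<bar> - \<eta>) * \<phi> x \<le> (u x * u x / (\<bar>u x\<bar> + \<eta>)) * \<phi> x" by (rule mult_right_mono[OF _ \<phi>(2)])
      then show "\<bar>u x\<bar> * \<phi> x - \<eta> * \<phi> x \<le> g x * u x" by (simp add: g_def algebra_simps)
    qed
    also have "(\<integral>x. \<bar>u x\<bar> * \<phi> x - \<eta> * \<phi> x \<partial>\<mu>) = (\<integral>x. \<bar>u x\<bar> * \<phi> x \<partial>\<mu>) - \<eta> * J"
      using i1 i2 by (simp add: J_def)
    finally show ?thesis using \<eta>J by (simp add: d_def)
  qed
  ultimately show ?thesis using that[OF gc] by blast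
qed

text \<open>
  Interpolating between the sup bound and the integral of \<open>F e\<close> normalises \<open>f\<close>; the dual power of the
  weight \<open>y powr (- \<beta>)\<close> is \<open>y powr (- D)\<close>, whose integral \<open>\<Lambda>\<close> normalises \<open>g\<close>. All powers of \<open>e\<close> cancel
  in the pairing and \<open>\<Lambda> powr (1 / q)\<close> remains.
\<close>

theorem unbounded_pairings:
  assumes N: "2 \<le> CARD('n)" and q: "1 \<le> q" "q < 2" and \<delta>: "0 < \<delta>" "\<delta> \<le> (2 * s + 1) / q - s - 1"
  shows "\<exists>n f g. continuous_on (sphere 0 1) f \<and> (\<integral>x. \<bar>f x\<bar> powr q \<partial>\<mu>) \<le> 1 \<and> continuous_on (sphere 0 1) g \<and>
     (if q = 1 then \<forall>x\<in>sphere 0 1. \<bar>g x\<bar> \<le> 1 else (\<integral>x. \<bar>g x\<bar> powr (q / (q - 1)) \<partial>\<mu>) \<le> 1) \<and>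
     (\<integral>x. g x * cesaro_mean \<kappa> \<delta> n f x \<partial>\<mu>) > B"
proof -
  define D where "D = 2 * s + 1"
  define \<delta>c where "\<delta>c = D / q - s - 1"
  define \<theta> where "\<theta> = 1 - 1 / q"
  define \<beta> where "\<beta> = s - \<delta>c"
  have D0: "D > 0" using s_pos by (simp add: D_def)
  have \<beta>: "\<beta> = D * \<theta>" unfolding \<beta>_def \<delta>c_def \<theta>_def right_diff_distrib by (simp add: D_def)
  have \<theta>0: "\<theta> \<ge> 0" using q by (simp add: \<theta>_def)
  have \<delta>c: "\<delta> \<le> \<delta>c" "\<delta>c \<le> s"
  proof -
    show "\<delta> \<le> \<delta>c" using \<delta> by (simp add: \<delta>c_def D_def)
    have "\<beta> \<ge> 0" using \<beta> D0 \<theta>0 by simp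
    then show "\<delta>c \<le> s" by (simp add: \<beta>_def)
  qed
  obtain M c where M: "M > 0" and c: "c > 0" and large: "\<And>e \<Lambda>. e \<in> {0<..1} \<Longrightarrow>
      \<Lambda> = (\<integral>x. cutoff i (M * e) x * trunc_sine i (M * e) x powr (- D) \<partial>\<mu>) \<Longrightarrow> \<Lambda> > 0 \<Longrightarrow>
      \<exists>n. c * e powr (- \<beta>) * \<Lambda> < (\<integral>x. \<bar>cesaro_mean \<kappa> \<delta> n (F e) x\<bar> *
        (cutoff i (M * e) x * trunc_sine i (M * e) x powr (- \<beta>)) \<partial>\<mu>)"
    using some_cesaro_mean_large[OF \<delta>(1) \<delta>c] unfolding Let_def D_def \<beta>_def by blast
  obtain C where C: "C > 0" and Fb: "\<And>e x. e \<in> {0<..1} \<Longrightarrow> x \<in> sphere 0 1 \<Longrightarrow> 0 \<le> F e x \<and> F e x \<le> C * e powr (- D)"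
    using F_bounds unfolding D_def by blast
  define c1 where "c1 = c * C powr (- \<theta>)"
  have c1: "c1 > 0" using c C by (simp add: c1_def)
  \<comment> \<open>The size of \<open>\<Lambda>\<close> for which \<open>c1 * \<Lambda> powr (1 / q)\<close> exceeds \<open>B\<close>.\<close>
  define B1 where "B1 = ((\<bar>B\<bar> + 1) / c1) powr q"
  have B1: "B1 > 0" using c1 by (simp add: B1_def)
  have D_eq: "D = real CARD('n) - 1 + 2 * ((\<Sum>j\<in>UNIV. \<kappa> $ j) - \<kappa> $ i)" 
  proof -
    have "2 * ((a - 2) / 2 + S - k) + 1 = a - 1 + 2 * (S - k)" for a S k :: real by (simp add: field_simps)
    then show ?thesis unfolding D_def s_def l_def .
  qed
  obtain m0 where m0: "m0 > 0" and Lam: "\<And>m. m \<in> {0<..m0} \<Longrightarrow> B1 \<le> (\<integral>x. cutoff i m x * trunc_sine i m x powr (- D) \<partial>\<mu>)"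
    using vertex_integral_unbounded[OF kap N D_eq, of B1] by blast
  define e where "e = min 1 (m0 / M)"
  have e: "e \<in> {0<..1}" "e > 0" using m0 M by (auto simp: e_def)
  define m where "m = M * e"
  have m: "m > 0" "m \<le> m0" using e M m0 by (auto simp: m_def e_def min_def field_simps)
  define \<Lambda> where "\<Lambda> = (\<integral>x. cutoff i m x * trunc_sine i m x powr (- D) \<partial>\<mu>)"
  have \<Lambda>: "B1 \<le> \<Lambda>" "\<Lambda> > 0" using Lam[of m] m B1 by (auto simp: \<Lambda>_def)
  define \<phi> where "\<phi> = (\<lambda>x. cutoff i m x * trunc_sine i m x powr (- \<beta>))"
  have \<phi>c: "continuous_on (sphere 0 1) \<phi>" unfolding \<phi>_def by (intro continuous_intros m(1))
  have \<phi>0: "\<phi> x \<ge> 0" for x by (simp add: \<phi>_def cutoff_bounds)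
  obtain n where n: "c * e powr (- \<beta>) * \<Lambda> < (\<integral>x. \<bar>cesaro_mean \<kappa> \<delta> n (F e) x\<bar> * \<phi> x \<partial>\<mu>)"
    using large[OF e(1), of \<Lambda>] \<Lambda> unfolding \<phi>_def m_def \<Lambda>_def by blast
  have Fc: "continuous_on (sphere 0 1) (F e)" by (rule F_continuous[OF e(2)])
  have Fi: "integrable \<mu> (F e)" by (rule integrable_hmeasure_continuous[OF kap Fc])
  obtain g where g: "continuous_on (sphere 0 1) g" "\<And>x. \<bar>g x\<bar> \<le> \<phi> x" and
     gl: "c * e powr (- \<beta>) * \<Lambda> < (\<integral>x. g x * cesaro_mean \<kappa> \<delta> n (F e) x \<partial>\<mu>)"
    using smoothed_sign[OF continuous_cesaro_mean[OF kap Fi] \<phi>c \<phi>0 n] by blast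
  define b where "b = (C * e powr (- D)) powr (- \<theta>)"
  have b0: "b > 0" using C e by (simp add: b_def)
  define f where "f = (\<lambda>x. b * F e x)"
  define h where "h = (\<lambda>x. \<Lambda> powr (- \<theta>) * g x)"
  have fq: "(\<integral>x. \<bar>f x\<bar> powr q \<partial>\<mu>) \<le> 1"
  proof -
    have "(\<integral>x. \<bar>f x\<bar> powr q \<partial>\<mu>) \<le> (\<integral>x. F e x \<partial>\<mu>)"
    proof (rule integral_mono[OF _ Fi])
      show "integrable \<mu> (\<lambda>x. \<bar>f x\<bar> powr q)" unfolding f_def
        using q by (intro integrable_hmeasure_continuous[OF kap] continuous_on_powr' continuous_intros Fc) auto
      fix x assume "x \<in> space \<mu>"
      then have Fx: "0 \<le> F e x" "F e x \<le> C * e powr (- D)" using Fb[OF e(1), of x] by auto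
      have "\<bar>f x\<bar> powr q = b powr q * (F e x * F e x powr (q - 1))"
        using b0 Fx(1) by (cases "F e x = 0") (auto simp: f_def abs_mult powr_mult powr_diff)
      also have "\<dots> \<le> b powr q * (F e x * (C * e powr (- D)) powr (q - 1))"
        using Fx q by (intro mult_left_mono powr_mono2) auto
      also have "b powr q * (F e x * (C * e powr (- D)) powr (q - 1)) = F e x"
      proof -
        have "b powr q * (C * e powr (- D)) powr (q - 1) = (C * e powr (- D)) powr (- \<theta> * q + (q - 1))"
          by (simp only: b_def powr_powr powr_add)
        also have "- \<theta> * q + (q - 1) = 0" using q by (simp add: \<theta>_def field_simps)
        finally have "b powr q * (C * e powr (- D)) powr (q - 1) = 1" using C e by simp
        then show ?thesis by (metis mult.left_commute mult.right_neutral)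
      qed
      finally show "\<bar>f x\<bar> powr q \<le> F e x" .
    qed
    then show ?thesis using F_integral_one[OF e(2)] by simp
  qed
  have hq: "if q = 1 then \<forall>x\<in>sphere 0 1. \<bar>h x\<bar> \<le> 1 else (\<integral>x. \<bar>h x\<bar> powr (q / (q - 1)) \<partial>\<mu>) \<le> 1"
  proof (cases "q = 1")
    case True
    then have "\<theta> = 0" "\<beta> = 0" by (auto simp: \<beta> \<theta>_def)
    then have "\<bar>h x\<bar> \<le> 1" for x
      using g(2)[of x] cutoff_bounds[of i m x] trunc_sine_pos[OF m(1), of i x] \<Lambda>(2) by (simp add: h_def \<phi>_def)
    then show ?thesis using True by simp
  next
    case False
    then have q1: "q > 1" using q by simp
    define q' where "q' = q / (q - 1)"
    have q': "q' > 0" "q' \<ge> 1" using q1 by (auto simp: q'_def le_divide_eq)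
    have "\<theta> = (q - 1) / q" using q1 by (simp add: \<theta>_def diff_divide_distrib)
    then have q'1: "\<theta> * q' = 1" using q1 by (simp add: q'_def)
    have "(\<integral>x. \<bar>h x\<bar> powr q' \<partial>\<mu>) \<le> (\<integral>x. inverse \<Lambda> * (cutoff i m x * trunc_sine i m x powr (- D)) \<partial>\<mu>)"
    proof (rule integral_mono)
      show "integrable \<mu> (\<lambda>x. \<bar>h x\<bar> powr q')" unfolding h_def
        using q' by (intro integrable_hmeasure_continuous[OF kap] continuous_on_powr' continuous_intros g(1)) auto
      show "integrable \<mu> (\<lambda>x. inverse \<Lambda> * (cutoff i m x * trunc_sine i m x powr (- D)))"
        by (intro integrable_hmeasure_continuous[OF kap] continuous_intros m(1))
      fix x
      have "\<bar>h x\<bar> powr q' \<le> (\<Lambda> powr (- \<theta>) * \<phi> x) powr q'"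
        using q' g(2)[of x] by (intro powr_mono2) (auto simp: h_def abs_mult intro: mult_left_mono)
      also have "\<dots> = \<Lambda> powr (- (\<theta> * q')) * (cutoff i m x powr q' * trunc_sine i m x powr (- (D * (\<theta> * q'))))"
        unfolding \<phi>_def \<beta> powr_mult powr_powr by (simp only: mult_minus_left mult.assoc)
      also have "\<dots> = inverse \<Lambda> * (cutoff i m x powr q' * trunc_sine i m x powr (- D))"
        using \<Lambda>(2) by (simp add: q'1 powr_minus)
      also have "\<dots> \<le> inverse \<Lambda> * (cutoff i m x powr 1 * trunc_sine i m x powr (- D))"
        using q' \<Lambda>(2) cutoff_bounds[of i m x] by (intro mult_left_mono mult_right_mono powr_mono') auto
      finally show "\<bar>h x\<bar> powr q' \<le> inverse \<Lambda> * (cutoff i m x * trunc_sine i m x powr (- D))"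
        using cutoff_bounds(1)[of i m x] by simp
    qed
    also have "\<dots> = 1" using \<Lambda>(2) by (simp add: \<Lambda>_def[symmetric])
    finally show ?thesis using False by (simp add: q'_def)
  qed
  have "(\<integral>x. h x * cesaro_mean \<kappa> \<delta> n f x \<partial>\<mu>) = (\<Lambda> powr (- \<theta>) * b) * (\<integral>x. g x * cesaro_mean \<kappa> \<delta> n (F e) x \<partial>\<mu>)"
  proof -
    have "h x * cesaro_mean \<kappa> \<delta> n f x = (\<Lambda> powr (- \<theta>) * b) * (g x * cesaro_mean \<kappa> \<delta> n (F e) x)" for x
      unfolding f_def cesaro_mean_scale h_def by (simp add: mult_ac)
    then show ?thesis by simp
  qed
  also have "\<dots> > (\<Lambda> powr (- \<theta>) * b) * (c * e powr (- \<beta>) * \<Lambda>)"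
    using gl b0 \<Lambda>(2) by (intro mult_strict_left_mono) auto
  also have "(\<Lambda> powr (- \<theta>) * b) * (c * e powr (- \<beta>) * \<Lambda>) = c1 * \<Lambda> powr (1 / q)"
  proof -
    have "b * e powr (- \<beta>) = C powr (- \<theta>) * (e powr (D * \<theta>) * e powr (- \<beta>))"
      using C e by (simp add: b_def powr_mult powr_powr)
    also have "\<dots> = C powr (- \<theta>)" using e by (simp add: \<beta> flip: powr_add)
    finally have 1: "b * e powr (- \<beta>) = C powr (- \<theta>)" .
    have "\<Lambda> powr (- \<theta>) * \<Lambda> = \<Lambda> powr (- \<theta>) * \<Lambda> powr 1" using \<Lambda>(2) by simp
    also have "\<dots> = \<Lambda> powr (1 / q)" by (simp only: powr_add[symmetric]) (simp add: \<theta>_def)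
    finally have 2: "\<Lambda> powr (- \<theta>) * \<Lambda> = \<Lambda> powr (1 / q)" .
    have "(\<Lambda> powr (- \<theta>) * b) * (c * e powr (- \<beta>) * \<Lambda>) = c * (b * e powr (- \<beta>)) * (\<Lambda> powr (- \<theta>) * \<Lambda>)" by (simp add: mult_ac)
    then show ?thesis unfolding 1 2 by (simp add: c1_def)
  qed
  finally have fin: "c1 * \<Lambda> powr (1 / q) < (\<integral>x. h x * cesaro_mean \<kappa> \<delta> n f x \<partial>\<mu>)" .
  have "(\<bar>B\<bar> + 1) / c1 = B1 powr (1 / q)" using q c1 by (simp add: B1_def powr_powr)
  also have "\<dots> \<le> \<Lambda> powr (1 / q)" using \<Lambda> B1 q by (intro powr_mono2) auto
  finally have "B < c1 * \<Lambda> powr (1 / q)" using c1 by (simp add: divide_le_eq mult.commute)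
  then have "B < (\<integral>x. h x * cesaro_mean \<kappa> \<delta> n f x \<partial>\<mu>)" using fin by linarith
  moreover have "continuous_on (sphere 0 1) f" "continuous_on (sphere 0 1) h"
    unfolding f_def h_def by (intro continuous_intros Fc g(1))+
  ultimately show ?thesis using fq hq by blast
qed

end

section \<open>Divergence in both ranges of exponents\<close>

lemma young_weight:
  fixes q a b :: real
  assumes "q > 1"
  shows "\<bar>a * b\<bar> \<le> \<bar>a\<bar> powr q + \<bar>b\<bar> powr (q / (q - 1))"
proof -
  have "\<bar>a\<bar> * \<bar>b\<bar> \<le> \<bar>a\<bar> powr q / q + \<bar>b\<bar> powr (q / (q - 1)) / (q / (q - 1))"
    using assms by (intro Youngs_inequality) (auto simp: field_simps)
  also have "\<dots> \<le> \<bar>a\<bar> powr q / 1 + \<bar>b\<bar> powr (q / (q - 1)) / 1"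
    using assms by (intro add_mono divide_left_mono) (auto simp: field_simps)
  finally show ?thesis by (simp add: abs_mult)
qed

theorem theorem3p2:
  fixes \<kappa> :: "real ^ 'n" and p :: ereal and \<delta> :: real
  assumes "2 \<le> CARD('n)"
    and "\<And>i. 0 \<le> \<kappa> $ i"
    and "1 \<le> p"
    and "0 < \<delta>" and "\<delta> \<le> delta_index \<kappa> p"
  shows "\<exists>f\<in>Lp_space \<kappa> p.
           \<not> (\<exists>g\<in>Lp_space \<kappa> p.
                (\<lambda>n. Lp_norm \<kappa> p (\<lambda>x. cesaro_mean \<kappa> \<delta> n f x - g x)) \<longlonglongrightarrow> 0)"
proof -
  note N = assms(1) and \<kappa> = assms(2)
  have "Min (range (\<lambda>i. \<kappa> $ i)) \<in> range (\<lambda>i. \<kappa> $ i)" by (rule Min_in) auto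
  then obtain i where i: "Min (range (\<lambda>i. \<kappa> $ i)) = \<kappa> $ i" by (elim rangeE) (rule that)
  define s where "s = sigma_index \<kappa>"
  define l where "l = (real CARD('n) - 2) / 2 + (\<Sum>j\<in>UNIV. \<kappa> $ j)"
  define D where "D = 2 * s + 1"
  have sl: "s = l - \<kappa> $ i" by (simp add: s_def sigma_index_def i l_def)
  define r where "r = real_of_ereal (1 / p)"
  have "\<kappa> $ i \<le> (\<Sum>j\<in>UNIV. \<kappa> $ j)" using \<kappa> by (intro member_le_sum) auto
  moreover have "0 \<le> (real CARD('n) - 2) / 2" using N by simp
  ultimately have "s \<ge> 0" unfolding sl l_def by linarith
  then have D1: "D \<ge> 1" by (simp add: D_def)
  \<comment> \<open>As \<open>\<delta>\<close> is positive, the maximum in \<open>delta_index\<close> is attained by its first argument; this excludes \<open>p = 2\<close> and forces \<open>s > 0\<close>.\<close>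
  have \<delta>D: "\<delta> \<le> D * \<bar>r - 1 / 2\<bar> - 1 / 2" using assms(4,5) by (simp add: delta_index_def D_def s_def r_def)
  have r: "0 \<le> r" "r \<le> 1"
    using assms(3) by (cases p; auto simp: r_def one_ereal_def zero_ereal_def)+
  have "\<bar>r - 1 / 2\<bar> \<le> 1 / 2" unfolding abs_le_iff using r by auto
  then have "D * \<bar>r - 1 / 2\<bar> \<le> D * (1 / 2)" using D1 by (intro mult_left_mono) auto
  then have s0: "s > 0" using \<delta>D assms(4) by (simp add: D_def)
  have r2: "r \<noteq> 1 / 2"
  proof
    assume "r = 1 / 2"
    then have "D * \<bar>r - 1 / 2\<bar> = 0" by simp
    then show False using \<delta>D assms(4) by linarith
  qed
  obtain \<nu> where \<nu>: "zonal_measure (\<kappa> $ i) s \<nu>" using zonal_measure_exists[OF \<kappa> s0] by blast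
  interpret vertex_kernel \<kappa> i s l \<nu>
    by unfold_locales (fact \<kappa> l_def sl s0 \<nu>)+
  \<comment> \<open>The smaller of \<open>p\<close> and its conjugate exponent is \<open>q\<close>, and \<open>\<delta>\<close> satisfies the same bound for both.\<close>
  have pairings: "\<exists>n f g. continuous_on (sphere 0 1) f \<and> (\<integral>x. \<bar>f x\<bar> powr q \<partial>\<mu>) \<le> 1 \<and> continuous_on (sphere 0 1) g \<and>
     (if q = 1 then \<forall>x\<in>sphere 0 1. \<bar>g x\<bar> \<le> 1 else (\<integral>x. \<bar>g x\<bar> powr (q / (q - 1)) \<partial>\<mu>) \<le> 1) \<and>
     (\<integral>x. g x * cesaro_mean \<kappa> \<delta> n f x \<partial>\<mu>) > B" if q: "1 \<le> q" "q < 2" and qr: "1 / q = max r (1 - r)" for q B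
  proof (rule unbounded_pairings[OF N q assms(4)])
    have "D * \<bar>r - 1 / 2\<bar> - 1 / 2 = D * (1 / q) - s - 1" unfolding qr by (auto simp: max_def D_def abs_if algebra_simps)
    then show "\<delta> \<le> (2 * s + 1) / q - s - 1" using \<delta>D by (simp add: D_def)
  qed
  have cont_i: "integrable \<mu> f" if "continuous_on (sphere 0 1) f" for f :: "real ^ 'n \<Rightarrow> real"
    by (rule integrable_hmeasure_continuous[OF \<kappa> that])
  have "\<exists>f\<in>Lp_space \<kappa> p. \<not> converges_in_Lp \<kappa> p \<delta> f"
  proof (cases p)
    case (real p')
    then have p1: "p' \<ge> 1" using assms(3) by simp
    have rp: "r = 1 / p'" unfolding r_def real one_ereal_def ereal_divide using p1 by simp
    show ?thesis unfolding real
    proof (rule divergence_finite_exponent[OF \<kappa> p1])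
      fix B
      show "\<exists>n f G W. continuous_on (sphere 0 1) f \<and> (\<integral>x. \<bar>f x\<bar> powr p' \<partial>\<mu>) \<le> 1 \<and>
        continuous_on (sphere 0 1) G \<and> continuous_on (sphere 0 1) W \<and>
        (\<forall>a. \<forall>x\<in>sphere 0 1. \<bar>a * G x\<bar> \<le> \<bar>a\<bar> powr p' + W x) \<and> (\<integral>x. W x \<partial>\<mu>) \<le> 1 \<and>
        (\<integral>x. G x * cesaro_mean \<kappa> \<delta> n f x \<partial>\<mu>) > B"
      proof (cases "p' < 2")
        case True
        have "1 / p' = max r (1 - r)" using True p1 by (auto simp: rp max_def field_simps)
        then obtain n f g where f: "continuous_on (sphere 0 1) f" "(\<integral>x. \<bar>f x\<bar> powr p' \<partial>\<mu>) \<le> 1" and g: "continuous_on (sphere 0 1) g" and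
         gb: "if p' = 1 then \<forall>x\<in>sphere 0 1. \<bar>g x\<bar> \<le> 1 else (\<integral>x. \<bar>g x\<bar> powr (p' / (p' - 1)) \<partial>\<mu>) \<le> 1" and
         big: "(\<integral>x. g x * cesaro_mean \<kappa> \<delta> n f x \<partial>\<mu>) > B" using pairings[OF p1 True] by blast
        define W where "W = (\<lambda>x. if p' = 1 then 0 else \<bar>g x\<bar> powr (p' / (p' - 1)))"
        have Wc: "continuous_on (sphere 0 1) W"
          unfolding W_def using p1 g by (cases "p' = 1") (auto intro!: continuous_intros continuous_on_powr')
        have "\<bar>a * g x\<bar> \<le> \<bar>a\<bar> powr p' + W x" if "x \<in> sphere 0 1" for a x
        proof (cases "p' = 1")
          case True
          then have "\<bar>a\<bar> * \<bar>g x\<bar> \<le> \<bar>a\<bar>" using gb that by (intro mult_left_le) auto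
          then show ?thesis using True by (simp add: W_def abs_mult)
        next
          case False
          then show ?thesis using young_weight[of p' a "g x"] p1 by (simp add: W_def)
        qed
        moreover have "(\<integral>x. W x \<partial>\<mu>) \<le> 1" using gb by (cases "p' = 1") (auto simp: W_def)
        ultimately show ?thesis using f g Wc big by blast
      next
        case False
        then have p2: "p' > 2" using r2 rp by (cases "p' = 2") auto
        \<comment> \<open>Above \<open>2\<close> the pair is used for the conjugate exponent, with the roles of \<open>f\<close> and \<open>g\<close> exchanged.\<close>
        define q where "q = p' / (p' - 1)"
        have q1: "q - 1 = 1 / (p' - 1)" using p2 by (simp add: q_def diff_divide_distrib[symmetric] eq_divide_eq field_simps)
        have q: "1 \<le> q" "q < 2" "q \<noteq> 1" using p2 by (auto simp: q_def le_divide_eq divide_less_eq)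
        have q': "q / (q - 1) = p'" unfolding q1 using p2 by (simp add: q_def)
        have "1 / q = 1 - r" using p2 by (simp add: q_def rp diff_divide_distrib)
        moreover have "r < 1 / 2" using p2 by (simp add: rp divide_less_eq)
        ultimately have qr: "1 / q = max r (1 - r)" by simp
        obtain n f g where f: "continuous_on (sphere 0 1) f" "(\<integral>x. \<bar>f x\<bar> powr q \<partial>\<mu>) \<le> 1" and g: "continuous_on (sphere 0 1) g" and
         gb: "(\<integral>x. \<bar>g x\<bar> powr p' \<partial>\<mu>) \<le> 1" and
         big: "(\<integral>x. g x * cesaro_mean \<kappa> \<delta> n f x \<partial>\<mu>) > B" using pairings[OF q(1,2) qr, of B] q(3) q' by auto
        have "(\<integral>x. f x * cesaro_mean \<kappa> \<delta> n g x \<partial>\<mu>) > B"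
          using big cesaro_mean_symmetric[OF \<kappa> cont_i[OF f(1)] cont_i[OF g], of \<delta> n] by simp
        moreover have "\<bar>a * f x\<bar> \<le> \<bar>a\<bar> powr p' + \<bar>f x\<bar> powr q" for a x
          using young_weight[of p' a "f x"] p2 by (simp add: q_def)
        moreover have "continuous_on (sphere 0 1) (\<lambda>x. \<bar>f x\<bar> powr q)"
          using q f by (intro continuous_on_powr' continuous_intros) auto
        ultimately show ?thesis using f g gb by blast
      qed
    qed
  next
    case PInf
    have r0: "1 / 1 = max r (1 - r)" using PInf by (simp add: r_def)
    show ?thesis unfolding PInf
    proof (rule divergence_uniform[OF \<kappa>])
      fix B
      obtain n f g where f: "continuous_on (sphere 0 1) f" "(\<integral>x. \<bar>f x\<bar> powr 1 \<partial>\<mu>) \<le> 1" and g: "continuous_on (sphere 0 1) g" and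
         gb: "\<forall>x\<in>sphere 0 1. \<bar>g x\<bar> \<le> 1" and
         big: "(\<integral>x. g x * cesaro_mean \<kappa> \<delta> n f x \<partial>\<mu>) > B" using pairings[OF _ _ r0, of B] by auto
      have "(\<integral>x. f x * cesaro_mean \<kappa> \<delta> n g x \<partial>\<mu>) > B"
        using big cesaro_mean_symmetric[OF \<kappa> cont_i[OF f(1)] cont_i[OF g], of \<delta> n] by simp
      then show "\<exists>n f G. continuous_on (sphere 0 1) f \<and> (\<forall>x\<in>sphere 0 1. \<bar>f x\<bar> \<le> 1) \<and>
          continuous_on (sphere 0 1) G \<and> (\<integral>x. \<bar>G x\<bar> \<partial>\<mu>) \<le> 1 \<and> (\<integral>x. G x * cesaro_mean \<kappa> \<delta> n f x \<partial>\<mu>) > B"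
        using f g gb by auto
    qed
  qed (use assms(3) in auto)
  then show ?thesis by (simp only: converges_in_Lp_def)
qed

end
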